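(* Let $\mathsf{k}$ be an algebraically closed field. For $i=1,2$ let $(\Lambda_i,\mathcal{M}_i,W_i)$ be a Galois ring setting over $\mathsf{k}$ with $\Lambda_i$ an affine (finitely generated) $\mathsf{k}$-algebra, let $L_i=\mathrm{Frac}\,\Lambda_i$, $\Gamma_i=\Lambda_i^{W_i}$, and let $U_i$ be a Galois $\Gamma_i$-ring in $(L_i*\mathcal{M}_i)^{W_i}$. Put $\Lambda=\Lambda_1\otimes_{\mathsf{k}}\Lambda_2$, $L=\mathrm{Frac}\,\Lambda$, $W=W_1\times W_2$, $\mathcal{M}=\mathcal{M}_1\times\mathcal{M}_2$ (acting componentwise on $\Lambda$), $\Gamma=\Gamma_1\otimes_{\mathsf{k}}\Gamma_2$ and $U=U_1\otimes_{\mathsf{k}}U_2$. Then $U$ is a Galois $\Gamma$-ring in $(L*\mathcal{M})^W$. If moreover $U_1$ and $U_2$ are Galois orders, then $U$ is a Galois order. If moreover $U_1$ and $U_2$ are principal Galois orders, then $U$ is a principal Galois order.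
   Context: All algebras are unital associative $\mathsf{k}$-algebras. A Galois ring setting is a triple $(\Lambda,\mathcal{M},W)$ where $\Lambda$ is a commutative Noetherian $\mathsf{k}$-algebra which is an integral domain, $\mathcal{M}$ is a submonoid of $\mathrm{Aut}_{\mathsf{k}}\Lambda$, and $W$ is a finite subgroup of $\mathrm{Aut}_{\mathsf{k}}\Lambda$ acting on $\mathcal{M}$ by conjugation (so $w\mathcal{M}w^{-1}=\mathcal{M}$ for $w\in W$), such that $\mathcal{M}$ is separating: $\mathcal{M}\mathcal{M}^{-1}\cap W=\{e\}$. No assumption is made on $|W|$ and the characteristic of $\mathsf{k}$. Put $L=\mathrm{Frac}\,\Lambda$ and let $\mathcal{L}=L*\mathcal{M}$ be the skew monoid ring: the free left $L$-module on $\mathcal{M}$ with $(l\mu)(l'\nu)=l\mu(l')\,\mu\nu$. The group $W$ acts on $\mathcal{L}$ by $w(\sum l_\mu\mu)=\sum w(l_\mu)\,w\mu w^{-1}$. Put $\mathcal{K}=\mathcal{L}^W$, $\Gamma=\Lambda^W$, $K=\mathrm{Frac}\,\Gamma=L^W$. For $X=\sum_\mu l_\mu\mu\in\mathcal{L}$ and $l\in L$ put $X(l)=\sum_\mu l_\mu\mu(l)$. A Galois $\Gamma$-ring in $\mathcal{K}$ (with respect to the setting) is a subalgebra $U\subset\mathcal{K}$ such that $\Lambda$ is a Noetherian $\Gamma$-module, $\Gamma\subset U$, and $KU=\mathcal{K}$. It is a principal Galois order if moreover $X(\Gamma)\subset\Gamma$ for all $X\in U$. A Galois $\Gamma$-ring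 $U$ is a Galois order if for every finite-dimensional left or right $K$-vector subspace $V$ of $\mathcal{K}$, $U\cap V$ is finitely generated as a left and as a right $\Gamma$-module. $U_1\otimes U_2$ is regarded as a subalgebra of $L*\mathcal{M}$ through the natural embeddings $(L_1*\mathcal{M}_1)\otimes(L_2*\mathcal{M}_2)\simeq(L_1\otimes L_2)*(\mathcal{M}_1\times\mathcal{M}_2)\hookrightarrow L*\mathcal{M}$. *)

theory Defs
  imports "HOL-Algebra.Algebra"
begin

text \<open>
  A \<open>k\<close>-algebra is a \<^typ>\<open>('k, 'a) module\<close> record whose scalars come from the ring record \<open>k\<close>.
  The library locale \<open>algebra\<close> is used for commutative algebras; the skew monoid rings and their
  subalgebras are non-commutative and use the same kind of record.
\<close>

definition with_smult :: "'a ring \<Rightarrow> ('k \<Rightarrow> 'a \<Rightarrow> 'a) \<Rightarrow> ('k, 'a) module" where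
  "with_smult R s = ring.extend R (module.fields s)"

definition k_subalgebra :: "('k, 'z) ring_scheme \<Rightarrow> 'a set \<Rightarrow> ('k, 'a) module \<Rightarrow> bool" where
  "k_subalgebra k B A \<longleftrightarrow> subring B A \<and> (\<forall>c\<in>carrier k. \<forall>b\<in>B. c \<odot>\<^bsub>A\<^esub> b \<in> B)"

definition affine_algebra :: "('k, 'z) ring_scheme \<Rightarrow> ('k, 'a) module \<Rightarrow> bool" where
  "affine_algebra k A \<longleftrightarrow>
     (\<exists>S. finite S \<and> S \<subseteq> carrier A \<and>
        (\<forall>B. k_subalgebra k B A \<and> S \<subseteq> B \<longrightarrow> B = carrier A))"

definition algebra_embedding ::
  "('k, 'z) ring_scheme \<Rightarrow> ('k, 'a) module \<Rightarrow> ('k, 'b) module \<Rightarrow> ('a \<Rightarrow> 'b) \<Rightarrow> bool" where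
  "algebra_embedding k A B h \<longleftrightarrow>
     h \<in> ring_hom A B \<and>
     (\<forall>c\<in>carrier k. \<forall>a\<in>carrier A. h (c \<odot>\<^bsub>A\<^esub> a) = c \<odot>\<^bsub>B\<^esub> h a) \<and>
     inj_on h (carrier A)"

text \<open>
  Following \<^const>\<open>BijGroup\<close>, automorphisms are functions that are \<open>extensional\<close> on the carrier.
\<close>

definition Aut_alg :: "('k, 'z) ring_scheme \<Rightarrow> ('k, 'a) module \<Rightarrow> ('a \<Rightarrow> 'a) monoid" where
  "Aut_alg k A = (BijGroup (carrier A))
     \<lparr>carrier := {\<sigma> \<in> Bij (carrier A). \<sigma> \<in> ring_hom A A \<and>
        (\<forall>c\<in>carrier k. \<forall>a\<in>carrier A. \<sigma> (c \<odot>\<^bsub>A\<^esub> a) = c \<odot>\<^bsub>A\<^esub> \<sigma> a)}\<rparr>"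

definition fixed_elements :: "('k, 'a) module \<Rightarrow> ('a \<Rightarrow> 'a) set \<Rightarrow> 'a set" where
  "fixed_elements A W = {a \<in> carrier A. \<forall>w\<in>W. w a = a}"


section \<open>Finitely generated modules over a subring\<close>

text \<open>
  For subsets of a ring \<open>R\<close>, \<open>span_left R A S\<close> is the set of finite sums of products \<open>a s\<close> (it is
  only used for \<open>A\<close> closed under negation), that is, \<open>AS\<close>; \<open>span_right R A S\<close> is \<open>SA\<close>. If \<open>A\<close> is
  a unital subring then \<open>fg_left R A N\<close> says that \<open>N\<close> is a finitely generated left
  \<open>A\<close>-submodule of \<open>R\<close>, so for a subfield \<open>A\<close> that \<open>N\<close> is a finite-dimensional left subspace.
\<close>

definition span_left :: "('a, 'z) ring_scheme \<Rightarrow> 'a set \<Rightarrow> 'a set \<Rightarrow> 'a set" where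
  "span_left R A S = generate (add_monoid R) {a \<otimes>\<^bsub>R\<^esub> s | a s. a \<in> A \<and> s \<in> S}"

definition span_right :: "('a, 'z) ring_scheme \<Rightarrow> 'a set \<Rightarrow> 'a set \<Rightarrow> 'a set" where
  "span_right R A S = generate (add_monoid R) {s \<otimes>\<^bsub>R\<^esub> a | a s. a \<in> A \<and> s \<in> S}"

definition fg_left :: "('a, 'z) ring_scheme \<Rightarrow> 'a set \<Rightarrow> 'a set \<Rightarrow> bool" where
  "fg_left R A N \<longleftrightarrow> (\<exists>S. finite S \<and> S \<subseteq> carrier R \<and> N = span_left R A S)"

definition fg_right :: "('a, 'z) ring_scheme \<Rightarrow> 'a set \<Rightarrow> 'a set \<Rightarrow> bool" where
  "fg_right R A N \<longleftrightarrow> (\<exists>S. finite S \<and> S \<subseteq> carrier R \<and> N = span_right R A S)"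

definition noetherian_over :: "('a, 'z) ring_scheme \<Rightarrow> 'a set \<Rightarrow> bool" where
  "noetherian_over R A \<longleftrightarrow>
     (\<forall>N. subgroup N (add_monoid R) \<and> (\<forall>a\<in>A. \<forall>n\<in>N. a \<otimes>\<^bsub>R\<^esub> n \<in> N) \<longrightarrow> fg_left R A N)"


section \<open>Field of fractions\<close>

text \<open>
  A fraction \<open>a / b\<close> is the set of all pairs \<open>(c, d)\<close> with \<open>d \<noteq> 0\<close> and \<open>a d = c b\<close>. Operations on
  fractions are unions over representatives; over a domain all sets in such a union coincide.
\<close>

definition frac :: "('k, 'a) module \<Rightarrow> 'a \<Rightarrow> 'a \<Rightarrow> ('a \<times> 'a) set" where
  "frac A a b = {(c, d). c \<in> carrier A \<and> d \<in> carrier A - {\<zero>\<^bsub>A\<^esub>} \<and> a \<otimes>\<^bsub>A\<^esub> d = c \<otimes>\<^bsub>A\<^esub> b}"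

definition Frac :: "('k, 'a) module \<Rightarrow> ('k, ('a \<times> 'a) set) module" where
  "Frac A =
     \<lparr>carrier = {frac A a b | a b. a \<in> carrier A \<and> b \<in> carrier A - {\<zero>\<^bsub>A\<^esub>}},
      monoid.mult = (\<lambda>x y. \<Union>(a, b)\<in>x. \<Union>(c, d)\<in>y. frac A (a \<otimes>\<^bsub>A\<^esub> c) (b \<otimes>\<^bsub>A\<^esub> d)),
      one = frac A \<one>\<^bsub>A\<^esub> \<one>\<^bsub>A\<^esub>,
      ring.zero = frac A \<zero>\<^bsub>A\<^esub> \<one>\<^bsub>A\<^esub>,
      ring.add = (\<lambda>x y. \<Union>(a, b)\<in>x. \<Union>(c, d)\<in>y.
               frac A (a \<otimes>\<^bsub>A\<^esub> d \<oplus>\<^bsub>A\<^esub> c \<otimes>\<^bsub>A\<^esub> b) (b \<otimes>\<^bsub>A\<^esub> d)),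
      module.smult = (\<lambda>r x. \<Union>(a, b)\<in>x. frac A (r \<odot>\<^bsub>A\<^esub> a) b)\<rparr>"

definition to_frac :: "('k, 'a) module \<Rightarrow> 'a \<Rightarrow> ('a \<times> 'a) set" where
  "to_frac A a = frac A a \<one>\<^bsub>A\<^esub>"

definition frac_map :: "('k, 'a) module \<Rightarrow> ('a \<Rightarrow> 'a) \<Rightarrow> ('a \<times> 'a) set \<Rightarrow> ('a \<times> 'a) set" where
  "frac_map A \<sigma> x = (\<Union>(a, b)\<in>x. frac A (\<sigma> a) (\<sigma> b))"


section \<open>Skew monoid rings\<close>

text \<open>Elements \<open>\<Sum> l\<^sub>\<mu> \<mu>\<close> are coefficient functions \<open>\<mu> \<mapsto> l\<^sub>\<mu>\<close> that vanish off the monoid.\<close>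

definition single :: "('l, 'z) ring_scheme \<Rightarrow> 'm \<Rightarrow> 'l \<Rightarrow> 'm \<Rightarrow> 'l" where
  "single R p l = (\<lambda>q. if q = p then l else \<zero>\<^bsub>R\<^esub>)"

definition supp :: "('l, 'z) ring_scheme \<Rightarrow> ('m \<Rightarrow> 'l) \<Rightarrow> 'm set" where
  "supp R f = {p. f p \<noteq> \<zero>\<^bsub>R\<^esub>}"

definition skew_monoid_ring ::
  "('l, 'z) ring_scheme \<Rightarrow> ('m, 'y) monoid_scheme \<Rightarrow> ('m \<Rightarrow> 'l \<Rightarrow> 'l) \<Rightarrow> ('m \<Rightarrow> 'l) ring" where
  "skew_monoid_ring R M act =
     \<lparr>carrier = {f. f ` carrier M \<subseteq> carrier R \<and> supp R f \<subseteq> carrier M \<and> finite (supp R f)},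
      monoid.mult = (\<lambda>f g \<rho>. finsum R (\<lambda>(\<mu>, \<nu>). f \<mu> \<otimes>\<^bsub>R\<^esub> act \<mu> (g \<nu>))
                {(\<mu>, \<nu>). \<mu> \<in> supp R f \<and> \<nu> \<in> supp R g \<and> \<mu> \<otimes>\<^bsub>M\<^esub> \<nu> = \<rho>}),
      one = single R \<one>\<^bsub>M\<^esub> \<one>\<^bsub>R\<^esub>,
      ring.zero = (\<lambda>_. \<zero>\<^bsub>R\<^esub>),
      ring.add = (\<lambda>f g \<mu>. f \<mu> \<oplus>\<^bsub>R\<^esub> g \<mu>)\<rparr>"


section \<open>Tensor products of algebras\<close>

text \<open>
  \<open>A \<otimes> B\<close> is the monoid algebra over \<open>k\<close> of the multiplicative monoid \<open>A \<times> B\<close>, that is, the free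
  \<open>k\<close>-module on \<open>A \<times> B\<close>, modulo the bilinearity relations. The \<open>k\<close>-span of these relations is
  already an ideal, so that the quotient by the ideal they generate is the tensor product of vector
  spaces with the multiplication \<open>(a \<otimes> b) (a' \<otimes> b') = a a' \<otimes> b b'\<close>. Neither \<open>A\<close> nor \<open>B\<close> need
  be commutative.
\<close>

definition pair_algebra ::
  "('k, 'z) ring_scheme \<Rightarrow> ('k, 'a) module \<Rightarrow> ('k, 'b) module \<Rightarrow> ('a \<times> 'b \<Rightarrow> 'k) ring" where
  "pair_algebra k A B = skew_monoid_ring k (A \<times>\<times> B) (\<lambda>_ c. c)"

definition tensor_ideal ::
  "('k, 'z) ring_scheme \<Rightarrow> ('k, 'a) module \<Rightarrow> ('k, 'b) module \<Rightarrow> ('a \<times> 'b \<Rightarrow> 'k) set" where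
  "tensor_ideal k A B =
     (let F = pair_algebra k A B; e = (\<lambda>a b. single k (a, b) \<one>\<^bsub>k\<^esub>)
      in Idl\<^bsub>F\<^esub>
        ({e (a \<oplus>\<^bsub>A\<^esub> a') b \<ominus>\<^bsub>F\<^esub> (e a b \<oplus>\<^bsub>F\<^esub> e a' b) | a a' b.
            a \<in> carrier A \<and> a' \<in> carrier A \<and> b \<in> carrier B} \<union>
         {e a (b \<oplus>\<^bsub>B\<^esub> b') \<ominus>\<^bsub>F\<^esub> (e a b \<oplus>\<^bsub>F\<^esub> e a b') | a b b'.
            a \<in> carrier A \<and> b \<in> carrier B \<and> b' \<in> carrier B} \<union>
         {e (c \<odot>\<^bsub>A\<^esub> a) b \<ominus>\<^bsub>F\<^esub> single k (a, b) c | c a b.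
            c \<in> carrier k \<and> a \<in> carrier A \<and> b \<in> carrier B} \<union>
         {e a (c \<odot>\<^bsub>B\<^esub> b) \<ominus>\<^bsub>F\<^esub> single k (a, b) c | c a b.
            c \<in> carrier k \<and> a \<in> carrier A \<and> b \<in> carrier B}))"

definition tensor ::
  "('k, 'z) ring_scheme \<Rightarrow> ('k, 'a) module \<Rightarrow> ('k, 'b) module \<Rightarrow>
   ('k, ('a \<times> 'b \<Rightarrow> 'k) set) module" where
  "tensor k A B =
     (let F = pair_algebra k A B; I = tensor_ideal k A B
      in with_smult (F Quot I)
           (\<lambda>c Q. (I +>\<^bsub>F\<^esub> single k (\<one>\<^bsub>A\<^esub>, \<one>\<^bsub>B\<^esub>) c) \<otimes>\<^bsub>F Quot I\<^esub> Q))"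

definition pure_tensor ::
  "('k, 'z) ring_scheme \<Rightarrow> ('k, 'a) module \<Rightarrow> ('k, 'b) module \<Rightarrow> 'a \<Rightarrow> 'b \<Rightarrow>
   ('a \<times> 'b \<Rightarrow> 'k) set" where
  "pure_tensor k A B a b =
     tensor_ideal k A B +>\<^bsub>pair_algebra k A B\<^esub> single k (a, b) \<one>\<^bsub>k\<^esub>"

text \<open>
  \<open>tensor_lift k C \<phi>\<close> is the linear map \<open>A \<otimes> B \<rightarrow> C\<close> induced by a bilinear map
  \<open>\<phi> : A \<times> B \<rightarrow> C\<close>; all representatives of a coset \<open>Q\<close> have the same image.
\<close>

definition tensor_lift ::
  "('k, 'z) ring_scheme \<Rightarrow> ('k, 'c) module \<Rightarrow> ('a \<Rightarrow> 'b \<Rightarrow> 'c) \<Rightarrow> ('a \<times> 'b \<Rightarrow> 'k) set \<Rightarrow> 'c" where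
  "tensor_lift k C \<phi> Q =
     the_elem ((\<lambda>x. finsum C (\<lambda>(a, b). x (a, b) \<odot>\<^bsub>C\<^esub> \<phi> a b) (supp k x)) ` Q)"

definition tensor_map ::
  "('k, 'z) ring_scheme \<Rightarrow> ('k, 'a) module \<Rightarrow> ('k, 'b) module \<Rightarrow> ('a \<Rightarrow> 'a) \<Rightarrow> ('b \<Rightarrow> 'b) \<Rightarrow>
   ('a \<times> 'b \<Rightarrow> 'k) set \<Rightarrow> ('a \<times> 'b \<Rightarrow> 'k) set" where
  "tensor_map k A B \<sigma> \<tau> =
     restrict (tensor_lift k (tensor k A B) (\<lambda>a b. pure_tensor k A B (\<sigma> a) (\<tau> b)))
       (carrier (tensor k A B))"

text \<open>The product of two sets of automorphisms, acting componentwise on \<open>A \<otimes> B\<close>.\<close>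

definition tensor_maps ::
  "('k, 'z) ring_scheme \<Rightarrow> ('k, 'a) module \<Rightarrow> ('k, 'b) module \<Rightarrow>
   ('a \<Rightarrow> 'a) set \<Rightarrow> ('b \<Rightarrow> 'b) set \<Rightarrow>
   (('a \<times> 'b \<Rightarrow> 'k) set \<Rightarrow> ('a \<times> 'b \<Rightarrow> 'k) set) set" where
  "tensor_maps k A B S T = {tensor_map k A B \<sigma> \<tau> | \<sigma> \<tau>. \<sigma> \<in> S \<and> \<tau> \<in> T}"


section \<open>Galois rings and Galois orders\<close>

locale galois_ring_setting =
  fixes k :: "('k, 'z) ring_scheme" and \<Lambda> :: "('k, 'a) module"
    and M :: "('a \<Rightarrow> 'a) set" and W :: "('a \<Rightarrow> 'a) set"
  assumes base_field: "field k"
    and algebra: "algebra k \<Lambda>"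
    and noetherian_domain: "noetherian_domain \<Lambda>"
    and submonoid: "submonoid M (Aut_alg k \<Lambda>)"
    and subgroup: "subgroup W (Aut_alg k \<Lambda>)"
    and finite_group: "finite W"
    and conjugation: "\<And>w. w \<in> W \<Longrightarrow>
      (\<lambda>\<mu>. w \<otimes>\<^bsub>Aut_alg k \<Lambda>\<^esub> \<mu> \<otimes>\<^bsub>Aut_alg k \<Lambda>\<^esub> inv\<^bsub>Aut_alg k \<Lambda>\<^esub> w) ` M = M"
    and separating:
      "(M <#>\<^bsub>Aut_alg k \<Lambda>\<^esub> set_inv\<^bsub>Aut_alg k \<Lambda>\<^esub> M) \<inter> W = {\<one>\<^bsub>Aut_alg k \<Lambda>\<^esub>}"

text \<open>The skew monoid ring \<open>L * M\<close> with \<open>L = Frac \<Lambda>\<close>.\<close>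

definition skew_alg ::
  "('k, 'z) ring_scheme \<Rightarrow> ('k, 'a) module \<Rightarrow> ('a \<Rightarrow> 'a) set \<Rightarrow>
   ('k, ('a \<Rightarrow> 'a) \<Rightarrow> ('a \<times> 'a) set) module" where
  "skew_alg k \<Lambda> M =
     with_smult (skew_monoid_ring (Frac \<Lambda>) ((Aut_alg k \<Lambda>)\<lparr>carrier := M\<rparr>) (frac_map \<Lambda>))
       (\<lambda>c f \<mu>. c \<odot>\<^bsub>Frac \<Lambda>\<^esub> f \<mu>)"

text \<open>
  The coefficient of \<open>w (\<Sum> l\<^sub>\<mu> \<mu>) = \<Sum> w(l\<^sub>\<mu>) w\<mu>w\<^sup>-\<^sup>1\<close> at \<open>\<nu>\<close> is \<open>w(l\<^sub>\<mu>)\<close> with \<open>\<mu> = w\<^sup>-\<^sup>1\<nu>w\<close>.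
\<close>

definition skew_action ::
  "('k, 'z) ring_scheme \<Rightarrow> ('k, 'a) module \<Rightarrow> ('a \<Rightarrow> 'a) set \<Rightarrow> ('a \<Rightarrow> 'a) \<Rightarrow>
   (('a \<Rightarrow> 'a) \<Rightarrow> ('a \<times> 'a) set) \<Rightarrow> (('a \<Rightarrow> 'a) \<Rightarrow> ('a \<times> 'a) set)" where
  "skew_action k \<Lambda> M w f =
     (\<lambda>\<nu>. if \<nu> \<in> M
           then frac_map \<Lambda> w (f (inv\<^bsub>Aut_alg k \<Lambda>\<^esub> w \<otimes>\<^bsub>Aut_alg k \<Lambda>\<^esub> \<nu> \<otimes>\<^bsub>Aut_alg k \<Lambda>\<^esub> w))
           else \<zero>\<^bsub>Frac \<Lambda>\<^esub>)"

definition skew_invariants ::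
  "('k, 'z) ring_scheme \<Rightarrow> ('k, 'a) module \<Rightarrow> ('a \<Rightarrow> 'a) set \<Rightarrow> ('a \<Rightarrow> 'a) set \<Rightarrow>
   (('a \<Rightarrow> 'a) \<Rightarrow> ('a \<times> 'a) set) set" where
  "skew_invariants k \<Lambda> M W =
     {f \<in> carrier (skew_alg k \<Lambda> M). \<forall>w\<in>W. skew_action k \<Lambda> M w f = f}"

text \<open>\<open>\<Gamma>\<close> and \<open>K = Frac \<Gamma>\<close> inside \<open>L\<close>, and the embedding \<open>l \<mapsto> l e\<close> of \<open>L\<close> into \<open>L * M\<close>.\<close>

definition Gamma_in_L :: "('k, 'a) module \<Rightarrow> ('a \<Rightarrow> 'a) set \<Rightarrow> ('a \<times> 'a) set set" where
  "Gamma_in_L \<Lambda> W = to_frac \<Lambda> ` fixed_elements \<Lambda> W"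

definition K_in_L :: "('k, 'a) module \<Rightarrow> ('a \<Rightarrow> 'a) set \<Rightarrow> ('a \<times> 'a) set set" where
  "K_in_L \<Lambda> W =
     {frac \<Lambda> a b | a b. a \<in> fixed_elements \<Lambda> W \<and> b \<in> fixed_elements \<Lambda> W - {\<zero>\<^bsub>\<Lambda>\<^esub>}}"

definition scalar ::
  "('k, 'z) ring_scheme \<Rightarrow> ('k, 'a) module \<Rightarrow> ('a \<times> 'a) set \<Rightarrow> (('a \<Rightarrow> 'a) \<Rightarrow> ('a \<times> 'a) set)" where
  "scalar k \<Lambda> l = single (Frac \<Lambda>) \<one>\<^bsub>Aut_alg k \<Lambda>\<^esub> l"

definition skew_eval ::
  "('k, 'a) module \<Rightarrow> (('a \<Rightarrow> 'a) \<Rightarrow> ('a \<times> 'a) set) \<Rightarrow> ('a \<times> 'a) set \<Rightarrow> ('a \<times> 'a) set" where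
  "skew_eval \<Lambda> f l =
     finsum (Frac \<Lambda>) (\<lambda>\<mu>. f \<mu> \<otimes>\<^bsub>Frac \<Lambda>\<^esub> frac_map \<Lambda> \<mu> l) (supp (Frac \<Lambda>) f)"

text \<open>A Galois \<open>\<Gamma>\<close>-ring in \<open>(L * M)\<^sup>W\<close>, where \<open>\<Gamma> = \<Lambda>\<^sup>W\<close> is determined by the setting.\<close>

locale galois_ring = galois_ring_setting k \<Lambda> M W
  for k :: "('k, 'z) ring_scheme" and \<Lambda> :: "('k, 'a) module"
    and M :: "('a \<Rightarrow> 'a) set" and W :: "('a \<Rightarrow> 'a) set" +
  fixes U :: "(('a \<Rightarrow> 'a) \<Rightarrow> ('a \<times> 'a) set) set"
  assumes noetherian_module: "noetherian_over \<Lambda> (fixed_elements \<Lambda> W)"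
    and subalgebra: "k_subalgebra k U (skew_alg k \<Lambda> M)"
    and subset_invariants: "U \<subseteq> skew_invariants k \<Lambda> M W"
    and contains_Gamma: "scalar k \<Lambda> ` Gamma_in_L \<Lambda> W \<subseteq> U"
    and KU: "span_left (skew_alg k \<Lambda> M) (scalar k \<Lambda> ` K_in_L \<Lambda> W) U = skew_invariants k \<Lambda> M W"

locale principal_galois_order = galois_ring k \<Lambda> M W U
  for k :: "('k, 'z) ring_scheme" and \<Lambda> :: "('k, 'a) module"
    and M :: "('a \<Rightarrow> 'a) set" and W :: "('a \<Rightarrow> 'a) set"
    and U :: "(('a \<Rightarrow> 'a) \<Rightarrow> ('a \<times> 'a) set) set" +
  assumes eval_Gamma:
    "\<And>f l. f \<in> U \<Longrightarrow> l \<in> Gamma_in_L \<Lambda> W \<Longrightarrow> skew_eval \<Lambda> f l \<in> Gamma_in_L \<Lambda> W"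

text \<open>
  Left subspaces \<open>V\<close> are tested for left, right ones for right finite generation: for a left
  subspace \<open>V\<close> the set \<open>U \<inter> V\<close> is in general only a left \<open>\<Gamma>\<close>-submodule.
\<close>

locale galois_order = galois_ring k \<Lambda> M W U
  for k :: "('k, 'z) ring_scheme" and \<Lambda> :: "('k, 'a) module"
    and M :: "('a \<Rightarrow> 'a) set" and W :: "('a \<Rightarrow> 'a) set"
    and U :: "(('a \<Rightarrow> 'a) \<Rightarrow> ('a \<times> 'a) set) set" +
  assumes left_order:
    "\<And>V. V \<subseteq> skew_invariants k \<Lambda> M W \<Longrightarrow>
       fg_left (skew_alg k \<Lambda> M) (scalar k \<Lambda> ` K_in_L \<Lambda> W) V \<Longrightarrow>
       fg_left (skew_alg k \<Lambda> M) (scalar k \<Lambda> ` Gamma_in_L \<Lambda> W) (U \<inter> V)"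
    and right_order:
    "\<And>V. V \<subseteq> skew_invariants k \<Lambda> M W \<Longrightarrow>
       fg_right (skew_alg k \<Lambda> M) (scalar k \<Lambda> ` K_in_L \<Lambda> W) V \<Longrightarrow>
       fg_right (skew_alg k \<Lambda> M) (scalar k \<Lambda> ` Gamma_in_L \<Lambda> W) (U \<inter> V)"


section \<open>The natural embeddings for tensor products\<close>

text \<open>\<open>L\<^sub>1 \<times> L\<^sub>2 \<rightarrow> Frac (A \<otimes> B)\<close>, \<open>(a / b, c / d) \<mapsto> (a \<otimes> c) / (b \<otimes> d)\<close>.\<close>

definition frac_tensor ::
  "('k, 'z) ring_scheme \<Rightarrow> ('k, 'a) module \<Rightarrow> ('k, 'b) module \<Rightarrow>
   ('a \<times> 'a) set \<Rightarrow> ('b \<times> 'b) set \<Rightarrow>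
   (('a \<times> 'b \<Rightarrow> 'k) set \<times> ('a \<times> 'b \<Rightarrow> 'k) set) set" where
  "frac_tensor k A B x y =
     (\<Union>(a, b)\<in>x. \<Union>(c, d)\<in>y.
        frac (tensor k A B) (pure_tensor k A B a c) (pure_tensor k A B b d))"

text \<open>
  \<open>(L\<^sub>1 * M\<^sub>1) \<times> (L\<^sub>2 * M\<^sub>2) \<rightarrow> L * (M\<^sub>1 \<times> M\<^sub>2)\<close>, determined by
  \<open>(l\<^sub>1 \<mu>, l\<^sub>2 \<nu>) \<mapsto> (l\<^sub>1 \<otimes> l\<^sub>2) (\<mu> \<times> \<nu>)\<close>.
\<close>

definition skew_tensor ::
  "('k, 'z) ring_scheme \<Rightarrow> ('k, 'a) module \<Rightarrow> ('k, 'b) module \<Rightarrow>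
   (('a \<Rightarrow> 'a) \<Rightarrow> ('a \<times> 'a) set) \<Rightarrow> (('b \<Rightarrow> 'b) \<Rightarrow> ('b \<times> 'b) set) \<Rightarrow>
   (('a \<times> 'b \<Rightarrow> 'k) set \<Rightarrow> ('a \<times> 'b \<Rightarrow> 'k) set) \<Rightarrow>
   (('a \<times> 'b \<Rightarrow> 'k) set \<times> ('a \<times> 'b \<Rightarrow> 'k) set) set" where
  "skew_tensor k A B f g =
     (\<lambda>\<rho>. finsum (Frac (tensor k A B)) (\<lambda>(\<mu>, \<nu>). frac_tensor k A B (f \<mu>) (g \<nu>))
       {(\<mu>, \<nu>). \<mu> \<in> supp (Frac A) f \<and> \<nu> \<in> supp (Frac B) g \<and> tensor_map k A B \<mu> \<nu> = \<rho>})"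

end

theory Submission
  imports Defs
begin

text \<open>
  Tensors are tested by linear functionals: a tensor is a sum of \<open>x\<^sub>i \<otimes> y\<^sub>i\<close> with both families linearly
  independent, and such sums stay faithful in \<open>L * M\<close>. Hence an automorphism of one factor fixes a tensor
  only if it fixes all \<open>x\<^sub>i\<close>, which gives the invariants of \<open>\<Lambda>\<close> and, after clearing denominators, \<open>KU\<close>.
  \<open>\<Lambda>\<close> is a domain because characters of the affine algebra \<open>\<Lambda>\<^sub>1\<close> over \<open>k\<close> separate its elements from
  zero, and it is Noetherian over \<open>\<Gamma>\<close> by the Artin--Tate argument and the Hilbert basis theorem. An element
  of \<open>U\<close> supported in \<open>S\<^sub>1 \<times> S\<^sub>2\<close> is a sum of tensors of elements of \<open>U\<^sub>i\<close> supported in \<open>S\<^sub>i\<close>, so that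
  the order property reduces to that of \<open>U\<^sub>1\<close> and \<open>U\<^sub>2\<close>.
\<close>

\<comment> \<open>Averaging over \<open>W\<close> is excluded, since the order of \<open>W\<close>
  may vanish in \<open>k\<close>; this is why invariants are read off from independent
  representations, and why denominators are made invariant by multiplying with conjugates. Algebraic
  closedness enters through the domain property: over a smaller field a tensor product of domains
  can have zero divisors, as for the complex numbers over the reals. A tensor product of Noetherian
  rings need not be Noetherian either; hence the detour through a finitely generated algebra of
  invariants over which \<Lambda> is a finite module. A subspace \<open>V\<close> of the invariants
  is in general not a tensor product of subspaces. Only the finiteness of its support is used:
  \<open>V\<close> is enlarged to all elements supported in a finite rectangle of indices, and
  \<open>U \<inter> V\<close> is recovered as a submodule of a finitely generated module over a
  Noetherian ring. The skew rings are not commutative, so the module lemmas are proved for left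
  modules over subrings of arbitrary rings; right modules are then left modules over the opposite
  ring.\<close>
text \<open>A short form of the structure index: \<open>\<otimes>\<^sub>A\<close> stands for \<open>\<otimes>\<^bsub>A\<^esub>\<close>.\<close>

syntax "_index" :: "logic \<Rightarrow> index" ("\<^sub>_" [1000] 1000)

abbreviation in_carrier :: "'a \<Rightarrow> ('a, 'z) partial_object_scheme \<Rightarrow> bool" (infix "<:" 50)
  where "x <: A \<equiv> x \<in> carrier A"

type_synonym ('a, 'b) skew_index = "(('a => 'a) => ('a \<times> 'a) set) \<times> (('b => 'b) => ('b \<times> 'b) set)"

abbreviation nz :: "('a, 'z) ring_scheme \<Rightarrow> 'a set"
  where "nz R \<equiv> carrier R - {\<zero>\<^bsub>R\<^esub>}"

section \<open>Modules over subrings of non-commutative rings\<close>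

definition submod :: "('a, 'z) ring_scheme => 'a set => 'a set => bool" where
 "submod R A N \<longleftrightarrow> subgroup N (add_monoid R) & (ALL a:A. ALL n:N. a \<otimes>\<^sub>R n : N)"

text \<open>\<open>P\<close> need not be a submodule. \<open>noeth_on R A A\<close> says that the
  subring \<open>A\<close> is left Noetherian, and smaller modules inherit the property by
  monotonicity in \<open>P\<close>.\<close>

definition noeth_on :: "('a, 'z) ring_scheme => 'a set => 'a set => bool" where
 "noeth_on R A P \<longleftrightarrow> (ALL N. submod R A N & N <= P --> fg_left R A N)"

lemma noeth_onD: "noeth_on R A P ==> submod R A N ==> N <= P ==> fg_left R A N"
 by (simp add: noeth_on_def)

lemma noeth_on_mono: "noeth_on R A P ==> Q <= P ==> noeth_on R A Q"
 by (auto simp: noeth_on_def)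

context ring
begin

lemma submodI:
 assumes "N <= carrier R" "\<zero> : N" "!!x y. x : N ==> y : N ==> x \<oplus> y : N"
  "!!x. x : N ==> \<ominus> x : N" "!!a n. a : A ==> n : N ==> a \<otimes> n : N"
 shows "submod R A N"
 unfolding submod_def
 using add.subgroupI[OF assms(1) _ assms(4,3)] assms(2,5) by auto

lemma submodE:
 assumes "submod R A N"
 shows "N <= carrier R" "\<zero> : N" "!!x y. x : N ==> y : N ==> x \<oplus> y : N"
  "!!x. x : N ==> \<ominus> x : N" "!!a n. a : A ==> n : N ==> a \<otimes> n : N"
  "!!x y. x : N ==> y : N ==> x \<ominus> y : N"
proof -
 have s: "subgroup N (add_monoid R)" and a: "!!a n. a : A ==> n : N ==> a \<otimes> n : N"
  using assms by (auto simp: submod_def)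
 show 1: "N <= carrier R" "\<zero> : N" "!!x y. x : N ==> y : N ==> x \<oplus> y : N"
   "!!a n. a : A ==> n : N ==> a \<otimes> n : N"
  using subgroup.subset[OF s] subgroup.one_closed[OF s] subgroup.m_closed[OF s] a by auto
 show 2: "!!x. x : N ==> \<ominus> x : N" using subgroup.m_inv_closed[OF s] by (simp add: a_inv_def)
 show "!!x y. x : N ==> y : N ==> x \<ominus> y : N" using 1 2 by (simp add: a_minus_def)
qed

text \<open>Induction over the generated additive group. The negative of a product
  \<open>b s\<close> is the product of \<open>- b\<close> and \<open>s\<close>, because
  \<open>A\<close> is closed under negation.\<close>

lemma span_left_submod:
 assumes "subring A R" "S <= carrier R"
 shows "submod R A (span_left R A S)"
proof -
 note A = subringE[OF assms(1)]
 let ?G = "{a \<otimes> s |a s. a : A & s : S}"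
 have G: "?G <= carrier R" using A(1) assms(2) by blast
 have sg: "subgroup (span_left R A S) (add_monoid R)"
  unfolding span_left_def using add.generate_is_subgroup G by simp
 have sub: "span_left R A S <= carrier R" using subgroup.subset[OF sg] by simp
 have "a \<otimes> n : span_left R A S" if a: "a : A" and n: "n : span_left R A S" for a n
  using n unfolding span_left_def
 proof (induction n rule: generate.induct)
  case one
  have "a <: R" using a A by blast
  then show ?case using generate.one[of "add_monoid R" ?G] by simp
 next
  case (incl h)
  then obtain b s where "h = b \<otimes> s" "b : A" "s : S" by blast
  then have "a \<otimes> h = (a \<otimes> b) \<otimes> s" "a \<otimes> b : A" using a A assms(2) by (auto simp: m_assoc subset_iff)
  then show ?case using \<open>s : S\<close> by (auto intro: generate.incl)
 next
  case (inv h)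
  then obtain b s where h: "h = b \<otimes> s" "b : A" "s : S" by blast
  then have c: "a <: R" "b <: R" "s <: R" using a A assms(2) by auto
  have "a \<otimes> (\<ominus> h) = (\<ominus> (a \<otimes> b)) \<otimes> s" "\<ominus> (a \<otimes> b) : A"
   using c h a A by (auto simp: m_assoc r_minus l_minus)
  then show ?case using \<open>s : S\<close> by (auto simp: a_inv_def intro: generate.incl)
 next
  case (eng h1 h2)
  have c: "h1 <: R" "h2 <: R"
   using eng(1,2) sub unfolding span_left_def by auto
  then have "a \<otimes> (h1 \<oplus> h2) = a \<otimes> h1 \<oplus> a \<otimes> h2" using a A by (auto simp: r_distr)
  then show ?case using generate.eng[OF eng.IH] by simp
 qed
 then show ?thesis using sg by (auto simp: submod_def)
qed

lemma span_left_incl: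
 assumes "subring A R" "S <= carrier R" "s : S"
 shows "s : span_left R A S"
proof -
 have "\<one> \<otimes> s = s" using assms by auto
 then have "s : {a \<otimes> s |a s. a : A & s : S}" using assms subringE(3)[OF assms(1)] by force
 then show ?thesis unfolding span_left_def by (rule generate.incl)
qed

lemma span_left_minimal:
 assumes "submod R A N" "S <= N"
 shows "span_left R A S <= N"
 unfolding span_left_def
 by (rule add.generate_subgroup_incl) (use assms in \<open>auto simp: submod_def\<close>)

lemma span_left_mult:
 assumes "subring A R" "S <= carrier R" "a : A" "s : S"
 shows "a \<otimes> s : span_left R A S"
 using submodE(5)[OF span_left_submod[OF assms(1,2)]] span_left_incl[OF assms(1,2,4)] assms(3) by auto

lemma span_left_mono:
 assumes "subring A R" "T <= carrier R" "S <= T"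
 shows "span_left R A S <= span_left R A T"
 using span_left_minimal[OF span_left_submod[OF assms(1,2)]] span_left_incl[OF assms(1,2)] assms(3)
 by auto

lemma submod_self: "subring A R ==> submod R A A"
 using subringE[of A R] by (intro submodI) auto

lemma submod_carrier: "A <= carrier R ==> submod R A (carrier R)"
 by (intro submodI) auto

lemma submod_inter: "submod R A N ==> submod R A N' ==> submod R A (N \<inter> N')"
 using submodE[of A N] submodE[of A N'] by (intro submodI) auto

lemma submod_antimono: "submod R A N ==> B <= A ==> submod R B N"
 by (auto simp: submod_def)

text \<open>Generators over \<open>A\<close> also generate over a larger subring that stabilizes
  \<open>N\<close>, since the larger span cannot leave \<open>N\<close>.\<close>

lemma fg_left_extend:
 assumes "subring A R" "subring B R" "A <= B" "fg_left R A N" "submod R B N"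
 shows "fg_left R B N"
proof -
 obtain S where S: "finite S" "S <= carrier R" "N = span_left R A S" using assms(4) by (auto simp: fg_left_def)
 have "S <= N" using span_left_incl[OF assms(1) S(2)] S(3) by auto
 then have "span_left R B S <= N" using span_left_minimal[OF assms(5)] by simp
 moreover have "N <= span_left R B S" unfolding S(3)
  using span_left_minimal[OF submod_antimono[OF span_left_submod[OF assms(2) S(2)] assms(3)]]
   span_left_incl[OF assms(2) S(2)] by auto
 ultimately show ?thesis using S(1,2) by (auto simp: fg_left_def)
qed

lemma noeth_on_extend:
 assumes "subring A R" "subring B R" "A <= B" "noeth_on R A P"
 shows "noeth_on R B P"
 using assms fg_left_extend submod_antimono by (metis noeth_on_def)

text \<open>The elements \<open>a s + n\<close> form a submodule that contains all generators. In
  what follows \<open>a\<close> plays the role of a leading coefficient with respect to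
  \<open>s\<close>.\<close>

lemma span_left_insert_elem:
 assumes A: "subring A R" and S: "insert s S <= carrier R" and x: "x : span_left R A (insert s S)"
 obtains a n where "a : A" "n : span_left R A S" "x = a \<otimes> s \<oplus> n"
proof -
 note AE = subringE[OF A]
 have S': "S <= carrier R" and s: "s <: R" using S by auto
 note sp = submodE[OF span_left_submod[OF A S']]
 let ?N = "{a \<otimes> s \<oplus> n | a n. a : A & n : span_left R A S}"
 have "submod R A ?N"
 proof (rule submodI)
  show "?N <= carrier R" using AE sp s by (auto simp: subset_iff)
  have "\<zero> = \<zero> \<otimes> s \<oplus> \<zero>" using s by simp
  then show "\<zero> : ?N" using AE(2) sp(2) by blast
 next
  fix x y assume "x : ?N" "y : ?N"
  then obtain a n a' n' where h: "x = a \<otimes> s \<oplus> n" "y = a' \<otimes> s \<oplus> n'" "a : A" "a' : A"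
   "n : span_left R A S" "n' : span_left R A S" by blast
  then have "x \<oplus> y = (a \<oplus> a') \<otimes> s \<oplus> (n \<oplus> n')" using AE sp s
   by (simp add: subset_iff l_distr a_ac)
  moreover have "a \<oplus> a' : A" "n \<oplus> n' : span_left R A S" using h AE(7) sp(3) by auto
  ultimately show "x \<oplus> y : ?N" by blast
 next
  fix x assume "x : ?N"
  then obtain a n where h: "x = a \<otimes> s \<oplus> n" "a : A" "n : span_left R A S" by blast
  then have "\<ominus> x = (\<ominus> a) \<otimes> s \<oplus> (\<ominus> n)" using AE sp s
   by (simp add: subset_iff l_minus minus_add)
  moreover have "\<ominus> a : A" "\<ominus> n : span_left R A S" using h AE(5) sp(4) by auto
  ultimately show "\<ominus> x : ?N" by blast
 next
  fix b x assume b: "b : A" and "x : ?N"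
  then obtain a n where h: "x = a \<otimes> s \<oplus> n" "a : A" "n : span_left R A S" by blast
  then have "b \<otimes> x = (b \<otimes> a) \<otimes> s \<oplus> (b \<otimes> n)" using AE sp s b
   by (simp add: subset_iff m_assoc r_distr)
  moreover have "b \<otimes> a : A" "b \<otimes> n : span_left R A S" using h b AE(6) sp(5) by auto
  ultimately show "b \<otimes> x : ?N" by blast
 qed
 moreover have "insert s S <= ?N"
 proof -
  have "s = \<one> \<otimes> s \<oplus> \<zero>" using s by simp
  then have "s : ?N" using AE(3) sp(2) by blast
  moreover have "S <= ?N"
  proof
   fix t assume t: "t : S"
   then have "t = \<zero> \<otimes> s \<oplus> t" using s S' by auto
   then show "t : ?N" using AE(2) span_left_incl[OF A S' t] by blast
  qed
  ultimately show ?thesis by blast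
 qed
 ultimately have "span_left R A (insert s S) <= ?N" by (rule span_left_minimal)
 then show thesis using x that by blast
qed

text \<open>If every \<open>t\<close> is the leading coefficient of \<open>g t\<close> modulo
  \<open>P\<close>, then a combination of the \<open>t\<close> is the leading coefficient of the
  same combination of the \<open>g t\<close>. The good \<open>a\<close> form a submodule, so no
  coefficients have to be written down. \<open>P\<close> will be the span of the remaining
  generators, and in the basis theorem the span of the lower powers.\<close>

lemma lift_span_left:
 assumes A: "subring A R" and T: "T <= carrier R" and s: "s <: R"
  and P: "submod R A P" and g: "!!t. t : T ==> g t <: R & (EX n:P. g t = t \<otimes> s \<oplus> n)"
  and a: "a : span_left R A T"
 shows "EX y:span_left R A (g ` T). EX n:P. y = a \<otimes> s \<oplus> n"
proof -
 note AE = subringE[OF A]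
 note PE = submodE[OF P]
 have gT: "g ` T <= carrier R" using g by auto
 note sp = submodE[OF span_left_submod[OF A gT]]
 let ?J = "{a : carrier R. EX y:span_left R A (g ` T). EX n:P. y = a \<otimes> s \<oplus> n}"
 have "submod R A ?J"
 proof (rule submodI)
  show "?J <= carrier R" by auto
  have "\<zero> = \<zero> \<otimes> s \<oplus> \<zero>" using s by simp
  then show "\<zero> : ?J" using sp(2) PE(2) by blast
 next
  fix x y assume "x : ?J" "y : ?J"
  then obtain u v n m where h: "x <: R" "y <: R" "u : span_left R A (g ` T)"
   "v : span_left R A (g ` T)" "n : P" "m : P" "u = x \<otimes> s \<oplus> n" "v = y \<otimes> s \<oplus> m" by blast
  then have "u \<oplus> v = (x \<oplus> y) \<otimes> s \<oplus> (n \<oplus> m)" using PE(1) s by (simp add: subset_iff l_distr a_ac)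
  moreover have "u \<oplus> v : span_left R A (g ` T)" "n \<oplus> m : P" "x \<oplus> y <: R" using h sp(3) PE(3) by auto
  ultimately show "x \<oplus> y : ?J" by blast
 next
  fix x assume "x : ?J"
  then obtain u n where h: "x <: R" "u : span_left R A (g ` T)"
    "n : P" "u = x \<otimes> s \<oplus> n" by blast
  then have "\<ominus> u = (\<ominus> x) \<otimes> s \<oplus> (\<ominus> n)" using PE(1) s by (simp add: subset_iff l_minus minus_add)
  moreover have "\<ominus> u : span_left R A (g ` T)" "\<ominus> n : P" "\<ominus> x <: R" using h sp(4) PE(4) by auto
  ultimately show "\<ominus> x : ?J" by blast
 next
  fix b x assume b: "b : A" and "x : ?J"
  then obtain u n where h: "x <: R" "u : span_left R A (g ` T)"
    "n : P" "u = x \<otimes> s \<oplus> n" by blast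
  then have "b \<otimes> u = (b \<otimes> x) \<otimes> s \<oplus> (b \<otimes> n)" using AE PE(1) s b
   by (simp add: subset_iff m_assoc r_distr)
  moreover have "b \<otimes> u : span_left R A (g ` T)" "b \<otimes> n : P" "b \<otimes> x <: R" using h b sp(5) PE(5) AE(1) by auto
  ultimately show "b \<otimes> x : ?J" by blast
 qed
 moreover have "T <= ?J"
 proof
  fix t assume t: "t : T"
  then show "t : ?J" using T g[OF t] span_left_incl[OF A gT] by blast
 qed
 ultimately have "span_left R A T <= ?J" by (rule span_left_minimal)
 then show ?thesis using a by blast
qed

text \<open>Leading coefficients of elements of \<open>N\<close>, taken modulo \<open>P\<close>.
  They are not unique, as \<open>s\<close> may depend on \<open>P\<close>, but linear operations on
  elements of \<open>N\<close> still act on them.\<close>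

lemma leading_submod:
 assumes A: "subring A R" and P: "submod R A P" and s: "s <: R" and N: "submod R A N"
 shows "submod R A {a : A. EX n:P. a \<otimes> s \<oplus> n : N}" (is "submod R A ?J")
proof (rule submodI)
 note AE = subringE[OF A]
 note PE = submodE[OF P]
 note NE = submodE[OF N]
 show "?J <= carrier R" using AE by auto
 have "\<zero> \<otimes> s \<oplus> \<zero> = \<zero>" using s by simp
 then show "\<zero> : ?J" using AE(2) NE(2) PE(2) by force
 fix x assume "x : ?J"
 then obtain n where h: "x : A" "n : P" "x \<otimes> s \<oplus> n : N" by blast
 then have "\<ominus> (x \<otimes> s \<oplus> n) = (\<ominus> x) \<otimes> s \<oplus> (\<ominus> n)" using PE(1) AE(1) s by (simp add: subset_iff l_minus minus_add)
 moreover have "\<ominus> (x \<otimes> s \<oplus> n) : N" "\<ominus> n : P" "\<ominus> x : A" using h PE(4) AE(5) NE(4) by auto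
 ultimately show "\<ominus> x : ?J" by auto
 {
  fix y assume "y : ?J"
  then obtain m where h': "y : A" "m : P" "y \<otimes> s \<oplus> m : N" by blast
  then have "(x \<otimes> s \<oplus> n) \<oplus> (y \<otimes> s \<oplus> m) = (x \<oplus> y) \<otimes> s \<oplus> (n \<oplus> m)" using PE(1) AE(1) s h
   by (simp add: subset_iff l_distr a_ac)
  moreover have "(x \<otimes> s \<oplus> n) \<oplus> (y \<otimes> s \<oplus> m) : N" "n \<oplus> m : P" "x \<oplus> y : A" using h h' PE(3) AE(7) NE(3) by auto
  ultimately show "x \<oplus> y : ?J" by auto
 }
 {
  fix b assume b: "b : A"
  then have "b \<otimes> (x \<otimes> s \<oplus> n) = (b \<otimes> x) \<otimes> s \<oplus> (b \<otimes> n)" using PE(1) AE(1) s h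
   by (simp add: subset_iff m_assoc r_distr)
  moreover have "b \<otimes> (x \<otimes> s \<oplus> n) : N" "b \<otimes> n : P" "b \<otimes> x : A" using h b PE(5) AE(6) NE(5) by auto
  ultimately show "b \<otimes> x : ?J" by auto
 }
qed

lemma add_diff_cancel:
 assumes "c <: R" "n <: R" "m <: R"
 shows "(c \<oplus> n) \<oplus> \<ominus> (c \<oplus> m) = n \<oplus> \<ominus> m"
proof -
 have "(c \<oplus> n) \<oplus> \<ominus> (c \<oplus> m) = (c \<oplus> \<ominus> c) \<oplus> (n \<oplus> \<ominus> m)"
  using assms by (simp add: minus_add a_ac del: r_neg)
 then show ?thesis using assms by (simp add: r_neg)
qed

lemma diff_add_cancel:
 assumes "x <: R" "y <: R"
 shows "(x \<ominus> y) \<oplus> y = x"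
 using assms by (simp add: a_minus_def a_assoc l_neg)

text \<open>Induction on the number of generators: \<open>N\<close> is generated by its intersection
  with the span of \<open>S\<close> together with lifts of generators of the leading coefficients
  with respect to \<open>s\<close>.\<close>

lemma noeth_on_span_left:
 assumes A: "subring A R" and noeth: "noeth_on R A A" and "finite S" and "S <= carrier R"
 shows "noeth_on R A (span_left R A S)"
 using assms(3,4)
proof (induction S rule: finite_induct)
 case empty
 have z: "submod R A {\<zero>}" using subringE(1)[OF A] by (intro submodI) auto
 have e: "span_left R A {} <= {\<zero>}" using span_left_minimal[OF z] by simp
 show ?case unfolding noeth_on_def
 proof (intro allI impI, elim conjE)
  fix N assume N: "submod R A N" and "N <= span_left R A {}"
  then have "N = span_left R A {}"
   using e submodE(2)[OF N] submodE(2)[OF span_left_submod[OF A, of "{}"]] by blast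
  then show "fg_left R A N" by (auto simp: fg_left_def)
 qed
next
 case (insert s S)
 note AE = subringE[OF A]
 have S: "S <= carrier R" and s: "s <: R" using insert.prems by auto
 note sp = submodE[OF span_left_submod[OF A S]]
 show ?case unfolding noeth_on_def
 proof (intro allI impI, elim conjE)
  fix N assume N: "submod R A N" and sub: "N <= span_left R A (insert s S)"
  note NE = submodE[OF N]
  let ?J = "{a : A. EX n:span_left R A S. a \<otimes> s \<oplus> n : N}"
  have "fg_left R A ?J"
   by (rule noeth_onD[OF noeth leading_submod[OF A span_left_submod[OF A S] s N]]) auto
  then obtain T where T: "finite T" "T <= carrier R" "?J = span_left R A T" by (auto simp: fg_left_def)
  then have TJ: "T <= ?J" using span_left_incl[OF A] by auto
  then have "ALL t:T. EX n. n : span_left R A S & t \<otimes> s \<oplus> n : N" by blast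
  then obtain h where h: "!!t. t : T ==> h t : span_left R A S & t \<otimes> s \<oplus> h t : N" by metis
  define g where "g t = t \<otimes> s \<oplus> h t" for t
  have "fg_left R A (N \<inter> span_left R A S)"
   by (rule noeth_onD[OF insert.IH[OF S] submod_inter[OF N span_left_submod[OF A S]]]) auto
  then obtain T' where T': "finite T'" "T' <= carrier R" "N \<inter> span_left R A S = span_left R A T'" by (auto simp: fg_left_def)
  have T'N: "T' <= N" using span_left_incl[OF A T'(2)] T'(3) by auto
  have gTN: "g ` T <= N" using h by (auto simp: g_def)
  \<comment> \<open>The lifts \<open>g t\<close> supply all leading coefficients; \<open>T'\<close>
    generates the part of \<open>N\<close> that has no term in \<open>s\<close>.\<close>
  let ?G = "g ` T \<union> T'"
  have G: "?G <= carrier R" using T'(2) gTN NE by auto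
  note Gs = submodE[OF span_left_submod[OF A G]]
  have "span_left R A ?G <= N" using span_left_minimal[OF N] gTN T'N by simp
  moreover have "N <= span_left R A ?G"
  proof
   fix x assume x: "x : N"
   then obtain a n where an: "a : A" "n : span_left R A S" "x = a \<otimes> s \<oplus> n"
    using span_left_insert_elem[OF A insert.prems] sub by blast
   then have "a : span_left R A T" using x T(3) by blast
   then obtain y m where y: "y : span_left R A (g ` T)" "m : span_left R A S" "y = a \<otimes> s \<oplus> m"
   proof -
    have "g t <: R & (EX n:span_left R A S. g t = t \<otimes> s \<oplus> n)" if "t : T" for t
     using h[OF that] NE(1) by (auto simp: g_def)
    from lift_span_left[OF A T(2) s span_left_submod[OF A S] this \<open>a : span_left R A T\<close>]
    show ?thesis using that by blast
   qed
   have yG: "y : span_left R A ?G" using span_left_mono[OF A G] y by blast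
   have yN: "y : N" using span_left_minimal[OF N gTN] y by blast
   have car: "a <: R" "n <: R" "m <: R" "a \<otimes> s <: R"
    using an(1,2) y(2) AE(1) sp(1) s by auto
   \<comment> \<open>\<open>y\<close> was built with the same leading coefficient \<open>a\<close>
     as \<open>x\<close>, so the terms in \<open>s\<close> cancel.\<close>
   have "x \<ominus> y = n \<ominus> m" using an y car
    using add_diff_cancel by (simp add: a_minus_def)
   then have "x \<ominus> y : span_left R A T'"
    using T'(3) NE(6)[OF x yN] sp(6)[OF an(2) y(2)] by (metis IntI)
   then have "x \<ominus> y : span_left R A ?G" using span_left_mono[OF A G, of T'] by blast
   then have "(x \<ominus> y) \<oplus> y : span_left R A ?G" using Gs(3) yG by blast
   moreover have "(x \<ominus> y) \<oplus> y = x" using x yN NE(1)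
    by (intro diff_add_cancel) auto
   ultimately show "x : span_left R A ?G" by simp
  qed
  ultimately have "N = span_left R A ?G" by (rule equalityI[rotated])
  moreover have "finite ?G" using T(1) T'(1) by simp
  ultimately show "fg_left R A N" unfolding fg_left_def using G by blast
 qed
qed

end

section \<open>The Hilbert basis theorem\<close>

text \<open>The polynomial expressions in \<open>x\<close> of degree below \<open>n\<close>. The
  strict bound makes \<open>n = 0\<close> the zero module, where inductions on the degree
  start.\<close>

definition pow_span :: "('a, 'z) ring_scheme => 'a set => 'a => nat => 'a set" where
 "pow_span R A x n = span_left R A {x [^]\<^sub>R i | i. i < n}"

text \<open>This is \<open>A[x]\<close>, introduced as a module; that it is a ring is proved in
  \<open>adjoin_subring\<close>.\<close>

definition adjoin :: "('a, 'z) ring_scheme => 'a set => 'a => 'a set" where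
 "adjoin R A x = span_left R A {x [^]\<^sub>R i | i::nat. True}"

fun adjoins :: "('a, 'z) ring_scheme => 'a set => 'a list => 'a set" where
 "adjoins R A [] = A"
| "adjoins R A (x # xs) = adjoins R (adjoin R A x) xs"

context cring
begin

lemma pow_span_submod: "subring A R ==> x <: R ==> submod R A (pow_span R A x n)"
 unfolding pow_span_def by (rule span_left_submod) auto

lemma adjoin_submod: "subring A R ==> x <: R ==> submod R A (adjoin R A x)"
 unfolding adjoin_def by (rule span_left_submod) auto

lemma pow_mem_adjoin: "subring A R ==> x <: R ==> x [^] (i::nat) : adjoin R A x"
 unfolding adjoin_def by (rule span_left_incl) auto

lemma pow_mem_pow_span: "subring A R ==> x <: R ==> i < n ==> x [^] (i::nat) : pow_span R A x n"
 unfolding pow_span_def by (rule span_left_incl) auto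

lemma pow_span_mono: "subring A R ==> x <: R ==> m \<le> n ==> pow_span R A x m <= pow_span R A x n"
 unfolding pow_span_def by (rule span_left_mono) auto

text \<open>Multiplication by \<open>z\<close> is \<open>A\<close>-linear in a commutative ring.
  Hence closure of a span under products can be tested on generators.\<close>

lemma submod_preimage:
 assumes "subring A R" "submod R A N" "z <: R"
 shows "submod R A {y : carrier R. z \<otimes> y : N}"
proof (rule submodI)
 note NE = submodE[OF assms(2)]
 show "{y : carrier R. z \<otimes> y : N} <= carrier R" by auto
 show "\<zero> : {y : carrier R. z \<otimes> y : N}" using NE(2) assms(3) by simp
 fix x assume x: "x : {y : carrier R. z \<otimes> y : N}"
 then show "\<ominus> x : {y : carrier R. z \<otimes> y : N}" using NE(4) assms(3) by (simp add: r_minus)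
 { fix y assume "y : {y : carrier R. z \<otimes> y : N}"
  then show "x \<oplus> y : {y : carrier R. z \<otimes> y : N}" using x NE(3) assms(3) by (simp add: r_distr) }
 { fix a assume a: "a : A"
  then have "a <: R" using subringE(1)[OF assms(1)] by auto
  moreover have "a \<otimes> (z \<otimes> x) : N" using NE(5) a x by simp
  ultimately show "a \<otimes> x : {y : carrier R. z \<otimes> y : N}" using x assms(3) by (simp add: m_lcomm) }
qed

lemma pow_span_shift:
 assumes A: "subring A R" and x: "x <: R" and y: "y : pow_span R A x n"
 shows "x [^] (m::nat) \<otimes> y : pow_span R A x (m + n)"
proof -
 let ?N = "{y : carrier R. x [^] m \<otimes> y : pow_span R A x (m + n)}"
 have "submod R A ?N" using submod_preimage[OF A pow_span_submod[OF A x]] x by simp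
 moreover have "{x [^] i | i. i < n} <= ?N" using x pow_mem_pow_span[OF A x] by (auto simp: nat_pow_mult)
 ultimately have "pow_span R A x n <= ?N" unfolding pow_span_def[of R A x n] by (rule span_left_minimal)
 then show ?thesis using y by auto
qed

lemma adjoin_pow_span:
 assumes A: "subring A R" and x: "x <: R" and y: "y : adjoin R A x"
 obtains n where "y : pow_span R A x n"
proof -
 let ?N = "\<Union>n. pow_span R A x n"
 have sm: "!!n. submod R A (pow_span R A x n)" by (rule pow_span_submod[OF A x])
 note NE = submodE[OF sm]
 have "submod R A ?N"
 proof (rule submodI)
  show "?N <= carrier R" using NE(1) by blast
  show "\<zero> : ?N" using NE(2) by blast
  show "\<ominus> x : ?N" if "x : ?N" for x using NE(4) that by blast
  show "a \<otimes> x : ?N" if "x : ?N" "a : A" for x a using NE(5) that by blast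
  fix u v assume "u : ?N" "v : ?N"
  then obtain n m where "u : pow_span R A x n" "v : pow_span R A x m" by blast
  then have "u : pow_span R A x (max n m)" "v : pow_span R A x (max n m)"
   using pow_span_mono[OF A x, of n "max n m"] pow_span_mono[OF A x, of m "max n m"] by auto
  then show "u \<oplus> v : ?N" using NE(3) by blast
 qed
 moreover have "{x [^] i | i::nat. True} <= ?N" using pow_mem_pow_span[OF A x] by blast
 ultimately have "adjoin R A x <= ?N" unfolding adjoin_def by (rule span_left_minimal)
 then show ?thesis using y that by auto
qed

lemma pow_span_0: "subring A R ==> x <: R ==> pow_span R A x 0 = {\<zero>}"
proof -
 assume A: "subring A R" and x: "x <: R"
 have z: "submod R A {\<zero>}" using subringE(1)[OF A] by (intro submodI) auto
 have e: "span_left R A {} <= {\<zero>}" using span_left_minimal[OF z] by simp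
 have "pow_span R A x 0 = span_left R A {}" by (simp add: pow_span_def)
 then show ?thesis using e submodE(2)[OF pow_span_submod[OF A x]] by blast
qed

lemma pow_span_Suc_elem:
 assumes A: "subring A R" and x: "x <: R" and f: "f : pow_span R A x (Suc n)"
 obtains a p where "a : A" "p : pow_span R A x n" "f = a \<otimes> x [^] n \<oplus> p"
proof -
 have "{x [^] i |i. i < Suc n} = insert (x [^] n) {x [^] i |i. i < n}"
  by (auto simp: less_Suc_eq)
 then have "f : span_left R A (insert (x [^] n) {x [^] i |i. i < n})" using f by (simp add: pow_span_def)
 moreover have "insert (x [^] n) {x [^] i |i. i < n} <= carrier R" using x by auto
 ultimately obtain a p where "a : A" "p : span_left R A {x [^] i |i. i < n}" "f = a \<otimes> x [^] n \<oplus> p"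
  using span_left_insert_elem[OF A] by blast
 then show ?thesis using that by (simp add: pow_span_def)
qed

lemma adjoin_subring:
 assumes A: "subring A R" and x: "x <: R"
 shows "subring (adjoin R A x) R"
proof (rule subringI)
 let ?B = "adjoin R A x"
 note sB = adjoin_submod[OF A x]
 note BE = submodE[OF sB]
 show "?B <= carrier R" by (rule BE(1))
 show "\<one> : ?B" using pow_mem_adjoin[OF A x, of 0] by simp
 show "\<ominus> h : ?B" if "h : ?B" for h using that BE(4) by simp
 show "h \<oplus> h' : ?B" if "h : ?B" "h' : ?B" for h h' using that BE(3) by simp
 \<comment> \<open>Products are treated one factor at a time: first a power of \<open>x\<close>
   times a general element, then a general element times a general element.\<close>
 have 1: "x [^] i \<otimes> c : ?B" if c: "c : ?B" for c and i :: nat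
 proof -
  have "submod R A {y : carrier R. x [^] i \<otimes> y : ?B}" using submod_preimage[OF A sB] x by simp
  moreover have "{x [^] i | i::nat. True} <= {y : carrier R. x [^] i \<otimes> y : ?B}"
   using x pow_mem_adjoin[OF A x] by (auto simp: nat_pow_mult)
  ultimately have "?B <= {y : carrier R. x [^] i \<otimes> y : ?B}"
   unfolding adjoin_def[of R A x] by (rule span_left_minimal[folded adjoin_def])
  then show ?thesis using c by auto
 qed
 show "h \<otimes> c : ?B" if h: "h : ?B" and c: "c : ?B" for h c
 proof -
  have cc: "c <: R" using c BE(1) by auto
  have "submod R A {y : carrier R. c \<otimes> y : ?B}" using submod_preimage[OF A sB cc] .
  moreover have "{x [^] i | i::nat. True} <= {y : carrier R. c \<otimes> y : ?B}"
   using 1[OF c] x cc by (auto simp: m_comm)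
  ultimately have "?B <= {y : carrier R. c \<otimes> y : ?B}"
   unfolding adjoin_def[of R A x] by (rule span_left_minimal[folded adjoin_def])
  then show ?thesis using h cc BE(1) m_comm by fastforce
 qed
qed

lemma adjoin_base:
 assumes A: "subring A R" and x: "x <: R"
 shows "A <= adjoin R A x"
proof
 fix a assume a: "a : A"
 then have "a <: R" using subringE(1)[OF A] by blast
 moreover have "a \<otimes> x [^] (0::nat) : adjoin R A x"
  using submodE(5)[OF adjoin_submod[OF A x] a pow_mem_adjoin[OF A x]] .
 ultimately show "a : adjoin R A x" by simp
qed

lemma adjoin_gen: "subring A R ==> x <: R ==> x : adjoin R A x"
 using pow_mem_adjoin[of A x 1] by (simp add: nat_pow_eone)

lemma adjoin_minimal:
 assumes A: "subring A R" and B: "subring B R" and "A <= B" "x : B"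
 shows "adjoin R A x <= B"
proof -
 have x: "x <: R" using subringE(1)[OF B] assms(4) by blast
 have "x [^] (i::nat) : B" for i
  by (induction i) (use subringE(3,6)[OF B] assms(4) in auto)
 then have "{x [^] i | i::nat. True} <= B" by auto
 then show ?thesis unfolding adjoin_def
  using span_left_minimal[OF submod_antimono[OF submod_self[OF B] \<open>A <= B\<close>]] by auto
qed

lemma adjoins_subring:
 "subring A R ==> set xs <= carrier R ==> subring (adjoins R A xs) R"
 by (induction xs arbitrary: A) (auto simp: adjoin_subring)

lemma adjoins_incl:
 "subring A R ==> set xs <= carrier R ==> A \<union> set xs <= adjoins R A xs"
proof (induction xs arbitrary: A)
 case (Cons x xs)
 then have "subring (adjoin R A x) R" using adjoin_subring by simp
 then have "adjoin R A x \<union> set xs <= adjoins R (adjoin R A x) xs" using Cons by simp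
 then show ?case using adjoin_base[of A x] adjoin_gen[of A x] Cons.prems by auto
qed simp

lemma adjoins_minimal:
 "subring A R ==> subring B R ==> A <= B ==> set xs <= B ==> adjoins R A xs <= B"
proof (induction xs arbitrary: A)
 case (Cons x xs)
 have x: "x <: R" using subringE(1)[OF Cons.prems(2)] Cons.prems(4) by auto
 show ?case using Cons.IH[OF adjoin_subring[OF Cons.prems(1) x]]
  adjoin_minimal[OF Cons.prems(1-3), of x] Cons.prems by simp
qed simp

lemma finite_subset_chain:
 assumes "finite T" "!!n m. n \<le> m ==> J n <= J m" "T <= (\<Union>n::nat. J n)"
 obtains N where "T <= J N"
proof -
 have "EX N. T <= J N" using assms(1,3)
 proof (induction T rule: finite_induct)
  case (insert t T)
  then obtain N M where "T <= J N" "t : J M" by auto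
  then have "insert t T <= J (max N M)" using assms(2)[of N "max N M"] assms(2)[of M "max N M"] by auto
  then show ?case by blast
 qed auto
 then show ?thesis using that by blast
qed

text \<open>Hilbert's argument with leading coefficients needs no polynomials: the representations
 \<open>a x\<^sup>n + \<dots>\<close> of the elements of \<open>A[x]\<close> need not be unique.\<close>

theorem noeth_on_adjoin:
 assumes A: "subring A R" and noeth: "noeth_on R A A" and x: "x <: R"
 shows "noeth_on R (adjoin R A x) (adjoin R A x)"
 unfolding noeth_on_def
proof (intro allI impI, elim conjE)
 let ?B = "adjoin R A x"
 fix I assume I: "submod R ?B I" and IB: "I <= ?B"
 note AE = subringE[OF A]
 note sB = adjoin_subring[OF A x]
 note IE = submodE[OF I]
 have IA: "submod R A I" using submod_antimono[OF I adjoin_base[OF A x]] .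
 let ?P = "pow_span R A x"
 have P: "!!n. submod R A (?P n)" by (rule pow_span_submod[OF A x])
 have xB: "x [^] (i::nat) : ?B" for i by (rule pow_mem_adjoin[OF A x])
 define J where "J n = {a : A. EX p:?P n. a \<otimes> x [^] n \<oplus> p : I}" for n
 have J: "submod R A (J n)" for n unfolding J_def using leading_submod[OF A P _ IA] x by simp
 have shift: "x [^] m \<otimes> (a \<otimes> x [^] n \<oplus> p) = a \<otimes> x [^] (m + n) \<oplus> x [^] m \<otimes> p"
  if "a <: R" "p <: R" for m n :: nat and a p
  using that x by (simp add: r_distr m_lcomm nat_pow_mult)
 have Pc: "?P n <= carrier R" for n using submodE(1)[OF P] .
 \<comment> \<open>Multiplication by a power of \<open>x\<close> raises the degree and keeps the
   leading coefficient, so these ideals grow with the degree.\<close>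
 have Jmono: "J n <= J m" if "n \<le> m" for n m
 proof
  fix a assume "a : J n"
  then obtain p where p: "a : A" "p : ?P n" "a \<otimes> x [^] n \<oplus> p : I" by (auto simp: J_def)
  have "x [^] (m - n) \<otimes> (a \<otimes> x [^] n \<oplus> p) : I" using IE(5)[OF xB p(3)] .
  moreover have "x [^] (m - n) \<otimes> (a \<otimes> x [^] n \<oplus> p) = a \<otimes> x [^] m \<oplus> x [^] (m - n) \<otimes> p"
   using shift[of a p "m - n" n] p(1,2) AE(1) Pc that by auto
  moreover have "x [^] (m - n) \<otimes> p : ?P m" using pow_span_shift[OF A x p(2), of "m - n"] that by simp
  ultimately show "a : J m" using p(1) unfolding J_def by auto
 qed
 let ?U = "\<Union>n. J n"
 have "submod R A ?U"
 proof (rule submodI)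
  show "?U <= carrier R" using submodE(1)[OF J] by blast
  show "\<zero> : ?U" using submodE(2)[OF J] by blast
  show "\<ominus> x : ?U" if "x : ?U" for x using submodE(4)[OF J] that by blast
  show "a \<otimes> x : ?U" if "x : ?U" "a : A" for x a using submodE(5)[OF J] that by blast
  fix u v assume "u : ?U" "v : ?U"
  then obtain n m where "u : J n" "v : J m" by blast
  then have "u : J (max n m)" "v : J (max n m)"
   using Jmono[of n "max n m"] Jmono[of m "max n m"] by auto
  then show "u \<oplus> v : ?U" using submodE(3)[OF J] by blast
 qed
 then have "fg_left R A ?U" by (rule noeth_onD[OF noeth]) (auto simp: J_def)
 then obtain T where T: "finite T" "T <= carrier R" "?U = span_left R A T" by (auto simp: fg_left_def)
 have "T <= ?U" using span_left_incl[OF A T(2)] T(3) by blast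
 \<comment> \<open>All leading coefficients are generated by the finite set \<open>T\<close>, and
   \<open>T\<close> already occurs in one degree \<open>N\<close>.\<close>
 then obtain N where TN: "T <= J N" using finite_subset_chain[OF T(1), of J] Jmono by blast
 have JN: "J n <= J N" for n
  using span_left_minimal[OF J TN] T(3) by blast
 have "EX Tn. finite Tn & Tn <= carrier R & J n = span_left R A Tn" for n
 proof -
  have "fg_left R A (J n)" by (rule noeth_onD[OF noeth J]) (auto simp: J_def)
  then show ?thesis by (auto simp: fg_left_def)
 qed
 then obtain F where F: "!!n. finite (F n)" "!!n. F n <= carrier R" "!!n. J n = span_left R A (F n)" by metis
 have FJ: "t : J n" if "t : F n" for n t using span_left_incl[OF A F(2) that] F(3) by blast
 have "EX q. t : F n --> q : ?P n & t \<otimes> x [^] n \<oplus> q : I" for n t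
  using FJ[of t n] unfolding J_def by blast
 then have "ALL n t. EX q. t : F n --> q : ?P n & t \<otimes> x [^] n \<oplus> q : I" by blast
 then have "EX q. ALL n t. t : F n --> q n t : ?P n & t \<otimes> x [^] n \<oplus> q n t : I" by (simp only: choice_iff)
 then obtain q where q: "!!n t. t : F n ==> q n t : ?P n & t \<otimes> x [^] n \<oplus> q n t : I" by blast
 define g where "g n t = t \<otimes> x [^] n \<oplus> q n t" for n t
 have gI: "g n ` F n <= I" for n using q unfolding g_def by blast
 let ?G = "\<Union>n\<in>{..N}. g n ` F n"
 have GI: "?G <= I" using gI by blast
 then have G: "?G <= carrier R" using IE(1) by blast
 have Gs: "submod R ?B (span_left R ?B ?G)" by (rule span_left_submod[OF sB G])
 note GsE = submodE[OF Gs]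
 have key: "f : I ==> f : ?P n ==> f : span_left R ?B ?G" for f n
 proof (induction n arbitrary: f)
  case 0
  then show ?case using pow_span_0[OF A x] GsE(2) by simp
 next
  case (Suc n)
  obtain a p where ap: "a : A" "p : ?P n" "f = a \<otimes> x [^] n \<oplus> p"
   using pow_span_Suc_elem[OF A x Suc.prems(2)] by blast
  \<comment> \<open>In degrees above \<open>N\<close> the leading coefficient is found in
    \<open>J N\<close>, and the lift is multiplied by the power \<open>n - m\<close> of
    \<open>x\<close>; up to degree \<open>N\<close> the lift has degree \<open>n\<close> itself and
    the power is trivial.\<close>
  define m where "m = min n N"
  have "a : J n" using ap Suc.prems(1) by (auto simp: J_def)
  then have "a : J m" using JN[of n] unfolding m_def min_def by auto
  then have "a : span_left R A (F m)" using F(3) by blast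
  have "g m t <: R & (EX n:?P m. g m t = t \<otimes> x [^] m \<oplus> n)" if "t : F m" for t
   using q[OF that] gI[of m] that IE(1) unfolding g_def by blast
  from lift_span_left[OF A F(2) _ P this \<open>a : span_left R A (F m)\<close>] x
  obtain y p' where y: "y : span_left R A (g m ` F m)" "p' : ?P m" "y = a \<otimes> x [^] m \<oplus> p'" by auto
  have "m : {..N}" by (simp add: m_def)
  then have "g m ` F m <= ?G" by (rule UN_upper)
  then have "y : span_left R ?B ?G"
   using span_left_minimal[OF submod_antimono[OF Gs adjoin_base[OF A x]], of "g m ` F m"] y(1)
    span_left_incl[OF sB G] by blast
  then have y'G: "x [^] (n - m) \<otimes> y : span_left R ?B ?G" using GsE(5)[OF xB] by blast
  have "x [^] (n - m) \<otimes> y = a \<otimes> x [^] n \<oplus> x [^] (n - m) \<otimes> p'"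
   using shift[of a p' "n - m" m] y(2,3) ap(1) AE(1) Pc by (auto simp: m_def)
  moreover have p'': "x [^] (n - m) \<otimes> p' : ?P n" using pow_span_shift[OF A x y(2), of "n - m"] by (simp add: m_def)
  moreover have "a \<otimes> x [^] n <: R" "p <: R" "x [^] (n - m) \<otimes> p' <: R"
   using ap(1,2) p'' AE(1) x Pc by auto
  \<comment> \<open>The leading terms cancel, so the difference has degree below \<open>n\<close>
    and the induction hypothesis applies.\<close>
  ultimately have "f \<ominus> x [^] (n - m) \<otimes> y = p \<ominus> x [^] (n - m) \<otimes> p'"
   unfolding ap(3) a_minus_def using add_diff_cancel by simp
  then have "f \<ominus> x [^] (n - m) \<otimes> y : ?P n" using submodE(6)[OF P ap(2) p''] by simp
  moreover have y'I: "x [^] (n - m) \<otimes> y : I" using y'G span_left_minimal[OF I GI] by blast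
  then have "f \<ominus> x [^] (n - m) \<otimes> y : I" using IE(6) Suc.prems(1) by blast
  ultimately have "f \<ominus> x [^] (n - m) \<otimes> y : span_left R ?B ?G" using Suc.IH by blast
  then have "(f \<ominus> x [^] (n - m) \<otimes> y) \<oplus> x [^] (n - m) \<otimes> y : span_left R ?B ?G" using GsE(3) y'G by blast
  moreover have "f <: R" "x [^] (n - m) \<otimes> y <: R" using Suc.prems(1) y'I IE(1) by auto
  ultimately show ?case using diff_add_cancel by simp
 qed
 have "I <= span_left R ?B ?G"
 proof
  fix f assume "f : I"
  then obtain n where "f : ?P n" using adjoin_pow_span[OF A x] IB by blast
  then show "f : span_left R ?B ?G" using key \<open>f : I\<close> by blast
 qed
 moreover have "span_left R ?B ?G <= I" by (rule span_left_minimal[OF I GI])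
 ultimately have "I = span_left R ?B ?G" by (rule equalityI)
 moreover have "finite ?G" using F(1) by simp
 ultimately show "fg_left R ?B I" unfolding fg_left_def using G by blast
qed

corollary noeth_on_adjoins:
 assumes "subring A R" "noeth_on R A A" "set xs <= carrier R"
 shows "noeth_on R (adjoins R A xs) (adjoins R A xs)"
 using assms
 by (induction xs arbitrary: A) (auto simp: adjoin_subring noeth_on_adjoin)

end

section \<open>Opposite rings\<close>

definition op_ring :: "('a, 'z) ring_scheme => ('a, 'z) ring_scheme" where
 "op_ring R = R\<lparr>monoid.mult := (\<lambda>x y. y \<otimes>\<^sub>R x)\<rparr>"

lemma op_ring_simps [simp]:
 "carrier (op_ring R) = carrier R" "x \<otimes>\<^bsub>op_ring R\<^esub> y = y \<otimes>\<^sub>R x"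
 "\<one>\<^bsub>op_ring R\<^esub> = \<one>\<^sub>R" "\<zero>\<^bsub>op_ring R\<^esub> = \<zero>\<^sub>R" "x \<oplus>\<^bsub>op_ring R\<^esub> y = x \<oplus>\<^sub>R y"
 by (simp_all add: op_ring_def)

text \<open>The inverse is itself defined from carrier, product and unit, so these three determine
  the generated subset.\<close>

lemma generate_cong:
 assumes "monoid.mult G = monoid.mult H" "one G = one H" "carrier G = carrier H"
 shows "generate G S = generate H S"
proof -
 have inv: "m_inv G = m_inv H" unfolding m_inv_def using assms by auto
 have "x : generate G S ==> x : generate H S" for x
  by (induction rule: generate.induct) (use assms inv in \<open>auto intro: generate.intros\<close>)
 moreover have "x : generate H S ==> x : generate G S" for x
  by (induction rule: generate.induct) (use assms[symmetric] inv[symmetric] in \<open>auto intro: generate.intros\<close>)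
 ultimately show ?thesis by blast
qed

text \<open>This turns every statement on right modules into one on left modules over the opposite
  ring, to which the lemmas above apply.\<close>

lemma span_right_op: "span_right R A S = span_left (op_ring R) A S"
 unfolding span_right_def span_left_def op_ring_simps by (rule generate_cong) auto

lemma fg_right_op: "fg_right R A N = fg_left (op_ring R) A N"
 by (simp add: fg_right_def fg_left_def span_right_op)

lemma (in ring) op_ring: "ring (op_ring R)"
proof (rule ringI)
 show "abelian_group (op_ring R)"
  by (rule abelian_groupI) (auto simp: a_ac intro: bexI[of _ "\<ominus> x" for x] l_neg)
 show "Group.monoid (op_ring R)" by (rule monoidI) (auto simp: m_assoc)
qed (auto simp: l_distr r_distr)

lemma op_ring_op [simp]: "op_ring (op_ring R) = R"
 by (simp add: op_ring_def)

lemma (in ring) subring_op: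
 assumes "subring A R" shows "subring A (op_ring R)"
proof -
 interpret O: ring "op_ring R" by (rule op_ring)
 have inv: "\<ominus>\<^bsub>op_ring R\<^esub> x = \<ominus> x" if "x <: R" for x
  using that O.minus_equality[of "\<ominus> x" x] by (simp add: l_neg)
 show ?thesis using subringE[OF assms] by (intro O.subringI) (auto simp: inv subset_iff)
qed

section \<open>Extension of homomorphisms\<close>

text \<open>A polynomial is a coefficient function together with a bound: only indices below
  \<open>n\<close> count, so \<open>pev R c x (Suc d)\<close> is the value of a polynomial of degree
  at most \<open>d\<close>. Coefficients beyond the bound are arbitrary.\<close>

primrec pev :: "('a, 'z) ring_scheme => (nat => 'a) => 'a => nat => 'a" where
 "pev R c x 0 = \<zero>\<^sub>R"
| "pev R c x (Suc n) = c n \<otimes>\<^sub>R x [^]\<^sub>R n \<oplus>\<^sub>R pev R c x n"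

text \<open>One step of pseudo-division by \<open>p\<close> of degree \<open>d\<close>: the
  polynomial \<open>f\<close> of degree \<open>n\<close> is multiplied by the leading coefficient of
  \<open>p\<close>, and a multiple of \<open>p\<close> shifted by \<open>n - d\<close> is
  subtracted, so that the coefficient of index \<open>n\<close> cancels.\<close>

definition prem :: "('a, 'z) ring_scheme => nat => (nat => 'a) => nat => (nat => 'a) => nat => 'a" where
 "prem R d p n f = (\<lambda>i. p d \<otimes>\<^sub>R f i \<ominus>\<^sub>R f n \<otimes>\<^sub>R (if i < n - d then \<zero>\<^sub>R else p (i - (n - d))))"

lemma pev_cong: "(!!i. i < n ==> c i = d i) ==> pev R c x n = pev R d x n"
 by (induction n) auto

context cring
begin

lemma pev_closed [simp]: "(!!i. c i <: R) ==> x <: R ==> pev R c x n <: R"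
 by (induction n) auto

lemma pev_zero: "(!!i. i < n ==> c i = \<zero>) ==> x <: R ==> pev R c x n = \<zero>"
 by (induction n) auto

lemma pev_lin:
 assumes "!!i. c i <: R" "!!i. d i <: R" "x <: R" "a <: R" "b <: R"
 shows "pev R (\<lambda>i. a \<otimes> c i \<ominus> b \<otimes> d i) x n = a \<otimes> pev R c x n \<ominus> b \<otimes> pev R d x n"
proof (induction n)
 case (Suc n)
 define y where "y = x [^] n"
 define u where "u = pev R c x n"
 define v where "v = pev R d x n"
 have c: "y <: R" "u <: R" "v <: R" using assms by (auto simp: y_def u_def v_def)
 show ?case using Suc c assms unfolding pev.simps y_def[symmetric] u_def[symmetric] v_def[symmetric]
  by (simp add: a_minus_def l_distr r_distr l_minus r_minus minus_add m_ac a_ac)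
qed (use assms in \<open>simp add: a_minus_def\<close>)

lemma pev_add:
 assumes "!!i. c i <: R" "!!i. d i <: R" "x <: R"
 shows "pev R (\<lambda>i. c i \<oplus> d i) x n = pev R c x n \<oplus> pev R d x n"
 using assms by (induction n) (auto simp: l_distr a_ac)

lemma pev_scale:
 assumes "!!i. c i <: R" "a <: R" "x <: R"
 shows "pev R (\<lambda>i. a \<otimes> c i) x n = a \<otimes> pev R c x n"
 using assms by (induction n) (auto simp: r_distr m_assoc)

lemma pev_shift:
 assumes "!!i. c i <: R" "x <: R"
 shows "pev R (\<lambda>i. if i < m then \<zero> else c (i - m)) x (m + n) = x [^] m \<otimes> pev R c x n"
proof (induction n)
 case 0
 show ?case using assms by (simp add: pev_zero)
next
 case (Suc n)
 show ?case using Suc assms by (simp add: r_distr nat_pow_mult[symmetric] m_lcomm)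
qed

lemma pev_pad:
 assumes "!!i. c i <: R" "x <: R" "n \<le> m"
 shows "pev R (\<lambda>i. if i < n then c i else \<zero>) x m = pev R c x n"
 using assms(3)
proof (induction m)
 case (Suc m)
 show ?case
 proof (cases "n = Suc m")
  case True
  show ?thesis unfolding True[symmetric] by (rule pev_cong) auto
 next
  case False
  then show ?thesis using Suc assms by simp
 qed
qed simp

lemma prem_closed: "(!!i. p i <: R) ==> (!!i. f i <: R) ==> prem R d p n f i <: R"
 by (simp add: prem_def)

text \<open>The coefficient of index \<open>n\<close> vanishes, so the values for the bounds
  \<open>n\<close> and \<open>Suc n\<close> agree, and the latter is computed by linearity.\<close>

lemma pev_prem:
 assumes p: "!!i. p i <: R" and f: "!!i. f i <: R" and x: "x <: R" and "d \<le> n"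
 shows "pev R (prem R d p n f) x n =
  p d \<otimes> pev R f x (Suc n) \<ominus> f n \<otimes> (x [^] (n - d) \<otimes> pev R p x (Suc d))"
proof -
 let ?s = "\<lambda>i. if i < n - d then \<zero> else p (i - (n - d))"
 have "pev R (prem R d p n f) x (Suc n) = p d \<otimes> pev R f x (Suc n) \<ominus> f n \<otimes> pev R ?s x (Suc n)"
  unfolding prem_def by (rule pev_lin) (use p f x in auto)
 moreover have "pev R ?s x (Suc n) = x [^] (n - d) \<otimes> pev R p x (Suc d)"
  using pev_shift[of p x "n - d" "Suc d", OF p x] \<open>d \<le> n\<close> by simp
 moreover have "prem R d p n f n = \<zero>"
 proof -
  have "\<not> n < n - d" by simp
  then show ?thesis using p f \<open>d \<le> n\<close> by (simp add: prem_def m_comm)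
 qed
 moreover have "pev R (prem R d p n f) x n <: R" using prem_closed[of p f, OF p f] x by simp
 ultimately show ?thesis using x by simp
qed

lemma pev_mem_adjoin:
 assumes "subring A R" "!!i. c i : A" "x <: R"
 shows "pev R c x n : adjoin R A x"
proof (induction n)
 case 0
 show ?case using submodE(2)[OF adjoin_submod] assms by simp
next
 case (Suc n)
 then show ?case
  using submodE(3,5)[OF adjoin_submod[OF assms(1,3)]] pow_mem_adjoin[OF assms(1,3)] assms(2) by simp
qed

lemma adjoin_pev:
 assumes A: "subring A R" and x: "x <: R" and f: "f : adjoin R A x"
 obtains c n where "!!i. c i : A" "f = pev R c x n"
proof -
 obtain n where "f : pow_span R A x n" using adjoin_pow_span[OF A x f] .
 then have "EX c. (ALL i. c i : A) & f = pev R c x n"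
 proof (induction n arbitrary: f)
  case 0
  then show ?case using pow_span_0[OF A x] subringE(2)[OF A] by (intro exI[of _ "\<lambda>_. \<zero>"]) auto
 next
  case (Suc n)
  obtain a p where ap: "a : A" "p : pow_span R A x n" "f = a \<otimes> x [^] n \<oplus> p"
   using pow_span_Suc_elem[OF A x Suc.prems] .
  then obtain c where c: "ALL i. c i : A" "p = pev R c x n" using Suc.IH by blast
  have "pev R (c(n := a)) x n = pev R c x n" by (rule pev_cong) auto
  then have "pev R (c(n := a)) x (Suc n) = f" using ap c by (simp only: pev.simps fun_upd_same)
  moreover have "ALL i. (c(n := a)) i : A" using ap c by simp
  ultimately show ?case by metis
 qed
 then show ?thesis using that by blast
qed

lemma prem_mem:
 assumes "subring A R" "!!i. p i : A" "!!i. f i : A"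
 shows "prem R d p n f i : A"
 using subringE[OF assms(1)] assms(2,3) by (auto simp: prem_def a_minus_def)

end

text \<open>Library polynomials are lists with the leading coefficient first, hence the
  \<open>rev\<close>.\<close>

lemma (in field) eval_pev:
 assumes "!!i. c i <: R" "x <: R"
 shows "eval (map c (rev [0..<n])) x = pev R c x n"
 by (induction n) (use assms in auto)

lemma (in algebraically_closed) pev_root:
 assumes c: "!!i. c i <: L" and "c d ~= \<zero>" and "d \<ge> 1"
 obtains x where "x <: L" "pev L c x (Suc d) = \<zero>"
proof -
 let ?P = "map c (rev [0..<Suc d])"
 have "set ?P <= carrier L" using c by auto
 moreover have "lead_coeff ?P ~= \<zero>" using assms(2) by simp
 ultimately have "polynomial\<^bsub>L\<^esub> (carrier L) ?P" by (simp add: polynomial_def)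
 then have P: "?P <: (poly_ring L)" by (simp add: univ_poly_carrier)
 then have "size (roots ?P) = d" using roots_over_carrier splitted_def by auto
 then have "roots ?P ~= {#}" using \<open>d \<ge> 1\<close> by auto
 then obtain x where "x \<in># roots ?P" by blast
 then have "is_root ?P x" using roots_mem_iff_is_root[OF P] by simp
 then have x: "x <: L" "eval ?P x = \<zero>" by (auto simp: is_root_def)
 then show ?thesis using that[OF x(1)] eval_pev[of c x "Suc d"] c x by argo
qed

text \<open>A root of the polynomial minus one is a point where the polynomial takes the value one.
  Degree zero is separate, since a constant minus one has no root in general.\<close>

lemma (in algebraically_closed) pev_nonroot:
 assumes c: "!!i. c i <: L" and "c d ~= \<zero>"
 obtains x where "x <: L" "pev L c x (Suc d) ~= \<zero>"
proof (cases "d = 0")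
 case True
 then show ?thesis using that[of \<zero>] assms c[of 0] by simp
next
 case False
 define c' where "c' = c(0 := c 0 \<ominus> \<one>)"
 have c': "!!i. c' i <: L" using c by (simp add: c'_def)
 have "c' d ~= \<zero>" using assms(2) False by (simp add: c'_def)
 then obtain x where x: "x <: L" "pev L c' x (Suc d) = \<zero>" using pev_root[of c' d] c' False by auto
 have "pev L c' x (Suc n) = pev L c x (Suc n) \<ominus> \<one>" for n
 proof (induction n)
  case 0
  then show ?case using c[of 0] x by (simp add: c'_def)
 next
  case (Suc n)
  define y where "y = x [^] Suc n"
  have "pev L c' x (Suc (Suc n)) = c (Suc n) \<otimes> y \<oplus> pev L c' x (Suc n)"
   by (simp only: pev.simps(2)[of L c' x "Suc n"] y_def) (simp add: c'_def)
  also have "\<dots> = c (Suc n) \<otimes> y \<oplus> (pev L c x (Suc n) \<ominus> \<one>)" by (simp only: Suc)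
  also have "\<dots> = (c (Suc n) \<otimes> y \<oplus> pev L c x (Suc n)) \<ominus> \<one>"
   unfolding a_minus_def using c x by (intro a_assoc[symmetric]) (auto simp: y_def)
  finally show ?case by (simp only: pev.simps(2)[of L c x "Suc n"] y_def)
 qed
 then have "pev L c x (Suc d) \<ominus> \<one> = \<zero>" using x(2) by simp
 then have "pev L c x (Suc d) = \<one>" using c x(1) by (metis pev_closed one_closed r_right_minus_eq)
 then show ?thesis using that x(1) by simp
qed

section \<open>Extension of characters from a subring A to A[x]\<close>

locale hom_extension = R: domain R + k: algebraically_closed k
 for R :: "('a, 'r) ring_scheme" (structure) and k :: "('k, 'z) ring_scheme" +
 fixes A assumes A: "subring A R"
begin

definition is_hom :: "('a => 'k) => 'a set => bool" where
 "is_hom \<chi> B \<longleftrightarrow> \<chi> : ring_hom (R\<lparr>carrier := B\<rparr>) k"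

lemma is_homI:
 assumes "!!a. a : B ==> \<chi> a <: k"
  "!!a b. a : B ==> b : B ==> \<chi> (a \<otimes> b) = \<chi> a \<otimes>\<^sub>k \<chi> b"
  "!!a b. a : B ==> b : B ==> \<chi> (a \<oplus> b) = \<chi> a \<oplus>\<^sub>k \<chi> b" "\<chi> \<one> = \<one>\<^sub>k"
 shows "is_hom \<chi> B"
 unfolding is_hom_def by (rule ring_hom_memI) (use assms in auto)

lemma is_homD:
 assumes "is_hom \<chi> A"
 shows "!!a. a : A ==> \<chi> a <: k"
  "!!a b. a : A ==> b : A ==> \<chi> (a \<otimes> b) = \<chi> a \<otimes>\<^sub>k \<chi> b"
  "!!a b. a : A ==> b : A ==> \<chi> (a \<oplus> b) = \<chi> a \<oplus>\<^sub>k \<chi> b" "\<chi> \<one> = \<one>\<^sub>k"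
  "\<chi> \<zero> = \<zero>\<^sub>k" "!!a. a : A ==> \<chi> (\<ominus> a) = \<ominus>\<^sub>k \<chi> a"
  "!!a b. a : A ==> b : A ==> \<chi> (a \<ominus> b) = \<chi> a \<ominus>\<^sub>k \<chi> b"
proof -
 have h: "\<chi> : ring_hom (R\<lparr>carrier := A\<rparr>) k" using assms by (simp add: is_hom_def)
 note AE = subringE[OF A]
 show 1: "!!a. a : A ==> \<chi> a <: k"
  "!!a b. a : A ==> b : A ==> \<chi> (a \<otimes> b) = \<chi> a \<otimes>\<^sub>k \<chi> b"
  "!!a b. a : A ==> b : A ==> \<chi> (a \<oplus> b) = \<chi> a \<oplus>\<^sub>k \<chi> b" "\<chi> \<one> = \<one>\<^sub>k"
  using ring_hom_memE[OF h] by auto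
 have "\<chi> \<zero> \<oplus>\<^sub>k \<chi> \<zero> = \<chi> \<zero>" using 1(3)[of \<zero> \<zero>] AE(2) by simp
 then show z: "\<chi> \<zero> = \<zero>\<^sub>k" using 1(1)[OF AE(2)] by (metis k.add.l_cancel_one)
 show m: "\<chi> (\<ominus> a) = \<ominus>\<^sub>k \<chi> a" if "a : A" for a
 proof -
  have "\<chi> (\<ominus> a) \<oplus>\<^sub>k \<chi> a = \<zero>\<^sub>k" using 1(3)[of "\<ominus> a" a] AE(5)[OF that] that z AE(1)
   by (metis R.l_neg subsetD)
  then show ?thesis using 1(1) that AE(5)[OF that] by (metis k.minus_equality)
 qed
 show "!!a b. a : A ==> b : A ==> \<chi> (a \<ominus> b) = \<chi> a \<ominus>\<^sub>k \<chi> b"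
  using 1(3) m AE(5) by (simp add: a_minus_def)
qed

lemma hom_prem:
 assumes h: "is_hom \<chi> A" and p: "!!i. p i : A" and f: "!!i. f i : A"
 shows "(\<lambda>i. \<chi> (prem R d p n f i)) = prem k d (\<lambda>i. \<chi> (p i)) n (\<lambda>i. \<chi> (f i))"
 using is_homD[OF h] p f subringE[OF A] by (auto simp: prem_def fun_eq_iff)

lemma Ac: "a : A ==> a <: R"
 using subringE(1)[OF A] by blast

text \<open>The extension sends the value at \<open>x\<close> of a polynomial over \<open>A\<close>
  to the value at \<xi> of its image under \<chi>. The assumption \<open>wd\<close> says that
  relations of \<open>x\<close> over \<open>A\<close> become relations of \<xi>, which makes the
  result independent of the representation.\<close>

lemma extend_hom:
 assumes h: "is_hom \<chi> A" and x: "x <: R" and \<xi>: "\<xi> <: k"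
  and wd: "!!c n. (!!i. c i : A) ==> pev R c x n = \<zero> ==> pev k (\<lambda>i. \<chi> (c i)) \<xi> n = \<zero>\<^sub>k"
 obtains \<chi>' where "is_hom \<chi>' (adjoin R A x)" "!!a. a : A ==> \<chi>' a = \<chi> a"
  "!!c n. (!!i. c i : A) ==> \<chi>' (pev R c x n) = pev k (\<lambda>i. \<chi> (c i)) \<xi> n"
proof -
 let ?B = "adjoin R A x"
 note AE = subringE[OF A]
 note H = is_homD[OF h]
 note BE = subringE[OF R.adjoin_subring[OF A x]]
 \<comment> \<open>Padding with zero coefficients brings two representations to a common length, so
   that they can be added and subtracted.\<close>
 have pad: "EX c'. (ALL i. c' i : A) & pev R c' x N = pev R c x n &
   pev k (\<lambda>i. \<chi> (c' i)) \<xi> N = pev k (\<lambda>i. \<chi> (c i)) \<xi> n"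
  if c: "!!i. c i : A" and "n \<le> N" for c n N
 proof -
  let ?c = "\<lambda>i. if i < n then c i else \<zero>"
  have "(\<lambda>i. \<chi> (?c i)) = (\<lambda>i. if i < n then \<chi> (c i) else \<zero>\<^sub>k)" using H(5) by auto
  moreover have "ALL i. ?c i : A" using c AE(2) by simp
  moreover have "pev k (\<lambda>i. if i < n then \<chi> (c i) else \<zero>\<^sub>k) \<xi> N = pev k (\<lambda>i. \<chi> (c i)) \<xi> n"
   by (rule k.pev_pad) (use H(1) c \<xi> that(2) in auto)
  moreover have "pev R ?c x N = pev R c x n" by (rule R.pev_pad) (use Ac c x that(2) in auto)
  ultimately show ?thesis by (intro exI[of _ ?c]) presburger
 qed
 have wd2: "pev k (\<lambda>i. \<chi> (c i)) \<xi> n = pev k (\<lambda>i. \<chi> (d i)) \<xi> m"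
  if c: "!!i. c i : A" and d: "!!i. d i : A" and eq: "pev R c x n = pev R d x m" for c d n m
 proof -
  define N where "N = max n m"
  obtain c' where c': "ALL i. c' i : A" "pev R c' x N = pev R c x n"
   "pev k (\<lambda>i. \<chi> (c' i)) \<xi> N = pev k (\<lambda>i. \<chi> (c i)) \<xi> n"
   using pad[of c n N] c by (auto simp: N_def)
  obtain d' where d': "ALL i. d' i : A" "pev R d' x N = pev R d x m"
   "pev k (\<lambda>i. \<chi> (d' i)) \<xi> N = pev k (\<lambda>i. \<chi> (d i)) \<xi> m"
   using pad[of d m N] d by (auto simp: N_def)
  define e where "e i = \<one> \<otimes> c' i \<ominus> \<one> \<otimes> d' i" for i
  have e: "e i : A" for i unfolding e_def a_minus_def using AE(3,5,6,7) c'(1) d'(1) by simp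
  have cc: "!!i. c' i <: R" "!!i. d' i <: R" using c' d' Ac by auto
  have kk: "!!i. \<chi> (c' i) <: k" "!!i. \<chi> (d' i) <: k" using c' d' H(1) by auto
  have "pev R e x N = \<one> \<otimes> pev R c' x N \<ominus> \<one> \<otimes> pev R d' x N"
   unfolding e_def by (rule R.pev_lin) (use cc x in auto)
  then have "pev R e x N = \<zero>" using c'(2) d'(2) eq R.pev_closed[of d' x N] cc x by simp
  then have z: "pev k (\<lambda>i. \<chi> (e i)) \<xi> N = \<zero>\<^sub>k" using wd[of e N] e by blast
  have "(\<lambda>i. \<chi> (e i)) = (\<lambda>i. \<one>\<^sub>k \<otimes>\<^sub>k \<chi> (c' i) \<ominus>\<^sub>k \<one>\<^sub>k \<otimes>\<^sub>k \<chi> (d' i))"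
   using H(7) c'(1) d'(1) cc kk by (simp add: e_def)
  moreover have "pev k (\<lambda>i. \<one>\<^sub>k \<otimes>\<^sub>k \<chi> (c' i) \<ominus>\<^sub>k \<one>\<^sub>k \<otimes>\<^sub>k \<chi> (d' i)) \<xi> N =
    \<one>\<^sub>k \<otimes>\<^sub>k pev k (\<lambda>i. \<chi> (c' i)) \<xi> N \<ominus>\<^sub>k \<one>\<^sub>k \<otimes>\<^sub>k pev k (\<lambda>i. \<chi> (d' i)) \<xi> N"
   by (rule k.pev_lin) (use kk \<xi> in auto)
  moreover have pc: "pev k (\<lambda>i. \<chi> (c' i)) \<xi> N <: k" "pev k (\<lambda>i. \<chi> (d' i)) \<xi> N <: k"
   using kk \<xi> by auto
  ultimately have "pev k (\<lambda>i. \<chi> (c' i)) \<xi> N \<ominus>\<^sub>k pev k (\<lambda>i. \<chi> (d' i)) \<xi> N = \<zero>\<^sub>k" using z by simp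
  then have "pev k (\<lambda>i. \<chi> (c' i)) \<xi> N = pev k (\<lambda>i. \<chi> (d' i)) \<xi> N" using pc by simp
  then show ?thesis using c'(3) d'(3) by simp
 qed
 \<comment> \<open>Any representation of \<open>f\<close> may be chosen here, by
   \<open>wd2\<close>.\<close>
 define \<chi>' where "\<chi>' f = (SOME z. EX c n. (ALL i. c i : A) & f = pev R c x n & z = pev k (\<lambda>i. \<chi> (c i)) \<xi> n)" for f
 have ev: "\<chi>' (pev R c x n) = pev k (\<lambda>i. \<chi> (c i)) \<xi> n" if c: "!!i. c i : A" for c n
 proof -
  have "EX z c' n'. (ALL i. c' i : A) & pev R c x n = pev R c' x n' & z = pev k (\<lambda>i. \<chi> (c' i)) \<xi> n'"
   using c by blast
  from someI_ex[OF this] obtain c' n' where c': "ALL i. c' i : A" "pev R c x n = pev R c' x n'"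
   "\<chi>' (pev R c x n) = pev k (\<lambda>i. \<chi> (c' i)) \<xi> n'" unfolding \<chi>'_def by blast
  then show ?thesis using wd2[of c c' n n'] c by simp
 qed
 have base: "\<chi>' a = \<chi> a" if a: "a : A" for a
 proof -
  have "pev R (\<lambda>_. a) x 1 = a" using Ac[OF a] by simp
  then show ?thesis using ev[of "\<lambda>_. a" 1] a H(1)[OF a] by simp
 qed
 have closed: "\<chi>' f <: k" if f: "f : ?B" for f
 proof -
  obtain c n where "!!i. c i : A" "f = pev R c x n" using R.adjoin_pev[OF A x f] by blast
  then show ?thesis using ev[of c n] H(1) \<xi> by simp
 qed
 have add: "\<chi>' (f \<oplus> g) = \<chi>' f \<oplus>\<^sub>k \<chi>' g" if f: "f : ?B" and g: "g : ?B" for f g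
 proof -
  obtain c n where c: "!!i. c i : A" "f = pev R c x n" using R.adjoin_pev[OF A x f] by blast
  obtain d m where d: "!!i. d i : A" "g = pev R d x m" using R.adjoin_pev[OF A x g] by blast
  define N where "N = max n m"
  obtain c' where c': "ALL i. c' i : A" "pev R c' x N = f" using pad[of c n N] c by (auto simp: N_def)
  obtain d' where d': "ALL i. d' i : A" "pev R d' x N = g" using pad[of d m N] d by (auto simp: N_def)
  have s: "f \<oplus> g = pev R (\<lambda>i. c' i \<oplus> d' i) x N"
   using R.pev_add[of c' d' x N] c' d' Ac x by simp
  have sA: "!!i. c' i \<oplus> d' i : A" using AE(7) c'(1) d'(1) by simp
  have "\<chi>' (f \<oplus> g) = pev k (\<lambda>i. \<chi> (c' i \<oplus> d' i)) \<xi> N" unfolding s by (rule ev) (rule sA)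
  also have "(\<lambda>i. \<chi> (c' i \<oplus> d' i)) = (\<lambda>i. \<chi> (c' i) \<oplus>\<^sub>k \<chi> (d' i))" using H(3) c'(1) d'(1) by simp
  also have "pev k \<dots> \<xi> N = pev k (\<lambda>i. \<chi> (c' i)) \<xi> N \<oplus>\<^sub>k pev k (\<lambda>i. \<chi> (d' i)) \<xi> N"
   by (rule k.pev_add) (use H(1) c'(1) d'(1) \<xi> in auto)
  finally show ?thesis using ev[of c' N] ev[of d' N] c' d' by simp
 qed
 have scale: "\<chi>' (a \<otimes> f) = \<chi> a \<otimes>\<^sub>k \<chi>' f" if a: "a : A" and f: "f : ?B" for a f
 proof -
  obtain c n where c: "!!i. c i : A" "f = pev R c x n" using R.adjoin_pev[OF A x f] by blast
  have "a \<otimes> f = pev R (\<lambda>i. a \<otimes> c i) x n" using R.pev_scale[of c a x n] c a Ac x by simp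
  moreover have "!!i. a \<otimes> c i : A" using AE(6) a c by simp
  ultimately have "\<chi>' (a \<otimes> f) = pev k (\<lambda>i. \<chi> (a \<otimes> c i)) \<xi> n" using ev[of "\<lambda>i. a \<otimes> c i" n] by simp
  also have "(\<lambda>i. \<chi> (a \<otimes> c i)) = (\<lambda>i. \<chi> a \<otimes>\<^sub>k \<chi> (c i))" using H(2) a c by simp
  also have "pev k (\<lambda>i. \<chi> a \<otimes>\<^sub>k \<chi> (c i)) \<xi> n = \<chi> a \<otimes>\<^sub>k pev k (\<lambda>i. \<chi> (c i)) \<xi> n"
   using k.pev_scale[of "\<lambda>i. \<chi> (c i)" "\<chi> a" \<xi> n] H(1) a c \<xi> by simp
  finally show ?thesis using ev[of c n] c by simp
 qed
 have pow: "\<chi>' (x [^] m \<otimes> f) = \<xi> [^]\<^sub>k m \<otimes>\<^sub>k \<chi>' f" if f: "f : ?B" for m :: nat and f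
 proof -
  obtain c n where c: "!!i. c i : A" "f = pev R c x n" using R.adjoin_pev[OF A x f] by blast
  let ?s = "\<lambda>i. if i < m then \<zero> else c (i - m)"
  have "x [^] m \<otimes> f = pev R ?s x (m + n)" using R.pev_shift[of c x m n] c Ac x by simp
  moreover have "!!i. ?s i : A" using AE(2) c by simp
  ultimately have "\<chi>' (x [^] m \<otimes> f) = pev k (\<lambda>i. \<chi> (?s i)) \<xi> (m + n)" using ev[of ?s "m + n"] by presburger
  also have "(\<lambda>i. \<chi> (?s i)) = (\<lambda>i. if i < m then \<zero>\<^sub>k else \<chi> (c (i - m)))" using H(5) by auto
  also have "pev k \<dots> \<xi> (m + n) = \<xi> [^]\<^sub>k m \<otimes>\<^sub>k pev k (\<lambda>i. \<chi> (c i)) \<xi> n"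
   using k.pev_shift[of "\<lambda>i. \<chi> (c i)" \<xi> m n] H(1) c \<xi> by simp
  finally show ?thesis using ev[of c n] c by simp
 qed
 \<comment> \<open>Multiplicativity follows from the two cases of a left factor in \<open>A\<close>
   (\<open>scale\<close>) and a power of \<open>x\<close> (\<open>pow\<close>), by induction on the
   length of the left factor.\<close>
 have mult: "\<chi>' (pev R c x n \<otimes> g) = pev k (\<lambda>i. \<chi> (c i)) \<xi> n \<otimes>\<^sub>k \<chi>' g"
  if c: "!!i. c i : A" and g: "g : ?B" for c n g
 proof (induction n)
  case 0
  have "\<chi>' \<zero> = \<zero>\<^sub>k" using base[OF AE(2)] H(5) by simp
  then show ?case using closed[OF g] BE(1) g by auto
 next
  case (Suc n)
  have car: "c n <: R" "g <: R" "pev R c x n <: R" "x [^] n <: R"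
   "\<chi> (c n) <: k" "pev k (\<lambda>i. \<chi> (c i)) \<xi> n <: k" "\<xi> [^]\<^sub>k n <: k" "\<chi>' g <: k"
   using c Ac g BE(1) x H(1) \<xi> closed[OF g] by auto
  have xg: "x [^] n \<otimes> g : ?B" using BE(6)[OF R.pow_mem_adjoin[OF A x] g] .
  have "pev R c x (Suc n) \<otimes> g = c n \<otimes> (x [^] n \<otimes> g) \<oplus> pev R c x n \<otimes> g"
   using car by (simp add: R.l_distr R.m_assoc)
  moreover have "c n \<otimes> (x [^] n \<otimes> g) : ?B" "pev R c x n \<otimes> g : ?B"
   using R.submodE(5)[OF R.adjoin_submod[OF A x] c xg] BE(6)[OF R.pev_mem_adjoin[OF A c x] g]
   by auto
  ultimately have "\<chi>' (pev R c x (Suc n) \<otimes> g) = \<chi> (c n) \<otimes>\<^sub>k (\<xi> [^]\<^sub>k n \<otimes>\<^sub>k \<chi>' g) \<oplus>\<^sub>k \<chi>' (pev R c x n \<otimes> g)"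
   using add scale[OF c xg] pow[OF g, of n] by simp
  then show ?case using Suc car by (simp add: k.l_distr k.m_assoc)
 qed
 have "is_hom \<chi>' ?B"
 proof (rule is_homI)
  show "\<chi>' (f \<otimes> g) = \<chi>' f \<otimes>\<^sub>k \<chi>' g" if f: "f : ?B" and g: "g : ?B" for f g
  proof -
   obtain c n where c: "!!i. c i : A" "f = pev R c x n" using R.adjoin_pev[OF A x f] by blast
   then show ?thesis using mult[of c g n] g ev[of c n] by simp
  qed
  show "\<chi>' \<one> = \<one>\<^sub>k" using base[OF AE(3)] H(4) by simp
 qed (use closed add in auto)
 then show ?thesis using that base ev by blast
qed

text \<open>Pseudo-division of the relation \<open>f\<close> by the relation \<open>p\<close> gives
  a shorter relation of \<open>x\<close>, whose image vanishes at \<xi> by induction. The image of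
  \<open>p\<close> vanishes there too, so the image of \<open>f\<close> times \<chi> of the leading
  coefficient of \<open>p\<close> is zero, and that factor is nonzero. Relations too short to be
  divided are trivial by minimality of \<open>d\<close>.\<close>

lemma min_relation_wd:
 assumes h: "is_hom \<chi> A" and x: "x <: R" and \<xi>: "\<xi> <: k"
  and min: "!!c n i. (!!i. c i : A) ==> n \<le> d ==> pev R c x n = \<zero> ==> i < n ==> c i = \<zero>"
  and p: "!!i. p i : A" "pev R p x (Suc d) = \<zero>" "\<chi> (p d) ~= \<zero>\<^sub>k"
  and root: "pev k (\<lambda>i. \<chi> (p i)) \<xi> (Suc d) = \<zero>\<^sub>k"
  and f: "!!i. f i : A" "pev R f x n = \<zero>"
 shows "pev k (\<lambda>i. \<chi> (f i)) \<xi> n = \<zero>\<^sub>k"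
 using f
proof (induction n arbitrary: f)
 case (Suc n)
 note H = is_homD[OF h]
 show ?case
 proof (cases "Suc n \<le> d")
  case True
  then show ?thesis using min[of f "Suc n"] Suc.prems H(5) \<xi> by (intro k.pev_zero) auto
 next
  case False
  then have dn: "d \<le> n" by simp
  let ?g = "prem R d p n f"
  have fc: "!!i. f i <: R" "!!i. p i <: R" using Suc.prems(1) p(1) Ac by auto
  have kc: "!!i. \<chi> (f i) <: k" "!!i. \<chi> (p i) <: k" using Suc.prems(1) p(1) H(1) by auto
  have "pev R ?g x n = p d \<otimes> \<zero> \<ominus> f n \<otimes> (x [^] (n - d) \<otimes> \<zero>)"
   using R.pev_prem[of p f x d n] fc x dn Suc.prems(2) p(2) by simp
  then have "pev R ?g x n = \<zero>" using fc x by simp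
  then have "pev k (\<lambda>i. \<chi> (?g i)) \<xi> n = \<zero>\<^sub>k"
   using Suc.IH[of ?g] R.prem_mem[OF A] Suc.prems(1) p(1) by simp
  moreover have "pev k (\<lambda>i. \<chi> (?g i)) \<xi> n = \<chi> (p d) \<otimes>\<^sub>k pev k (\<lambda>i. \<chi> (f i)) \<xi> (Suc n) \<ominus>\<^sub>k
    \<chi> (f n) \<otimes>\<^sub>k (\<xi> [^]\<^sub>k (n - d) \<otimes>\<^sub>k pev k (\<lambda>i. \<chi> (p i)) \<xi> (Suc d))"
   unfolding hom_prem[OF h p(1) Suc.prems(1)] by (rule k.pev_prem) (use kc \<xi> dn in auto)
  moreover have Pc: "pev k (\<lambda>i. \<chi> (f i)) \<xi> (Suc n) <: k" by (rule k.pev_closed) (use kc \<xi> in auto)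
  ultimately have "\<chi> (p d) \<otimes>\<^sub>k pev k (\<lambda>i. \<chi> (f i)) \<xi> (Suc n) = \<zero>\<^sub>k"
   using kc \<xi> unfolding root by (simp del: pev.simps add: k.minus_zero)
  then show ?thesis using p(3) kc Pc by (meson k.integral)
 qed
qed simp

text \<open>Division with remainder by \<open>r\<close> of degree \<open>m\<close>, after
  multiplication by a nonzero \<alpha>, since leading coefficients need not be invertible in
  \<open>A\<close>. The top coefficient of the quotient is recorded as a nonzero multiple of that of
  \<open>f\<close>; later this is what prevents the quotient from being the zero polynomial.\<close>

lemma pseudo_division:
 assumes x: "x <: R" and r: "!!i. r i : A" "r m ~= \<zero>" and f: "!!i. f i : A"
 shows "EX \<alpha> \<alpha>' q s. \<alpha> : A & \<alpha> ~= \<zero> & \<alpha>' : A & \<alpha>' ~= \<zero> & (ALL i. q i : A) & (ALL i. s i : A) & q j = \<alpha>' \<otimes> f (m + j) \<and>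
  \<alpha> \<otimes> pev R f x (Suc (m + j)) = pev R q x (Suc j) \<otimes> pev R r x (Suc m) \<oplus> pev R s x m"
 using f
proof (induction j arbitrary: f)
 case 0
 let ?g = "prem R m r m f"
 have fc: "!!i. f i <: R" "!!i. r i <: R" using 0 r(1) Ac by auto
 have P: "pev R f x (Suc m) <: R" "pev R r x (Suc m) <: R" by (rule R.pev_closed, use fc x in auto)+
 have "pev R ?g x m = r m \<otimes> pev R f x (Suc m) \<ominus> f m \<otimes> pev R r x (Suc m)"
  using R.pev_prem[of r f x m m] fc x by (simp del: pev.simps add: P)
 then have "r m \<otimes> pev R f x (Suc m) = f m \<otimes> pev R r x (Suc m) \<oplus> pev R ?g x m"
  using R.diff_add_cancel[of "r m \<otimes> pev R f x (Suc m)" "f m \<otimes> pev R r x (Suc m)"] P fc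
  by (simp del: pev.simps add: R.a_comm)
 moreover have "pev R (\<lambda>_. f m) x (Suc 0) = f m" using fc x by simp
 moreover have "ALL i. ?g i : A" using R.prem_mem[OF A] r(1) 0 by simp
 moreover have "f m = \<one> \<otimes> f m" using fc by simp
 ultimately show ?case using r(1) 0 subringE(3)[OF A] R.one_not_zero
  by - (rule exI[of _ "r m"], rule exI[of _ \<one>], rule exI[of _ "\<lambda>_. f m"], rule exI[of _ ?g],
   simp del: pev.simps add: r(2))
next
 case (Suc j)
 let ?n = "m + Suc j"
 let ?g = "prem R m r ?n f"
 have gA: "!!i. ?g i : A" using R.prem_mem[OF A] r(1) Suc.prems by simp
 obtain \<alpha> \<alpha>' q s where IH: "\<alpha> : A" "\<alpha> ~= \<zero>" "\<alpha>' : A" "ALL i. q i : A" "ALL i. s i : A" "q j = \<alpha>' \<otimes> ?g (m + j)"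
  "\<alpha> \<otimes> pev R ?g x (Suc (m + j)) = pev R q x (Suc j) \<otimes> pev R r x (Suc m) \<oplus> pev R s x m"
  using Suc.IH[of ?g, OF gA] by blast
 \<comment> \<open>The monomial removed in the reduction step, multiplied by \<alpha>, becomes the
   top coefficient of the quotient.\<close>
 define q' where "q' = q(Suc j := \<alpha> \<otimes> f ?n)"
 have fc: "!!i. f i <: R" "!!i. r i <: R" "!!i. q i <: R" "!!i. s i <: R" "\<alpha> <: R"
  using Suc.prems r(1) IH Ac by auto
 define F where "F = pev R f x (Suc ?n)"
 define Y where "Y = pev R r x (Suc m)"
 define Q where "Q = pev R q x (Suc j)"
 define S where "S = pev R s x m"
 define Z where "Z = x [^] Suc j"
 have c: "F <: R" "Y <: R" "Q <: R" "S <: R" "Z <: R"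
  unfolding F_def Y_def Q_def S_def Z_def by (rule R.pev_closed, use fc x in auto)+
 have "pev R ?g x ?n = r m \<otimes> F \<ominus> f ?n \<otimes> (Z \<otimes> Y)"
  using R.pev_prem[of r f x m ?n] fc x by (simp del: pev.simps add: F_def Z_def Y_def)
 then have e: "\<alpha> \<otimes> (r m \<otimes> F \<ominus> f ?n \<otimes> (Z \<otimes> Y)) = Q \<otimes> Y \<oplus> S"
  using IH(7) by (simp del: pev.simps add: Q_def Y_def S_def)
 have "\<alpha> \<otimes> r m \<otimes> F = \<alpha> \<otimes> (r m \<otimes> F \<ominus> f ?n \<otimes> (Z \<otimes> Y)) \<oplus> \<alpha> \<otimes> (f ?n \<otimes> (Z \<otimes> Y))"
 proof -
  have "r m \<otimes> F = (r m \<otimes> F \<ominus> f ?n \<otimes> (Z \<otimes> Y)) \<oplus> f ?n \<otimes> (Z \<otimes> Y)"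
   using R.diff_add_cancel[of "r m \<otimes> F" "f ?n \<otimes> (Z \<otimes> Y)"] c fc by simp
  then have "\<alpha> \<otimes> (r m \<otimes> F) = \<alpha> \<otimes> (r m \<otimes> F \<ominus> f ?n \<otimes> (Z \<otimes> Y)) \<oplus> \<alpha> \<otimes> (f ?n \<otimes> (Z \<otimes> Y))"
   using c fc by (metis R.minus_closed R.m_closed R.r_distr)
  then show ?thesis using c fc by (simp add: R.m_assoc)
 qed
 also have "\<dots> = (Q \<otimes> Y \<oplus> S) \<oplus> \<alpha> \<otimes> (f ?n \<otimes> (Z \<otimes> Y))" unfolding e ..
 also have "\<dots> = (\<alpha> \<otimes> f ?n \<otimes> Z \<oplus> Q) \<otimes> Y \<oplus> S" using c fc by (simp add: R.l_distr R.m_assoc R.a_ac)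
 also have "\<alpha> \<otimes> f ?n \<otimes> Z \<oplus> Q = pev R q' x (Suc (Suc j))"
 proof -
  have "pev R q' x (Suc j) = Q" unfolding Q_def by (rule pev_cong) (simp add: q'_def)
  moreover have "q' (Suc j) = \<alpha> \<otimes> f ?n" by (simp add: q'_def)
  ultimately show ?thesis unfolding Z_def by (simp only: pev.simps(2)[of R q' x "Suc j"])
 qed
 finally have eq: "\<alpha> \<otimes> r m \<otimes> F = pev R q' x (Suc (Suc j)) \<otimes> Y \<oplus> S" .
 have q'Suc: "q' (Suc j) = \<alpha> \<otimes> f ?n" by (simp add: q'_def)
 have q'A: "ALL i. q' i : A" using IH(1,4) Suc.prems subringE(6)[OF A] by (simp add: q'_def)
 have "\<alpha> \<otimes> r m ~= \<zero>" using R.integral_iff[OF fc(5) fc(2)[of m]] IH(2) r(2) by simp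
 then show ?case
  using eq q'A IH(1,2,5) r(1) subringE(6)[OF A]
  by - (rule exI[of _ "\<alpha> \<otimes> r m"], rule exI[of _ \<alpha>], rule exI[of _ q'], rule exI[of _ s],
   simp del: pev.simps add: F_def Y_def S_def q'Suc)
qed

text \<open>In the ideal of \<open>A[x]\<close> generated by \<open>b\<close> take a nonzero element
  with a representation \<open>r\<close> of least degree \<open>m\<close>. Then
  \<open>m = 0\<close>: if \<open>m\<close> were at least \<open>d\<close>, the relation
  \<open>p\<close> would reduce \<open>r\<close>, and if \<open>m\<close> were strictly between zero
  and \<open>d\<close>, division of \<open>p\<close> by \<open>r\<close> would produce a relation
  shorter than \<open>p\<close>.\<close>

lemma algebraic_norm:
 assumes x: "x <: R"
  and min: "!!c n i. (!!i. c i : A) ==> n \<le> d ==> pev R c x n = \<zero> ==> i < n ==> c i = \<zero>"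
  and p: "!!i. p i : A" "pev R p x (Suc d) = \<zero>" "p d ~= \<zero>"
  and b: "b : adjoin R A x" "b ~= \<zero>"
 shows "EX b':adjoin R A x. b \<otimes> b' : A & b \<otimes> b' ~= \<zero>"
proof -
 let ?B = "adjoin R A x"
 note BE = subringE[OF R.adjoin_subring[OF A x]]
 have bc: "b <: R" using b BE(1) by auto
 define I where "I = {b \<otimes> b' | b'. b' : ?B}"
 define ok where "ok m \<longleftrightarrow> (EX r. (ALL i. r i : A) & pev R r x (Suc m) : I & pev R r x (Suc m) ~= \<zero>)" for m
 have "b = b \<otimes> \<one>" using bc by simp
 then have bI: "b : I" unfolding I_def using BE(3) by blast
 obtain c n where c: "!!i. c i : A" "b = pev R c x n" using R.adjoin_pev[OF A x b(1)] by blast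
 then have "n ~= 0" using b(2) by (metis pev.simps(1))
 then obtain n' where "n = Suc n'" using not0_implies_Suc by blast
 then have "ok n'" unfolding ok_def using c bI b(2) by blast
 define m where "m = (LEAST m. ok m)"
 have okm: "ok m" unfolding m_def by (rule LeastI) fact
 have least: "\<not> ok m'" if "m' < m" for m' using not_less_Least that unfolding m_def by blast
 obtain r where r: "!!i. r i : A" "pev R r x (Suc m) : I" "pev R r x (Suc m) ~= \<zero>"
  using okm unfolding ok_def by blast
 have small: "pev R s x m = \<zero>" if "!!i. s i : A" "pev R s x m : I" for s
 proof (cases m)
  case (Suc m')
  then show ?thesis using least[of m'] that unfolding ok_def by blast
 qed simp
 have Imult: "y \<otimes> f : I" if y: "y : ?B" and f: "f : I" for f y
 proof -
  obtain b' where b': "b' : ?B" "f = b \<otimes> b'" using f by (auto simp: I_def)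
  have "y \<otimes> f = b \<otimes> (y \<otimes> b')"
   using b'(2) subsetD[OF BE(1) b'(1)] subsetD[OF BE(1) y] bc by (simp add: R.m_lcomm)
  then show ?thesis using BE(6)[OF y b'(1)] by (auto simp: I_def)
 qed
 have AB: "A <= ?B" by (rule R.adjoin_base[OF A x])
 have c: "!!i. r i <: R" "!!i. p i <: R" using r p Ac by auto
 define Y where "Y = pev R r x (Suc m)"
 have Yc: "Y <: R" unfolding Y_def by (rule R.pev_closed) (use c x in auto)
 have rm: "r m ~= \<zero>"
 proof
  assume "r m = \<zero>"
  then have "pev R r x (Suc m) = pev R r x m" using R.pev_closed[of r x m] c x by simp
  then show False using small[of r] r by simp
 qed
 have "m = 0"
 proof (rule ccontr)
  assume m0: "m ~= 0"
  have md: "m < d"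
  proof (rule ccontr)
   assume "\<not> m < d"
   then have dm: "d \<le> m" by simp
   let ?g = "prem R d p m r"
   have "pev R ?g x m = p d \<otimes> Y \<ominus> r m \<otimes> (x [^] (m - d) \<otimes> \<zero>)"
    using R.pev_prem[of p r x d m] c x dm p(2) by (simp del: pev.simps add: Y_def)
   then have e: "pev R ?g x m = p d \<otimes> Y" using c x Yc by (simp add: a_minus_def)
   moreover have "p d \<otimes> Y : I" using Imult[of "p d" Y] p(1) AB r(2) by (auto simp: Y_def)
   ultimately have "p d \<otimes> Y = \<zero>" using small[of ?g] R.prem_mem[OF A] p(1) r(1) by simp
   then show False using R.integral_iff[OF c(2) Yc] p(3) r(3) unfolding Y_def by simp
  qed
  obtain \<alpha> \<alpha>' q s where q: "\<alpha> : A" "\<alpha>' : A" "\<alpha>' ~= \<zero>" "ALL i. q i : A" "ALL i. s i : A"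
   "q (d - m) = \<alpha>' \<otimes> p (m + (d - m))"
   "\<alpha> \<otimes> pev R p x (Suc (m + (d - m))) = pev R q x (Suc (d - m)) \<otimes> pev R r x (Suc m) \<oplus> pev R s x m"
   using pseudo_division[where r=r and m=m and f=p and j="d - m", OF x r(1) rm p(1)] by blast
  define Q where "Q = pev R q x (Suc (d - m))"
  have qc: "!!i. q i <: R" "!!i. s i <: R" using q Ac by auto
  have Qc: "Q <: R" "pev R s x m <: R" unfolding Q_def by (rule R.pev_closed, use qc x in auto)+
  have QB: "Q : ?B" unfolding Q_def by (rule R.pev_mem_adjoin) (use A q x in auto)
  \<comment> \<open>\<open>p\<close> vanishes at \<open>x\<close>, so the quotient term and the
    remainder cancel. The remainder therefore lies in the ideal and, having degree below
    \<open>m\<close>, is zero.\<close>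
  have z: "Q \<otimes> Y \<oplus> pev R s x m = \<zero>" using q(1,7) md p(2) Ac by (simp del: pev.simps add: Q_def Y_def)
  then have "pev R s x m \<oplus> Q \<otimes> Y = \<zero>" using Qc Yc by (simp add: R.a_comm)
  then have "pev R s x m = \<ominus> (Q \<otimes> Y)"
   using Qc Yc R.minus_equality[of "pev R s x m" "Q \<otimes> Y"] by simp
  also have "\<dots> = (\<ominus> Q) \<otimes> Y" using Qc Yc by (simp add: R.l_minus)
  also have "\<dots> : I" using Imult[of "\<ominus> Q" Y] QB BE(5) r(2) by (simp add: Y_def)
  finally have s0: "pev R s x m = \<zero>" using small[of s] q(5) by simp
  then have "Q \<otimes> Y = \<zero>" using z Qc Yc by simp
  then have "Q = \<zero>" using R.integral_iff[OF Qc(1) Yc] r(3) unfolding Y_def by simp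
  \<comment> \<open>The relation \<open>q\<close> has degree at most \<open>d - m\<close>, which is
    below \<open>d\<close> because \<open>m\<close> is positive, so minimality of \<open>d\<close>
    kills its coefficients.\<close>
  then have "q (d - m) = \<zero>" using min[of q "Suc (d - m)" "d - m"] q(4) md m0 by (simp add: Q_def)
  moreover have "m + (d - m) = d" using md by simp
  ultimately have "\<alpha>' \<otimes> p d = \<zero>" using q(6) by simp
  then show False using R.integral_iff[OF Ac[OF q(2)] c(2)] q(3) p(3) by simp
 qed
 then have "Y = r 0" using c(1)[of 0] by (simp add: Y_def)
 moreover obtain b' where "b' : ?B" "Y = b \<otimes> b'" using r(2) unfolding Y_def I_def by blast
 ultimately show ?thesis using r(1)[of 0] r(3) unfolding Y_def[symmetric] by (intro bexI[of _ b']) auto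
qed

text \<open>Either \<open>x\<close> satisfies no nontrivial relation over \<open>A\<close>, and
  \<xi> may be any point outside the roots of one polynomial, or a relation of least degree dictates
  \<xi> as a root of its image.\<close>

theorem ext:
 assumes x: "x <: R" and b: "b : adjoin R A x" "b ~= \<zero>"
 shows "EX a:A. a ~= \<zero> & (ALL \<chi>. is_hom \<chi> A & \<chi> a ~= \<zero>\<^sub>k -->
  (EX \<chi>'. is_hom \<chi>' (adjoin R A x) & (ALL a:A. \<chi>' a = \<chi> a) & \<chi>' b ~= \<zero>\<^sub>k))"
proof (cases "ALL c n. (ALL i. c i : A) & pev R c x n = \<zero> --> (ALL i<n. c i = \<zero>)")
 case True
 obtain c n where c: "!!i. c i : A" "b = pev R c x n" using R.adjoin_pev[OF A x b(1)] by blast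
 then have "EX m<n. c m ~= \<zero>" using b(2) R.pev_zero[of n c x] x by blast
 \<comment> \<open>The last nonzero coefficient of \<open>b\<close> serves as \<open>a\<close>: if
   \<chi> does not kill it, the image of the polynomial is nonzero and some \<xi> is not a
   root.\<close>
 then obtain m where m: "m < n" "c m ~= \<zero>" and last: "!!i. m < i ==> i < n ==> c i = \<zero>"
 proof -
  assume *: "EX m<n. c m ~= \<zero>" and th: "!!m. m < n ==> c m ~= \<zero> ==> (!!i. m < i ==> i < n ==> c i = \<zero>) ==> thesis"
  let ?S = "{m. m < n & c m ~= \<zero>}"
  have "finite ?S" "?S ~= {}" using * by auto
  then have 1: "Max ?S : ?S" by (rule Max_in)
  have "c i = \<zero>" if "Max ?S < i" "i < n" for i
   using Max_ge[OF \<open>finite ?S\<close>, of i] that by fastforce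
  moreover have "Max ?S < n" "c (Max ?S) ~= \<zero>" using 1 by blast+
  ultimately show thesis using th by blast
 qed
 show ?thesis
 proof (intro bexI[of _ "c m"] conjI allI impI)
  show "c m : A" "c m ~= \<zero>" by fact+
  fix \<chi> assume "is_hom \<chi> A & \<chi> (c m) ~= \<zero>\<^sub>k"
  then have h: "is_hom \<chi> A" and nz: "\<chi> (c m) ~= \<zero>\<^sub>k" by auto
  note H = is_homD[OF h]
  have kc: "!!i. \<chi> (c i) <: k" using H(1) c(1) by simp
  obtain \<xi> where \<xi>: "\<xi> <: k" "pev k (\<lambda>i. \<chi> (c i)) \<xi> (Suc m) ~= \<zero>\<^sub>k"
   using k.pev_nonroot[of "\<lambda>i. \<chi> (c i)" m] kc nz by blast
  have wd: "pev k (\<lambda>i. \<chi> (f i)) \<xi> l = \<zero>\<^sub>k" if "!!i. f i : A" "pev R f x l = \<zero>" for f l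

  proof (rule k.pev_zero)
   have "ALL i<l. f i = \<zero>" using True that by blast
   then show "\<chi> (f i) = \<zero>\<^sub>k" if "i < l" for i using H(5) that by simp
  qed (rule \<xi>(1))
  obtain \<chi>' where \<chi>': "is_hom \<chi>' (adjoin R A x)" "!!a. a : A ==> \<chi>' a = \<chi> a"
   "!!c n. (!!i. c i : A) ==> \<chi>' (pev R c x n) = pev k (\<lambda>i. \<chi> (c i)) \<xi> n"
   using extend_hom[OF h x \<xi>(1) wd] by blast
  have "pev k (\<lambda>i. \<chi> (c i)) \<xi> n = pev k (\<lambda>i. if i < Suc m then \<chi> (c i) else \<zero>\<^sub>k) \<xi> n"
   by (rule pev_cong) (use last H(5) in auto)
  also have "\<dots> = pev k (\<lambda>i. \<chi> (c i)) \<xi> (Suc m)" by (rule k.pev_pad) (use kc \<xi> m in auto)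
  finally have "\<chi>' b ~= \<zero>\<^sub>k" using \<chi>'(3)[of c n] c \<xi>(2) by simp
  then show "EX \<chi>'. is_hom \<chi>' (adjoin R A x) & (ALL a:A. \<chi>' a = \<chi> a) & \<chi>' b ~= \<zero>\<^sub>k"
   using \<chi>' by blast
 qed
next
 case False
 \<comment> \<open>A nontrivial relation of degree at most \<open>d\<close>. The least such
   \<open>d\<close> is the degree of \<open>x\<close> over \<open>A\<close>.\<close>
 define rel where "rel d \<longleftrightarrow> (EX c. (ALL i. c i : A) & pev R c x (Suc d) = \<zero> & (EX i<=d. c i ~= \<zero>))" for d
 have relI: "rel (n - 1)" if "!!i. c i : A" "pev R c x n = \<zero>" "i < n" "c i ~= \<zero>" for c n i
 proof -
  obtain n' where n: "n = Suc n'" using \<open>i < n\<close> by (cases n) auto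
  then have "i \<le> n'" using \<open>i < n\<close> by simp
  have "(ALL i. c i : A) & pev R c x (Suc n') = \<zero> & (EX i<=n'. c i ~= \<zero>)"
  proof (intro conjI allI)
   show "EX i<=n'. c i ~= \<zero>" using \<open>i \<le> n'\<close> that(4) by (intro exI[of _ i] conjI)
  qed (use that(1,2) n in \<open>simp_all only:\<close>)
  then show ?thesis unfolding n rel_def diff_Suc_1 by (rule exI[of _ c])
 qed
 obtain c n i where c: "!!i. c i : A" "pev R c x n = \<zero>" "i < n" "c i ~= \<zero>" using False by blast
 then have "rel (n - 1)" by (rule relI)
 define d where "d = (LEAST d. rel d)"
 have reld: "rel d" unfolding d_def by (rule LeastI) fact
 have least: "\<not> rel d'" if "d' < d" for d' using not_less_Least that unfolding d_def by blast
 have min: "c i = \<zero>" if "!!i. c i : A" "n \<le> d" "pev R c x n = \<zero>" "i < n" for c n i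
 proof (rule ccontr)
  assume "c i ~= \<zero>"
  then have "rel (n - 1)" using relI that by blast
  moreover have "n - 1 < d" using that(2,4) by linarith
  ultimately show False using least by blast
 qed
 obtain p j where p: "!!i. p i : A" "pev R p x (Suc d) = \<zero>" "j \<le> d" "p j ~= \<zero>"
  using reld unfolding rel_def by blast
 have pc: "!!i. p i <: R" using p(1) Ac by auto
 have pd: "p d ~= \<zero>"
 proof
  assume *: "p d = \<zero>"
  then have "pev R p x d = \<zero>" using p(2) R.pev_closed[of p x d] pc x by simp
  then have "p j = \<zero>" if "j < d" using min[of p d j] p(1) that by simp
  then show False using * p(3,4) by (cases "j = d") auto
 qed
 have d1: "d \<ge> 1"
 proof (rule ccontr)
  assume "\<not> d \<ge> 1"
  then have "d = 0" by simp
  then show False using p(2) pd pc[of 0] by simp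
 qed
 obtain b' where b': "b' : adjoin R A x" "b \<otimes> b' : A" "b \<otimes> b' ~= \<zero>"
  using algebraic_norm[where p=p and d=d and x=x and b=b, OF x _ _ p(2) pd b] min p(1) by blast
 \<comment> \<open>The factor \<open>p d\<close> preserves the degree of \<open>p\<close> under
   \<chi>, so that a root \<xi> exists; the factor \<open>b b'\<close> is a multiple of
   \<open>b\<close> inside \<open>A\<close>, so that the extension cannot vanish at
   \<open>b\<close>.\<close>
 let ?a = "p d \<otimes> (b \<otimes> b')"
 show ?thesis
 proof (intro bexI[of _ ?a] conjI allI impI)
  show "?a : A" using subringE(6)[OF A p(1) b'(2)] .
  show "?a ~= \<zero>" using R.integral_iff[OF pc Ac[OF b'(2)]] pd b'(3) by simp
  fix \<chi> assume "is_hom \<chi> A & \<chi> ?a ~= \<zero>\<^sub>k"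
  then have h: "is_hom \<chi> A" and nz: "\<chi> ?a ~= \<zero>\<^sub>k" by auto
  note H = is_homD[OF h]
  have kc: "!!i. \<chi> (p i) <: k" using H(1) p(1) by simp
  have nz1: "\<chi> (p d) ~= \<zero>\<^sub>k" and nz2: "\<chi> (b \<otimes> b') ~= \<zero>\<^sub>k"
   using nz H(2)[OF p(1)[of d] b'(2)] kc H(1)[OF b'(2)] by auto
  obtain \<xi> where \<xi>: "\<xi> <: k" "pev k (\<lambda>i. \<chi> (p i)) \<xi> (Suc d) = \<zero>\<^sub>k"
   using k.pev_root[of "\<lambda>i. \<chi> (p i)" d] kc nz1 d1 by blast
  have wd: "pev k (\<lambda>i. \<chi> (f i)) \<xi> l = \<zero>\<^sub>k" if "!!i. f i : A" "pev R f x l = \<zero>" for f l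
  proof (rule min_relation_wd[where p=p and d=d and x=x and f=f and n=l, OF h x \<xi>(1) _ _ p(2) nz1 \<xi>(2) _ that(2)])
   show "c i = \<zero>" if "!!i. c i : A" "n \<le> d" "pev R c x n = \<zero>" "i < n" for c n i
    by (rule min[of c n i]) (rule that)+
  qed (rule p(1) that(1))+
  obtain \<chi>' where \<chi>': "is_hom \<chi>' (adjoin R A x)" "!!a. a : A ==> \<chi>' a = \<chi> a"
  proof (rule extend_hom[where \<chi>=\<chi> and \<xi>=\<xi> and x=x, OF h x \<xi>(1)])
   show "pev k (\<lambda>i. \<chi> (f i)) \<xi> l = \<zero>\<^sub>k" if "!!i. f i : A" "pev R f x l = \<zero>" for f l
    by (rule wd[of f l]) (rule that)+
  qed (rule that, assumption+)
  have "\<chi>' (b \<otimes> b') = \<chi>' b \<otimes>\<^sub>k \<chi>' b'"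
   using \<chi>'(1) b(1) b'(1) unfolding is_hom_def by (auto dest: ring_hom_mult)
  moreover have "\<chi>' b' <: k" using \<chi>'(1) b'(1) unfolding is_hom_def by (auto dest: ring_hom_closed)
  ultimately have "\<chi>' b ~= \<zero>\<^sub>k" using nz2 \<chi>'(2)[OF b'(2)] by auto
  then show "EX \<chi>'. is_hom \<chi>' (adjoin R A x) & (ALL a:A. \<chi>' a = \<chi> a) & \<chi>' b ~= \<zero>\<^sub>k"
   using \<chi>' by blast
 qed
qed

end

text \<open>Iteration over the generators: the nonzero element is pushed down from the full algebra
  to \<open>A\<close>, and the character is then lifted back step by step.\<close>

lemma adjoins_ext:
 assumes R: "domain R" and k: "algebraically_closed k" and A: "subring A R" and xs: "set xs <= carrier R"
  and b: "b : adjoins R A xs" "b ~= \<zero>\<^sub>R"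
 shows "EX a:A. a ~= \<zero>\<^sub>R & (ALL \<chi>. \<chi> : ring_hom (R\<lparr>carrier := A\<rparr>) k & \<chi> a ~= \<zero>\<^sub>k -->
  (EX \<chi>'. \<chi>' : ring_hom (R\<lparr>carrier := adjoins R A xs\<rparr>) k & (ALL a:A. \<chi>' a = \<chi> a) & \<chi>' b ~= \<zero>\<^sub>k))"
 using A xs b
proof (induction xs arbitrary: A)
 case Nil
 then show ?case by auto
next
 case (Cons x xs)
 interpret R: domain R by (rule R)
 interpret k: algebraically_closed k by (rule k)
 interpret hom_extension R k A
  by (intro hom_extension.intro hom_extension_axioms.intro R k Cons.prems(1))
 have x: "x <: R" using Cons.prems by simp
 have s: "subring (adjoin R A x) R" by (rule R.adjoin_subring[OF Cons.prems(1) x])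
 obtain a where a: "a : adjoin R A x" "a ~= \<zero>\<^sub>R"
  and lift1: "!!\<chi>. \<chi> : ring_hom (R\<lparr>carrier := adjoin R A x\<rparr>) k ==> \<chi> a ~= \<zero>\<^sub>k ==>
  (EX \<chi>'. \<chi>' : ring_hom (R\<lparr>carrier := adjoins R (adjoin R A x) xs\<rparr>) k & (ALL a:adjoin R A x. \<chi>' a = \<chi> a) & \<chi>' b ~= \<zero>\<^sub>k)"
  using Cons.IH[OF s] Cons.prems by auto
 obtain a' where a': "a' : A" "a' ~= \<zero>\<^sub>R"
  and lift2: "!!\<chi>. is_hom \<chi> A ==> \<chi> a' ~= \<zero>\<^sub>k ==>
  (EX \<chi>'. is_hom \<chi>' (adjoin R A x) & (ALL a:A. \<chi>' a = \<chi> a) & \<chi>' a ~= \<zero>\<^sub>k)"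
  using ext[OF x a] by blast
 have sub: "A <= adjoin R A x" by (rule R.adjoin_base[OF Cons.prems(1) x])
 show ?case
 proof (intro bexI[OF _ a'(1)] conjI allI impI a'(2))
  fix \<chi> assume "\<chi> : ring_hom (R\<lparr>carrier := A\<rparr>) k & \<chi> a' ~= \<zero>\<^sub>k"
  then obtain \<chi>1 where 1: "is_hom \<chi>1 (adjoin R A x)" "ALL a:A. \<chi>1 a = \<chi> a" "\<chi>1 a ~= \<zero>\<^sub>k"
   using lift2 unfolding is_hom_def by blast
  then obtain \<chi>2 where "\<chi>2 : ring_hom (R\<lparr>carrier := adjoins R (adjoin R A x) xs\<rparr>) k"
   "ALL a:adjoin R A x. \<chi>2 a = \<chi>1 a" "\<chi>2 b ~= \<zero>\<^sub>k" using lift1[of \<chi>1] unfolding is_hom_def by blast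
  then show "EX \<chi>'. \<chi>' : ring_hom (R\<lparr>carrier := adjoins R A (x # xs)\<rparr>) k & (ALL a:A. \<chi>' a = \<chi> a) & \<chi>' b ~= \<zero>\<^sub>k"
   using 1(2) sub by (auto intro!: exI[of _ \<chi>2])
 qed
qed

section \<open>Linear functionals\<close>

lemma finsum_hom:
 assumes C: "abelian_group C" and D: "abelian_group D"
  and h: "!!x. x <: C ==> h x <: D"
   "!!x y. x <: C ==> y <: C ==> h (x \<oplus>\<^sub>C y) = h x \<oplus>\<^sub>D h y"
  and g: "!!i. i : J ==> g i <: C"
  and "finite J"
 shows "h (finsum C g J) = finsum D (\<lambda>i. h (g i)) J"
 using \<open>finite J\<close> g
proof (induction J rule: finite_induct)
 interpret C: abelian_group C by fact
 interpret D: abelian_group D by fact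
 case empty
 have "h \<zero>\<^sub>C \<oplus>\<^sub>D h \<zero>\<^sub>C = h \<zero>\<^sub>C" using h(2)[of "\<zero>\<^sub>C" "\<zero>\<^sub>C"] by simp
 then have "h \<zero>\<^sub>C = \<zero>\<^sub>D" using h(1)[of "\<zero>\<^sub>C"] by simp
 then show ?case by simp
next
 interpret C: abelian_group C by fact
 interpret D: abelian_group D by fact
 case (insert i J)
 have "finsum C g (insert i J) = g i \<oplus>\<^sub>C finsum C g J"
  using insert by (intro C.finsum_insert) auto
 moreover have "finsum D (\<lambda>i. h (g i)) (insert i J) = h (g i) \<oplus>\<^sub>D finsum D (\<lambda>i. h (g i)) J"
  using insert h(1) by (intro D.finsum_insert) auto
 moreover have "finsum C g J <: C" using insert by (intro C.finsum_closed) auto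
 ultimately show ?case using insert h by simp
qed

locale vspace = K: field k + V: module k V for k :: "('k, 'z) ring_scheme" and V :: "('k, 'v) module"
begin

definition vsub :: "'v set => bool" where
 "vsub N \<longleftrightarrow> N <= carrier V & \<zero>\<^sub>V : N & (ALL x:N. ALL y:N. x \<oplus>\<^sub>V y : N) & (ALL c:carrier k. ALL x:N. c \<odot>\<^sub>V x : N)"

definition functional :: "('v => 'k) => bool" where
 "functional f \<longleftrightarrow> (ALL x:carrier V. f x <: k) &
  (ALL x:carrier V. ALL y:carrier V. f (x \<oplus>\<^sub>V y) = f x \<oplus>\<^sub>k f y) \<and>
  (ALL c:carrier k. ALL x:carrier V. f (c \<odot>\<^sub>V x) = c \<otimes>\<^sub>k f x)"

text \<open>Independence of a family, not of its set of values, so that a repeated nonzero vector is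
  already a dependence.\<close>

definition indep :: "'i set => ('i => 'v) => bool" where
 "indep J y \<longleftrightarrow> (ALL c. (ALL i:J. c i <: k) & finsum V (\<lambda>i. c i \<odot>\<^sub>V y i) J = \<zero>\<^sub>V --> (ALL i:J. c i = \<zero>\<^sub>k))"

lemma smult_zero_left [simp]: "x <: V ==> \<zero>\<^sub>k \<odot>\<^sub>V x = \<zero>\<^sub>V"
 by (rule V.smult_l_null)

lemma smult_zero_right [simp]: "c <: k ==> c \<odot>\<^sub>V \<zero>\<^sub>V = \<zero>\<^sub>V"
 by (rule V.smult_r_null)

lemma neg_smult: "x <: V ==> \<ominus>\<^sub>V x = (\<ominus>\<^sub>k \<one>\<^sub>k) \<odot>\<^sub>V x"
 using V.smult_l_minus[of "\<one>\<^sub>k" x] by simp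

lemma functional_zero: "functional f ==> f \<zero>\<^sub>V = \<zero>\<^sub>k"
proof -
 assume f: "functional f"
 have "f \<zero>\<^sub>V = f (\<zero>\<^sub>k \<odot>\<^sub>V \<zero>\<^sub>V)" by simp
 also have "\<dots> = \<zero>\<^sub>k \<otimes>\<^sub>k f \<zero>\<^sub>V"
  using f K.zero_closed V.zero_closed unfolding functional_def by blast
 also have "\<dots> = \<zero>\<^sub>k" using f unfolding functional_def by simp
 finally show ?thesis .
qed

text \<open>A subspace \<open>H\<close> maximal among those that contain \<open>N\<close> but not
  \<open>v\<close> is a complement of the line through \<open>v\<close>; the functional reads off
  the coefficient of \<open>v\<close>.\<close>

theorem separation:
 assumes N: "vsub N" and v: "v <: V" "v \<notin> N"
 obtains f where "functional f" "f v = \<one>\<^sub>k" "!!x. x : N ==> f x = \<zero>\<^sub>k"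
proof -
 let ?S = "{H. vsub H & N <= H & v \<notin> H}"
 have "EX H:?S. ALL P:?S. H <= P --> P = H"
 proof (rule subset_Zorn_nonempty)
  show "?S ~= {}" using assms by blast
  fix C assume ne: "C ~= {}" and ch: "subset.chain ?S C"
  then have CS: "C <= ?S" and tot: "!!P Y. P : C ==> Y : C ==> P <= Y \<or> Y <= P"
   by (auto simp: subset_chain_def)
  have vs: "!!P. P : C ==> vsub P" using CS by auto
  have "vsub (\<Union>C)" unfolding vsub_def
  proof (intro conjI ballI)
   show "\<Union>C <= carrier V" using vs unfolding vsub_def by blast
   show "\<zero>\<^sub>V : \<Union>C" using vs ne unfolding vsub_def by blast
   show "c \<odot>\<^sub>V x : \<Union>C" if "c <: k" "x : \<Union>C" for c x using vs that unfolding vsub_def by blast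
   fix x y assume "x : \<Union>C" "y : \<Union>C"
   then obtain P Y where PY: "P : C" "Y : C" "x : P" "y : Y" by blast
   then obtain Z where "Z : C" "x : Z" "y : Z" using tot[OF PY(1,2)] by blast
   then show "x \<oplus>\<^sub>V y : \<Union>C" using vs unfolding vsub_def by blast
  qed
  then show "\<Union>C : ?S" using CS ne by blast
 qed
 then obtain H where HS: "H : ?S" and mx: "ALL P:?S. H <= P --> P = H" by (rule bexE)
 then have H: "vsub H" "N <= H" "v \<notin> H" by simp_all
 have max: "P = H" if "vsub P" "v \<notin> P" "H <= P" for P
  by (rule mx[rule_format]) (use that H(2) in auto)
 have Hc: "H <= carrier V" "\<zero>\<^sub>V : H" "!!x y. x : H ==> y : H ==> x \<oplus>\<^sub>V y : H"
  "!!c x. c <: k ==> x : H ==> c \<odot>\<^sub>V x : H" using H(1) unfolding vsub_def by auto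
 \<comment> \<open>If \<open>x\<close> is not in \<open>H\<close>, then by maximality
   \<open>v\<close> lies in the span of \<open>H\<close> and \<open>x\<close>; solving for
   \<open>x\<close> expresses it by \<open>v\<close> modulo \<open>H\<close>.\<close>
 have ex: "EX c h. c <: k & h : H & x = c \<odot>\<^sub>V v \<oplus>\<^sub>V h" if x: "x <: V" for x
 proof (cases "x : H")
  case True
  have "x = \<zero>\<^sub>k \<odot>\<^sub>V v \<oplus>\<^sub>V x" using x v by simp
  then show ?thesis using True K.zero_closed by blast
 next
  case False
  let ?H = "{h \<oplus>\<^sub>V c \<odot>\<^sub>V x | h c. h : H & c <: k}"
  have "vsub ?H" unfolding vsub_def
  proof (intro conjI ballI)
   show "?H <= carrier V" using Hc(1) x by auto
   have "\<zero>\<^sub>V = \<zero>\<^sub>V \<oplus>\<^sub>V \<zero>\<^sub>k \<odot>\<^sub>V x" using x by simp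
   then show "\<zero>\<^sub>V : ?H" using Hc(2) K.zero_closed by blast
  next
   fix a b assume "a : ?H" "b : ?H"
   then obtain h c h' c' where q: "h : H" "h' : H" "c <: k" "c' <: k"
    "a = h \<oplus>\<^sub>V c \<odot>\<^sub>V x" "b = h' \<oplus>\<^sub>V c' \<odot>\<^sub>V x" by blast
   have "h <: V" "h' <: V" using q Hc(1) by auto
   then have "a \<oplus>\<^sub>V b = (h \<oplus>\<^sub>V h') \<oplus>\<^sub>V (c \<oplus>\<^sub>k c') \<odot>\<^sub>V x"
    using q x by (simp add: V.smult_l_distr V.a_ac)
   then show "a \<oplus>\<^sub>V b : ?H" using Hc(3)[OF q(1,2)] K.a_closed[OF q(3,4)] by blast
  next
   fix d a assume d: "d <: k" and "a : ?H"
   then obtain h c where q: "h : H" "c <: k" "a = h \<oplus>\<^sub>V c \<odot>\<^sub>V x" by blast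
   have "h <: V" using q Hc(1) by auto
   then have "d \<odot>\<^sub>V a = d \<odot>\<^sub>V h \<oplus>\<^sub>V (d \<otimes>\<^sub>k c) \<odot>\<^sub>V x"
    using q x d by (simp add: V.smult_r_distr V.smult_assoc1)
   then show "d \<odot>\<^sub>V a : ?H" using Hc(4)[OF d q(1)] K.m_closed[OF d q(2)] by blast
  qed
  moreover have "H <= ?H"
  proof
   fix h assume h: "h : H"
   then have "h = h \<oplus>\<^sub>V \<zero>\<^sub>k \<odot>\<^sub>V x" using x Hc(1) by auto
   then show "h : ?H" using h K.zero_closed by blast
  qed
  moreover have "x = \<zero>\<^sub>V \<oplus>\<^sub>V \<one>\<^sub>k \<odot>\<^sub>V x" using x by simp
  then have "x : ?H" using Hc(2) K.one_closed by blast
  ultimately have "v : ?H" using max[of ?H] False by blast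
  then obtain h c where q: "h : H" "c <: k" "v = h \<oplus>\<^sub>V c \<odot>\<^sub>V x" by blast
  have hc: "h <: V" using q Hc(1) by auto
  have "c ~= \<zero>\<^sub>k"
  proof
   assume "c = \<zero>\<^sub>k"
   then have "v = h" using q(3) x hc by simp
   then show False using q(1) H(3) by simp
  qed
  then have ci: "inv\<^bsub>k\<^esub> c <: k" "inv\<^bsub>k\<^esub> c \<otimes>\<^sub>k c = \<one>\<^sub>k" using q(2) K.field_Units by auto
  have "inv\<^bsub>k\<^esub> c \<odot>\<^sub>V v = inv\<^bsub>k\<^esub> c \<odot>\<^sub>V h \<oplus>\<^sub>V x"
   using q ci hc x by (simp add: V.smult_r_distr V.smult_assoc1[symmetric])
  then have "inv\<^bsub>k\<^esub> c \<odot>\<^sub>V v \<oplus>\<^sub>V (\<ominus>\<^sub>V (inv\<^bsub>k\<^esub> c \<odot>\<^sub>V h)) = x"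
   using ci hc x by (simp add: V.a_ac V.r_neg1 V.r_neg)
  moreover have "\<ominus>\<^sub>V (inv\<^bsub>k\<^esub> c \<odot>\<^sub>V h) : H"
   using neg_smult[of "inv\<^bsub>k\<^esub> c \<odot>\<^sub>V h"] Hc(4) ci q(1) hc by simp
  ultimately show ?thesis using ci(1) by metis
 qed
 \<comment> \<open>Two different coefficients would put a nonzero multiple of \<open>v\<close>, and
   hence \<open>v\<close>, into \<open>H\<close>.\<close>
 have uniq: "c = c'" if "c <: k" "c' <: k" "h : H" "h' : H"
  "c \<odot>\<^sub>V v \<oplus>\<^sub>V h = c' \<odot>\<^sub>V v \<oplus>\<^sub>V h'" for c c' h h'
 proof (rule ccontr)
  assume ne: "c ~= c'"
  let ?d = "c \<ominus>\<^sub>k c'"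
  have d: "?d <: k" "?d ~= \<zero>\<^sub>k" using that(1,2) ne by auto
  then have di: "inv\<^bsub>k\<^esub> ?d <: k" "inv\<^bsub>k\<^esub> ?d \<otimes>\<^sub>k ?d = \<one>\<^sub>k" using K.field_Units by auto
  have hh: "h <: V" "h' <: V" using that Hc(1) by auto
  define cv where "cv = c \<odot>\<^sub>V v"
  define cv' where "cv' = c' \<odot>\<^sub>V v"
  have cc: "cv <: V" "cv' <: V" using that v by (auto simp: cv_def cv'_def)
  have "?d \<odot>\<^sub>V v = cv \<oplus>\<^sub>V \<ominus>\<^sub>V cv'" unfolding cv_def cv'_def
   using that v by (simp add: a_minus_def V.smult_l_distr V.smult_l_minus)
  also have "cv = (cv \<oplus>\<^sub>V h) \<oplus>\<^sub>V \<ominus>\<^sub>V h" using cc hh by (simp add: V.a_assoc V.r_neg)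
  also have "cv \<oplus>\<^sub>V h = cv' \<oplus>\<^sub>V h'" using that(5) by (simp add: cv_def cv'_def)
  also have "cv' \<oplus>\<^sub>V h' \<oplus>\<^sub>V \<ominus>\<^sub>V h \<oplus>\<^sub>V \<ominus>\<^sub>V cv' = (cv' \<oplus>\<^sub>V \<ominus>\<^sub>V cv') \<oplus>\<^sub>V (h' \<oplus>\<^sub>V \<ominus>\<^sub>V h)"
   using cc hh by (simp add: V.a_ac del: V.r_neg)
  also have "\<dots> = h' \<oplus>\<^sub>V \<ominus>\<^sub>V h" using cc hh by (simp add: V.r_neg)
  also have "\<dots> : H" using Hc(3,4) that(3,4) neg_smult[OF hh(1)] by simp
  finally have "?d \<odot>\<^sub>V v : H" .
  then have "inv\<^bsub>k\<^esub> ?d \<odot>\<^sub>V (?d \<odot>\<^sub>V v) : H" using Hc(4) di by blast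
  moreover have "inv\<^bsub>k\<^esub> ?d \<odot>\<^sub>V (?d \<odot>\<^sub>V v) = v"
   using V.smult_assoc1[of "inv\<^bsub>k\<^esub> ?d" ?d v] d di v by simp
  ultimately show False using H(3) by simp
 qed
 define f where "f x = (THE c. EX h. c <: k & h : H & x = c \<odot>\<^sub>V v \<oplus>\<^sub>V h)" for x
 have fI: "f (c \<odot>\<^sub>V v \<oplus>\<^sub>V h) = c" if "c <: k" "h : H" for c h
  unfolding f_def by (rule the_equality) (use that uniq in blast)+
 show ?thesis
 proof (rule that[of f])
  show "functional f" unfolding functional_def
  proof (intro conjI ballI)
   fix x assume "x <: V"
   then obtain c h where x: "c <: k" "h : H" "x = c \<odot>\<^sub>V v \<oplus>\<^sub>V h" using ex by blast
   then show "f x <: k" using fI by simp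
   have hc: "h <: V" using x(2) Hc(1) by auto
   { fix y assume "y <: V"
    then obtain d l where y: "d <: k" "l : H" "y = d \<odot>\<^sub>V v \<oplus>\<^sub>V l" using ex by blast
    have lc: "l <: V" using y(2) Hc(1) by auto
    have "x \<oplus>\<^sub>V y = (c \<oplus>\<^sub>k d) \<odot>\<^sub>V v \<oplus>\<^sub>V (h \<oplus>\<^sub>V l)"
     using x y hc lc v by (simp add: V.smult_l_distr V.a_ac)
    then show "f (x \<oplus>\<^sub>V y) = f x \<oplus>\<^sub>k f y" using fI x y Hc(3) by simp }
   { fix d assume d: "d <: k"
    have "d \<odot>\<^sub>V x = (d \<otimes>\<^sub>k c) \<odot>\<^sub>V v \<oplus>\<^sub>V (d \<odot>\<^sub>V h)"
     using x d hc v by (simp add: V.smult_r_distr V.smult_assoc1)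
    then show "f (d \<odot>\<^sub>V x) = d \<otimes>\<^sub>k f x" using fI x d Hc(4) by simp }
  qed
  show "f v = \<one>\<^sub>k" using fI[of "\<one>\<^sub>k" "\<zero>\<^sub>V"] Hc(2) v by simp
  show "f x = \<zero>\<^sub>k" if "x : N" for x
  proof -
   have "x : H" using that H(2) by blast
   then show ?thesis using fI[of "\<zero>\<^sub>k" x] subsetD[OF Hc(1), of x] v(1) by simp
  qed
 qed
qed

lemma functional_separates:
 assumes "x <: V" "!!f. functional f ==> f x = \<zero>\<^sub>k"
 shows "x = \<zero>\<^sub>V"
proof (rule ccontr)
 assume "x ~= \<zero>\<^sub>V"
 moreover have "vsub {\<zero>\<^sub>V}" by (auto simp: vsub_def)
 ultimately obtain f where "functional f" "f x = \<one>\<^sub>k" using separation[of "{\<zero>\<^sub>V}" x] assms(1) by blast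
 then show False using assms(2)[of f] K.one_not_zero by simp
qed

lemma smult_finsum:
 assumes "c <: k" and "finite J" and "!!i. i : J ==> y i <: V"
 shows "c \<odot>\<^sub>V finsum V y J = finsum V (\<lambda>i. c \<odot>\<^sub>V y i) J"
 by (rule finsum_hom[OF V.abelian_group_axioms V.abelian_group_axioms])
  (use assms V.smult_r_distr in auto)

lemma indep_solve:
 assumes J: "finite J" and j: "j : J" and y: "!!i. i : J ==> y i <: V"
  and c: "!!i. i : J ==> c i <: k" "c j ~= \<zero>\<^sub>k" "finsum V (\<lambda>i. c i \<odot>\<^sub>V y i) J = \<zero>\<^sub>V"
 obtains d where "!!i. i : J ==> d i <: k" "y j = finsum V (\<lambda>i. d i \<odot>\<^sub>V y i) (J - {j})"
proof -
 define e where "e = \<ominus>\<^sub>k (inv\<^bsub>k\<^esub> (c j))"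
 have ci: "inv\<^bsub>k\<^esub> (c j) <: k" "inv\<^bsub>k\<^esub> (c j) \<otimes>\<^sub>k c j = \<one>\<^sub>k" using c j K.field_Units by auto
 have ec: "e <: k" using ci by (simp add: e_def)
 define s where "s = finsum V (\<lambda>i. c i \<odot>\<^sub>V y i) (J - {j})"
 have sc: "s <: V" unfolding s_def by (rule V.finsum_closed) (use c y in auto)
 have cy: "c j \<odot>\<^sub>V y j <: V" using c y j by simp
 have "finsum V (\<lambda>i. c i \<odot>\<^sub>V y i) (insert j (J - {j})) = c j \<odot>\<^sub>V y j \<oplus>\<^sub>V s"
  unfolding s_def by (rule V.finsum_insert) (use J c y j in auto)
 moreover have "insert j (J - {j}) = J" using j by auto
 ultimately have "c j \<odot>\<^sub>V y j \<oplus>\<^sub>V s = \<zero>\<^sub>V" using c(3) by simp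
 then have cs: "c j \<odot>\<^sub>V y j = \<ominus>\<^sub>V s" using V.minus_equality[of "c j \<odot>\<^sub>V y j" s] sc cy by simp
 have "y j = inv\<^bsub>k\<^esub> (c j) \<odot>\<^sub>V (c j \<odot>\<^sub>V y j)"
  using V.smult_assoc1[of "inv\<^bsub>k\<^esub> (c j)" "c j" "y j"] ci c(1)[OF j] y[OF j] by simp
 also have "\<dots> = e \<odot>\<^sub>V s" unfolding cs e_def using ci sc by (simp add: V.smult_r_minus V.smult_l_minus)
 also have "\<dots> = finsum V (\<lambda>i. e \<odot>\<^sub>V (c i \<odot>\<^sub>V y i)) (J - {j})"
  unfolding s_def by (rule smult_finsum) (use ec J c y in auto)
 also have "\<dots> = finsum V (\<lambda>i. (e \<otimes>\<^sub>k c i) \<odot>\<^sub>V y i) (J - {j})"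
  by (rule V.finsum_cong') (use ec c y in \<open>auto simp: V.smult_assoc1\<close>)
 finally show ?thesis by (intro that[of "\<lambda>i. e \<otimes>\<^sub>k c i"]) (use ec c in auto)
qed

text \<open>Independence keeps \<open>y j\<close> outside the span \<open>N\<close> of the other
  members; a functional separating the two is the dual vector of \<open>y j\<close>.\<close>

lemma indep_functional:
 assumes J: "finite J" and j: "j : J" and y: "!!i. i : J ==> y i <: V" and ind: "indep J y"
 obtains f where "functional f" "f (y j) = \<one>\<^sub>k" "!!i. i : J ==> i ~= j ==> f (y i) = \<zero>\<^sub>k"
proof -
 define N where "N = {x. EX c. (ALL i:J. c i <: k) & x = finsum V (\<lambda>i. c i \<odot>\<^sub>V y i) (J - {j})}"
 have "vsub N" unfolding vsub_def
 proof (intro conjI ballI subsetI)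
  show "x <: V" if "x : N" for x
   using that y unfolding N_def by (auto intro!: V.finsum_closed)
  have "finsum V (\<lambda>i. \<zero>\<^sub>k \<odot>\<^sub>V y i) (J - {j}) = finsum V (\<lambda>i. \<zero>\<^sub>V) (J - {j})"
   by (rule V.finsum_cong') (use y in auto)
  also have "\<dots> = \<zero>\<^sub>V" by simp
  finally show "\<zero>\<^sub>V : N" unfolding N_def by (intro CollectI exI[of _ "\<lambda>i. \<zero>\<^sub>k"]) auto
 next
  fix x z assume "x : N" "z : N"
  then obtain c d where c: "ALL i:J. c i <: k" "x = finsum V (\<lambda>i. c i \<odot>\<^sub>V y i) (J - {j})"
   and d: "ALL i:J. d i <: k" "z = finsum V (\<lambda>i. d i \<odot>\<^sub>V y i) (J - {j})" by (auto simp: N_def)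
  have "finsum V (\<lambda>i. (c i \<oplus>\<^sub>k d i) \<odot>\<^sub>V y i) (J - {j}) =
   finsum V (\<lambda>i. c i \<odot>\<^sub>V y i \<oplus>\<^sub>V d i \<odot>\<^sub>V y i) (J - {j})"
   by (rule V.finsum_cong') (use y c d in \<open>auto simp: V.smult_l_distr\<close>)
  also have "\<dots> = x \<oplus>\<^sub>V z" unfolding c(2) d(2) by (rule V.finsum_addf) (use y c d in auto)
  finally show "x \<oplus>\<^sub>V z : N" unfolding N_def using c(1) d(1)
   by (intro CollectI exI[of _ "\<lambda>i. c i \<oplus>\<^sub>k d i"]) auto
 next
  fix e x assume e: "e <: k" and "x : N"
  then obtain c where c: "ALL i:J. c i <: k" "x = finsum V (\<lambda>i. c i \<odot>\<^sub>V y i) (J - {j})"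
   by (auto simp: N_def)
  have "e \<odot>\<^sub>V x = finsum V (\<lambda>i. e \<odot>\<^sub>V (c i \<odot>\<^sub>V y i)) (J - {j})"
   unfolding c(2) by (rule smult_finsum) (use e J c y in auto)
  also have "\<dots> = finsum V (\<lambda>i. (e \<otimes>\<^sub>k c i) \<odot>\<^sub>V y i) (J - {j})"
   by (rule V.finsum_cong') (use e c y in \<open>auto simp: V.smult_assoc1\<close>)
  finally show "e \<odot>\<^sub>V x : N" unfolding N_def using c(1) e
   by (intro CollectI exI[of _ "\<lambda>i. e \<otimes>\<^sub>k c i"]) auto
 qed
 moreover have "y j \<notin> N"
 proof
  assume "y j : N"
  then obtain c where c: "ALL i:J. c i <: k" "y j = finsum V (\<lambda>i. c i \<odot>\<^sub>V y i) (J - {j})"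
   by (auto simp: N_def)
  \<comment> \<open>Moving \<open>y j\<close> to the other side gives a linear relation with
    coefficient minus one at \<open>j\<close>.\<close>
  define d where "d = c(j := \<ominus>\<^sub>k \<one>\<^sub>k)"
  have dk: "ALL i:J. d i <: k" using c(1) by (simp add: d_def)
  have "finsum V (\<lambda>i. d i \<odot>\<^sub>V y i) (insert j (J - {j})) =
    d j \<odot>\<^sub>V y j \<oplus>\<^sub>V finsum V (\<lambda>i. d i \<odot>\<^sub>V y i) (J - {j})"
   by (rule V.finsum_insert) (use J dk y j in auto)
  also have "finsum V (\<lambda>i. d i \<odot>\<^sub>V y i) (J - {j}) = y j" unfolding c(2)
   by (rule V.finsum_cong') (use c y in \<open>auto simp: d_def\<close>)
  also have "d j \<odot>\<^sub>V y j = \<ominus>\<^sub>V (y j)" using neg_smult[OF y[OF j]] by (simp add: d_def)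
  also have "\<ominus>\<^sub>V (y j) \<oplus>\<^sub>V y j = \<zero>\<^sub>V" using y[OF j] by (rule V.l_neg)
  also have "insert j (J - {j}) = J" using j by auto
  finally have "d j = \<zero>\<^sub>k" using ind dk j unfolding indep_def by blast
  then have "\<one>\<^sub>k = \<zero>\<^sub>k" using K.minus_minus[of "\<one>\<^sub>k"] by (simp add: d_def)
  then show False using K.one_not_zero by simp
 qed
 ultimately obtain f where f: "functional f" "f (y j) = \<one>\<^sub>k" "!!x. x : N ==> f x = \<zero>\<^sub>k"
  using separation[of N "y j"] y[OF j] by blast
 have "f (y i) = \<zero>\<^sub>k" if i: "i : J" "i ~= j" for i
 proof (rule f(3))
  let ?c = "\<lambda>l. if l = i then \<one>\<^sub>k else \<zero>\<^sub>k"
  have "finsum V (\<lambda>l. ?c l \<odot>\<^sub>V y l) (J - {j}) = finsum V (\<lambda>l. if i = l then y l else \<zero>\<^sub>V) (J - {j})"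
   by (rule V.finsum_cong') (use y in auto)
  also have "\<dots> = y i" by (rule V.finsum_singleton) (use i J y in auto)
  finally show "y i : N" unfolding N_def by (intro CollectI exI[of _ ?c]) auto
 qed
 then show ?thesis using that f by blast
qed

end

section \<open>Skew monoid rings\<close>

definition finsupp :: "('l, 'z) ring_scheme => 'm set => ('m => 'l) set" where
 "finsupp R P = {f. f ` P <= carrier R & supp R f <= P & finite (supp R f)}"

lemma skew_monoid_ring_simps [simp]:
 "carrier (skew_monoid_ring R M act) = finsupp R (carrier M)"
 "\<one>\<^bsub>skew_monoid_ring R M act\<^esub> = single R \<one>\<^sub>M \<one>\<^sub>R"
 "\<zero>\<^bsub>skew_monoid_ring R M act\<^esub> = (\<lambda>_. \<zero>\<^sub>R)"
 "f \<oplus>\<^bsub>skew_monoid_ring R M act\<^esub> g = (\<lambda>\<mu>. f \<mu> \<oplus>\<^sub>R g \<mu>)"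
 by (simp_all add: skew_monoid_ring_def finsupp_def)

lemma skew_monoid_ring_mult:
 "f \<otimes>\<^bsub>skew_monoid_ring R M act\<^esub> g = (\<lambda>\<rho>. finsum R (\<lambda>(\<mu>, \<nu>). f \<mu> \<otimes>\<^sub>R act \<mu> (g \<nu>))
        {(\<mu>, \<nu>). \<mu> : supp R f & \<nu> : supp R g & \<mu> \<otimes>\<^sub>M \<nu> = \<rho>})"
 by (simp add: skew_monoid_ring_def)

text \<open>The common shape of the skew product and of the map \<open>skew_tensor\<close>:
  \<open>opn\<close> combines indices and \<open>h\<close> combines coefficients, with possibly
  three different coefficient rings.\<close>

definition conv :: "('a, 'x) ring_scheme => ('b, 'y) ring_scheme => ('c, 'z) ring_scheme => ('m => 'n => 'p) =>
  ('m => 'n => 'a => 'b => 'c) => ('m => 'a) => ('n => 'b) => 'p => 'c" where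
 "conv R1 R2 R3 opn h f g = (\<lambda>\<rho>. finsum R3 (\<lambda>(\<mu>, \<nu>). h \<mu> \<nu> (f \<mu>) (g \<nu>))
   {(\<mu>, \<nu>). \<mu> : supp R1 f & \<nu> : supp R2 g & opn \<mu> \<nu> = \<rho>})"

lemma finsuppD:
 assumes "f : finsupp R P"
 shows "p : P ==> f p <: R" "p \<notin> P ==> f p = \<zero>\<^sub>R" "supp R f <= P" "finite (supp R f)"
 using assms by (auto simp: finsupp_def supp_def)

lemma finsupp_mem: "abelian_group R ==> f : finsupp R P ==> f p <: R"
proof (cases "p : P")
 assume R: "abelian_group R" and f: "f : finsupp R P" and p: "p \<notin> P"
 interpret abelian_group R by (rule R)
 show ?thesis using finsuppD(2)[OF f p] by simp
qed (rule finsuppD(1))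

context abelian_group
begin

lemma finsuppI:
 assumes "!!p. f p <: G" "!!p. p \<notin> S ==> f p = \<zero>" "finite S" "S <= P"
 shows "f : finsupp G P"
 using assms finite_subset[of "supp G f" S] unfolding finsupp_def supp_def by auto

lemma finsupp_zero: "(\<lambda>_. \<zero>) : finsupp G P"
 by (rule finsuppI[of _ "{}"]) auto

lemma finsupp_single: "p : P ==> l <: G ==> single G p l : finsupp G P"
 by (rule finsuppI[of _ "{p}"]) (auto simp: single_def)

lemma finsupp_add:
 assumes "f : finsupp G P" "g : finsupp G P"
 shows "(\<lambda>p. f p \<oplus> g p) : finsupp G P"
proof (rule finsuppI[of _ "supp G f \<union> supp G g"])
 show "f p \<oplus> g p <: G" for p
  using finsupp_mem[OF abelian_group_axioms assms(1)] finsupp_mem[OF abelian_group_axioms assms(2)] by simp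
 show "f p \<oplus> g p = \<zero>" if "p \<notin> supp G f \<union> supp G g" for p using that by (simp add: supp_def)
qed (use finsuppD(3,4)[OF assms(1)] finsuppD(3,4)[OF assms(2)] in auto)

lemma finsupp_neg:
 assumes "f : finsupp G P"
 shows "(\<lambda>p. \<ominus> f p) : finsupp G P"
proof (rule finsuppI[of _ "supp G f"])
 show "\<ominus> f p <: G" for p
  using finsupp_mem[OF abelian_group_axioms assms] by simp
 show "\<ominus> f p = \<zero>" if "p \<notin> supp G f" for p using that by (simp add: supp_def)
qed (use finsuppD(3,4)[OF assms] in auto)

lemma single_zero [simp]: "single G p \<zero> = (\<lambda>_. \<zero>)"
 by (auto simp: single_def)

lemma single_add: "a <: G ==> b <: G ==> single G p (a \<oplus> b) = (\<lambda>q. single G p a q \<oplus> single G p b q)"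
 by (auto simp: single_def)

lemma supp_single: "supp G (single G p l) = (if l = \<zero> then {} else {p})"
 by (auto simp: supp_def single_def)

text \<open>The support is exhausted one point at a time. Identities that are additive in
  \<open>f\<close> thus only have to be checked on single coefficients.\<close>

lemma finsupp_induct [consumes 1, case_names zero single add]:
 assumes f: "f : finsupp G P"
  and zero: "Q (\<lambda>_. \<zero>)"
  and single: "!!p l. p : P ==> l <: G ==> Q (single G p l)"
  and add: "!!f g. f : finsupp G P ==> g : finsupp G P ==> Q f ==> Q g ==> Q (\<lambda>p. f p \<oplus> g p)"
 shows "Q f"
proof -
 have "finite S ==> f : finsupp G P ==> supp G f <= S ==> Q f" for S f
 proof (induction S arbitrary: f rule: finite_induct)
  case empty
  then have "f = (\<lambda>_. \<zero>)" by (auto simp: supp_def)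
  then show ?case using zero by simp
 next
  case (insert s S)
  show ?case
  proof (cases "s : P")
   case True
   let ?g = "\<lambda>p. if p = s then \<zero> else f p"
   have fc: "f p <: G" for p using finsupp_mem[OF abelian_group_axioms insert.prems(1)] .
   have g: "?g : finsupp G P"
    by (rule finsuppI[of _ "supp G f"]) (use fc finsuppD[OF insert.prems(1)] in \<open>auto simp: supp_def\<close>)
   have "supp G ?g <= S" using insert.prems(2) by (auto simp: supp_def)
   then have "Q ?g" using insert.IH g by blast
   moreover have "f = (\<lambda>p. single G s (f s) p \<oplus> ?g p)" using fc by (auto simp: single_def)
   ultimately show ?thesis using add[OF finsupp_single[OF True fc[of s]] g single[OF True fc]] by simp
  next
   case False
   then have "supp G f <= S" using insert.prems finsuppD(2)[OF insert.prems(1) False] by (auto simp: supp_def)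
   then show ?thesis using insert.IH insert.prems by blast
  qed
 qed
 then show ?thesis using f finsuppD(4)[OF f] by blast
qed

end

section \<open>Additive maps and biadditive products of finitely supported functions\<close>

locale linear_lift = R: abelian_group R + C: abelian_group C
 for R :: "('a, 'x) ring_scheme" and C :: "('c, 'y) ring_scheme" +
 fixes P :: "'m set" and h :: "'m => 'a => 'c"
 assumes h_closed: "!!p a. p : P ==> a <: R ==> h p a <: C"
  and h_add: "!!p a b. p : P ==> a <: R ==> b <: R ==> h p (a \<oplus>\<^sub>R b) = h p a \<oplus>\<^sub>C h p b"
begin

definition llift :: "('m => 'a) => 'c" where
 "llift f = finsum C (\<lambda>p. h p (f p)) (supp R f)"

lemma h_zero: "p : P ==> h p \<zero>\<^sub>R = \<zero>\<^sub>C"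
proof -
 assume p: "p : P"
 have "h p \<zero>\<^sub>R \<oplus>\<^sub>C h p \<zero>\<^sub>R = h p \<zero>\<^sub>R" using h_add[OF p, of "\<zero>\<^sub>R" "\<zero>\<^sub>R"] by simp
 then show ?thesis using h_closed[OF p R.zero_closed] by simp
qed

lemma fmem: "f : finsupp R P ==> f p <: R"
 using finsupp_mem[OF R.abelian_group_axioms] .

lemma llift_closed: "f : finsupp R P ==> llift f <: C"
 unfolding llift_def
 by (rule C.finsum_closed) (use h_closed fmem[of f] finsuppD(3)[of f R P] in blast)

text \<open>\<open>h p\<close> sends zero to zero, so the sum may run over any finite set containing
  the support. This is needed because the support of a sum can shrink.\<close>

lemma llift_eq:
 assumes f: "f : finsupp R P" and S: "finite S" "supp R f <= S" "S <= P"
 shows "llift f = finsum C (\<lambda>p. h p (f p)) S"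
 unfolding llift_def
proof (rule C.add.finprod_mono_neutral_cong_left)
 show "h i (f i) = \<zero>\<^sub>C" if "i : S - supp R f" for i
  using that S(3) h_zero[of i] by (auto simp: supp_def)
 show "(\<lambda>p. h p (f p)) : S \<rightarrow> carrier C" using S(3) h_closed fmem[OF f] by blast
qed (use S in auto)

lemma llift_add:
 assumes f: "f : finsupp R P" and g: "g : finsupp R P"
 shows "llift (\<lambda>p. f p \<oplus>\<^sub>R g p) = llift f \<oplus>\<^sub>C llift g"
proof -
 let ?S = "supp R f \<union> supp R g"
 have S: "finite ?S" "?S <= P" using finsuppD(3,4)[OF f] finsuppD(3,4)[OF g] by auto
 have "supp R (\<lambda>p. f p \<oplus>\<^sub>R g p) <= ?S" by (auto simp: supp_def)
 then have "llift (\<lambda>p. f p \<oplus>\<^sub>R g p) = finsum C (\<lambda>p. h p (f p \<oplus>\<^sub>R g p)) ?S"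
  by (rule llift_eq[OF R.finsupp_add[OF f g] S(1) _ S(2)])
 also have "\<dots> = finsum C (\<lambda>p. h p (f p) \<oplus>\<^sub>C h p (g p)) ?S"
 proof (rule C.finsum_cong')
  show "h p (f p \<oplus>\<^sub>R g p) = h p (f p) \<oplus>\<^sub>C h p (g p)" if "p : ?S" for p
   using h_add[of p "f p" "g p"] that S(2) fmem[OF f] fmem[OF g] by blast
  show "(\<lambda>p. h p (f p) \<oplus>\<^sub>C h p (g p)) : ?S \<rightarrow> carrier C"
   using S(2) h_closed fmem[OF f] fmem[OF g] by blast
 qed simp
 also have "\<dots> = finsum C (\<lambda>p. h p (f p)) ?S \<oplus>\<^sub>C finsum C (\<lambda>p. h p (g p)) ?S"
  by (rule C.finsum_addf) (use S(2) h_closed fmem[OF f] fmem[OF g] in blast)+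
 also have "finsum C (\<lambda>p. h p (f p)) ?S = llift f" by (rule llift_eq[symmetric]) (use f S in auto)
 also have "finsum C (\<lambda>p. h p (g p)) ?S = llift g" by (rule llift_eq[symmetric]) (use g S in auto)
 finally show ?thesis .
qed

lemma llift_single: "p : P ==> l <: R ==> llift (single R p l) = h p l"
proof -
 assume p: "p : P" and l: "l <: R"
 have "llift (single R p l) = finsum C (\<lambda>q. h q (single R p l q)) {p}"
  by (rule llift_eq) (use p l R.finsupp_single in \<open>auto simp: R.supp_single\<close>)
 also have "\<dots> = h p l" using h_closed[OF p l] by (simp add: single_def)
 finally show ?thesis .
qed

lemma llift_zero: "llift (\<lambda>_. \<zero>\<^sub>R) = \<zero>\<^sub>C"
proof -
 have "supp R (\<lambda>_ :: 'm. \<zero>\<^sub>R) = {}" by (simp add: supp_def)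
 then show ?thesis by (simp add: llift_def)
qed

end

locale biadditive_conv = R1: abelian_group R1 + R2: abelian_group R2 + R3: abelian_group R3
 for R1 :: "('a, 'x) ring_scheme" and R2 :: "('b, 'y) ring_scheme" and R3 :: "('c, 'z) ring_scheme" +
 fixes P1 :: "'m set" and P2 :: "'n set" and P3 :: "'p set" and opn :: "'m => 'n => 'p"
  and h :: "'m => 'n => 'a => 'b => 'c"
 assumes opn: "!!\<mu> \<nu>. \<mu> : P1 ==> \<nu> : P2 ==> opn \<mu> \<nu> : P3"
  and h_closed: "!!\<mu> \<nu> a b. \<mu> : P1 ==> \<nu> : P2 ==> a <: R1 ==> b <: R2 ==> h \<mu> \<nu> a b <: R3"
  and h_add1: "!!\<mu> \<nu> a a' b. \<mu> : P1 ==> \<nu> : P2 ==> a <: R1 ==> a' <: R1 ==> b <: R2 ==>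
   h \<mu> \<nu> (a \<oplus>\<^sub>R1 a') b = h \<mu> \<nu> a b \<oplus>\<^sub>R3 h \<mu> \<nu> a' b"
  and h_add2: "!!\<mu> \<nu> a b b'. \<mu> : P1 ==> \<nu> : P2 ==> a <: R1 ==> b <: R2 ==> b' <: R2 ==>
   h \<mu> \<nu> a (b \<oplus>\<^sub>R2 b') = h \<mu> \<nu> a b \<oplus>\<^sub>R3 h \<mu> \<nu> a b'"
begin

abbreviation cv :: "('m => 'a) => ('n => 'b) => 'p => 'c" where "cv \<equiv> conv R1 R2 R3 opn h"

lemma fmem1: "f : finsupp R1 P1 ==> f p <: R1"
 using finsupp_mem[OF R1.abelian_group_axioms] .
lemma fmem2: "f : finsupp R2 P2 ==> f p <: R2"
 using finsupp_mem[OF R2.abelian_group_axioms] .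

lemma h_zero1: "\<mu> : P1 ==> \<nu> : P2 ==> b <: R2 ==> h \<mu> \<nu> \<zero>\<^sub>R1 b = \<zero>\<^sub>R3"
 using h_add1[of \<mu> \<nu> "\<zero>\<^sub>R1" "\<zero>\<^sub>R1" b] h_closed[of \<mu> \<nu> "\<zero>\<^sub>R1" b] by simp

lemma h_zero2: "\<mu> : P1 ==> \<nu> : P2 ==> a <: R1 ==> h \<mu> \<nu> a \<zero>\<^sub>R2 = \<zero>\<^sub>R3"
 using h_add2[of \<mu> \<nu> a "\<zero>\<^sub>R2" "\<zero>\<^sub>R2"] h_closed[of \<mu> \<nu> a "\<zero>\<^sub>R2"] by simp

lemma fibre_finite: "finite S ==> finite T ==> finite {(\<mu>, \<nu>). \<mu> : S & \<nu> : T & opn \<mu> \<nu> = \<rho>}"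
 by (rule finite_subset[of _ "S \<times> T"]) auto

text \<open>Pairs with a zero coefficient contribute nothing. The freedom to enlarge both supports
  allows different functions to be summed over the same index set.\<close>

lemma cv_eq:
 assumes f: "f : finsupp R1 P1" and g: "g : finsupp R2 P2"
  and S: "finite S" "supp R1 f <= S" "S <= P1" and T: "finite T" "supp R2 g <= T" "T <= P2"
 shows "cv f g \<rho> = finsum R3 (\<lambda>(\<mu>, \<nu>). h \<mu> \<nu> (f \<mu>) (g \<nu>)) {(\<mu>, \<nu>). \<mu> : S & \<nu> : T & opn \<mu> \<nu> = \<rho>}"
 unfolding conv_def
proof (rule R3.add.finprod_mono_neutral_cong_left)
 let ?A = "{(\<mu>, \<nu>). \<mu> : supp R1 f & \<nu> : supp R2 g & opn \<mu> \<nu> = \<rho>}"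
 let ?B = "{(\<mu>, \<nu>). \<mu> : S & \<nu> : T & opn \<mu> \<nu> = \<rho>}"
 show "finite ?B" by (rule fibre_finite[OF S(1) T(1)])
 show "?A <= ?B" using S T by auto
 show "(case i of (\<mu>, \<nu>) => h \<mu> \<nu> (f \<mu>) (g \<nu>)) = \<zero>\<^sub>R3" if i: "i : ?B - ?A" for i
 proof -
  obtain \<mu> \<nu> where m: "i = (\<mu>, \<nu>)" "\<mu> : P1" "\<nu> : P2" "\<mu> \<notin> supp R1 f \<or> \<nu> \<notin> supp R2 g"
   using i S(3) T(3) by auto
  then show ?thesis using h_zero1[OF m(2,3) fmem2[OF g]] h_zero2[OF m(2,3) fmem1[OF f]]
   by (auto simp: supp_def)
 qed
 show "(\<lambda>(\<mu>, \<nu>). h \<mu> \<nu> (f \<mu>) (g \<nu>)) : ?B \<rightarrow> carrier R3"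
  using S(3) T(3) h_closed fmem1[OF f] fmem2[OF g] by (auto simp: subset_iff)
qed auto

lemma cv_closed:
 assumes f: "f : finsupp R1 P1" and g: "g : finsupp R2 P2"
 shows "cv f g : finsupp R3 P3"
proof (rule R3.finsuppI[of _ "(\<lambda>(\<mu>, \<nu>). opn \<mu> \<nu>) ` (supp R1 f \<times> supp R2 g)"])
 note F = finsuppD(3,4)[OF f] finsuppD(3,4)[OF g]
 show "cv f g p <: R3" for p
  unfolding conv_def using F(1,3) h_closed fmem1[OF f] fmem2[OF g] by (intro R3.finsum_closed) (auto simp: subset_iff)
 show "cv f g p = \<zero>\<^sub>R3" if "p \<notin> (\<lambda>(\<mu>, \<nu>). opn \<mu> \<nu>) ` (supp R1 f \<times> supp R2 g)" for p
 proof -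
  have "{(\<mu>, \<nu>). \<mu> : supp R1 f & \<nu> : supp R2 g & opn \<mu> \<nu> = p} = {}" using that by force
  then show ?thesis by (simp only: conv_def R3.finsum_empty)
 qed
 show "finite ((\<lambda>(\<mu>, \<nu>). opn \<mu> \<nu>) ` (supp R1 f \<times> supp R2 g))" using F by simp
 show "(\<lambda>(\<mu>, \<nu>). opn \<mu> \<nu>) ` (supp R1 f \<times> supp R2 g) <= P3" using opn F(1,3) by auto
qed

lemma cv_add1:
 assumes f: "f : finsupp R1 P1" and f': "f' : finsupp R1 P1" and g: "g : finsupp R2 P2"
 shows "cv (\<lambda>p. f p \<oplus>\<^sub>R1 f' p) g = (\<lambda>\<rho>. cv f g \<rho> \<oplus>\<^sub>R3 cv f' g \<rho>)"
proof
 fix \<rho>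
 let ?S = "supp R1 f \<union> supp R1 f'" and ?T = "supp R2 g"
 let ?B = "{(\<mu>, \<nu>). \<mu> : ?S & \<nu> : ?T & opn \<mu> \<nu> = \<rho>}"
 note F = finsuppD(3,4)[OF f] finsuppD(3,4)[OF f'] finsuppD(3,4)[OF g]
 have S: "finite ?S" "?S <= P1" using F by auto
 have "supp R1 (\<lambda>p. f p \<oplus>\<^sub>R1 f' p) <= ?S" by (auto simp: supp_def)
 then have "cv (\<lambda>p. f p \<oplus>\<^sub>R1 f' p) g \<rho> = finsum R3 (\<lambda>(\<mu>, \<nu>). h \<mu> \<nu> (f \<mu> \<oplus>\<^sub>R1 f' \<mu>) (g \<nu>)) ?B"
  by (rule cv_eq[OF R1.finsupp_add[OF f f'] g S(1) _ S(2) F(6) _ F(5)]) simp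
 also have "\<dots> = finsum R3 (\<lambda>q. (case q of (\<mu>, \<nu>) => h \<mu> \<nu> (f \<mu>) (g \<nu>)) \<oplus>\<^sub>R3 (case q of (\<mu>, \<nu>) => h \<mu> \<nu> (f' \<mu>) (g \<nu>))) ?B"
  by (rule R3.finsum_cong') (use S(2) F(5) h_closed h_add1 fmem1[OF f] fmem1[OF f'] fmem2[OF g] in \<open>auto simp: subset_iff\<close>)
 also have "\<dots> = finsum R3 (\<lambda>(\<mu>, \<nu>). h \<mu> \<nu> (f \<mu>) (g \<nu>)) ?B \<oplus>\<^sub>R3 finsum R3 (\<lambda>(\<mu>, \<nu>). h \<mu> \<nu> (f' \<mu>) (g \<nu>)) ?B"
  by (rule R3.finsum_addf) (use S(2) F(5) h_closed fmem1[OF f] fmem1[OF f'] fmem2[OF g] in \<open>auto simp: subset_iff\<close>)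
 also have "finsum R3 (\<lambda>(\<mu>, \<nu>). h \<mu> \<nu> (f \<mu>) (g \<nu>)) ?B = cv f g \<rho>"
  by (rule cv_eq[symmetric]) (use f g S F in auto)
 also have "finsum R3 (\<lambda>(\<mu>, \<nu>). h \<mu> \<nu> (f' \<mu>) (g \<nu>)) ?B = cv f' g \<rho>"
  by (rule cv_eq[symmetric]) (use f' g S F in auto)
 finally show "cv (\<lambda>p. f p \<oplus>\<^sub>R1 f' p) g \<rho> = cv f g \<rho> \<oplus>\<^sub>R3 cv f' g \<rho>" .
qed

lemma cv_add2:
 assumes f: "f : finsupp R1 P1" and g: "g : finsupp R2 P2" and g': "g' : finsupp R2 P2"
 shows "cv f (\<lambda>p. g p \<oplus>\<^sub>R2 g' p) = (\<lambda>\<rho>. cv f g \<rho> \<oplus>\<^sub>R3 cv f g' \<rho>)"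
proof
 fix \<rho>
 let ?S = "supp R1 f" and ?T = "supp R2 g \<union> supp R2 g'"
 let ?B = "{(\<mu>, \<nu>). \<mu> : ?S & \<nu> : ?T & opn \<mu> \<nu> = \<rho>}"
 note F = finsuppD(3,4)[OF f] finsuppD(3,4)[OF g] finsuppD(3,4)[OF g']
 have T: "finite ?T" "?T <= P2" using F by auto
 have "supp R2 (\<lambda>p. g p \<oplus>\<^sub>R2 g' p) <= ?T" by (auto simp: supp_def)
 then have "cv f (\<lambda>p. g p \<oplus>\<^sub>R2 g' p) \<rho> = finsum R3 (\<lambda>(\<mu>, \<nu>). h \<mu> \<nu> (f \<mu>) (g \<nu> \<oplus>\<^sub>R2 g' \<nu>)) ?B"
  by (rule cv_eq[OF f R2.finsupp_add[OF g g'] F(2) _ F(1) T(1) _ T(2), rotated]) simp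
 also have "\<dots> = finsum R3 (\<lambda>q. (case q of (\<mu>, \<nu>) => h \<mu> \<nu> (f \<mu>) (g \<nu>)) \<oplus>\<^sub>R3 (case q of (\<mu>, \<nu>) => h \<mu> \<nu> (f \<mu>) (g' \<nu>))) ?B"
  by (rule R3.finsum_cong') (use T(2) F(1) h_closed h_add2 fmem1[OF f] fmem2[OF g] fmem2[OF g'] in \<open>auto simp: subset_iff\<close>)
 also have "\<dots> = finsum R3 (\<lambda>(\<mu>, \<nu>). h \<mu> \<nu> (f \<mu>) (g \<nu>)) ?B \<oplus>\<^sub>R3 finsum R3 (\<lambda>(\<mu>, \<nu>). h \<mu> \<nu> (f \<mu>) (g' \<nu>)) ?B"
  by (rule R3.finsum_addf) (use T(2) F(1) h_closed fmem1[OF f] fmem2[OF g] fmem2[OF g'] in \<open>auto simp: subset_iff\<close>)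
 also have "finsum R3 (\<lambda>(\<mu>, \<nu>). h \<mu> \<nu> (f \<mu>) (g \<nu>)) ?B = cv f g \<rho>"
  by (rule cv_eq[symmetric]) (use f g T F in auto)
 also have "finsum R3 (\<lambda>(\<mu>, \<nu>). h \<mu> \<nu> (f \<mu>) (g' \<nu>)) ?B = cv f g' \<rho>"
  by (rule cv_eq[symmetric]) (use f g' T F in auto)
 finally show "cv f (\<lambda>p. g p \<oplus>\<^sub>R2 g' p) \<rho> = cv f g \<rho> \<oplus>\<^sub>R3 cv f g' \<rho>" .
qed

lemma cv_single:
 assumes "\<mu> : P1" "\<nu> : P2" "a <: R1" "b <: R2"
 shows "cv (single R1 \<mu> a) (single R2 \<nu> b) = single R3 (opn \<mu> \<nu>) (h \<mu> \<nu> a b)"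
proof
 fix \<rho>
 have "cv (single R1 \<mu> a) (single R2 \<nu> b) \<rho> = finsum R3 (\<lambda>(\<mu>', \<nu>'). h \<mu>' \<nu>' (single R1 \<mu> a \<mu>') (single R2 \<nu> b \<nu>'))
   {(\<mu>', \<nu>'). \<mu>' : {\<mu>} & \<nu>' : {\<nu>} & opn \<mu>' \<nu>' = \<rho>}"
  by (rule cv_eq) (use assms R1.finsupp_single R2.finsupp_single in \<open>auto simp: R1.supp_single R2.supp_single\<close>)
 also have "{(\<mu>', \<nu>'). \<mu>' : {\<mu>} & \<nu>' : {\<nu>} & opn \<mu>' \<nu>' = \<rho>} = (if opn \<mu> \<nu> = \<rho> then {(\<mu>, \<nu>)} else {})" by auto
 also have "finsum R3 (\<lambda>(\<mu>', \<nu>'). h \<mu>' \<nu>' (single R1 \<mu> a \<mu>') (single R2 \<nu> b \<nu>')) \<dots> = single R3 (opn \<mu> \<nu>) (h \<mu> \<nu> a b) \<rho>"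
  using h_closed[OF assms] by (auto simp: single_def)
 finally show "cv (single R1 \<mu> a) (single R2 \<nu> b) \<rho> = single R3 (opn \<mu> \<nu>) (h \<mu> \<nu> a b) \<rho>" .
qed

lemma cv_zero1: "g : finsupp R2 P2 ==> cv (\<lambda>_. \<zero>\<^sub>R1) g = (\<lambda>_. \<zero>\<^sub>R3)"
proof -
 have "supp R1 (\<lambda>_ :: 'm. \<zero>\<^sub>R1) = {}" by (simp add: supp_def)
 then show ?thesis by (simp add: conv_def)
qed

lemma cv_zero2: "f : finsupp R1 P1 ==> cv f (\<lambda>_. \<zero>\<^sub>R2) = (\<lambda>_. \<zero>\<^sub>R3)"
proof -
 have "supp R2 (\<lambda>_ :: 'n. \<zero>\<^sub>R2) = {}" by (simp add: supp_def)
 then show ?thesis by (simp add: conv_def)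
qed

end

section \<open>Skew monoid rings\<close>

locale skew_setup = R: ring R + M: Group.monoid M
 for R :: "('l, 'z) ring_scheme" and M :: "('m, 'y) monoid_scheme" +
 fixes act :: "'m => 'l => 'l"
 assumes act_closed: "!!\<mu> a. \<mu> <: M ==> a <: R ==> act \<mu> a <: R"
  and act_add: "!!\<mu> a b. \<mu> <: M ==> a <: R ==> b <: R ==> act \<mu> (a \<oplus>\<^sub>R b) = act \<mu> a \<oplus>\<^sub>R act \<mu> b"
  and act_mult: "!!\<mu> a b. \<mu> <: M ==> a <: R ==> b <: R ==> act \<mu> (a \<otimes>\<^sub>R b) = act \<mu> a \<otimes>\<^sub>R act \<mu> b"
  and act_unit: "!!\<mu>. \<mu> <: M ==> act \<mu> \<one>\<^sub>R = \<one>\<^sub>R"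
  and act_one: "!!a. a <: R ==> act \<one>\<^sub>M a = a"
  and act_comp: "!!\<mu> \<nu> a. \<mu> <: M ==> \<nu> <: M ==> a <: R ==> act (\<mu> \<otimes>\<^sub>M \<nu>) a = act \<mu> (act \<nu> a)"
begin

abbreviation S where "S \<equiv> skew_monoid_ring R M act"

sublocale CV: biadditive_conv R R R "carrier M" "carrier M" "carrier M" "monoid.mult M" "\<lambda>\<mu> \<nu> a b. a \<otimes>\<^sub>R act \<mu> b"
 by (unfold_locales) (auto simp: act_closed act_add R.l_distr R.r_distr)

lemma mult_cv: "f \<otimes>\<^sub>S g = CV.cv f g"
 by (simp add: skew_monoid_ring_mult conv_def)

lemma mult_single:
 assumes "\<mu> <: M" "\<nu> <: M" "a <: R" "b <: R"
 shows "single R \<mu> a \<otimes>\<^sub>S single R \<nu> b = single R (\<mu> \<otimes>\<^sub>M \<nu>) (a \<otimes>\<^sub>R act \<mu> b)"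
 unfolding mult_cv by (rule CV.cv_single[OF assms])

lemma mult_assoc_single:
 assumes "\<mu> <: M" "\<nu> <: M" "\<rho> <: M" "a <: R" "b <: R" "c <: R"
 shows "CV.cv (CV.cv (single R \<mu> a) (single R \<nu> b)) (single R \<rho> c) = CV.cv (single R \<mu> a) (CV.cv (single R \<nu> b) (single R \<rho> c))"
 using assms by (simp add: CV.cv_single act_closed act_mult act_comp R.m_assoc M.m_assoc)

lemma ring_axioms: "ring S"
proof (rule ringI)
 show "abelian_group S"
 proof (rule abelian_groupI)
  fix x y assume "x <: S" "y <: S"
  then show "x \<oplus>\<^sub>S y <: S" using R.finsupp_add by simp
 next
  show "\<zero>\<^sub>S <: S" using R.finsupp_zero by simp
 next
  fix x assume x: "x <: S"
  then have "x : finsupp R (carrier M)" by simp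
  note xc = CV.fmem1[OF this]
  have "(\<lambda>p. \<ominus>\<^sub>R x p) <: S" using x R.finsupp_neg by simp
  moreover have "(\<lambda>p. \<ominus>\<^sub>R x p) \<oplus>\<^sub>S x = \<zero>\<^sub>S" using xc by (auto simp: R.l_neg)
  ultimately show "EX y:carrier S. y \<oplus>\<^sub>S x = \<zero>\<^sub>S" by blast
  show "\<zero>\<^sub>S \<oplus>\<^sub>S x = x" using xc by simp
 next
  fix x y assume "x <: S" "y <: S"
  then have "x : finsupp R (carrier M)" "y : finsupp R (carrier M)" by simp_all
  then show "x \<oplus>\<^sub>S y = y \<oplus>\<^sub>S x" by (auto intro!: ext R.a_comm simp: CV.fmem1)
 next
  fix x y z assume "x <: S" "y <: S" "z <: S"
  then have "x : finsupp R (carrier M)" "y : finsupp R (carrier M)" "z : finsupp R (carrier M)" by simp_all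
  then show "(x \<oplus>\<^sub>S y) \<oplus>\<^sub>S z = x \<oplus>\<^sub>S (y \<oplus>\<^sub>S z)" by (auto intro!: ext R.a_assoc simp: CV.fmem1)
 qed
 show "Group.monoid S"
 proof (rule monoidI)
  fix x y assume "x <: S" "y <: S"
  then show "x \<otimes>\<^sub>S y <: S" using CV.cv_closed by (simp add: mult_cv)
 next
  show "\<one>\<^sub>S <: S" using R.finsupp_single[OF M.one_closed R.one_closed] by simp
 next
  fix x assume "x <: S"
  then have x: "x : finsupp R (carrier M)" by simp
  have o: "single R \<one>\<^sub>M \<one>\<^sub>R : finsupp R (carrier M)"
   by (rule R.finsupp_single[OF M.one_closed R.one_closed])
  have "CV.cv (single R \<one>\<^sub>M \<one>\<^sub>R) x = x" using x
  proof (induction rule: R.finsupp_induct)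
   case zero then show ?case by (rule CV.cv_zero2[OF o])
  next
   case (single p l) then show ?case by (simp add: CV.cv_single act_one)
  next
   case (add f g) then show ?case by (simp add: CV.cv_add2[OF o])
  qed
  then show "\<one>\<^sub>S \<otimes>\<^sub>S x = x" by (simp add: mult_cv)
  have "CV.cv x (single R \<one>\<^sub>M \<one>\<^sub>R) = x" using x
  proof (induction rule: R.finsupp_induct)
   case zero then show ?case by (rule CV.cv_zero1[OF o])
  next
   case (single p l) then show ?case by (simp add: CV.cv_single act_unit)
  next
   case (add f g) then show ?case by (simp add: CV.cv_add1[OF _ _ o])
  qed
  then show "x \<otimes>\<^sub>S \<one>\<^sub>S = x" by (simp add: mult_cv)
 next
  fix x y z assume "x <: S" "y <: S" "z <: S"
  then have x: "x : finsupp R (carrier M)" and y: "y : finsupp R (carrier M)" and z: "z : finsupp R (carrier M)"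
   by simp_all
  note cl = CV.cv_closed
  \<comment> \<open>Associativity is additive in each argument; the arguments are reduced to singles
    one after the other, beginning with the last.\<close>
  have 1: "CV.cv (CV.cv (single R \<mu> a) (single R \<nu> b)) z = CV.cv (single R \<mu> a) (CV.cv (single R \<nu> b) z)"
   if h: "\<mu> <: M" "\<nu> <: M" "a <: R" "b <: R" for \<mu> \<nu> a b
  proof -
   have s: "single R \<mu> a : finsupp R (carrier M)" "single R \<nu> b : finsupp R (carrier M)"
    by (rule R.finsupp_single; fact h)+
   show ?thesis using z
   proof (induction rule: R.finsupp_induct)
    case zero then show ?case using s cl by (simp add: CV.cv_zero2)
   next
    case (single p l) then show ?case using h mult_assoc_single by blast
   next
    case (add f g) then show ?case using s cl by (simp add: CV.cv_add2)
   qed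
  qed
  have 2: "CV.cv (CV.cv (single R \<mu> a) y) z = CV.cv (single R \<mu> a) (CV.cv y z)"
   if h: "\<mu> <: M" "a <: R" for \<mu> a
  proof -
   have s: "single R \<mu> a : finsupp R (carrier M)" by (rule R.finsupp_single; fact h)
   show ?thesis using y
   proof (induction rule: R.finsupp_induct)
    case zero then show ?case using s z cl by (simp add: CV.cv_zero2 CV.cv_zero1)
   next
    case (single p l) then show ?case using h 1 by blast
   next
    case (add f g) then show ?case using s z cl by (simp add: CV.cv_add2 CV.cv_add1)
   qed
  qed
  have "CV.cv (CV.cv x y) z = CV.cv x (CV.cv y z)" using x
  proof (induction rule: R.finsupp_induct)
   case zero then show ?case using y z cl by (simp add: CV.cv_zero1)
  next
   case (single p l) then show ?case using 2 by blast
  next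
   case (add f g) then show ?case using y z cl by (simp add: CV.cv_add1)
  qed
  then show "(x \<otimes>\<^sub>S y) \<otimes>\<^sub>S z = x \<otimes>\<^sub>S (y \<otimes>\<^sub>S z)" by (simp add: mult_cv)
 qed
 fix x y z assume "x <: S" "y <: S" "z <: S"
 then show "(x \<oplus>\<^sub>S y) \<otimes>\<^sub>S z = x \<otimes>\<^sub>S z \<oplus>\<^sub>S y \<otimes>\<^sub>S z" "z \<otimes>\<^sub>S (x \<oplus>\<^sub>S y) = z \<otimes>\<^sub>S x \<oplus>\<^sub>S z \<otimes>\<^sub>S y"
  by (simp_all add: mult_cv CV.cv_add1 CV.cv_add2)
qed

end

section \<open>Tensor products\<close>

lemma with_smult_simps [simp]:
 "carrier (with_smult R s) = carrier R" "monoid.mult (with_smult R s) = monoid.mult R"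
 "one (with_smult R s) = one R" "ring.zero (with_smult R s) = ring.zero R"
 "ring.add (with_smult R s) = ring.add R" "module.smult (with_smult R s) = s"
 by (simp_all add: with_smult_def ring.extend_def module.fields_def)

lemma ring_same_ops:
 assumes "ring R" "carrier R' = carrier R" "monoid.mult R' = monoid.mult R" "one R' = one R"
  "ring.zero R' = ring.zero R" "ring.add R' = ring.add R"
 shows "ring R'"
proof -
 interpret R: ring R by (rule assms(1))
 show ?thesis
 proof (rule ringI)
  show "abelian_group R'"
   by (rule abelian_groupI) (auto simp: assms(2-) R.a_ac intro: bexI[of _ "\<ominus>\<^sub>R x" for x] R.l_neg)
  show "Group.monoid R'" by (rule monoidI) (auto simp: assms(2-) R.m_assoc)
 qed (auto simp: assms(2-) R.l_distr R.r_distr)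
qed

section \<open>Algebras over a field and bilinear maps\<close>

locale kalg = A: ring A + vspace k A for k :: "('k, 'z) ring_scheme" and A :: "('k, 'a) module" +
 assumes smult_mult_l: "!!c x y. c <: k ==> x <: A ==> y <: A ==>
   (c \<odot>\<^sub>A x) \<otimes>\<^sub>A y = c \<odot>\<^sub>A (x \<otimes>\<^sub>A y)"
  and smult_mult_r: "!!c x y. c <: k ==> x <: A ==> y <: A ==>
   x \<otimes>\<^sub>A (c \<odot>\<^sub>A y) = c \<odot>\<^sub>A (x \<otimes>\<^sub>A y)"

lemma vspaceI: "field k ==> module k V ==> vspace k V"
 by (simp add: vspace_def)

lemma kalgI_comm: "field k ==> algebra k A ==> kalg k A"
proof -
 assume k: "field k" and A: "algebra k A"
 interpret Ac: cring A by (rule algebra.axioms(2)[OF A])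
 interpret V: vspace k A by (rule vspaceI[OF k algebra.axioms(1)[OF A]])
 note smult_assoc2 = algebra.smult_assoc2[OF A]
 show "kalg k A"
 proof (intro kalg.intro kalg_axioms.intro)
  show "ring A" by (rule cring.axioms(1)[OF algebra.axioms(2)[OF A]])
  show "vspace k A" by (rule V.vspace_axioms)
  fix c x y assume c: "c <: k" "x <: A" "y <: A"
  show "(c \<odot>\<^sub>A x) \<otimes>\<^sub>A y = c \<odot>\<^sub>A (x \<otimes>\<^sub>A y)" by (rule smult_assoc2[OF c])
  then show "x \<otimes>\<^sub>A (c \<odot>\<^sub>A y) = c \<odot>\<^sub>A (x \<otimes>\<^sub>A y)"
   using smult_assoc2[of c y x] c Ac.m_comm[of x "c \<odot>\<^sub>A y"] Ac.m_comm[of x y] V.V.smult_closed by simp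
 qed
qed

context vspace
begin

definition bilin :: "('k, 'a) module => ('k, 'b) module => ('a => 'b => 'v) => bool" where
 "bilin A B \<beta> \<longleftrightarrow> (ALL a:carrier A. ALL b:carrier B. \<beta> a b <: V) \<and>
  (ALL a:carrier A. ALL a':carrier A. ALL b:carrier B. \<beta> (a \<oplus>\<^sub>A a') b = \<beta> a b \<oplus>\<^sub>V \<beta> a' b) \<and>
  (ALL a:carrier A. ALL b:carrier B. ALL b':carrier B. \<beta> a (b \<oplus>\<^sub>B b') = \<beta> a b \<oplus>\<^sub>V \<beta> a b') \<and>
  (ALL c:carrier k. ALL a:carrier A. ALL b:carrier B. \<beta> (c \<odot>\<^sub>A a) b = c \<odot>\<^sub>V \<beta> a b) \<and>
  (ALL c:carrier k. ALL a:carrier A. ALL b:carrier B. \<beta> a (c \<odot>\<^sub>B b) = c \<odot>\<^sub>V \<beta> a b)"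

lemma bilinI:
 assumes "!!a b. a <: A ==> b <: B ==> \<beta> a b <: V"
  "!!a a' b. a <: A ==> a' <: A ==> b <: B ==> \<beta> (a \<oplus>\<^sub>A a') b = \<beta> a b \<oplus>\<^sub>V \<beta> a' b"
  "!!a b b'. a <: A ==> b <: B ==> b' <: B ==> \<beta> a (b \<oplus>\<^sub>B b') = \<beta> a b \<oplus>\<^sub>V \<beta> a b'"
  "!!c a b. c <: k ==> a <: A ==> b <: B ==> \<beta> (c \<odot>\<^sub>A a) b = c \<odot>\<^sub>V \<beta> a b"
  "!!c a b. c <: k ==> a <: A ==> b <: B ==> \<beta> a (c \<odot>\<^sub>B b) = c \<odot>\<^sub>V \<beta> a b"
 shows "bilin A B \<beta>"
 unfolding bilin_def using assms by simp

lemma bilinD: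
 assumes "bilin A B \<beta>"
 shows "!!a b. a <: A ==> b <: B ==> \<beta> a b <: V"
  "!!a a' b. a <: A ==> a' <: A ==> b <: B ==> \<beta> (a \<oplus>\<^sub>A a') b = \<beta> a b \<oplus>\<^sub>V \<beta> a' b"
  "!!a b b'. a <: A ==> b <: B ==> b' <: B ==> \<beta> a (b \<oplus>\<^sub>B b') = \<beta> a b \<oplus>\<^sub>V \<beta> a b'"
  "!!c a b. c <: k ==> a <: A ==> b <: B ==> \<beta> (c \<odot>\<^sub>A a) b = c \<odot>\<^sub>V \<beta> a b"
  "!!c a b. c <: k ==> a <: A ==> b <: B ==> \<beta> a (c \<odot>\<^sub>B b) = c \<odot>\<^sub>V \<beta> a b"
 using assms unfolding bilin_def by simp_all

end

section \<open>The tensor product as a quotient algebra\<close>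

locale tensor_alg = A: kalg k A + B: kalg k B
 for k :: "('k, 'z) ring_scheme" and A :: "('k, 'a) module" and B :: "('k, 'b) module"
begin

abbreviation F where "F \<equiv> pair_algebra k A B"
abbreviation J where "J \<equiv> tensor_ideal k A B"
abbreviation T where "T \<equiv> tensor k A B"
abbreviation e where "e a b \<equiv> single k (a, b) \<one>\<^sub>k"
abbreviation pt where "pt \<equiv> pure_tensor k A B"

sublocale F: skew_setup k "A \<times>\<times> B" "\<lambda>_ c. c"
proof -
 interpret M: Group.monoid "A \<times>\<times> B" by (rule DirProd_monoid[OF A.A.is_monoid B.A.is_monoid])
 show "skew_setup k (A \<times>\<times> B) (\<lambda>_ c. c)" by unfold_locales auto
qed

lemma F_skew: "F = skew_monoid_ring k (A \<times>\<times> B) (\<lambda>_ c. c)" by (simp add: pair_algebra_def)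

lemma F_ring: "ring F" unfolding F_skew by (rule F.ring_axioms)

sublocale FR: ring F by (rule F_ring)

lemma F_carrier: "carrier F = finsupp k (carrier A \<times> carrier B)"
 by (simp add: F_skew DirProd_def)

lemma F_single: "a <: A ==> b <: B ==> c <: k ==> single k (a, b) c <: F"
 unfolding F_carrier by (rule A.K.finsupp_single) auto

lemma F_add: "f \<oplus>\<^sub>F g = (\<lambda>p. f p \<oplus>\<^sub>k g p)" by (simp add: F_skew)
lemma F_zero: "\<zero>\<^sub>F = (\<lambda>_. \<zero>\<^sub>k)" by (simp add: F_skew)
lemma F_one: "\<one>\<^sub>F = e \<one>\<^sub>A \<one>\<^sub>B" by (simp add: F_skew)

lemma F_mult_single:
 assumes "a <: A" "b <: B" "c <: k" "a' <: A" "b' <: B" "c' <: k"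
 shows "single k (a, b) c \<otimes>\<^sub>F single k (a', b') c' = single k (a \<otimes>\<^sub>A a', b \<otimes>\<^sub>B b') (c \<otimes>\<^sub>k c')"
 unfolding F_skew using F.mult_single[of "(a, b)" "(a', b')" c c'] assms by simp

lemma F_induct [consumes 1, case_names zero single add]:
 assumes f: "f <: F" and "Q \<zero>\<^sub>F"
  and "!!a b l. a <: A ==> b <: B ==> l <: k ==> Q (single k (a, b) l)"
  and "!!f g. f <: F ==> g <: F ==> Q f ==> Q g ==> Q (f \<oplus>\<^sub>F g)"
 shows "Q f"
 using f unfolding F_carrier
proof (induction rule: A.K.finsupp_induct)
 case zero then show ?case using assms(2) by (simp add: F_zero)
next
 case (single p l) then show ?case using assms(3) by (cases p) auto
next
 case (add f g) then show ?case using assms(4)[of f g] by (simp add: F_add F_carrier)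
qed

definition rels where
 "rels = {e (a \<oplus>\<^sub>A a') b \<ominus>\<^sub>F (e a b \<oplus>\<^sub>F e a' b) | a a' b.
      a <: A & a' <: A & b <: B} \<union>
     {e a (b \<oplus>\<^sub>B b') \<ominus>\<^sub>F (e a b \<oplus>\<^sub>F e a b') | a b b'.
      a <: A & b <: B & b' <: B} \<union>
     {e (c \<odot>\<^sub>A a) b \<ominus>\<^sub>F single k (a, b) c | c a b.
      c <: k & a <: A & b <: B} \<union>
     {e a (c \<odot>\<^sub>B b) \<ominus>\<^sub>F single k (a, b) c | c a b.
      c <: k & a <: A & b <: B}"

lemma J_rels: "J = Idl\<^bsub>F\<^esub> rels"
 by (simp add: tensor_ideal_def Let_def rels_def)

lemma rels_carrier: "rels <= carrier F"
 unfolding rels_def using F_single by (auto intro!: FR.minus_closed FR.a_closed)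

sublocale J: ideal J F
 unfolding J_rels by (rule FR.genideal_ideal[OF rels_carrier])

lemma rels_J: "rels <= J" unfolding J_rels by (rule FR.genideal_self[OF rels_carrier])

text \<open>The linear extension of \<beta> to the free module on pairs, before passing to the
  quotient.\<close>

definition blift :: "('k, 'c) module => ('a => 'b => 'c) => ('a \<times> 'b => 'k) => 'c" where
 "blift C \<beta> x = finsum C (\<lambda>(a, b). x (a, b) \<odot>\<^sub>C \<beta> a b) (supp k x)"

end

section \<open>Lifting bilinear maps to the tensor product\<close>

locale bilin_lift = tensor_alg k A B + C: vspace k C
 for k :: "('k, 'z) ring_scheme" and A :: "('k, 'a) module" and B :: "('k, 'b) module" and C :: "('k, 'c) module"
begin

lemma llift:
 assumes \<beta>: "C.bilin A B \<beta>"
 shows "linear_lift k C (carrier A \<times> carrier B) (\<lambda>(a, b) c. c \<odot>\<^sub>C \<beta> a b)"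
  "blift C \<beta> x = linear_lift.llift k C (\<lambda>(a, b) c. c \<odot>\<^sub>C \<beta> a b) x"
proof -
 show 1: "linear_lift k C (carrier A \<times> carrier B) (\<lambda>(a, b) c. c \<odot>\<^sub>C \<beta> a b)"
  by unfold_locales (auto simp: C.bilinD(1)[OF \<beta>] C.V.smult_l_distr)
 show "blift C \<beta> x = linear_lift.llift k C (\<lambda>(a, b) c. c \<odot>\<^sub>C \<beta> a b) x"
  unfolding linear_lift.llift_def[OF 1] blift_def by (rule arg_cong2[where f="finsum C"]) (auto split: prod.split)
qed

lemma blift_closed: "C.bilin A B \<beta> ==> x <: F ==> blift C \<beta> x <: C"
 using linear_lift.llift_closed[OF llift(1)] llift(2) F_carrier by metis

lemma blift_add: "C.bilin A B \<beta> ==> x <: F ==> y <: F ==>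
  blift C \<beta> (x \<oplus>\<^sub>F y) = blift C \<beta> x \<oplus>\<^sub>C blift C \<beta> y"
 using linear_lift.llift_add[OF llift(1), of \<beta> x y] llift(2)[of \<beta>] F_carrier F_add by simp

lemma blift_single: "C.bilin A B \<beta> ==> a <: A ==> b <: B ==> c <: k ==>
  blift C \<beta> (single k (a, b) c) = c \<odot>\<^sub>C \<beta> a b"
 using linear_lift.llift_single[OF llift(1), of \<beta> "(a, b)" c] llift(2)[of \<beta>] by simp

lemma blift_zero: "C.bilin A B \<beta> ==> blift C \<beta> \<zero>\<^sub>F = \<zero>\<^sub>C"
 using linear_lift.llift_zero[OF llift(1), of \<beta>] llift(2)[of \<beta>] F_zero by simp

lemma blift_neg:
 assumes \<beta>: "C.bilin A B \<beta>" and x: "x <: F"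
 shows "blift C \<beta> (\<ominus>\<^sub>F x) = \<ominus>\<^sub>C blift C \<beta> x"
proof -
 have "blift C \<beta> (\<ominus>\<^sub>F x) \<oplus>\<^sub>C blift C \<beta> x = \<zero>\<^sub>C"
  using blift_add[OF \<beta>, of "\<ominus>\<^sub>F x" x] blift_zero[OF \<beta>] x by (simp add: FR.l_neg)
 then show ?thesis using C.V.minus_equality[of "blift C \<beta> (\<ominus>\<^sub>F x)" "blift C \<beta> x"] blift_closed[OF \<beta>] x by simp
qed

lemma blift_minus: "C.bilin A B \<beta> ==> x <: F ==> y <: F ==>
  blift C \<beta> (x \<ominus>\<^sub>F y) = blift C \<beta> x \<ominus>\<^sub>C blift C \<beta> y"
 by (simp add: a_minus_def blift_add blift_neg)

lemma blift_rels:
 assumes \<beta>: "C.bilin A B \<beta>" and r: "r : rels"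
 shows "blift C \<beta> r = \<zero>\<^sub>C"
proof -
 note D = C.bilinD[OF \<beta>]
 have [simp]: "blift C \<beta> (e a b) = \<beta> a b" if "a <: A" "b <: B" for a b
  using blift_single[OF \<beta> that] D(1)[OF that] by simp
 note s = blift_minus[OF \<beta>] blift_add[OF \<beta>] blift_single[OF \<beta>] F_single D C.V.r_neg a_minus_def[of C]
 show ?thesis using r unfolding rels_def
  by (elim UnE CollectE exE conjE) (simp_all add: s)
qed

text \<open>Each lift kills the relations, but \<open>J\<close> is the ideal generated by them, and
  the kernel of a single lift need not be an ideal. Intersecting over all bilinear maps into
  \<open>C\<close> repairs this: multiplication by a pair turns \<beta> into another bilinear
  map.\<close>

definition ker :: "('a \<times> 'b => 'k) set" where
 "ker = {x : carrier F. ALL \<beta>. C.bilin A B \<beta> --> blift C \<beta> x = \<zero>\<^sub>C}"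

lemma bilin_left:
 assumes \<beta>: "C.bilin A B \<beta>" and "a <: A" "b <: B"
 shows "C.bilin A B (\<lambda>a' b'. \<beta> (a \<otimes>\<^sub>A a') (b \<otimes>\<^sub>B b'))"
 by (rule C.bilinI) (use assms in \<open>simp_all add: C.bilinD[OF \<beta>] A.A.r_distr B.A.r_distr A.smult_mult_r B.smult_mult_r\<close>)

lemma bilin_right:
 assumes \<beta>: "C.bilin A B \<beta>" and "a <: A" "b <: B"
 shows "C.bilin A B (\<lambda>a' b'. \<beta> (a' \<otimes>\<^sub>A a) (b' \<otimes>\<^sub>B b))"
 by (rule C.bilinI) (use assms in \<open>simp_all add: C.bilinD[OF \<beta>] A.A.l_distr B.A.l_distr A.smult_mult_l B.smult_mult_l\<close>)

lemma blift_mult_single: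
 assumes \<beta>: "C.bilin A B \<beta>" and ab: "a <: A" "b <: B" "c <: k" and x: "x <: F"
 shows "blift C \<beta> (single k (a, b) c \<otimes>\<^sub>F x) = c \<odot>\<^sub>C blift C (\<lambda>a' b'. \<beta> (a \<otimes>\<^sub>A a') (b \<otimes>\<^sub>B b')) x"
  "blift C \<beta> (x \<otimes>\<^sub>F single k (a, b) c) = c \<odot>\<^sub>C blift C (\<lambda>a' b'. \<beta> (a' \<otimes>\<^sub>A a) (b' \<otimes>\<^sub>B b)) x"
proof -
 note L = bilin_left[OF \<beta> ab(1,2)] and R = bilin_right[OF \<beta> ab(1,2)]
 note s = F_single[OF ab]
 show "blift C \<beta> (single k (a, b) c \<otimes>\<^sub>F x) = c \<odot>\<^sub>C blift C (\<lambda>a' b'. \<beta> (a \<otimes>\<^sub>A a') (b \<otimes>\<^sub>B b')) x" using x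
 proof (induction rule: F_induct)
  case zero then show ?case using ab s by (simp add: blift_zero[OF \<beta>] blift_zero[OF L])
 next
  case (single a' b' l)
  then show ?case using ab by (simp add: F_mult_single blift_single[OF \<beta>] blift_single[OF L] C.V.smult_assoc1 C.bilinD[OF \<beta>])
 next
  case (add f g)
  then show ?case using ab s by (simp add: FR.r_distr blift_add[OF \<beta>] blift_add[OF L] C.V.smult_r_distr blift_closed[OF L])
 qed
 show "blift C \<beta> (x \<otimes>\<^sub>F single k (a, b) c) = c \<odot>\<^sub>C blift C (\<lambda>a' b'. \<beta> (a' \<otimes>\<^sub>A a) (b' \<otimes>\<^sub>B b)) x" using x
 proof (induction rule: F_induct)
  case zero then show ?case using ab s by (simp add: blift_zero[OF \<beta>] blift_zero[OF R])
 next
  case (single a' b' l)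
  then show ?case using ab by (simp add: F_mult_single blift_single[OF \<beta>] blift_single[OF R] C.V.smult_assoc1[symmetric] C.bilinD[OF \<beta>] A.K.m_comm)
 next
  case (add f g)
  then show ?case using ab s by (simp add: FR.l_distr blift_add[OF \<beta>] blift_add[OF R] C.V.smult_r_distr blift_closed[OF R])
 qed
qed

lemma ker_ideal: "ideal ker F"
proof (intro idealI)
 show "ring F" by (rule F_ring)
 show "subgroup ker (add_monoid F)"
 proof (rule FR.add.subgroupI)
  show "ker <= carrier F" by (auto simp: ker_def)
  have "\<zero>\<^sub>F : ker" using blift_zero by (simp add: ker_def)
  then show "ker ~= {}" by blast
  show "\<ominus>\<^sub>F a : ker" if "a : ker" for a using that blift_neg by (simp add: ker_def)
  show "a \<oplus>\<^sub>F b : ker" if "a : ker" "b : ker" for a b using that blift_add by (simp add: ker_def)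
 qed
 note kd = ker_def
 fix x y assume x: "x : ker" and y: "y <: F"
 have xc: "x <: F" using x by (simp add: kd)
 show "y \<otimes>\<^sub>F x : ker" using y
 proof (induction rule: F_induct)
  case zero then show ?case using xc blift_zero by (simp add: kd)
 next
  case (single a b l)
  have "blift C \<beta> (single k (a, b) l \<otimes>\<^sub>F x) = \<zero>\<^sub>C" if \<beta>: "C.bilin A B \<beta>" for \<beta>
   using x blift_mult_single(1)[OF \<beta> single xc] bilin_left[OF \<beta> single(1,2)] single(3) by (simp add: kd)
  then show ?case using xc F_single[OF single] by (simp add: kd)
 next
  case (add f g)
  then show ?case using xc by (simp add: kd FR.l_distr blift_add)
 qed
 show "x \<otimes>\<^sub>F y : ker" using y
 proof (induction rule: F_induct)
  case zero then show ?case using xc blift_zero by (simp add: kd)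
 next
  case (single a b l)
  have "blift C \<beta> (x \<otimes>\<^sub>F single k (a, b) l) = \<zero>\<^sub>C" if \<beta>: "C.bilin A B \<beta>" for \<beta>
   using x blift_mult_single(2)[OF \<beta> single xc] bilin_right[OF \<beta> single(1,2)] single(3) by (simp add: kd)
  then show ?case using xc F_single[OF single] by (simp add: kd)
 next
  case (add f g)
  then show ?case using xc by (simp add: kd FR.r_distr blift_add)
 qed
qed

lemma blift_J:
 assumes "C.bilin A B \<beta>" "x : J"
 shows "blift C \<beta> x = \<zero>\<^sub>C"
proof -
 have "rels <= ker" using rels_carrier blift_rels by (auto simp: ker_def)
 then have "J <= ker" unfolding J_rels by (rule FR.genideal_minimal[OF ker_ideal])
 then show ?thesis using assms by (auto simp: ker_def)
qed

end

context tensor_alg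
begin

definition coset_of where "coset_of x = J +>\<^sub>F x"

lemma T_def: "T = with_smult (F Quot J) (\<lambda>c Q. coset_of (single k (\<one>\<^sub>A, \<one>\<^sub>B) c) \<otimes>\<^bsub>F Quot J\<^esub> Q)"
 by (simp add: tensor_def Let_def coset_of_def)

lemma T_ring: "ring T"
 by (rule ring_same_ops[OF J.quotient_is_ring]) (simp_all add: T_def)

sublocale T: ring T by (rule T_ring)

lemma coset_of_hom: "coset_of : ring_hom F T"
 using J.rcos_ring_hom unfolding ring_hom_def T_def coset_of_def by simp

lemma coset_of_closed: "x <: F ==> coset_of x <: T"
 and coset_of_mult: "x <: F ==> y <: F ==> coset_of (x \<otimes>\<^sub>F y) = coset_of x \<otimes>\<^sub>T coset_of y"
 and coset_of_add: "x <: F ==> y <: F ==> coset_of (x \<oplus>\<^sub>F y) = coset_of x \<oplus>\<^sub>T coset_of y"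
 and coset_of_one: "coset_of \<one>\<^sub>F = \<one>\<^sub>T"
 using ring_hom_memE[OF coset_of_hom] by auto

lemma coset_of_zero: "coset_of \<zero>\<^sub>F = \<zero>\<^sub>T"
 using coset_of_add[of "\<zero>\<^sub>F" "\<zero>\<^sub>F"] coset_of_closed[of "\<zero>\<^sub>F"] by simp

lemma coset_of_minus:
 assumes x: "x <: F" and y: "y <: F"
 shows "coset_of (x \<ominus>\<^sub>F y) = coset_of x \<ominus>\<^sub>T coset_of y"
proof -
 have "coset_of (\<ominus>\<^sub>F y) \<oplus>\<^sub>T coset_of y = \<zero>\<^sub>T"
  using coset_of_add[of "\<ominus>\<^sub>F y" y] y coset_of_zero by (simp add: FR.l_neg)
 then have "coset_of (\<ominus>\<^sub>F y) = \<ominus>\<^sub>T coset_of y"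
  using T.minus_equality[of "coset_of (\<ominus>\<^sub>F y)" "coset_of y"] coset_of_closed y by simp
 then show ?thesis using x y coset_of_add by (simp add: a_minus_def)
qed

lemma T_cases: "t <: T ==> (!!x. x <: F ==> t = coset_of x ==> thesis) ==> thesis"
 by (auto simp: T_def FactRing_def A_RCOSETS_def' coset_of_def a_r_coset_def')

lemma coset_of_J: "x : J ==> coset_of x = \<zero>\<^sub>T"
 unfolding coset_of_def T_def by (simp add: FactRing_def J.a_rcos_const)

lemma pt_coset_of: "pt a b = coset_of (e a b)"
 by (simp add: pure_tensor_def coset_of_def)

lemma pt_closed: "a <: A ==> b <: B ==> pt a b <: T"
 unfolding pt_coset_of by (intro coset_of_closed F_single) auto

lemma T_smult: "c \<odot>\<^sub>T t = coset_of (single k (\<one>\<^sub>A, \<one>\<^sub>B) c) \<otimes>\<^sub>T t"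
 by (simp add: T_def)

lemma smult_coset_of:
 assumes "a <: A" "b <: B" "c <: k" "d <: k"
 shows "c \<odot>\<^sub>T coset_of (single k (a, b) d) = coset_of (single k (a, b) (c \<otimes>\<^sub>k d))"
 unfolding T_smult using assms F_single by (simp add: coset_of_mult[symmetric] F_mult_single)

lemma coset_of_eqI:
 assumes "x <: F" "y <: F" "x \<ominus>\<^sub>F y : J"
 shows "coset_of x = coset_of y"
 using coset_of_J[OF assms(3)] coset_of_minus[OF assms(1,2)] coset_of_closed[OF assms(1)] coset_of_closed[OF assms(2)] by simp

lemma pt_add1:
 assumes "a <: A" "a' <: A" "b <: B"
 shows "pt (a \<oplus>\<^sub>A a') b = pt a b \<oplus>\<^sub>T pt a' b"
proof -
 have "e (a \<oplus>\<^sub>A a') b \<ominus>\<^sub>F (e a b \<oplus>\<^sub>F e a' b) : rels" unfolding rels_def using assms by blast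
 then have "coset_of (e (a \<oplus>\<^sub>A a') b) = coset_of (e a b \<oplus>\<^sub>F e a' b)"
  using rels_J assms by (intro coset_of_eqI) (auto intro!: FR.a_closed F_single)
 then show ?thesis using assms by (simp add: pt_coset_of coset_of_add F_single)
qed

lemma pt_add2:
 assumes "a <: A" "b <: B" "b' <: B"
 shows "pt a (b \<oplus>\<^sub>B b') = pt a b \<oplus>\<^sub>T pt a b'"
proof -
 have "e a (b \<oplus>\<^sub>B b') \<ominus>\<^sub>F (e a b \<oplus>\<^sub>F e a b') : rels" unfolding rels_def using assms by blast
 then have "coset_of (e a (b \<oplus>\<^sub>B b')) = coset_of (e a b \<oplus>\<^sub>F e a b')"
  using rels_J assms by (intro coset_of_eqI) (auto intro!: FR.a_closed F_single)
 then show ?thesis using assms by (simp add: pt_coset_of coset_of_add F_single)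
qed

lemma pt_smult_cos:
 assumes "a <: A" "b <: B" "c <: k"
 shows "pt (c \<odot>\<^sub>A a) b = coset_of (single k (a, b) c)" "pt a (c \<odot>\<^sub>B b) = coset_of (single k (a, b) c)"
  "c \<odot>\<^sub>T pt a b = coset_of (single k (a, b) c)"
proof -
 have "e (c \<odot>\<^sub>A a) b \<ominus>\<^sub>F single k (a, b) c : rels" unfolding rels_def using assms by blast
 then show "pt (c \<odot>\<^sub>A a) b = coset_of (single k (a, b) c)" unfolding pt_coset_of
  using rels_J assms by (intro coset_of_eqI) (auto intro!: F_single)
 have "e a (c \<odot>\<^sub>B b) \<ominus>\<^sub>F single k (a, b) c : rels" unfolding rels_def using assms by blast
 then show "pt a (c \<odot>\<^sub>B b) = coset_of (single k (a, b) c)" unfolding pt_coset_of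
  using rels_J assms by (intro coset_of_eqI) (auto intro!: F_single)
 show "c \<odot>\<^sub>T pt a b = coset_of (single k (a, b) c)" unfolding pt_coset_of
  using smult_coset_of[of a b c "\<one>\<^sub>k"] assms by simp
qed

lemma pt_smult1: "a <: A ==> b <: B ==> c <: k ==> pt (c \<odot>\<^sub>A a) b = c \<odot>\<^sub>T pt a b"
 and pt_smult2: "a <: A ==> b <: B ==> c <: k ==> pt a (c \<odot>\<^sub>B b) = c \<odot>\<^sub>T pt a b"
 by (simp_all add: pt_smult_cos)

lemma pt_mult:
 "a <: A ==> b <: B ==> a' <: A ==> b' <: B ==>
  pt a b \<otimes>\<^sub>T pt a' b' = pt (a \<otimes>\<^sub>A a') (b \<otimes>\<^sub>B b')"
 by (simp add: pt_coset_of coset_of_mult[symmetric] F_single F_mult_single)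

lemma pt_one: "pt \<one>\<^sub>A \<one>\<^sub>B = \<one>\<^sub>T"
 by (simp add: pt_coset_of coset_of_one[symmetric] F_one)

text \<open>There is no scalar case because a coefficient is absorbed into the first tensor
  factor.\<close>

lemma T_induct [consumes 1, case_names zero pt add]:
 assumes t: "t <: T" and zero: "Q \<zero>\<^sub>T"
  and pt: "!!a b. a <: A ==> b <: B ==> Q (pt a b)"
  and add: "!!s t. s <: T ==> t <: T ==> Q s ==> Q t ==> Q (s \<oplus>\<^sub>T t)"
 shows "Q t"
proof -
 obtain x where x: "x <: F" "t = coset_of x" using T_cases[OF t] by blast
 have "Q (coset_of x)" using x(1)
 proof (induction rule: F_induct)
  case zero then show ?case using assms(2) by (simp add: coset_of_zero)
 next
  case (single a b l) then show ?case using pt[of "l \<odot>\<^sub>A a" b] by (simp add: pt_smult_cos)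
 next
  case (add f g) then show ?case using assms(4)[of "coset_of f" "coset_of g"] by (simp add: coset_of_add coset_of_closed)
 qed
 then show ?thesis using x by simp
qed

text \<open>Scalars act on the quotient by multiplication with a multiple of the unit pair. For a
  scalar in the second factor to move to the front, this element has to be central.\<close>

lemma single_one_central:
 assumes c: "c <: k" and x: "x <: F"
 shows "single k (\<one>\<^sub>A, \<one>\<^sub>B) c \<otimes>\<^sub>F x = x \<otimes>\<^sub>F single k (\<one>\<^sub>A, \<one>\<^sub>B) c"
 using x
proof (induction rule: F_induct)
 case zero then show ?case using F_single[OF _ _ c] by simp
next
 case (single a b l) then show ?case using c by (simp add: F_mult_single A.K.m_comm)
next
 case (add f g) then show ?case using F_single[OF _ _ c] by (simp add: FR.l_distr FR.r_distr)
qed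

lemma T_kalg: "kalg k T"
proof -
 let ?s = "\<lambda>c. coset_of (single k (\<one>\<^sub>A, \<one>\<^sub>B) c)"
 have sF: "single k (\<one>\<^sub>A, \<one>\<^sub>B) c <: F" if "c <: k" for c
  using F_single that by simp
 have sc: "?s c <: T" if "c <: k" for c
  using coset_of_closed sF that by simp
 have central: "?s c \<otimes>\<^sub>T t = t \<otimes>\<^sub>T ?s c" if c: "c <: k" and t: "t <: T" for c t
 proof -
  obtain x where x: "x <: F" "t = coset_of x" using T_cases[OF t] by blast
  then show ?thesis using single_one_central[OF c x(1)] sF[OF c] by (simp add: coset_of_mult[symmetric])
 qed
 have add: "?s (a \<oplus>\<^sub>k b) = ?s a \<oplus>\<^sub>T ?s b" if "a <: k" "b <: k" for a b
  using that sF by (simp add: coset_of_add[symmetric] F_add A.K.single_add)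
 have mult: "?s (a \<otimes>\<^sub>k b) = ?s a \<otimes>\<^sub>T ?s b" if "a <: k" "b <: k" for a b
  using that sF by (simp add: coset_of_mult[symmetric] F_mult_single)
 have "module k T"
  by (rule moduleI[OF A.K.cring_axioms T.abelian_group_axioms])
   (use sc in \<open>simp_all add: T_smult add mult T.l_distr T.r_distr T.m_assoc coset_of_one F_one[symmetric]\<close>)
 then have "vspace k T" by (rule vspaceI[OF A.K.field_axioms])
 then show ?thesis
 proof (intro kalg.intro T_ring kalg_axioms.intro)
  fix c x y assume c: "c <: k" "x <: T" "y <: T"
  show "(c \<odot>\<^sub>T x) \<otimes>\<^sub>T y = c \<odot>\<^sub>T (x \<otimes>\<^sub>T y)" using c sc by (simp add: T_smult T.m_assoc)
  show "x \<otimes>\<^sub>T (c \<odot>\<^sub>T y) = c \<odot>\<^sub>T (x \<otimes>\<^sub>T y)"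
   using c sc central[of c x] by (simp add: T_smult T.m_assoc[symmetric])
 qed
qed

sublocale TA: kalg k T by (rule T_kalg)

lemma pt_bilin: "TA.bilin A B pt"
 by (rule TA.bilinI) (simp_all add: pt_closed pt_add1 pt_add2 pt_smult1 pt_smult2)

lemma T_algebra:
 assumes "cring A" "cring B"
 shows "algebra k T"
proof -
 interpret Ac: cring A by fact
 interpret Bc: cring B by fact
 have comm: "s \<otimes>\<^sub>T t = t \<otimes>\<^sub>T s" if s: "s <: T" and t: "t <: T" for s t
  using s
 proof (induction rule: T_induct)
  case (pt a b)
  note ab = pt
  show ?case using t
  proof (induction rule: T_induct)
   case (pt a' b') then show ?case using ab by (simp add: pt_mult Ac.m_comm Bc.m_comm)
  next
   case (add x y) then show ?case using ab pt_closed by (simp add: T.l_distr T.r_distr)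
  qed (use ab pt_closed in auto)
 next
  case (add x y) then show ?case using t by (simp add: T.l_distr T.r_distr)
 qed (use t in auto)
 show ?thesis
  by (intro algebra.intro algebra_axioms.intro cring.intro TA.V.module_axioms T_ring
    comm_monoid.intro comm_monoid_axioms.intro T.is_monoid)
   ((rule comm TA.smult_mult_l; assumption)+)
qed

end

context bilin_lift
begin

abbreviation L where "L \<beta> \<equiv> tensor_lift k C \<beta>"

text \<open>\<open>J\<close> is sent to zero, so the image of a coset is a singleton and
  \<open>the_elem\<close> returns the value at any representative.\<close>

lemma L_coset_of:
 assumes \<beta>: "C.bilin A B \<beta>" and x: "x <: F"
 shows "L \<beta> (coset_of x) = blift C \<beta> x"
proof -
 have "blift C \<beta> ` (coset_of x) = {blift C \<beta> x}"
 proof -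
  have c: "blift C \<beta> y = blift C \<beta> x" if "y : coset_of x" for y
  proof -
   obtain i where i: "i : J" "y = i \<oplus>\<^sub>F x" using \<open>y : coset_of x\<close> by (auto simp: coset_of_def a_r_coset_def')
   then have "i <: F" using J.Icarr by simp
   then show ?thesis using i blift_add[OF \<beta> _ x, of i] blift_J[OF \<beta> i(1)] blift_closed[OF \<beta> x] by simp
  qed
  have "x : coset_of x" unfolding coset_of_def by (rule J.a_rcos_self[OF x])
  moreover have "blift C \<beta> ` coset_of x = (\<lambda>_. blift C \<beta> x) ` coset_of x" by (rule image_cong[OF refl]) (rule c)
  ultimately show ?thesis using image_constant[of x "coset_of x" "blift C \<beta> x"] by simp
 qed
 moreover have "L \<beta> (coset_of x) = the_elem (blift C \<beta> ` (coset_of x))"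
  unfolding tensor_lift_def blift_def ..
 ultimately show ?thesis by simp
qed

lemma L_closed:
 assumes \<beta>: "C.bilin A B \<beta>" and t: "t <: T" shows "L \<beta> t <: C"
proof -
 obtain x where x: "x <: F" "t = coset_of x" using T_cases[OF t] by blast
 then show ?thesis using L_coset_of[OF \<beta>] blift_closed[OF \<beta>] by simp
qed

lemma L_add:
 assumes \<beta>: "C.bilin A B \<beta>" and s: "s <: T" and t: "t <: T"
 shows "L \<beta> (s \<oplus>\<^sub>T t) = L \<beta> s \<oplus>\<^sub>C L \<beta> t"
proof -
 obtain x where x: "x <: F" "s = coset_of x" using T_cases[OF s] by blast
 obtain y where y: "y <: F" "t = coset_of y" using T_cases[OF t] by blast
 show ?thesis using x y L_coset_of[OF \<beta>] blift_add[OF \<beta>] by (simp add: coset_of_add[symmetric])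
qed

lemma L_zero: "C.bilin A B \<beta> ==> L \<beta> \<zero>\<^sub>T = \<zero>\<^sub>C"
 using L_coset_of[of \<beta> "\<zero>\<^sub>F"] blift_zero by (simp add: coset_of_zero)

lemma L_pt: "C.bilin A B \<beta> ==> a <: A ==> b <: B ==> L \<beta> (pt a b) = \<beta> a b"
 using L_coset_of[of \<beta> "e a b"] blift_single[of \<beta> a b "\<one>\<^sub>k"] C.bilinD(1)[of A B \<beta> a b]
 by (simp add: pt_coset_of F_single)

lemma L_smult:
 assumes \<beta>: "C.bilin A B \<beta>" and c: "c <: k" and t: "t <: T"
 shows "L \<beta> (c \<odot>\<^sub>T t) = c \<odot>\<^sub>C L \<beta> t"
 using t
proof (induction rule: T_induct)
 case zero then show ?case using c by (simp add: L_zero[OF \<beta>])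
next
 case (pt a b) then show ?case using c
  by (simp add: pt_smult1[symmetric] L_pt[OF \<beta>] C.bilinD[OF \<beta>])
next
 case (add s t) then show ?case using c by (simp add: TA.V.smult_r_distr L_add[OF \<beta>] L_closed[OF \<beta>] C.V.smult_r_distr)
qed

lemma L_finsum:
 assumes \<beta>: "C.bilin A B \<beta>" and I: "finite I" and x: "!!i. i : I ==> x i <: A" and y: "!!i. i : I ==> y i <: B"
 shows "L \<beta> (finsum T (\<lambda>i. pt (x i) (y i)) I) = finsum C (\<lambda>i. \<beta> (x i) (y i)) I"
proof -
 have "L \<beta> (finsum T (\<lambda>i. pt (x i) (y i)) I) = finsum C (\<lambda>i. L \<beta> (pt (x i) (y i))) I"
  by (rule finsum_hom[OF T.abelian_group_axioms C.V.abelian_group_axioms])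
   (use I x y in \<open>auto simp: L_closed[OF \<beta>] L_add[OF \<beta>] pt_closed\<close>)
 also have "\<dots> = finsum C (\<lambda>i. \<beta> (x i) (y i)) I"
  by (rule C.V.finsum_cong') (use x y in \<open>auto simp: L_pt[OF \<beta>] C.bilinD(1)[OF \<beta>]\<close>)
 finally show ?thesis .
qed

end

section \<open>Representing tensors by linearly independent families\<close>

context tensor_alg
begin

definition rep :: "('a \<times> 'b => 'k) set => 'i set => ('i => 'a) => ('i => 'b) => bool" where
 "rep t I x y \<longleftrightarrow> finite I & (ALL i:I. x i <: A & y i <: B) & t = finsum T (\<lambda>i. pt (x i) (y i)) I"

lemma exists_rep:
 assumes t: "t <: T"
 shows "EX (I :: ('a \<times> 'b) set) x y. rep t I x y"
proof -
 obtain f where f: "f <: F" "t = coset_of f" using T_cases[OF t] by blast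
 have ll: "linear_lift k T (carrier A \<times> carrier B) (\<lambda>p c. coset_of (single k p c))"
 proof unfold_locales
  fix p c assume "p : carrier A \<times> carrier B" "c <: k"
  then show "coset_of (single k p c) <: T" by (cases p) (auto intro!: coset_of_closed F_single)
 next
  fix p c d assume "p : carrier A \<times> carrier B" "c <: k" "d <: k"
  then show "coset_of (single k p (c \<oplus>\<^sub>k d)) = coset_of (single k p c) \<oplus>\<^sub>T coset_of (single k p d)"
   by (cases p) (simp add: coset_of_add[symmetric] F_single F_add A.K.single_add)
 qed
 interpret ll: linear_lift k T "carrier A \<times> carrier B" "\<lambda>p c. coset_of (single k p c)" by (rule ll)
 have "ll.llift f = coset_of f" using f(1)
 proof (induction rule: F_induct)
  case zero then show ?case using ll.llift_zero by (simp add: F_zero[symmetric] coset_of_zero)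
 next
  case (single a b l) then show ?case using ll.llift_single by simp
 next
  case (add f g) then show ?case using ll.llift_add[of f g] by (simp add: F_add[symmetric] F_carrier coset_of_add)
 qed
 then have "t = finsum T (\<lambda>p. coset_of (single k p (f p))) (supp k f)" using f(2) by (simp add: ll.llift_def)
 also have "\<dots> = finsum T (\<lambda>p. pt (f p \<odot>\<^sub>A fst p) (snd p)) (supp k f)"
 proof (rule T.finsum_cong')
  have fc: "f p <: k" for p using ll.fmem f(1) F_carrier by simp
  have sub: "supp k f <= carrier A \<times> carrier B" using f(1) finsuppD(3) F_carrier by metis
  show "(\<lambda>p. pt (f p \<odot>\<^sub>A fst p) (snd p)) : supp k f \<rightarrow> carrier T"
   using sub fc by (auto intro!: pt_closed)
  show "coset_of (single k p (f p)) = pt (f p \<odot>\<^sub>A fst p) (snd p)" if "p : supp k f" for p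
  proof -
   obtain a b where p: "p = (a, b)" by (cases p)
   then show ?thesis using sub that fc[of p] pt_smult_cos(1)[of a b "f p"] by auto
  qed
 qed simp
 finally have "rep t (supp k f) (\<lambda>p. f p \<odot>\<^sub>A fst p) snd"
 proof -
  assume *: "t = finsum T (\<lambda>p. pt (f p \<odot>\<^sub>A fst p) (snd p)) (supp k f)"
  have ff: "f : finsupp k (carrier A \<times> carrier B)" using f(1) F_carrier by simp
  have "ALL p:supp k f. f p \<odot>\<^sub>A fst p <: A & snd p <: B"
   using finsuppD(3)[OF ff] ll.fmem[OF ff] by auto
  then show ?thesis unfolding rep_def using * finsuppD(4)[OF ff] by blast
 qed
 then show ?thesis by blast
qed

text \<open>A dependence expresses \<open>y j\<close> by the other members. By bilinearity the term
  of index \<open>j\<close> is distributed over the remaining terms, which changes only their first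
  factors.\<close>

lemma reduce_y:
 assumes r: "rep t I x y" and dep: "\<not> B.indep I y"
 shows "EX j:I. EX x'. rep t (I - {j}) x' y"
proof -
 have I: "finite I" and x: "!!i. i : I ==> x i <: A" and y: "!!i. i : I ==> y i <: B"
  and t: "t = finsum T (\<lambda>i. pt (x i) (y i)) I" using r by (auto simp: rep_def)
 obtain c j where c: "!!i. i : I ==> c i <: k" "finsum B (\<lambda>i. c i \<odot>\<^sub>B y i) I = \<zero>\<^sub>B" and j: "j : I" "c j ~= \<zero>\<^sub>k"
  using dep unfolding B.indep_def by blast
 obtain d where d: "!!i. i : I ==> d i <: k" "y j = finsum B (\<lambda>i. d i \<odot>\<^sub>B y i) (I - {j})"
  using B.indep_solve[where J=I and j=j and y=y and c=c, OF I j(1) y c(1) j(2) c(2)] by blast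
 have "insert j (I - {j}) = I" using j by auto
 moreover have "finsum T (\<lambda>i. pt (x i) (y i)) (insert j (I - {j})) = pt (x j) (y j) \<oplus>\<^sub>T finsum T (\<lambda>i. pt (x i) (y i)) (I - {j})"
  by (rule T.finsum_insert) (use I x y j pt_closed in auto)
 ultimately have "t = pt (x j) (y j) \<oplus>\<^sub>T finsum T (\<lambda>i. pt (x i) (y i)) (I - {j})" using t by simp
 also have "pt (x j) (y j) = finsum T (\<lambda>i. pt (x j) (d i \<odot>\<^sub>B y i)) (I - {j})"
  unfolding d(2) by (rule finsum_hom[OF B.A.abelian_group_axioms T.abelian_group_axioms])
   (use I x y j d pt_closed pt_add2 in auto)
 also have "\<dots> \<oplus>\<^sub>T finsum T (\<lambda>i. pt (x i) (y i)) (I - {j}) =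
   finsum T (\<lambda>i. pt (x j) (d i \<odot>\<^sub>B y i) \<oplus>\<^sub>T pt (x i) (y i)) (I - {j})"
  by (rule T.finsum_addf[symmetric]) (use x y j d pt_closed in auto)
 also have "\<dots> = finsum T (\<lambda>i. pt (d i \<odot>\<^sub>A x j \<oplus>\<^sub>A x i) (y i)) (I - {j})"
  by (rule T.finsum_cong') (use x y j d pt_closed in \<open>auto simp: pt_smult1 pt_smult2 pt_add1\<close>)
 finally have "rep t (I - {j}) (\<lambda>i. d i \<odot>\<^sub>A x j \<oplus>\<^sub>A x i) y"
  unfolding rep_def using I x y j d(1) by auto
 then show ?thesis using j by blast
qed

lemma reduce_x:
 assumes r: "rep t I x y" and dep: "\<not> A.indep I x"
 shows "EX j:I. EX y'. rep t (I - {j}) x y'"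
proof -
 have I: "finite I" and x: "!!i. i : I ==> x i <: A" and y: "!!i. i : I ==> y i <: B"
  and t: "t = finsum T (\<lambda>i. pt (x i) (y i)) I" using r by (auto simp: rep_def)
 obtain c j where c: "!!i. i : I ==> c i <: k" "finsum A (\<lambda>i. c i \<odot>\<^sub>A x i) I = \<zero>\<^sub>A" and j: "j : I" "c j ~= \<zero>\<^sub>k"
  using dep unfolding A.indep_def by blast
 obtain d where d: "!!i. i : I ==> d i <: k" "x j = finsum A (\<lambda>i. d i \<odot>\<^sub>A x i) (I - {j})"
  using A.indep_solve[where J=I and j=j and y=x and c=c, OF I j(1) x c(1) j(2) c(2)] by blast
 have "insert j (I - {j}) = I" using j by auto
 moreover have "finsum T (\<lambda>i. pt (x i) (y i)) (insert j (I - {j})) = pt (x j) (y j) \<oplus>\<^sub>T finsum T (\<lambda>i. pt (x i) (y i)) (I - {j})"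
  by (rule T.finsum_insert) (use I x y j pt_closed in auto)
 ultimately have "t = pt (x j) (y j) \<oplus>\<^sub>T finsum T (\<lambda>i. pt (x i) (y i)) (I - {j})" using t by simp
 also have "pt (x j) (y j) = finsum T (\<lambda>i. pt (d i \<odot>\<^sub>A x i) (y j)) (I - {j})"
  unfolding d(2) by (rule finsum_hom[OF A.A.abelian_group_axioms T.abelian_group_axioms, of "\<lambda>z. pt z (y j)"])
   (use I x y j d pt_closed pt_add1 in auto)
 also have "\<dots> \<oplus>\<^sub>T finsum T (\<lambda>i. pt (x i) (y i)) (I - {j}) =
   finsum T (\<lambda>i. pt (d i \<odot>\<^sub>A x i) (y j) \<oplus>\<^sub>T pt (x i) (y i)) (I - {j})"
  by (rule T.finsum_addf[symmetric]) (use x y j d pt_closed in auto)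
 also have "\<dots> = finsum T (\<lambda>i. pt (x i) (d i \<odot>\<^sub>B y j \<oplus>\<^sub>B y i)) (I - {j})"
  by (rule T.finsum_cong') (use x y j d pt_closed in \<open>auto simp: pt_smult1 pt_smult2 pt_add2\<close>)
 finally have "rep t (I - {j}) x (\<lambda>i. d i \<odot>\<^sub>B y j \<oplus>\<^sub>B y i)"
  unfolding rep_def using I x y j d(1) by auto
 then show ?thesis using j by blast
qed

text \<open>Each dependence in one of the two families saves a term, so the reduction stops with
  both families independent. The index type is that of the support of a representative in the free
  module.\<close>

theorem indep_rep:
 assumes t: "t <: T"
 obtains I :: "('a \<times> 'b) set" and x y where "rep t I x y" "A.indep I x" "B.indep I y"
proof -
 have red: "rep t (I :: ('a \<times> 'b) set) x y ==> EX (I' :: ('a \<times> 'b) set) x' y'. rep t I' x' y' & A.indep I' x' & B.indep I' y'" for I x y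
 proof (induction "card I" arbitrary: I x y rule: less_induct)
  case less
  have fin: "finite I" using less.prems by (simp add: rep_def)
  have smaller: "card (I - {j}) < card I" if "j : I" for j using card_Diff1_less[OF fin that] .
  consider "A.indep I x & B.indep I y" | "\<not> A.indep I x" | "\<not> B.indep I y" by blast
  then show ?case
  proof cases
   case 1
   show ?thesis by (rule exI[of _ I], rule exI[of _ x], rule exI[of _ y]) (use less.prems 1 in simp)
  next
   case 2
   obtain j y' where j: "j : I" "rep t (I - {j}) x y'" using reduce_x[OF less.prems 2] by blast
   show ?thesis by (rule less.hyps[OF smaller[OF j(1)] j(2)])
  next
   case 3
   obtain j x' where j: "j : I" "rep t (I - {j}) x' y" using reduce_y[OF less.prems 3] by blast
   show ?thesis by (rule less.hyps[OF smaller[OF j(1)] j(2)])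
  qed
 qed
 obtain I :: "('a \<times> 'b) set" and x y where "rep t I x y" using exists_rep[OF t] by blast
 from red[OF this] show ?thesis using that by blast
qed

lemma pt_zero1: "b <: B ==> pt \<zero>\<^sub>A b = \<zero>\<^sub>T"
 using pt_smult1[of "\<zero>\<^sub>A" b "\<zero>\<^sub>k"] pt_closed[of "\<zero>\<^sub>A" b] by simp

text \<open>Contract the second factor with the functional dual to \<open>y j\<close>: only
  \<open>x j\<close> remains of the sum.\<close>

lemma pure_left_faithful:
 assumes I: "finite I" and x: "!!i. i : I ==> x i <: A" and y: "!!i. i : I ==> y i <: B"
  and ind: "B.indep I y" and z: "finsum T (\<lambda>i. pt (x i) (y i)) I = \<zero>\<^sub>T" and j: "j : I"
 shows "x j = \<zero>\<^sub>A"
proof -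
 interpret bl: bilin_lift k A B A by unfold_locales
 obtain f where f: "B.functional f" "f (y j) = \<one>\<^sub>k" "!!i. i : I ==> i ~= j ==> f (y i) = \<zero>\<^sub>k"
  using B.indep_functional[where J=I and j=j and y=y, OF I j y ind] by blast
 let ?\<beta> = "\<lambda>a b. f b \<odot>\<^sub>A a"
 have \<beta>: "A.bilin A B ?\<beta>"
  by (rule A.bilinI) (use f(1) in \<open>auto simp: B.functional_def A.V.smult_l_distr A.V.smult_r_distr
    A.V.smult_assoc1[symmetric] A.K.m_comm\<close>)
 have "\<zero>\<^sub>A = finsum A (\<lambda>i. f (y i) \<odot>\<^sub>A x i) I"
  using bl.L_finsum[where I=I and x=x and y=y, OF \<beta> I x y] bl.L_zero[OF \<beta>] z by simp
 also have "\<dots> = finsum A (\<lambda>i. if j = i then x i else \<zero>\<^sub>A) I"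
  by (rule A.A.finsum_cong') (use x f in auto)
 also have "\<dots> = x j" by (rule A.A.finsum_singleton) (use j I x in auto)
 finally show ?thesis by simp
qed

lemma pure_right_faithful:
 assumes I: "finite I" and x: "!!i. i : I ==> x i <: A" and y: "!!i. i : I ==> y i <: B"
  and ind: "A.indep I x" and z: "finsum T (\<lambda>i. pt (x i) (y i)) I = \<zero>\<^sub>T" and j: "j : I"
 shows "y j = \<zero>\<^sub>B"
proof -
 interpret bl: bilin_lift k A B B by unfold_locales
 obtain f where f: "A.functional f" "f (x j) = \<one>\<^sub>k" "!!i. i : I ==> i ~= j ==> f (x i) = \<zero>\<^sub>k"
  using A.indep_functional[where J=I and j=j and y=x, OF I j x ind] by blast
 let ?\<beta> = "\<lambda>a b. f a \<odot>\<^sub>B b"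
 have \<beta>: "B.bilin A B ?\<beta>"
  by (rule B.bilinI) (use f(1) in \<open>auto simp: A.functional_def B.V.smult_l_distr B.V.smult_r_distr
    B.V.smult_assoc1[symmetric] A.K.m_comm\<close>)
 have "\<zero>\<^sub>B = finsum B (\<lambda>i. f (x i) \<odot>\<^sub>B y i) I"
  using bl.L_finsum[where I=I and x=x and y=y, OF \<beta> I x y] bl.L_zero[OF \<beta>] z by simp
 also have "\<dots> = finsum B (\<lambda>i. if j = i then y i else \<zero>\<^sub>B) I"
  by (rule B.A.finsum_cong') (use y f in auto)
 also have "\<dots> = y j" by (rule B.A.finsum_singleton) (use j I y in auto)
 finally show ?thesis by simp
qed

text \<open>Contraction of the first factor is induced by a bilinear map, so a relation between
  tensors passes to a relation in \<open>B\<close>.\<close>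

lemma functional_contract:
 assumes I: "finite I" and x: "!!i. i : I ==> x i <: A" and y: "!!i. i : I ==> y i <: B"
  and z: "finsum T (\<lambda>i. pt (x i) (y i)) I = \<zero>\<^sub>T" and g: "A.functional g"
 shows "finsum B (\<lambda>i. g (x i) \<odot>\<^sub>B y i) I = \<zero>\<^sub>B"
proof -
 interpret bl: bilin_lift k A B B by unfold_locales
 let ?\<beta> = "\<lambda>a b. g a \<odot>\<^sub>B b"
 have \<beta>: "B.bilin A B ?\<beta>"
  by (rule B.bilinI) (use g in \<open>auto simp: A.functional_def B.V.smult_l_distr B.V.smult_r_distr
    B.V.smult_assoc1[symmetric] A.K.m_comm\<close>)
 show ?thesis using bl.L_finsum[where I=I and x=x and y=y, OF \<beta> I x y] bl.L_zero[OF \<beta>] z by simp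
qed

lemma T_nontrivial:
 assumes "a <: A" "b <: B" "a ~= \<zero>\<^sub>A" "b ~= \<zero>\<^sub>B"
 shows "pt a b ~= \<zero>\<^sub>T"
proof
 assume z: "pt a b = \<zero>\<^sub>T"
 have "a = \<zero>\<^sub>A"
 proof (rule A.functional_separates[OF assms(1)])
  fix g assume g: "A.functional g"
  then have gk: "g a <: k" using assms(1) by (simp add: A.functional_def)
  have "finsum B (\<lambda>i. g a \<odot>\<^sub>B b) {()} = \<zero>\<^sub>B"
   by (rule functional_contract[where x="\<lambda>_. a" and y="\<lambda>_. b", OF _ _ _ _ g]) (use assms z pt_closed in simp_all)
  then have "g a \<odot>\<^sub>B b = \<zero>\<^sub>B" using gk assms by simp
  show "g a = \<zero>\<^sub>k"
  proof (rule ccontr)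
   assume "g a ~= \<zero>\<^sub>k"
   then have i: "inv\<^bsub>k\<^esub> g a <: k" "inv\<^bsub>k\<^esub> g a \<otimes>\<^sub>k g a = \<one>\<^sub>k" using gk A.K.field_Units by auto
   then have "b = inv\<^bsub>k\<^esub> g a \<odot>\<^sub>B (g a \<odot>\<^sub>B b)" using B.V.smult_assoc1[of "inv\<^bsub>k\<^esub> g a" "g a" b] gk assms by simp
   then show False using \<open>g a \<odot>\<^sub>B b = \<zero>\<^sub>B\<close> i assms by simp
  qed
 qed
 then show False using assms by simp
qed

end

context bilin_lift
begin

text \<open>The difference of two elements with equal image is written with an independent second
  family; faithfulness then makes all its first factors zero.\<close>

lemma L_inj:
 assumes \<beta>: "C.bilin A B \<beta>"
  and faithful: "!!I x y j. finite (I :: ('a \<times> 'b) set) ==> (!!i. i : I ==> x i <: A) ==> (!!i. i : I ==> y i <: B) ==>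
   B.indep I y ==> finsum C (\<lambda>i. \<beta> (x i) (y i)) I = \<zero>\<^sub>C ==> j : I ==> x j = \<zero>\<^sub>A"
 shows "inj_on (L \<beta>) (carrier T)"
proof (rule inj_onI)
 fix s t assume s: "s <: T" and t: "t <: T" and eq: "L \<beta> s = L \<beta> t"
 have "L \<beta> (s \<ominus>\<^sub>T t) \<oplus>\<^sub>C L \<beta> t = L \<beta> t"
  using L_add[OF \<beta>, of "s \<ominus>\<^sub>T t" t] s t T.diff_add_cancel[OF s t] eq by simp
 then have z: "L \<beta> (s \<ominus>\<^sub>T t) = \<zero>\<^sub>C" using L_closed[OF \<beta>] s t by simp
 have "s \<ominus>\<^sub>T t <: T" using s t by simp
 then obtain I x y where r: "rep (s \<ominus>\<^sub>T t) (I :: ('a \<times> 'b) set) x y" "A.indep I x" "B.indep I y" by (rule indep_rep)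
 have I: "finite I" and x: "!!i. i : I ==> x i <: A" and y: "!!i. i : I ==> y i <: B"
  and st: "s \<ominus>\<^sub>T t = finsum T (\<lambda>i. pt (x i) (y i)) I" using r by (auto simp: rep_def)
 have zz: "finsum C (\<lambda>i. \<beta> (x i) (y i)) I = \<zero>\<^sub>C" using L_finsum[where I=I and x=x and y=y, OF \<beta> I x y] z st by simp
 have "x i = \<zero>\<^sub>A" if "i : I" for i by (rule faithful[of I x y i, OF I x y r(3) zz that])
 then have "finsum T (\<lambda>i. pt (x i) (y i)) I = finsum T (\<lambda>i. \<zero>\<^sub>T) I"
  by (intro T.finsum_cong') (use y pt_zero1 in auto)
 then have "s \<ominus>\<^sub>T t = \<zero>\<^sub>T" using st by simp
 then show "s = t" using s t by simp
qed

lemma faithful_left: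
 assumes \<beta>: "C.bilin A B \<beta>" and inj: "inj_on (L \<beta>) (carrier T)"
  and I: "finite I" and x: "!!i. i : I ==> x i <: A" and y: "!!i. i : I ==> y i <: B"
  and z: "finsum C (\<lambda>i. \<beta> (x i) (y i)) I = \<zero>\<^sub>C"
 shows "finsum T (\<lambda>i. pt (x i) (y i)) I = \<zero>\<^sub>T"
proof (rule inj_onD[OF inj])
 show "L \<beta> (finsum T (\<lambda>i. pt (x i) (y i)) I) = L \<beta> \<zero>\<^sub>T"
  using L_finsum[where I=I and x=x and y=y, OF \<beta> I x y] L_zero[OF \<beta>] z by simp
 show "finsum T (\<lambda>i. pt (x i) (y i)) I <: T" using x y pt_closed by (intro T.finsum_closed) auto
qed simp

lemma L_mult:
 assumes \<beta>: "C.bilin A B \<beta>" and ring: "ring C"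
  and mult: "!!a b a' b'. a <: A ==> b <: B ==> a' <: A ==> b' <: B ==>
   \<beta> (a \<otimes>\<^sub>A a') (b \<otimes>\<^sub>B b') = \<beta> a b \<otimes>\<^sub>C \<beta> a' b'"
  and s: "s <: T" and t: "t <: T"
 shows "L \<beta> (s \<otimes>\<^sub>T t) = L \<beta> s \<otimes>\<^sub>C L \<beta> t"
 using s
proof (induction rule: T_induct)
 interpret RC: ring C by (rule ring)
 case zero then show ?case using t L_closed[OF \<beta>] by (simp add: L_zero[OF \<beta>])
next
 interpret RC: ring C by (rule ring)
 case (pt a b)
 note ab = pt
 show ?case using t
 proof (induction rule: T_induct)
  case zero then show ?case using ab pt_closed L_closed[OF \<beta>] by (simp add: L_zero[OF \<beta>])
 next
  case (pt a' b') then show ?case using ab mult by (simp add: pt_mult L_pt[OF \<beta>])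
 next
  case (add u v) then show ?case using ab pt_closed L_closed[OF \<beta>]
   by (simp add: T.r_distr L_add[OF \<beta>] RC.r_distr)
 qed
next
 interpret RC: ring C by (rule ring)
 case (add u v) then show ?case using t L_closed[OF \<beta>] by (simp add: T.l_distr L_add[OF \<beta>] RC.l_distr)
qed

end

lemma kalg_sub:
 assumes A: "kalg k A" and S: "k_subalgebra k S A"
 shows "kalg k (A\<lparr>carrier := S\<rparr>)"
proof -
 interpret A: kalg k A by (rule A)
 have sub: "subring S A" and sm: "!!c b. c <: k ==> b : S ==> c \<odot>\<^sub>A b : S" using S by (auto simp: k_subalgebra_def)
 have SA: "!!x. x : S ==> x <: A" using subringE(1)[OF sub] by blast
 interpret S: ring "A\<lparr>carrier := S\<rparr>" by (rule A.A.subring_is_ring[OF sub])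
 have "module k (A\<lparr>carrier := S\<rparr>)"
  by (rule moduleI[OF A.K.cring_axioms S.abelian_group_axioms])
   (auto simp: sm SA A.V.smult_l_distr A.V.smult_r_distr A.V.smult_assoc1)
 then have "vspace k (A\<lparr>carrier := S\<rparr>)" by (rule vspaceI[OF A.K.field_axioms])
 then show ?thesis
  by (intro kalg.intro kalg_axioms.intro S.ring_axioms) (auto simp: SA A.smult_mult_l A.smult_mult_r)
qed

lemma finsum_sub:
 assumes A: "abelian_group A" and S: "abelian_group (A\<lparr>carrier := S\<rparr>)" and SA: "S <= carrier A"
  and "finite I" and g: "!!i. i : I ==> g i : S"
 shows "finsum (A\<lparr>carrier := S\<rparr>) g I = finsum A g I"
 using finsum_hom[OF S A, of "\<lambda>x. x" I g] SA assms(4) g by auto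

text \<open>Independent representations found inside subalgebras can therefore be used in the
  ambient algebras.\<close>

lemma indep_sub:
 assumes A: "kalg k A" and S: "k_subalgebra k S A" and I: "finite I" and y: "!!i. i : I ==> y i : S"
 shows "vspace.indep k (A\<lparr>carrier := S\<rparr>) I y \<longleftrightarrow> vspace.indep k A I y"
proof -
 interpret A: kalg k A by (rule A)
 interpret S: kalg k "A\<lparr>carrier := S\<rparr>" by (rule kalg_sub[OF A S])
 have sub: "subring S A" and sm: "!!c b. c <: k ==> b : S ==> c \<odot>\<^sub>A b : S" using S by (auto simp: k_subalgebra_def)
 have "finsum (A\<lparr>carrier := S\<rparr>) (\<lambda>i. c i \<odot>\<^sub>A y i) I = finsum A (\<lambda>i. c i \<odot>\<^sub>A y i) I" if "ALL i:I. c i <: k" for c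
  by (rule finsum_sub[OF A.A.abelian_group_axioms S.A.abelian_group_axioms subringE(1)[OF sub] I]) (use that sm y in auto)
 then show ?thesis unfolding S.indep_def A.indep_def by (simp cong: conj_cong)
qed

section \<open>Fields of fractions and automorphisms\<close>

locale dom_alg = kalg k A + D: domain A for k :: "('k, 'z) ring_scheme" and A :: "('k, 'a) module"
begin

abbreviation fr where "fr \<equiv> frac A"
abbreviation L where "L \<equiv> Frac A"

lemma frI: "a <: A ==> b : nz A ==> (a, b) : fr a b"
 by (auto simp: frac_def)

lemma fr_mem: "(c, d) : fr a b \<longleftrightarrow> c <: A & d : nz A & a \<otimes>\<^sub>A d = c \<otimes>\<^sub>A b"
 by (simp add: frac_def)

lemma nz_mult: "b : nz A ==> d : nz A ==> b \<otimes>\<^sub>A d : nz A"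
 using D.integral_iff by auto

lemma cross_trans:
 assumes "a <: A" "b : nz A" "c <: A" "d <: A" "p <: A" "q <: A"
  "a \<otimes>\<^sub>A d = c \<otimes>\<^sub>A b" "a \<otimes>\<^sub>A q = p \<otimes>\<^sub>A b"
 shows "c \<otimes>\<^sub>A q = p \<otimes>\<^sub>A d"
proof -
 have b: "b <: A" "b ~= \<zero>\<^sub>A" using assms by auto
 have "b \<otimes>\<^sub>A (c \<otimes>\<^sub>A q) = (c \<otimes>\<^sub>A b) \<otimes>\<^sub>A q" using assms(3,6) b by (simp add: D.m_ac)
 also have "\<dots> = (a \<otimes>\<^sub>A d) \<otimes>\<^sub>A q" using assms by simp
 also have "\<dots> = (a \<otimes>\<^sub>A q) \<otimes>\<^sub>A d" using assms(1,4,6) b by (simp add: D.m_ac)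
 also have "\<dots> = (p \<otimes>\<^sub>A b) \<otimes>\<^sub>A d" using assms by simp
 also have "\<dots> = b \<otimes>\<^sub>A (p \<otimes>\<^sub>A d)" using assms(4,5) b by (simp add: D.m_ac)
 finally show ?thesis using D.m_lcancel[OF b(2,1)] assms by simp
qed

lemma fr_eq:
 assumes a: "a <: A" and b: "b : nz A" and c: "c <: A" and d: "d : nz A"
 shows "fr a b = fr c d \<longleftrightarrow> a \<otimes>\<^sub>A d = c \<otimes>\<^sub>A b"
proof
 assume "fr a b = fr c d"
 then have "(c, d) : fr a b" using frI[OF c d] by simp
 then show "a \<otimes>\<^sub>A d = c \<otimes>\<^sub>A b" by (simp add: fr_mem)
next
 assume eq: "a \<otimes>\<^sub>A d = c \<otimes>\<^sub>A b"
 have "(p, q) : fr a b \<longleftrightarrow> (p, q) : fr c d" for p q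
 proof (cases "p <: A & q : nz A")
  case True
  have "a \<otimes>\<^sub>A q = p \<otimes>\<^sub>A b \<longleftrightarrow> c \<otimes>\<^sub>A q = p \<otimes>\<^sub>A d"
   using cross_trans[of a b c d p q] cross_trans[of c d a b p q] a b c d True eq by auto
  then show ?thesis using True by (simp add: fr_mem)
 qed (auto simp: fr_mem)
 then show "fr a b = fr c d" by auto
qed

lemma fr_of_mem:
 assumes "a <: A" "b : nz A" "(p, q) : fr a b"
 shows "fr p q = fr a b" "p <: A" "q : nz A"
 using assms fr_eq[of p q a b] by (auto simp: fr_mem)

text \<open>Evaluates the unions over representatives in the definitions on fractions: the index set
  is nonempty and all its members give the same value.\<close>

lemma UN_fr:
 assumes "a <: A" "b : nz A"
  and "!!p q. p <: A ==> q : nz A ==> fr p q = fr a b ==> h p q = c"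
 shows "(\<Union>(p, q)\<in>fr a b. h p q) = c"
 by (rule UN_constant_eq[OF frI[OF assms(1,2)]]) (use fr_of_mem[OF assms(1,2)] assms(3) in auto)

lemma L_carrier: "x <: L \<longleftrightarrow> (EX a b. a <: A & b : nz A & x = fr a b)"
 by (auto simp: Frac_def)

lemma L_cases:
 assumes "x <: L" obtains a b where "a <: A" "b : nz A" "x = fr a b"
 using assms L_carrier by blast

lemma fr_closed: "a <: A ==> b : nz A ==> fr a b <: L"
 using L_carrier by blast

lemma L_one: "\<one>\<^sub>L = fr \<one>\<^sub>A \<one>\<^sub>A" and L_zero: "\<zero>\<^sub>L = fr \<zero>\<^sub>A \<one>\<^sub>A"
 by (simp_all add: Frac_def)

lemma L_mult:
 assumes "a <: A" "b : nz A" "c <: A" "d : nz A"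
 shows "fr a b \<otimes>\<^sub>L fr c d = fr (a \<otimes>\<^sub>A c) (b \<otimes>\<^sub>A d)"
proof -
 have "fr a b \<otimes>\<^sub>L fr c d = (\<Union>(p, q)\<in>fr a b. \<Union>(r, s)\<in>fr c d. fr (p \<otimes>\<^sub>A r) (q \<otimes>\<^sub>A s))" by (simp add: Frac_def)
 also have "\<dots> = fr (a \<otimes>\<^sub>A c) (b \<otimes>\<^sub>A d)"
 proof (rule UN_fr[OF assms(1,2)], rule UN_fr[OF assms(3,4)])
  fix p q r s assume h: "p <: A" "q : nz A" "fr p q = fr a b"
   "r <: A" "s : nz A" "fr r s = fr c d"
  then have e: "p \<otimes>\<^sub>A b = a \<otimes>\<^sub>A q" "r \<otimes>\<^sub>A d = c \<otimes>\<^sub>A s" using fr_eq assms by auto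
  have "(p \<otimes>\<^sub>A r) \<otimes>\<^sub>A (b \<otimes>\<^sub>A d) = (p \<otimes>\<^sub>A b) \<otimes>\<^sub>A (r \<otimes>\<^sub>A d)" using h assms by (simp add: D.m_ac)
  also have "\<dots> = (a \<otimes>\<^sub>A c) \<otimes>\<^sub>A (q \<otimes>\<^sub>A s)" unfolding e using h assms by (simp add: D.m_ac)
  finally show "fr (p \<otimes>\<^sub>A r) (q \<otimes>\<^sub>A s) = fr (a \<otimes>\<^sub>A c) (b \<otimes>\<^sub>A d)"
   using fr_eq[of "p \<otimes>\<^sub>A r" "q \<otimes>\<^sub>A s" "a \<otimes>\<^sub>A c" "b \<otimes>\<^sub>A d"] nz_mult h assms by simp
 qed
 finally show ?thesis .
qed

lemma L_add:
 assumes "a <: A" "b : nz A" "c <: A" "d : nz A"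
 shows "fr a b \<oplus>\<^sub>L fr c d = fr (a \<otimes>\<^sub>A d \<oplus>\<^sub>A c \<otimes>\<^sub>A b) (b \<otimes>\<^sub>A d)"
proof -
 have "fr a b \<oplus>\<^sub>L fr c d = (\<Union>(p, q)\<in>fr a b. \<Union>(r, s)\<in>fr c d. fr (p \<otimes>\<^sub>A s \<oplus>\<^sub>A r \<otimes>\<^sub>A q) (q \<otimes>\<^sub>A s))" by (simp add: Frac_def)
 also have "\<dots> = fr (a \<otimes>\<^sub>A d \<oplus>\<^sub>A c \<otimes>\<^sub>A b) (b \<otimes>\<^sub>A d)"
 proof (rule UN_fr[OF assms(1,2)], rule UN_fr[OF assms(3,4)])
  fix p q r s assume h: "p <: A" "q : nz A" "fr p q = fr a b"
   "r <: A" "s : nz A" "fr r s = fr c d"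
  then have e: "p \<otimes>\<^sub>A b = a \<otimes>\<^sub>A q" "r \<otimes>\<^sub>A d = c \<otimes>\<^sub>A s" using fr_eq assms by auto
  have "(p \<otimes>\<^sub>A s \<oplus>\<^sub>A r \<otimes>\<^sub>A q) \<otimes>\<^sub>A (b \<otimes>\<^sub>A d) = (p \<otimes>\<^sub>A b) \<otimes>\<^sub>A (s \<otimes>\<^sub>A d) \<oplus>\<^sub>A (r \<otimes>\<^sub>A d) \<otimes>\<^sub>A (q \<otimes>\<^sub>A b)"
   using h assms by (simp add: D.m_ac A.l_distr A.r_distr)
  also have "\<dots> = (a \<otimes>\<^sub>A d \<oplus>\<^sub>A c \<otimes>\<^sub>A b) \<otimes>\<^sub>A (q \<otimes>\<^sub>A s)" unfolding e using h assms by (simp add: D.m_ac A.l_distr A.r_distr)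
  finally show "fr (p \<otimes>\<^sub>A s \<oplus>\<^sub>A r \<otimes>\<^sub>A q) (q \<otimes>\<^sub>A s) = fr (a \<otimes>\<^sub>A d \<oplus>\<^sub>A c \<otimes>\<^sub>A b) (b \<otimes>\<^sub>A d)"
   using fr_eq[of "p \<otimes>\<^sub>A s \<oplus>\<^sub>A r \<otimes>\<^sub>A q" "q \<otimes>\<^sub>A s" "a \<otimes>\<^sub>A d \<oplus>\<^sub>A c \<otimes>\<^sub>A b" "b \<otimes>\<^sub>A d"] nz_mult h assms by simp
 qed
 finally show ?thesis .
qed

lemma L_smult:
 assumes "r <: k" "a <: A" "b : nz A"
 shows "r \<odot>\<^sub>L fr a b = fr (r \<odot>\<^sub>A a) b"
proof -
 have "r \<odot>\<^sub>L fr a b = (\<Union>(p, q)\<in>fr a b. fr (r \<odot>\<^sub>A p) q)" by (simp add: Frac_def)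
 also have "\<dots> = fr (r \<odot>\<^sub>A a) b"
 proof (rule UN_fr[OF assms(2,3)])
  fix p q assume h: "p <: A" "q : nz A" "fr p q = fr a b"
  then have "p \<otimes>\<^sub>A b = a \<otimes>\<^sub>A q" using fr_eq assms by auto
  then have "(r \<odot>\<^sub>A p) \<otimes>\<^sub>A b = (r \<odot>\<^sub>A a) \<otimes>\<^sub>A q" using h assms by (simp add: smult_mult_l)
  then show "fr (r \<odot>\<^sub>A p) q = fr (r \<odot>\<^sub>A a) b" using fr_eq[of "r \<odot>\<^sub>A p" q "r \<odot>\<^sub>A a" b] h assms by simp
 qed
 finally show ?thesis .
qed

lemma one_nz: "\<one>\<^sub>A : nz A" using D.one_not_zero by simp

lemma nzD: "b : nz A ==> b <: A" by simp

lemma L_cring: "cring L"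
proof (rule cringI)
 show "abelian_group L"
 proof (rule abelian_groupI)
  fix x y z assume x: "x <: L" and y: "y <: L" and z: "z <: L"
  obtain a b where ab: "a <: A" "b : nz A" "x = fr a b" using L_cases[OF x] .
  obtain c d where cd: "c <: A" "d : nz A" "y = fr c d" using L_cases[OF y] .
  obtain u v where uv: "u <: A" "v : nz A" "z = fr u v" using L_cases[OF z] .
  note n = nzD[OF ab(2)] nzD[OF cd(2)] nzD[OF uv(2)]
  have "((a \<otimes>\<^sub>A d \<oplus>\<^sub>A c \<otimes>\<^sub>A b) \<otimes>\<^sub>A v \<oplus>\<^sub>A u \<otimes>\<^sub>A (b \<otimes>\<^sub>A d)) = (a \<otimes>\<^sub>A (d \<otimes>\<^sub>A v) \<oplus>\<^sub>A (c \<otimes>\<^sub>A v \<oplus>\<^sub>A u \<otimes>\<^sub>A d) \<otimes>\<^sub>A b)"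
   "b \<otimes>\<^sub>A d \<otimes>\<^sub>A v = b \<otimes>\<^sub>A (d \<otimes>\<^sub>A v)"
   using ab(1) cd(1) uv(1) n by (simp_all add: A.l_distr A.r_distr D.m_ac A.a_ac)
  then show "x \<oplus>\<^sub>L y \<oplus>\<^sub>L z = x \<oplus>\<^sub>L (y \<oplus>\<^sub>L z)"
   using ab cd uv n nz_mult by (simp add: L_add)
 next
  fix x y assume x: "x <: L" and y: "y <: L"
  obtain a b where ab: "a <: A" "b : nz A" "x = fr a b" using L_cases[OF x] .
  obtain c d where cd: "c <: A" "d : nz A" "y = fr c d" using L_cases[OF y] .
  show "x \<oplus>\<^sub>L y <: L" using ab cd nz_mult by (auto simp: L_add intro!: fr_closed)
  show "x \<oplus>\<^sub>L y = y \<oplus>\<^sub>L x" using ab cd by (simp add: L_add A.a_comm D.m_comm)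
 next
  show "\<zero>\<^sub>L <: L" unfolding L_zero using one_nz by (intro fr_closed) auto
 next
  fix x assume x: "x <: L"
  obtain a b where ab: "a <: A" "b : nz A" "x = fr a b" using L_cases[OF x] .
  show "\<zero>\<^sub>L \<oplus>\<^sub>L x = x" unfolding L_zero using ab one_nz by (simp add: L_add)
  have "fr (\<ominus>\<^sub>A a) b \<oplus>\<^sub>L x = fr \<zero>\<^sub>A (b \<otimes>\<^sub>A b)" using ab by (simp add: L_add A.l_minus A.l_neg)
  also have "\<dots> = \<zero>\<^sub>L" unfolding L_zero using fr_eq[of "\<zero>\<^sub>A" "b \<otimes>\<^sub>A b" "\<zero>\<^sub>A" "\<one>\<^sub>A"] ab nz_mult[OF ab(2,2)] one_nz by simp
  finally show "EX y:carrier L. y \<oplus>\<^sub>L x = \<zero>\<^sub>L" using ab by (intro bexI[of _ "fr (\<ominus>\<^sub>A a) b"]) (auto intro!: fr_closed)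
 qed
 show "Group.comm_monoid L"
 proof (rule comm_monoidI)
  fix x y z assume x: "x <: L" and y: "y <: L" and z: "z <: L"
  obtain a b where ab: "a <: A" "b : nz A" "x = fr a b" using L_cases[OF x] .
  obtain c d where cd: "c <: A" "d : nz A" "y = fr c d" using L_cases[OF y] .
  obtain u v where uv: "u <: A" "v : nz A" "z = fr u v" using L_cases[OF z] .
  show "x \<otimes>\<^sub>L y \<otimes>\<^sub>L z = x \<otimes>\<^sub>L (y \<otimes>\<^sub>L z)" using ab cd uv nz_mult by (simp add: L_mult A.m_assoc)
 next
  fix x y assume x: "x <: L" and y: "y <: L"
  obtain a b where ab: "a <: A" "b : nz A" "x = fr a b" using L_cases[OF x] .
  obtain c d where cd: "c <: A" "d : nz A" "y = fr c d" using L_cases[OF y] .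
  show "x \<otimes>\<^sub>L y <: L" using ab cd nz_mult by (auto simp: L_mult intro!: fr_closed)
  show "x \<otimes>\<^sub>L y = y \<otimes>\<^sub>L x" using ab cd by (simp add: L_mult D.m_comm)
 next
  show "\<one>\<^sub>L <: L" unfolding L_one using one_nz by (intro fr_closed) auto
 next
  fix x assume x: "x <: L"
  obtain a b where ab: "a <: A" "b : nz A" "x = fr a b" using L_cases[OF x] .
  show "\<one>\<^sub>L \<otimes>\<^sub>L x = x" unfolding L_one using ab one_nz by (simp add: L_mult)
 qed
 fix x y z assume x: "x <: L" and y: "y <: L" and z: "z <: L"
 obtain a b where ab: "a <: A" "b : nz A" "x = fr a b" using L_cases[OF x] .
 obtain c d where cd: "c <: A" "d : nz A" "y = fr c d" using L_cases[OF y] .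
 obtain u v where uv: "u <: A" "v : nz A" "z = fr u v" using L_cases[OF z] .
 note n = nzD[OF ab(2)] nzD[OF cd(2)] nzD[OF uv(2)]
 have 1: "(x \<oplus>\<^sub>L y) \<otimes>\<^sub>L z = fr ((a \<otimes>\<^sub>A d \<oplus>\<^sub>A c \<otimes>\<^sub>A b) \<otimes>\<^sub>A u) (b \<otimes>\<^sub>A d \<otimes>\<^sub>A v)"
  using ab cd uv nz_mult by (simp add: L_mult L_add)
 have 2: "x \<otimes>\<^sub>L z \<oplus>\<^sub>L y \<otimes>\<^sub>L z = fr (a \<otimes>\<^sub>A u \<otimes>\<^sub>A (d \<otimes>\<^sub>A v) \<oplus>\<^sub>A c \<otimes>\<^sub>A u \<otimes>\<^sub>A (b \<otimes>\<^sub>A v)) (b \<otimes>\<^sub>A v \<otimes>\<^sub>A (d \<otimes>\<^sub>A v))"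
  using ab cd uv nz_mult by (simp add: L_mult L_add)
 have 3: "((a \<otimes>\<^sub>A d \<oplus>\<^sub>A c \<otimes>\<^sub>A b) \<otimes>\<^sub>A u) \<otimes>\<^sub>A (b \<otimes>\<^sub>A v \<otimes>\<^sub>A (d \<otimes>\<^sub>A v)) = (a \<otimes>\<^sub>A u \<otimes>\<^sub>A (d \<otimes>\<^sub>A v) \<oplus>\<^sub>A c \<otimes>\<^sub>A u \<otimes>\<^sub>A (b \<otimes>\<^sub>A v)) \<otimes>\<^sub>A (b \<otimes>\<^sub>A d \<otimes>\<^sub>A v)"
  using ab(1) cd(1) uv(1) n by (simp add: A.l_distr A.r_distr D.m_ac A.a_ac)
 show "(x \<oplus>\<^sub>L y) \<otimes>\<^sub>L z = x \<otimes>\<^sub>L z \<oplus>\<^sub>L y \<otimes>\<^sub>L z"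
  unfolding 1 2 by (subst fr_eq) (use 3 ab(1) cd(1) uv(1) n nz_mult ab(2) cd(2) uv(2) in simp_all)
qed

lemma L_field: "field L"
proof (rule cring.cring_fieldI2[OF L_cring])
 show "\<zero>\<^sub>L ~= \<one>\<^sub>L" unfolding L_zero L_one using fr_eq[of "\<zero>\<^sub>A" "\<one>\<^sub>A" "\<one>\<^sub>A" "\<one>\<^sub>A"] one_nz by simp
 fix x assume x: "x <: L" and nz: "x ~= \<zero>\<^sub>L"
 obtain a b where ab: "a <: A" "b : nz A" "x = fr a b" using L_cases[OF x] .
 have a: "a : nz A" using nz ab fr_eq[of a b "\<zero>\<^sub>A" "\<one>\<^sub>A"] one_nz by (auto simp: L_zero)
 have "x \<otimes>\<^sub>L fr b a = \<one>\<^sub>L" unfolding L_one using ab a nz_mult[OF ab(2) a] one_nz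
  by (simp add: L_mult fr_eq D.m_comm)
 then show "EX y:carrier L. x \<otimes>\<^sub>L y = \<one>\<^sub>L" using ab a by (intro bexI[of _ "fr b a"]) (auto intro!: fr_closed)
qed

sublocale L: field L by (rule L_field)

lemma L_module: "module k L"
proof (rule moduleI[OF K.cring_axioms L.abelian_group_axioms])
 fix c x assume c: "c <: k" and x: "x <: L"
 obtain a b where ab: "a <: A" "b : nz A" "x = fr a b" using L_cases[OF x] .
 note n = nzD[OF ab(2)]
 show "c \<odot>\<^sub>L x <: L" using c ab by (auto simp: L_smult intro!: fr_closed)
 { fix d assume d: "d <: k"
  have "fr ((c \<oplus>\<^sub>k d) \<odot>\<^sub>A a) b = fr ((c \<odot>\<^sub>A a) \<otimes>\<^sub>A b \<oplus>\<^sub>A (d \<odot>\<^sub>A a) \<otimes>\<^sub>A b) (b \<otimes>\<^sub>A b)"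
   by (subst fr_eq) (use c d ab(1,2) n nz_mult in \<open>simp_all add: V.smult_l_distr A.l_distr A.m_assoc\<close>)
  then show "(c \<oplus>\<^sub>k d) \<odot>\<^sub>L x = c \<odot>\<^sub>L x \<oplus>\<^sub>L d \<odot>\<^sub>L x" using c d ab n by (simp add: L_smult L_add)
  show "(c \<otimes>\<^sub>k d) \<odot>\<^sub>L x = c \<odot>\<^sub>L (d \<odot>\<^sub>L x)" using c d ab by (simp add: L_smult V.smult_assoc1) }
 { fix y assume y: "y <: L"
  obtain u v where uv: "u <: A" "v : nz A" "y = fr u v" using L_cases[OF y] .
  show "c \<odot>\<^sub>L (x \<oplus>\<^sub>L y) = c \<odot>\<^sub>L x \<oplus>\<^sub>L c \<odot>\<^sub>L y"
   using c ab uv nz_mult by (simp add: L_smult L_add V.smult_r_distr smult_mult_l) }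
next
 fix x assume x: "x <: L"
 obtain a b where ab: "a <: A" "b : nz A" "x = fr a b" using L_cases[OF x] .
 show "\<one>\<^sub>k \<odot>\<^sub>L x = x" using ab by (simp add: L_smult)
qed

lemma L_kalg: "kalg k L"
proof (intro kalg.intro kalg_axioms.intro L.ring_axioms vspaceI[OF K.field_axioms L_module])
 have 1: "(c \<odot>\<^sub>L x) \<otimes>\<^sub>L y = c \<odot>\<^sub>L (x \<otimes>\<^sub>L y)" if c: "c <: k" and x: "x <: L" and y: "y <: L" for c x y
 proof -
  obtain a b where ab: "a <: A" "b : nz A" "x = fr a b" using L_cases[OF x] .
  obtain u v where uv: "u <: A" "v : nz A" "y = fr u v" using L_cases[OF y] .
  show ?thesis using c ab uv nz_mult by (simp add: L_smult L_mult smult_mult_l)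
 qed
 show "(c \<odot>\<^sub>L x) \<otimes>\<^sub>L y = c \<odot>\<^sub>L (x \<otimes>\<^sub>L y)" if "c <: k" "x <: L" "y <: L" for c x y
  by (rule 1[OF that])
 show "x \<otimes>\<^sub>L (c \<odot>\<^sub>L y) = c \<odot>\<^sub>L (x \<otimes>\<^sub>L y)" if h: "c <: k" "x <: L" "y <: L" for c x y
  using 1[OF h(1,3,2)] module.smult_closed[OF L_module h(1,3)] h L.m_comm[of x "c \<odot>\<^sub>L y"] L.m_comm[of x y] by simp
qed

sublocale LA: kalg k L by (rule L_kalg)

lemma to_frac_closed: "a <: A ==> to_frac A a <: L"
 unfolding to_frac_def using one_nz by (intro fr_closed) auto
lemma to_frac_add: "a <: A ==> b <: A ==> to_frac A (a \<oplus>\<^sub>A b) = to_frac A a \<oplus>\<^sub>L to_frac A b"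
 unfolding to_frac_def using one_nz by (simp add: L_add)
lemma to_frac_mult: "a <: A ==> b <: A ==> to_frac A (a \<otimes>\<^sub>A b) = to_frac A a \<otimes>\<^sub>L to_frac A b"
 unfolding to_frac_def using one_nz by (simp add: L_mult)
lemma to_frac_one: "to_frac A \<one>\<^sub>A = \<one>\<^sub>L" by (simp add: to_frac_def L_one)
lemma to_frac_zero: "to_frac A \<zero>\<^sub>A = \<zero>\<^sub>L" by (simp add: to_frac_def L_zero)
lemma fr_to_frac: "a <: A ==> b : nz A ==> to_frac A b \<otimes>\<^sub>L fr a b = to_frac A a"
 unfolding to_frac_def using one_nz nz_mult[of b b] by (simp add: L_mult fr_eq D.m_comm)
lemma fr_zero_iff: "a <: A ==> b : nz A ==> fr a b = \<zero>\<^sub>L \<longleftrightarrow> a = \<zero>\<^sub>A"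
 unfolding L_zero using one_nz by (simp add: fr_eq)

text \<open>Injectivity keeps denominators nonzero, which is what the extension of \<sigma> to
  fractions requires.\<close>

definition alg_inj :: "('a => 'a) => bool" where
 "alg_inj \<sigma> \<longleftrightarrow> \<sigma> : ring_hom A A & inj_on \<sigma> (carrier A) &
  (ALL c:carrier k. ALL a:carrier A. \<sigma> (c \<odot>\<^sub>A a) = c \<odot>\<^sub>A \<sigma> a)"

lemma alg_injD:
 assumes "alg_inj \<sigma>"
 shows "a <: A ==> \<sigma> a <: A" "a <: A ==> b <: A ==> \<sigma> (a \<oplus>\<^sub>A b) = \<sigma> a \<oplus>\<^sub>A \<sigma> b"
  "a <: A ==> b <: A ==> \<sigma> (a \<otimes>\<^sub>A b) = \<sigma> a \<otimes>\<^sub>A \<sigma> b" "\<sigma> \<one>\<^sub>A = \<one>\<^sub>A" "\<sigma> \<zero>\<^sub>A = \<zero>\<^sub>A"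
  "b : nz A ==> \<sigma> b : nz A"
  "c <: k ==> a <: A ==> \<sigma> (c \<odot>\<^sub>A a) = c \<odot>\<^sub>A \<sigma> a"
proof -
 have h: "\<sigma> : ring_hom A A" and inj: "inj_on \<sigma> (carrier A)" using assms by (auto simp: alg_inj_def)
 show 1: "a <: A ==> \<sigma> a <: A" for a using ring_hom_closed[OF h] .
 show 2: "a <: A ==> b <: A ==> \<sigma> (a \<oplus>\<^sub>A b) = \<sigma> a \<oplus>\<^sub>A \<sigma> b" for a b using ring_hom_add[OF h] .
 show "a <: A ==> b <: A ==> \<sigma> (a \<otimes>\<^sub>A b) = \<sigma> a \<otimes>\<^sub>A \<sigma> b" using ring_hom_mult[OF h] .
 show "\<sigma> \<one>\<^sub>A = \<one>\<^sub>A" using ring_hom_one[OF h] .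
 show z: "\<sigma> \<zero>\<^sub>A = \<zero>\<^sub>A" using 2[of "\<zero>\<^sub>A" "\<zero>\<^sub>A"] 1[of "\<zero>\<^sub>A"] by simp
 show "b : nz A ==> \<sigma> b : nz A"
  using 1[of b] z inj_onD[OF inj, of b "\<zero>\<^sub>A"] by auto
 show "c <: k ==> a <: A ==> \<sigma> (c \<odot>\<^sub>A a) = c \<odot>\<^sub>A \<sigma> a" using assms by (simp add: alg_inj_def)
qed

lemma frac_map_fr:
 assumes \<sigma>: "alg_inj \<sigma>" and ab: "a <: A" "b : nz A"
 shows "frac_map A \<sigma> (fr a b) = fr (\<sigma> a) (\<sigma> b)"
 unfolding frac_map_def
proof (rule UN_fr[OF ab])
 note s = alg_injD[OF \<sigma>]
 fix p q assume h: "p <: A" "q : nz A" "fr p q = fr a b"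
 then have "p \<otimes>\<^sub>A b = a \<otimes>\<^sub>A q" using fr_eq ab by auto
 then have "\<sigma> p \<otimes>\<^sub>A \<sigma> b = \<sigma> a \<otimes>\<^sub>A \<sigma> q" using s(3)[OF h(1) nzD[OF ab(2)]] s(3)[OF ab(1) nzD[OF h(2)]] by simp
 then show "fr (\<sigma> p) (\<sigma> q) = fr (\<sigma> a) (\<sigma> b)"
  using fr_eq[OF s(1)[OF h(1)] s(6)[OF h(2)] s(1)[OF ab(1)] s(6)[OF ab(2)]] by simp
qed

lemma frac_map_closed:
 assumes \<sigma>: "alg_inj \<sigma>" and x: "x <: L"
 shows "frac_map A \<sigma> x <: L"
proof -
 obtain a b where ab: "a <: A" "b : nz A" "x = fr a b" using L_cases[OF x] .
 show ?thesis unfolding ab(3) frac_map_fr[OF \<sigma> ab(1,2)]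
  by (rule fr_closed[OF alg_injD(1)[OF \<sigma> ab(1)] alg_injD(6)[OF \<sigma> ab(2)]])
qed

lemma frac_map_props:
 assumes \<sigma>: "alg_inj \<sigma>" and x: "x <: L" and y: "y <: L"
 shows "frac_map A \<sigma> (x \<oplus>\<^sub>L y) = frac_map A \<sigma> x \<oplus>\<^sub>L frac_map A \<sigma> y"
  "frac_map A \<sigma> (x \<otimes>\<^sub>L y) = frac_map A \<sigma> x \<otimes>\<^sub>L frac_map A \<sigma> y"
  "frac_map A \<sigma> x = frac_map A \<sigma> y \<longleftrightarrow> x = y"
  "c <: k ==> frac_map A \<sigma> (c \<odot>\<^sub>L x) = c \<odot>\<^sub>L frac_map A \<sigma> x"
proof -
 note s = alg_injD[OF \<sigma>]
 obtain a b where ab: "a <: A" "b : nz A" "x = fr a b" using L_cases[OF x] .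
 obtain u v where uv: "u <: A" "v : nz A" "y = fr u v" using L_cases[OF y] .
 note n = nzD[OF ab(2)] nzD[OF uv(2)]
 note c = s(1)[OF ab(1)] s(6)[OF ab(2)] s(1)[OF uv(1)] s(6)[OF uv(2)]
 have e: "frac_map A \<sigma> x = fr (\<sigma> a) (\<sigma> b)" "frac_map A \<sigma> y = fr (\<sigma> u) (\<sigma> v)"
  using ab uv by (simp_all only: frac_map_fr[OF \<sigma>])
 have "x \<oplus>\<^sub>L y = fr (a \<otimes>\<^sub>A v \<oplus>\<^sub>A u \<otimes>\<^sub>A b) (b \<otimes>\<^sub>A v)" using L_add[OF ab(1,2) uv(1,2)] ab uv by simp
 then have "frac_map A \<sigma> (x \<oplus>\<^sub>L y) = fr (\<sigma> (a \<otimes>\<^sub>A v \<oplus>\<^sub>A u \<otimes>\<^sub>A b)) (\<sigma> (b \<otimes>\<^sub>A v))"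
  using frac_map_fr[OF \<sigma> _ nz_mult[OF ab(2) uv(2)]] ab uv n by simp
 then show "frac_map A \<sigma> (x \<oplus>\<^sub>L y) = frac_map A \<sigma> x \<oplus>\<^sub>L frac_map A \<sigma> y"
  unfolding e L_add[OF c] using ab(1) uv(1) n by (simp add: s(2,3))
 have "x \<otimes>\<^sub>L y = fr (a \<otimes>\<^sub>A u) (b \<otimes>\<^sub>A v)" using L_mult[OF ab(1,2) uv(1,2)] ab uv by simp
 then have "frac_map A \<sigma> (x \<otimes>\<^sub>L y) = fr (\<sigma> (a \<otimes>\<^sub>A u)) (\<sigma> (b \<otimes>\<^sub>A v))"
  using frac_map_fr[OF \<sigma> _ nz_mult[OF ab(2) uv(2)]] ab uv n by simp
 then show "frac_map A \<sigma> (x \<otimes>\<^sub>L y) = frac_map A \<sigma> x \<otimes>\<^sub>L frac_map A \<sigma> y"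
  unfolding e L_mult[OF c] using ab(1) uv(1) n by (simp add: s(3))
 have "fr (\<sigma> a) (\<sigma> b) = fr (\<sigma> u) (\<sigma> v) \<longleftrightarrow> \<sigma> (a \<otimes>\<^sub>A v) = \<sigma> (u \<otimes>\<^sub>A b)"
  unfolding fr_eq[OF c] using ab(1) uv(1) n by (simp add: s(3))
 also have "\<dots> \<longleftrightarrow> a \<otimes>\<^sub>A v = u \<otimes>\<^sub>A b" using \<sigma> ab(1) uv(1) n inj_on_eq_iff[of \<sigma> "carrier A"] by (simp add: alg_inj_def)
 also have "\<dots> \<longleftrightarrow> x = y" unfolding ab(3) uv(3) using fr_eq[OF ab(1,2) uv(1,2)] by simp
 finally show "frac_map A \<sigma> x = frac_map A \<sigma> y \<longleftrightarrow> x = y" unfolding e .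
 assume ck: "c <: k"
 have "c \<odot>\<^sub>L x = fr (c \<odot>\<^sub>A a) b" using L_smult[OF ck ab(1,2)] ab(3) by simp
 then have "frac_map A \<sigma> (c \<odot>\<^sub>L x) = fr (\<sigma> (c \<odot>\<^sub>A a)) (\<sigma> b)" using frac_map_fr[OF \<sigma> _ ab(2)] ck ab(1) by simp
 then show "frac_map A \<sigma> (c \<odot>\<^sub>L x) = c \<odot>\<^sub>L frac_map A \<sigma> x"
  unfolding e L_smult[OF ck c(1,2)] using ck ab(1) by (simp add: s(7))
qed

lemma frac_map_one: "alg_inj \<sigma> ==> frac_map A \<sigma> \<one>\<^sub>L = \<one>\<^sub>L"
 unfolding L_one using one_nz by (simp add: frac_map_fr alg_injD(4))

lemma frac_map_zero: "alg_inj \<sigma> ==> frac_map A \<sigma> \<zero>\<^sub>L = \<zero>\<^sub>L"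
 unfolding L_zero using one_nz by (simp add: frac_map_fr alg_injD(4,5))

section \<open>The automorphism group of an algebra\<close>

abbreviation AA where "AA \<equiv> Aut_alg k A"

lemma Aut_mem: "\<sigma> <: AA \<longleftrightarrow> \<sigma> : Bij (carrier A) & \<sigma> : ring_hom A A \<and>
  (ALL c:carrier k. ALL a:carrier A. \<sigma> (c \<odot>\<^sub>A a) = c \<odot>\<^sub>A \<sigma> a)"
 by (simp add: Aut_alg_def)

lemma Aut_alg_inj: "\<sigma> <: AA ==> alg_inj \<sigma>"
 by (simp add: Aut_mem alg_inj_def Bij_def bij_betw_def)

lemma Aut_one: "\<one>\<^sub>AA = (\<lambda>x\<in>carrier A. x)"
 by (simp add: Aut_alg_def BijGroup_def)

lemma Aut_mult: "\<sigma> <: AA ==> \<tau> <: AA ==> \<sigma> \<otimes>\<^sub>AA \<tau> = compose (carrier A) \<sigma> \<tau>"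
 by (simp add: Aut_alg_def BijGroup_def)

text \<open>Realized as a subgroup of the group of bijections of the carrier. The inverse is again
  an algebra map, which is checked by applying \<sigma> to both sides.\<close>

lemma Aut_group: "group AA"
proof -
 interpret B: group "BijGroup (carrier A)" by (rule group_BijGroup)
 have one: "(\<lambda>x\<in>carrier A. x) <: AA"
  by (auto simp: Aut_mem id_Bij intro!: ring_hom_memI)
 have "subgroup (carrier AA) (BijGroup (carrier A))"
 proof (rule B.subgroupI)
  show "carrier AA <= carrier (BijGroup (carrier A))" by (auto simp: Aut_alg_def BijGroup_def)
  show "carrier AA ~= {}" using one by blast
 next
  fix \<sigma> assume s: "\<sigma> <: AA"
  then have b: "\<sigma> : Bij (carrier A)" and bb: "bij_betw \<sigma> (carrier A) (carrier A)" by (auto simp: Aut_mem Bij_def)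
  let ?\<tau> = "\<lambda>x\<in>carrier A. inv_into (carrier A) \<sigma> x"
  have e: "inv\<^bsub>BijGroup (carrier A)\<^esub> \<sigma> = ?\<tau>" by (rule inv_BijGroup[OF b])
  note D = alg_injD[OF Aut_alg_inj[OF s]]
  have ti: "?\<tau> a <: A" "\<sigma> (?\<tau> a) = a" if "a <: A" for a
   using that bij_betw_inv_into_right[OF bb that] bij_betw_imp_surj_on[OF bb] inv_into_into[of a \<sigma> "carrier A"] by auto
  have ui: "?\<tau> a = c" if "a <: A" "c <: A" "\<sigma> c = a" for a c
   using that bij_betw_inv_into_left[OF bb] by auto
  have "?\<tau> : ring_hom A A"
  proof (rule ring_hom_memI)
   fix x y assume xy: "x <: A" "y <: A"
   show "?\<tau> (x \<otimes>\<^sub>A y) = ?\<tau> x \<otimes>\<^sub>A ?\<tau> y" by (rule ui) (use xy ti[OF xy(1)] ti[OF xy(2)] D(3) in simp_all)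
   show "?\<tau> (x \<oplus>\<^sub>A y) = ?\<tau> x \<oplus>\<^sub>A ?\<tau> y" by (rule ui) (use xy ti[OF xy(1)] ti[OF xy(2)] D(2) in simp_all)
  next
   show "?\<tau> \<one>\<^sub>A = \<one>\<^sub>A" by (rule ui) (use D(4) in simp_all)
  qed (use ti in simp)
  moreover have "?\<tau> (c \<odot>\<^sub>A a) = c \<odot>\<^sub>A ?\<tau> a" if ca: "c <: k" "a <: A" for c a
   by (rule ui) (use ca ti[OF ca(2)] D(7) in simp_all)
  ultimately show "inv\<^bsub>BijGroup (carrier A)\<^esub> \<sigma> <: AA" unfolding e Aut_mem using restrict_inv_into_Bij[OF b] by blast
 next
  fix \<sigma> \<tau> assume s: "\<sigma> <: AA" and t: "\<tau> <: AA"
  have e: "\<sigma> \<otimes>\<^bsub>BijGroup (carrier A)\<^esub> \<tau> = compose (carrier A) \<sigma> \<tau>" using s t by (simp add: BijGroup_def Aut_mem)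
  note D = alg_injD[OF Aut_alg_inj[OF s]] and E = alg_injD[OF Aut_alg_inj[OF t]]
  have "compose (carrier A) \<sigma> \<tau> : ring_hom A A"
   by (rule ring_hom_memI) (simp_all add: compose_def D E)
  then show "\<sigma> \<otimes>\<^bsub>BijGroup (carrier A)\<^esub> \<tau> <: AA" unfolding e Aut_mem
   using s t compose_Bij by (auto simp: Aut_mem compose_def D E)
 qed
 then have "group ((BijGroup (carrier A))\<lparr>carrier := carrier AA\<rparr>)" by (rule B.subgroup_imp_group)
 moreover have "(BijGroup (carrier A))\<lparr>carrier := carrier AA\<rparr> = AA" by (simp add: Aut_alg_def)
 ultimately show ?thesis by simp
qed

sublocale AG: group AA by (rule Aut_group)

lemma Aut_apply: "\<sigma> <: AA ==> \<tau> <: AA ==> a <: A ==> (\<sigma> \<otimes>\<^sub>AA \<tau>) a = \<sigma> (\<tau> a)"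
 by (simp add: Aut_mult compose_def)

lemma Aut_eqI: "\<sigma> <: AA ==> \<tau> <: AA ==> (!!a. a <: A ==> \<sigma> a = \<tau> a) ==> \<sigma> = \<tau>"
 by (rule extensionalityI[of _ "carrier A"]) (auto simp: Aut_mem Bij_def)

lemma frac_map_Aut_comp:
 assumes "\<sigma> <: AA" "\<tau> <: AA" "x <: L"
 shows "frac_map A (\<sigma> \<otimes>\<^sub>AA \<tau>) x = frac_map A \<sigma> (frac_map A \<tau> x)"
proof -
 obtain a b where ab: "a <: A" "b : nz A" "x = fr a b" using L_cases[OF assms(3)] .
 note i = Aut_alg_inj[OF assms(1)] Aut_alg_inj[OF assms(2)] Aut_alg_inj[OF AG.m_closed[OF assms(1,2)]]
 have "frac_map A \<sigma> (frac_map A \<tau> x) = fr (\<sigma> (\<tau> a)) (\<sigma> (\<tau> b))"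
  unfolding ab(3) frac_map_fr[OF i(2) ab(1,2)] by (rule frac_map_fr[OF i(1) alg_injD(1,6)[OF i(2)]]) (rule ab)+
 then show ?thesis unfolding ab(3) frac_map_fr[OF i(3) ab(1,2)] using assms ab by (simp add: Aut_apply)
qed

lemma frac_map_Aut_one: "x <: L ==> frac_map A \<one>\<^sub>AA x = x"
 by (erule L_cases) (simp add: frac_map_fr[OF Aut_alg_inj[OF AG.one_closed]], simp add: Aut_one)

end

section \<open>The skew monoid algebra over the field of fractions\<close>

locale aut_alg = dom_alg k A for k :: "('k, 'z) ring_scheme" and A :: "('k, 'a) module" +
 fixes M :: "('a => 'a) set"
 assumes submon: "submonoid M (Aut_alg k A)"
begin

lemma M_Aut: "\<mu> : M ==> \<mu> <: AA"
 using submonoid.subset[OF submon] by blast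

sublocale SK: skew_setup L "AA\<lparr>carrier := M\<rparr>" "frac_map A"
proof -
 have "Group.monoid (AA\<lparr>carrier := M\<rparr>)" by (rule submonoid.submonoid_is_monoid[OF submon AG.is_monoid])
 then show "skew_setup L (AA\<lparr>carrier := M\<rparr>) (frac_map A)"
  by (intro skew_setup.intro skew_setup_axioms.intro L.ring_axioms)
   (simp_all add: M_Aut Aut_alg_inj frac_map_closed frac_map_props frac_map_one frac_map_Aut_one frac_map_Aut_comp)
qed

abbreviation SA where "SA \<equiv> skew_alg k A M"

lemma SA_simps [simp]:
 "carrier SA = finsupp L M" "\<one>\<^sub>SA = single L \<one>\<^sub>AA \<one>\<^sub>L" "\<zero>\<^sub>SA = (\<lambda>_. \<zero>\<^sub>L)"
 "f \<oplus>\<^sub>SA g = (\<lambda>\<mu>. f \<mu> \<oplus>\<^sub>L g \<mu>)" "c \<odot>\<^sub>SA f = (\<lambda>\<mu>. c \<odot>\<^sub>L f \<mu>)"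
 by (simp_all add: skew_alg_def)

lemma SA_mult: "f \<otimes>\<^sub>SA g = SK.CV.cv f g"
 by (simp add: skew_alg_def SK.mult_cv)

lemma SA_mult_single:
 "\<mu> : M ==> \<nu> : M ==> a <: L ==> b <: L ==>
  single L \<mu> a \<otimes>\<^sub>SA single L \<nu> b = single L (\<mu> \<otimes>\<^sub>AA \<nu>) (a \<otimes>\<^sub>L frac_map A \<mu> b)"
 using SK.CV.cv_single[of \<mu> \<nu> a b] by (simp add: SA_mult)

lemma SA_val: "f <: SA ==> f \<mu> <: L"
 using SK.CV.fmem1[of f \<mu>] by simp

lemma SA_ring: "ring SA"
 by (rule ring_same_ops[OF SK.ring_axioms]) (simp_all add: skew_alg_def)

sublocale SA: ring SA by (rule SA_ring)

lemma SA_induct [consumes 1, case_names zero single add]: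
 assumes "f <: SA" "Q \<zero>\<^sub>SA" "!!\<mu> l. \<mu> : M ==> l <: L ==> Q (single L \<mu> l)"
  "!!f g. f <: SA ==> g <: SA ==> Q f ==> Q g ==> Q (f \<oplus>\<^sub>SA g)"
 shows "Q f"
proof -
 have "f : finsupp L M" using assms(1) by simp
 then show ?thesis
 proof (induction rule: L.finsupp_induct)
  case zero then show ?case using assms(2) by simp
 next
  case (single p l) then show ?case using assms(3) by simp
 next
  case (add f g) then show ?case using assms(4)[of f g] by simp
 qed
qed

lemma single_SA: "\<mu> : M ==> l <: L ==> single L \<mu> l <: SA"
 using L.finsupp_single[of \<mu> M l] by simp

lemma smult_single: "c <: k ==> c \<odot>\<^sub>SA single L \<mu> l = single L \<mu> (c \<odot>\<^sub>L l)"
 by (rule ext) (simp add: single_def LA.V.smult_r_null)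

lemma SA_smult_closed:
 assumes c: "c <: k" and f: "f <: SA"
 shows "c \<odot>\<^sub>SA f <: SA"
proof -
 have f: "f : finsupp L M" using f by simp
 have "(\<lambda>\<mu>. c \<odot>\<^sub>L f \<mu>) : finsupp L M"
 proof (rule L.finsuppI[of _ "supp L f"])
  show "c \<odot>\<^sub>L f p <: L" for p using c SK.CV.fmem1[of f p] f by (intro LA.V.smult_closed) simp_all
  show "c \<odot>\<^sub>L f p = \<zero>\<^sub>L" if "p \<notin> supp L f" for p using c that by (simp add: supp_def LA.V.smult_r_null)
 qed (use finsuppD(3,4)[OF f] in auto)
 then show ?thesis by simp
qed

lemma SA_kalg: "kalg k SA"
proof -
 have "module k SA"
 proof (rule moduleI[OF K.cring_axioms SA.abelian_group_axioms])
  fix c f assume c: "c <: k" and f: "f <: SA"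
  show "c \<odot>\<^sub>SA f <: SA" by (rule SA_smult_closed[OF c f])
  note fv = SA_val[OF f]
  { fix d assume d: "d <: k"
   show "(c \<oplus>\<^sub>k d) \<odot>\<^sub>SA f = c \<odot>\<^sub>SA f \<oplus>\<^sub>SA d \<odot>\<^sub>SA f" using c d fv by (simp add: LA.V.smult_l_distr)
   show "(c \<otimes>\<^sub>k d) \<odot>\<^sub>SA f = c \<odot>\<^sub>SA (d \<odot>\<^sub>SA f)" using c d fv by (simp add: LA.V.smult_assoc1) }
  { fix g assume g: "g <: SA"
   show "c \<odot>\<^sub>SA (f \<oplus>\<^sub>SA g) = c \<odot>\<^sub>SA f \<oplus>\<^sub>SA c \<odot>\<^sub>SA g" using c fv SA_val[OF g] by (simp add: LA.V.smult_r_distr) }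
 next
  fix f assume f: "f <: SA"
  show "\<one>\<^sub>k \<odot>\<^sub>SA f = f" using SA_val[OF f] by simp
 qed
 then interpret V: vspace k SA by (rule vspaceI[OF K.field_axioms])
 have 1: "(c \<odot>\<^sub>SA f) \<otimes>\<^sub>SA g = c \<odot>\<^sub>SA (f \<otimes>\<^sub>SA g) & f \<otimes>\<^sub>SA (c \<odot>\<^sub>SA g) = c \<odot>\<^sub>SA (f \<otimes>\<^sub>SA g)"
  if c: "c <: k" and f: "f <: SA" and g: "g <: SA" for c f g
  using f
 proof (induction rule: SA_induct)
  case zero
  show ?case using c g V.V.smult_closed[OF c g] V.V.smult_r_null[OF c] SA.l_null by (simp del: SA_simps)
 next
  case (single \<mu> l)
  note ml = single
  show ?case using g
  proof (induction rule: SA_induct)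
   case zero
   show ?case using c single_SA[OF ml] V.V.smult_closed[OF c single_SA[OF ml]] V.V.smult_r_null[OF c] SA.r_null by (simp del: SA_simps)
  next
   case (single \<nu> l')
   then show ?case using ml c
    by (simp add: smult_single SA_mult_single LA.smult_mult_l LA.smult_mult_r LA.V.smult_closed frac_map_props(4)
      Aut_alg_inj M_Aut frac_map_closed del: SA_simps)
  next
   case (add u v)
   then show ?case using c single_SA[OF ml] SA_smult_closed[OF c]
    by (simp add: SA.r_distr V.V.smult_r_distr del: SA_simps)
  qed
 next
  case (add u v)
  then show ?case using c g SA_smult_closed[OF c] by (simp add: SA.l_distr V.V.smult_r_distr del: SA_simps)
 qed
 show ?thesis
  by (intro kalg.intro kalg_axioms.intro SA_ring V.vspace_axioms) (use 1 in blast)+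
qed

sublocale SAA: kalg k SA by (rule SA_kalg)

end

section \<open>Tensor products of domains\<close>

lemma (in vspace) smult_eq_zero:
 assumes "c <: k" "x <: V" "c \<odot>\<^sub>V x = \<zero>\<^sub>V" "x ~= \<zero>\<^sub>V"
 shows "c = \<zero>\<^sub>k"
proof (rule ccontr)
 assume "c ~= \<zero>\<^sub>k"
 then have i: "inv\<^bsub>k\<^esub> c <: k" "inv\<^bsub>k\<^esub> c \<otimes>\<^sub>k c = \<one>\<^sub>k" using assms(1) K.field_Units by auto
 then have "x = inv\<^bsub>k\<^esub> c \<odot>\<^sub>V (c \<odot>\<^sub>V x)" using V.smult_assoc1[of "inv\<^bsub>k\<^esub> c" c x] assms(1,2) by simp
 then show False using assms(3,4) i(1) by simp
qed

lemma (in vspace) indep_nonzero: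
 assumes I: "finite I" and x: "!!i. i : I ==> x i <: V" and ind: "indep I x" and j: "j : I"
 shows "x j ~= \<zero>\<^sub>V"
proof -
 obtain f where "functional f" "f (x j) = \<one>\<^sub>k" using indep_functional[where J=I and j=j and y=x, OF I j x ind] by blast
 then show ?thesis using functional_zero[of f] K.one_not_zero by auto
qed

section \<open>The base field inside an algebra and characters of affine domains\<close>

context kalg
begin

definition scalars where "scalars = {c \<odot>\<^sub>A \<one>\<^sub>A | c. c <: k}"

lemma smult_eq_mult: "c <: k ==> x <: A ==> c \<odot>\<^sub>A x = (c \<odot>\<^sub>A \<one>\<^sub>A) \<otimes>\<^sub>A x"
 using smult_mult_l[of c "\<one>\<^sub>A" x] by simp

lemma scalar_mult: "c <: k ==> d <: k ==> (c \<odot>\<^sub>A \<one>\<^sub>A) \<otimes>\<^sub>A (d \<odot>\<^sub>A \<one>\<^sub>A) = (c \<otimes>\<^sub>k d) \<odot>\<^sub>A \<one>\<^sub>A"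
 by (simp add: smult_mult_l V.smult_assoc1)

lemma scalars_subring: "subring scalars A"
proof (rule A.subringI)
 show "scalars <= carrier A" by (auto simp: scalars_def)
 have "\<one>\<^sub>A = \<one>\<^sub>k \<odot>\<^sub>A \<one>\<^sub>A" by simp
 then show "\<one>\<^sub>A : scalars" unfolding scalars_def using K.one_closed by blast
next
 fix h assume "h : scalars"
 then obtain c where c: "c <: k" "h = c \<odot>\<^sub>A \<one>\<^sub>A" by (auto simp: scalars_def)
 then have "\<ominus>\<^sub>A h = (\<ominus>\<^sub>k c) \<odot>\<^sub>A \<one>\<^sub>A" by (simp add: V.smult_l_minus)
 then show "\<ominus>\<^sub>A h : scalars" using c unfolding scalars_def by blast
next
 fix h h' assume "h : scalars" "h' : scalars"
 then obtain c d where c: "c <: k" "h = c \<odot>\<^sub>A \<one>\<^sub>A" and d: "d <: k" "h' = d \<odot>\<^sub>A \<one>\<^sub>A" by (auto simp: scalars_def)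
 have "h \<otimes>\<^sub>A h' = (c \<otimes>\<^sub>k d) \<odot>\<^sub>A \<one>\<^sub>A" using c d by (simp add: scalar_mult)
 then show "h \<otimes>\<^sub>A h' : scalars" using K.m_closed[OF c(1) d(1)] unfolding scalars_def by blast
 have "h \<oplus>\<^sub>A h' = (c \<oplus>\<^sub>k d) \<odot>\<^sub>A \<one>\<^sub>A" using c d by (simp add: V.smult_l_distr)
 then show "h \<oplus>\<^sub>A h' : scalars" using K.a_closed[OF c(1) d(1)] unfolding scalars_def by blast
qed

lemma k_subalgebraI:
 assumes "subring B A" "scalars <= B" shows "k_subalgebra k B A"
 unfolding k_subalgebra_def
proof (intro conjI ballI assms(1))
 fix c b assume c: "c <: k" and b: "b : B"
 have "c \<odot>\<^sub>A \<one>\<^sub>A : B" using assms(2) c by (auto simp: scalars_def)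
 then show "c \<odot>\<^sub>A b : B" using smult_eq_mult[OF c, of b] b subringE(1,6)[OF assms(1)] by auto
qed

lemma scalars_sub: "k_subalgebra k B A ==> scalars <= B"
 unfolding k_subalgebra_def scalars_def using subringE(3)[of B A] by auto

lemma scalars_noeth:
 assumes "\<one>\<^sub>A ~= \<zero>\<^sub>A"
 shows "noeth_on A scalars scalars"
 unfolding noeth_on_def
proof (intro allI impI, elim conjE)
 note S = scalars_subring
 fix N assume N: "submod A scalars N" and NS: "N <= scalars"
 note NE = A.submodE[OF N]
 show "fg_left A scalars N"
 proof (cases "N = {\<zero>\<^sub>A}")
  case True
  have "span_left A scalars {} = N" unfolding True
   using A.span_left_minimal[OF N[unfolded True], of "{}"] A.submodE(2)[OF A.span_left_submod[OF S, of "{}"]] by blast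
  then show ?thesis unfolding fg_left_def by (intro exI[of _ "{}"]) simp
 next
  case False
  then obtain n where n: "n : N" "n ~= \<zero>\<^sub>A" using NE(2) by blast
  then obtain c where c: "c <: k" "n = c \<odot>\<^sub>A \<one>\<^sub>A" using NS by (auto simp: scalars_def)
  then have "c ~= \<zero>\<^sub>k" using n(2) by auto
  then have i: "inv\<^bsub>k\<^esub> c <: k" "inv\<^bsub>k\<^esub> c \<otimes>\<^sub>k c = \<one>\<^sub>k" using c(1) K.field_Units by auto
  have "(inv\<^bsub>k\<^esub> c \<odot>\<^sub>A \<one>\<^sub>A) \<otimes>\<^sub>A n = \<one>\<^sub>A" using scalar_mult[OF i(1) c(1)] c i by simp
  moreover have "inv\<^bsub>k\<^esub> c \<odot>\<^sub>A \<one>\<^sub>A : scalars" using i by (auto simp: scalars_def)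
  ultimately have one: "\<one>\<^sub>A : N" using NE(5)[OF _ n(1)] by metis
  have "N = span_left A scalars {\<one>\<^sub>A}"
  proof
   show "span_left A scalars {\<one>\<^sub>A} <= N" by (rule A.span_left_minimal[OF N]) (use one in simp)
   show "N <= span_left A scalars {\<one>\<^sub>A}"
   proof
    fix x assume "x : N"
    then have x: "x : scalars" "x <: A" using NS NE(1) by auto
    have "x \<otimes>\<^sub>A \<one>\<^sub>A : span_left A scalars {\<one>\<^sub>A}" by (rule A.span_left_mult[OF S]) (use x in auto)
    then show "x : span_left A scalars {\<one>\<^sub>A}" using x(2) by simp
   qed
  qed
  then show ?thesis unfolding fg_left_def by (intro exI[of _ "{\<one>\<^sub>A}"]) simp
 qed
qed

end

text \<open>The iterated adjunction is a subalgebra containing the given generators, hence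
  everything.\<close>

lemma (in dom_alg) affine_adjoins:
 assumes "affine_algebra k A"
 obtains xs where "set xs <= carrier A" "adjoins A scalars xs = carrier A"
proof -
 obtain S where S: "finite S" "S <= carrier A" "!!B. k_subalgebra k B A ==> S <= B ==> B = carrier A"
  using assms unfolding affine_algebra_def by blast
 obtain xs where xs: "set xs = S" using finite_list[OF S(1)] by blast
 have s: "subring (adjoins A scalars xs) A" using D.adjoins_subring[OF scalars_subring] xs S(2) by simp
 have "scalars \<union> set xs <= adjoins A scalars xs" by (rule D.adjoins_incl[OF scalars_subring]) (use xs S(2) in simp)
 then have "adjoins A scalars xs = carrier A" using S(3) k_subalgebraI[OF s] xs by simp
 then show ?thesis using that[of xs] xs S(2) by simp
qed

text \<open>A form of the Nullstellensatz: the character of the scalars that inverts the map from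
  \<open>k\<close> does not vanish at the nonzero scalar \<open>b\<close> supplied by
  \<open>adjoins_ext\<close>, so it extends to a character of \<open>A\<close> that does not vanish
  at \<open>a\<close>.\<close>

theorem (in dom_alg) character_exists:
 assumes kc: "algebraically_closed k" and aff: "affine_algebra k A" and a: "a <: A" "a ~= \<zero>\<^sub>A"
 obtains \<chi> where "\<chi> : ring_hom A k" "!!c x. c <: k ==> x <: A ==> \<chi> (c \<odot>\<^sub>A x) = c \<otimes>\<^sub>k \<chi> x" "\<chi> a ~= \<zero>\<^sub>k"
proof -
 obtain xs where xs: "set xs <= carrier A" "adjoins A scalars xs = carrier A" using affine_adjoins[OF aff] .
 obtain b where b: "b : scalars" "b ~= \<zero>\<^sub>A" and lift: "!!\<chi>. \<chi> : ring_hom (A\<lparr>carrier := scalars\<rparr>) k ==> \<chi> b ~= \<zero>\<^sub>k ==>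
  EX \<chi>'. \<chi>' : ring_hom (A\<lparr>carrier := adjoins A scalars xs\<rparr>) k & (ALL a:scalars. \<chi>' a = \<chi> a) & \<chi>' a ~= \<zero>\<^sub>k"
  using adjoins_ext[OF D.domain_axioms kc scalars_subring xs(1), of a] a xs(2) by auto
 define \<chi>0 where "\<chi>0 x = (THE c. c <: k & x = c \<odot>\<^sub>A \<one>\<^sub>A)" for x
 have \<chi>0: "\<chi>0 (c \<odot>\<^sub>A \<one>\<^sub>A) = c" if c: "c <: k" for c
  unfolding \<chi>0_def
 proof (rule the_equality)
  fix d assume d: "d <: k & c \<odot>\<^sub>A \<one>\<^sub>A = d \<odot>\<^sub>A \<one>\<^sub>A"
  then have "(d \<ominus>\<^sub>k c) \<odot>\<^sub>A \<one>\<^sub>A = \<zero>\<^sub>A" using c by (simp add: a_minus_def V.smult_l_distr V.smult_l_minus A.r_neg)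
  then have "d \<ominus>\<^sub>k c = \<zero>\<^sub>k" using smult_eq_zero[of "d \<ominus>\<^sub>k c" "\<one>\<^sub>A"] d c D.one_not_zero by simp
  then show "d = c" using d c by simp
 qed (use c in simp)
 have "\<chi>0 : ring_hom (A\<lparr>carrier := scalars\<rparr>) k"
 proof (rule ring_hom_memI)
  show "\<chi>0 x <: k" if "x <: (A\<lparr>carrier := scalars\<rparr>)" for x using that \<chi>0 by (auto simp: scalars_def)
  fix x y assume "x <: (A\<lparr>carrier := scalars\<rparr>)" "y <: (A\<lparr>carrier := scalars\<rparr>)"
  then obtain c d where cd: "c <: k" "d <: k" "x = c \<odot>\<^sub>A \<one>\<^sub>A" "y = d \<odot>\<^sub>A \<one>\<^sub>A" by (auto simp: scalars_def)
  show "\<chi>0 (x \<otimes>\<^bsub>A\<lparr>carrier := scalars\<rparr>\<^esub> y) = \<chi>0 x \<otimes>\<^sub>k \<chi>0 y" using cd \<chi>0 by (simp add: scalar_mult)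
  show "\<chi>0 (x \<oplus>\<^bsub>A\<lparr>carrier := scalars\<rparr>\<^esub> y) = \<chi>0 x \<oplus>\<^sub>k \<chi>0 y" using cd \<chi>0 by (simp add: V.smult_l_distr[symmetric])
 next
  show "\<chi>0 \<one>\<^bsub>A\<lparr>carrier := scalars\<rparr>\<^esub> = \<one>\<^sub>k" using \<chi>0[OF K.one_closed] by simp
 qed
 moreover have "\<chi>0 b ~= \<zero>\<^sub>k" using b \<chi>0 by (auto simp: scalars_def)
 ultimately obtain \<chi> where \<chi>: "\<chi> : ring_hom (A\<lparr>carrier := adjoins A scalars xs\<rparr>) k" "ALL a:scalars. \<chi> a = \<chi>0 a" "\<chi> a ~= \<zero>\<^sub>k"
  using lift by blast
 have h: "\<chi> : ring_hom A k" using \<chi>(1) xs(2) by simp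
 have "\<chi> (c \<odot>\<^sub>A x) = c \<otimes>\<^sub>k \<chi> x" if c: "c <: k" and x: "x <: A" for c x
 proof -
  have "\<chi> (c \<odot>\<^sub>A \<one>\<^sub>A) = c" using \<chi>(2) \<chi>0[OF c] c by (auto simp: scalars_def)
  then show ?thesis using smult_eq_mult[OF c x] ring_hom_mult[OF h, of "c \<odot>\<^sub>A \<one>\<^sub>A" x] c x by simp
 qed
 then show ?thesis using that h \<chi>(3) by blast
qed

text \<open>Suppose \<open>s t = 0\<close> with both factors nonzero, and take independent
  representations. A character of \<open>A\<close> that is nonzero at the product of one first
  factor of \<open>s\<close> with one of \<open>t\<close> maps \<open>s\<close> and \<open>t\<close>
  to elements of the domain \<open>B\<close> with product zero. One of these elements is zero, and
  independence of its second factors makes the character vanish at the chosen first factor.\<close>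

theorem tensor_domain:
 fixes k :: "('k, 'z) ring_scheme" and A :: "('k, 'a) module" and B :: "('k, 'b) module"
 assumes kc: "algebraically_closed k" and A: "dom_alg k A" and B: "dom_alg k B" and aff: "affine_algebra k A"
 shows "domain (tensor k A B)"
proof -
 interpret tensor_alg k A B by (intro tensor_alg.intro dom_alg.axioms(1) A B)
 interpret DA: dom_alg k A by (rule A)
 interpret DB: dom_alg k B by (rule B)
 interpret bl: bilin_lift k A B B by unfold_locales
 have "algebra k T" by (rule T_algebra[OF DA.D.is_cring DB.D.is_cring])
 then have cr: "cring T" by (rule algebra.axioms(2))
 show ?thesis
 proof (rule domain.intro[OF cr], rule domain_axioms.intro)
  show "\<one>\<^sub>T ~= \<zero>\<^sub>T"
   using T_nontrivial[of "\<one>\<^sub>A" "\<one>\<^sub>B"] DA.D.one_not_zero DB.D.one_not_zero by (simp add: pt_one)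
  fix s t assume st: "s \<otimes>\<^sub>T t = \<zero>\<^sub>T" and s: "s <: T" and t: "t <: T"
  show "s = \<zero>\<^sub>T \<or> t = \<zero>\<^sub>T"
  proof (rule ccontr)
   assume ne: "\<not> (s = \<zero>\<^sub>T \<or> t = \<zero>\<^sub>T)"
   obtain I :: "('a \<times> 'b) set" and x y where r: "rep s I x y" "A.indep I x" "B.indep I y" using indep_rep[OF s] .
   obtain I' :: "('a \<times> 'b) set" and x' y' where r': "rep t I' x' y'" "A.indep I' x'" "B.indep I' y'" using indep_rep[OF t] .
   have I: "finite I" and x: "!!i. i : I ==> x i <: A" and y: "!!i. i : I ==> y i <: B"
    and se: "s = finsum T (\<lambda>i. pt (x i) (y i)) I" using r by (auto simp: rep_def)
   have I': "finite I'" and x': "!!i. i : I' ==> x' i <: A" and y': "!!i. i : I' ==> y' i <: B"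
    and te: "t = finsum T (\<lambda>i. pt (x' i) (y' i)) I'" using r' by (auto simp: rep_def)
   have "I ~= {}" using ne se by auto
   then obtain i where i: "i : I" by blast
   have "I' ~= {}" using ne te by auto
   then obtain j where j: "j : I'" by blast
   have xi: "x i ~= \<zero>\<^sub>A" by (rule A.indep_nonzero[where x=x and I=I, OF I x r(2) i])
   have xj: "x' j ~= \<zero>\<^sub>A" by (rule A.indep_nonzero[where x=x' and I=I', OF I' x' r'(2) j])
   have "x i \<otimes>\<^sub>A x' j ~= \<zero>\<^sub>A" using DA.D.integral_iff[OF x[OF i] x'[OF j]] xi xj by simp
   then obtain \<chi> where \<chi>: "\<chi> : ring_hom A k" "!!c x. c <: k ==> x <: A ==> \<chi> (c \<odot>\<^sub>A x) = c \<otimes>\<^sub>k \<chi> x"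
    "\<chi> (x i \<otimes>\<^sub>A x' j) ~= \<zero>\<^sub>k"
    using DA.character_exists[OF kc aff, of "x i \<otimes>\<^sub>A x' j"] x[OF i] x'[OF j] by blast
   note h = ring_hom_memE[OF \<chi>(1)]
   \<comment> \<open>The bilinear map whose lift is \<chi> tensored with the identity, an algebra
     map from the tensor product to \<open>B\<close>.\<close>
   let ?\<beta> = "\<lambda>a b. \<chi> a \<odot>\<^sub>B b"
   have \<beta>: "B.bilin A B ?\<beta>"
    by (rule B.bilinI) (simp_all add: h \<chi>(2) B.V.smult_l_distr B.V.smult_r_distr B.V.smult_assoc1[symmetric] A.K.m_comm)
   have "bl.L ?\<beta> (s \<otimes>\<^sub>T t) = bl.L ?\<beta> s \<otimes>\<^sub>B bl.L ?\<beta> t"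
   proof (rule bl.L_mult[OF \<beta> B.A.ring_axioms _ s t])
    fix a b a' b' assume c: "a <: A" "b <: B" "a' <: A" "b' <: B"
    show "\<chi> (a \<otimes>\<^sub>A a') \<odot>\<^sub>B (b \<otimes>\<^sub>B b') = \<chi> a \<odot>\<^sub>B b \<otimes>\<^sub>B (\<chi> a' \<odot>\<^sub>B b')"
     using c h by (simp add: B.smult_mult_l B.smult_mult_r B.V.smult_assoc1[symmetric] A.K.m_comm)
   qed
   then have "bl.L ?\<beta> s \<otimes>\<^sub>B bl.L ?\<beta> t = \<zero>\<^sub>B" using st bl.L_zero[OF \<beta>] by simp
   then have or: "bl.L ?\<beta> s = \<zero>\<^sub>B \<or> bl.L ?\<beta> t = \<zero>\<^sub>B"
    using DB.D.integral bl.L_closed[OF \<beta> s] bl.L_closed[OF \<beta> t] by blast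
   have cs: "\<chi> (x i) <: k" "\<chi> (x' j) <: k" using h(1) x[OF i] x'[OF j] by auto
   from or show False
   proof
    assume "bl.L ?\<beta> s = \<zero>\<^sub>B"
    then have "finsum B (\<lambda>i. \<chi> (x i) \<odot>\<^sub>B y i) I = \<zero>\<^sub>B" using bl.L_finsum[where I=I and x=x and y=y, OF \<beta> I x y] se by simp
    moreover have "ALL i:I. \<chi> (x i) <: k" using h(1) x by blast
    ultimately have "ALL i:I. \<chi> (x i) = \<zero>\<^sub>k"
     using r(3)[unfolded B.indep_def, rule_format, of "\<lambda>i. \<chi> (x i)"] by blast
    then have "\<chi> (x i) = \<zero>\<^sub>k" using i by blast
    then show False using \<chi>(3) h(2)[OF x[OF i] x'[OF j]] cs by simp
   next
    assume "bl.L ?\<beta> t = \<zero>\<^sub>B"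
    then have "finsum B (\<lambda>i. \<chi> (x' i) \<odot>\<^sub>B y' i) I' = \<zero>\<^sub>B" using bl.L_finsum[where I=I' and x=x' and y=y', OF \<beta> I' x' y'] te by simp
    moreover have "ALL i:I'. \<chi> (x' i) <: k" using h(1) x' by blast
    ultimately have "ALL i:I'. \<chi> (x' i) = \<zero>\<^sub>k"
     using r'(3)[unfolded B.indep_def, rule_format, of "\<lambda>i. \<chi> (x' i)"] by blast
    then have "\<chi> (x' j) = \<zero>\<^sub>k" using j by blast
    then show False using \<chi>(3) h(2)[OF x[OF i] x'[OF j]] cs by simp
   qed
  qed
 qed
qed

section \<open>Componentwise automorphisms and fractions on a tensor product of domains\<close>

locale dom_pair = tensor_alg k A B + DA: dom_alg k A + DB: dom_alg k B
 for k :: "('k, 'z) ring_scheme" and A :: "('k, 'a) module" and B :: "('k, 'b) module" +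
 assumes T_domain: "domain (tensor k A B)"
begin

sublocale DT: dom_alg k T by (intro dom_alg.intro T_kalg T_domain)

definition tm where "tm \<sigma> \<tau> = tensor_map k A B \<sigma> \<tau>"

lemma tm_bilin:
 assumes \<sigma>: "DA.alg_inj \<sigma>" and \<tau>: "DB.alg_inj \<tau>"
 shows "TA.bilin A B (\<lambda>a b. pt (\<sigma> a) (\<tau> b))"
 by (rule TA.bilinI) (simp_all add: DA.alg_injD[OF \<sigma>] DB.alg_injD[OF \<tau>] pt_closed pt_add1 pt_add2 pt_smult1 pt_smult2)

sublocale bT: bilin_lift k A B T ..

lemma tm_eq: "t <: T ==> tm \<sigma> \<tau> t = bT.L (\<lambda>a b. pt (\<sigma> a) (\<tau> b)) t"
 by (simp add: tm_def tensor_map_def)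

lemma tm_pt:
 assumes "DA.alg_inj \<sigma>" "DB.alg_inj \<tau>" "a <: A" "b <: B"
 shows "tm \<sigma> \<tau> (pt a b) = pt (\<sigma> a) (\<tau> b)"
 using tm_eq[OF pt_closed[OF assms(3,4)]] bT.L_pt[OF tm_bilin[OF assms(1,2)] assms(3,4)] by simp

lemma tm_hom:
 assumes \<sigma>: "DA.alg_inj \<sigma>" and \<tau>: "DB.alg_inj \<tau>"
 shows "t <: T ==> tm \<sigma> \<tau> t <: T"
  "s <: T ==> t <: T ==> tm \<sigma> \<tau> (s \<oplus>\<^sub>T t) = tm \<sigma> \<tau> s \<oplus>\<^sub>T tm \<sigma> \<tau> t"
  "s <: T ==> t <: T ==> tm \<sigma> \<tau> (s \<otimes>\<^sub>T t) = tm \<sigma> \<tau> s \<otimes>\<^sub>T tm \<sigma> \<tau> t"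
  "tm \<sigma> \<tau> \<one>\<^sub>T = \<one>\<^sub>T" "tm \<sigma> \<tau> \<zero>\<^sub>T = \<zero>\<^sub>T"
  "c <: k ==> t <: T ==> tm \<sigma> \<tau> (c \<odot>\<^sub>T t) = c \<odot>\<^sub>T tm \<sigma> \<tau> t"
proof -
 note b = tm_bilin[OF \<sigma> \<tau>]
 show "t <: T ==> tm \<sigma> \<tau> t <: T" using bT.L_closed[OF b] by (simp add: tm_eq)
 show "s <: T ==> t <: T ==> tm \<sigma> \<tau> (s \<oplus>\<^sub>T t) = tm \<sigma> \<tau> s \<oplus>\<^sub>T tm \<sigma> \<tau> t"
  using bT.L_add[OF b] by (simp add: tm_eq)
 show "s <: T ==> t <: T ==> tm \<sigma> \<tau> (s \<otimes>\<^sub>T t) = tm \<sigma> \<tau> s \<otimes>\<^sub>T tm \<sigma> \<tau> t"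
  using bT.L_mult[OF b T.ring_axioms, of s t] by (simp add: tm_eq pt_mult DA.alg_injD[OF \<sigma>] DB.alg_injD[OF \<tau>])
 show "tm \<sigma> \<tau> \<one>\<^sub>T = \<one>\<^sub>T"
  using tm_pt[OF \<sigma> \<tau>, of "\<one>\<^sub>A" "\<one>\<^sub>B"] DA.alg_injD(4)[OF \<sigma>] DB.alg_injD(4)[OF \<tau>] by (simp add: pt_one)
 show "tm \<sigma> \<tau> \<zero>\<^sub>T = \<zero>\<^sub>T" using bT.L_zero[OF b] by (simp add: tm_eq)
 show "c <: k ==> t <: T ==> tm \<sigma> \<tau> (c \<odot>\<^sub>T t) = c \<odot>\<^sub>T tm \<sigma> \<tau> t"
  using bT.L_smult[OF b] by (simp add: tm_eq)
qed

lemma tm_comp: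
 assumes s: "\<sigma> <: DA.AA" "\<sigma>' <: DA.AA" and t: "\<tau> <: DB.AA" "\<tau>' <: DB.AA" and z: "z <: T"
 shows "tm (\<sigma> \<otimes>\<^sub>DA.AA \<sigma>') (\<tau> \<otimes>\<^sub>DB.AA \<tau>') z = tm \<sigma> \<tau> (tm \<sigma>' \<tau>' z)"
proof -
 note i = DA.Aut_alg_inj[OF s(1)] DA.Aut_alg_inj[OF s(2)] DB.Aut_alg_inj[OF t(1)] DB.Aut_alg_inj[OF t(2)]
  DA.Aut_alg_inj[OF DA.AG.m_closed[OF s]] DB.Aut_alg_inj[OF DB.AG.m_closed[OF t]]
 show ?thesis using z
 proof (induction rule: T_induct)
  case zero then show ?case by (simp add: tm_hom(5) i)
 next
  case (pt a b) then show ?case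
   by (simp add: tm_pt i DA.Aut_apply[OF s] DB.Aut_apply[OF t] DA.alg_injD(1)[OF i(2)] DB.alg_injD(1)[OF i(4)])
 next
  case (add u v) then show ?case by (simp add: tm_hom(1,2) i)
 qed
qed

lemma tm_one: "z <: T ==> tm \<one>\<^sub>DA.AA \<one>\<^sub>DB.AA z = z"
proof (induction rule: T_induct)
 note i = DA.Aut_alg_inj[OF DA.AG.one_closed] DB.Aut_alg_inj[OF DB.AG.one_closed]
 case zero then show ?case by (simp add: tm_hom(5) i)
next
 note i = DA.Aut_alg_inj[OF DA.AG.one_closed] DB.Aut_alg_inj[OF DB.AG.one_closed]
 case (pt a b) then show ?case by (simp only: tm_pt[OF i]) (simp add: DA.Aut_one DB.Aut_one)
next
 note i = DA.Aut_alg_inj[OF DA.AG.one_closed] DB.Aut_alg_inj[OF DB.AG.one_closed]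
 case (add u v) then show ?case by (simp add: tm_hom(2)[OF i])
qed

text \<open>The two-sided inverse is the tensor product of the inverse automorphisms.\<close>

lemma tm_Aut:
 assumes s: "\<sigma> <: DA.AA" and t: "\<tau> <: DB.AA"
 shows "tm \<sigma> \<tau> <: DT.AA"
proof -
 note i = DA.Aut_alg_inj[OF s] DB.Aut_alg_inj[OF t]
 note h = tm_hom[OF i]
 let ?\<sigma> = "inv\<^bsub>DA.AA\<^esub> \<sigma>" and ?\<tau> = "inv\<^bsub>DB.AA\<^esub> \<tau>"
 have s': "?\<sigma> <: DA.AA" and t': "?\<tau> <: DB.AA" using s t by simp_all
 note h' = tm_hom[OF DA.Aut_alg_inj[OF s'] DB.Aut_alg_inj[OF t']]
 have "bij_betw (tm \<sigma> \<tau>) (carrier T) (carrier T)"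
 proof (rule bij_betw_byWitness[of _ "tm ?\<sigma> ?\<tau>"])
  show "ALL a:carrier T. tm ?\<sigma> ?\<tau> (tm \<sigma> \<tau> a) = a"
   using tm_comp[OF s' s t' t] s t tm_one by simp
  show "ALL a:carrier T. tm \<sigma> \<tau> (tm ?\<sigma> ?\<tau> a) = a"
   using tm_comp[OF s s' t t'] s t tm_one by simp
 qed (use h(1) h'(1) in auto)
 moreover have "tm \<sigma> \<tau> : extensional (carrier T)" by (simp add: tm_def tensor_map_def)
 moreover have "tm \<sigma> \<tau> : ring_hom T T" by (rule ring_hom_memI) (simp_all add: h)
 ultimately show ?thesis using h(6) by (simp add: DT.Aut_mem Bij_def)
qed

lemma tm_mult:
 assumes s: "\<sigma> <: DA.AA" "\<sigma>' <: DA.AA" and t: "\<tau> <: DB.AA" "\<tau>' <: DB.AA"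
 shows "tm (\<sigma> \<otimes>\<^sub>DA.AA \<sigma>') (\<tau> \<otimes>\<^sub>DB.AA \<tau>') = tm \<sigma> \<tau> \<otimes>\<^sub>DT.AA tm \<sigma>' \<tau>'"
proof -
 note a = tm_Aut[OF s(1) t(1)] tm_Aut[OF s(2) t(2)] tm_Aut[OF DA.AG.m_closed[OF s] DB.AG.m_closed[OF t]]
 show ?thesis by (rule DT.Aut_eqI[OF a(3) DT.AG.m_closed[OF a(1,2)]]) (simp add: tm_comp[OF s t] DT.Aut_apply[OF a(1,2)])
qed

lemma tm_one_eq: "tm \<one>\<^sub>DA.AA \<one>\<^sub>DB.AA = \<one>\<^sub>DT.AA"
 by (rule DT.Aut_eqI[OF tm_Aut DT.AG.one_closed]) (simp_all add: tm_one, simp add: DT.Aut_one)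

lemma tm_inv:
 assumes s: "\<sigma> <: DA.AA" and t: "\<tau> <: DB.AA"
 shows "inv\<^bsub>DT.AA\<^esub> (tm \<sigma> \<tau>) = tm (inv\<^bsub>DA.AA\<^esub> \<sigma>) (inv\<^bsub>DB.AA\<^esub> \<tau>)"
proof (rule DT.AG.inv_equality)
 show "tm (inv\<^bsub>DA.AA\<^esub> \<sigma>) (inv\<^bsub>DB.AA\<^esub> \<tau>) \<otimes>\<^sub>DT.AA tm \<sigma> \<tau> = \<one>\<^sub>DT.AA"
  using tm_mult[of "inv\<^bsub>DA.AA\<^esub> \<sigma>" \<sigma> "inv\<^bsub>DB.AA\<^esub> \<tau>" \<tau>] s t by (simp add: tm_one_eq)
qed (use s t tm_Aut in simp_all)

lemma pt_minus_eq:
 assumes "a <: A" "a' <: A" "b <: B" "b ~= \<zero>\<^sub>B" "pt a b = pt a' b"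
 shows "a = a'"
proof (rule ccontr)
 assume "a ~= a'"
 then have "a \<ominus>\<^sub>A a' ~= \<zero>\<^sub>A" using assms(1,2) by simp
 moreover have "pt (a \<ominus>\<^sub>A a') b \<oplus>\<^sub>T pt a' b = pt a b"
  using pt_add1[of "a \<ominus>\<^sub>A a'" a' b] A.A.diff_add_cancel[of a a'] assms(1-3) by simp
 then have "pt (a \<ominus>\<^sub>A a') b = \<zero>\<^sub>T" using assms pt_closed[of "a \<ominus>\<^sub>A a'" b] pt_closed[of a' b] by simp
 ultimately show False using T_nontrivial[of "a \<ominus>\<^sub>A a'" b] assms by simp
qed

lemma pt_minus_eq2:
 assumes "b <: B" "b' <: B" "a <: A" "a ~= \<zero>\<^sub>A" "pt a b = pt a b'"
 shows "b = b'"
proof (rule ccontr)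
 assume "b ~= b'"
 then have "b \<ominus>\<^sub>B b' ~= \<zero>\<^sub>B" using assms(1,2) by simp
 moreover have "pt a (b \<ominus>\<^sub>B b') \<oplus>\<^sub>T pt a b' = pt a b"
  using pt_add2[of a "b \<ominus>\<^sub>B b'" b'] B.A.diff_add_cancel[of b b'] assms(1-3) by simp
 then have "pt a (b \<ominus>\<^sub>B b') = \<zero>\<^sub>T" using assms pt_closed[of a "b \<ominus>\<^sub>B b'"] pt_closed[of a b'] by simp
 ultimately show False using T_nontrivial[of a "b \<ominus>\<^sub>B b'"] assms by simp
qed

text \<open>Evaluate at pure tensors with one factor equal to the unit and cancel that factor. Hence
  pairs of automorphisms can serve as coordinates on their products.\<close>

lemma tm_inj:
 assumes s: "\<sigma> <: DA.AA" "\<sigma>' <: DA.AA" and t: "\<tau> <: DB.AA" "\<tau>' <: DB.AA"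
  and eq: "tm \<sigma> \<tau> = tm \<sigma>' \<tau>'"
 shows "\<sigma> = \<sigma>' & \<tau> = \<tau>'"
proof -
 note i = DA.Aut_alg_inj[OF s(1)] DA.Aut_alg_inj[OF s(2)] DB.Aut_alg_inj[OF t(1)] DB.Aut_alg_inj[OF t(2)]
 have "\<sigma> a = \<sigma>' a" if a: "a <: A" for a
 proof (rule pt_minus_eq[of _ _ "\<one>\<^sub>B"])
  have "tm \<sigma> \<tau> (pt a \<one>\<^sub>B) = tm \<sigma>' \<tau>' (pt a \<one>\<^sub>B)" using eq by simp
  then show "pt (\<sigma> a) \<one>\<^sub>B = pt (\<sigma>' a) \<one>\<^sub>B" using a by (simp add: tm_pt i DB.alg_injD(4)[OF i(3)] DB.alg_injD(4)[OF i(4)])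
 qed (use a DA.alg_injD(1)[OF i(1)] DA.alg_injD(1)[OF i(2)] DB.D.one_not_zero in simp_all)
 moreover have "\<tau> b = \<tau>' b" if b: "b <: B" for b
 proof (rule pt_minus_eq2[of _ _ "\<one>\<^sub>A"])
  have "tm \<sigma> \<tau> (pt \<one>\<^sub>A b) = tm \<sigma>' \<tau>' (pt \<one>\<^sub>A b)" using eq by simp
  then show "pt \<one>\<^sub>A (\<tau> b) = pt \<one>\<^sub>A (\<tau>' b)" using b by (simp add: tm_pt i DA.alg_injD(4)[OF i(1)] DA.alg_injD(4)[OF i(2)])
 qed (use b DB.alg_injD(1)[OF i(3)] DB.alg_injD(1)[OF i(4)] DA.D.one_not_zero in simp_all)
 ultimately show ?thesis using DA.Aut_eqI[OF s] DB.Aut_eqI[OF t] by blast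
qed

definition ft where "ft = frac_tensor k A B"

lemma pt_nz: "b : nz A ==> d : nz B ==> pt b d : nz T"
 using T_nontrivial pt_closed by auto

lemma ft_fr:
 assumes ab: "a <: A" "b : nz A" and cd: "c <: B" "d : nz B"
 shows "ft (DA.fr a b) (DB.fr c d) = DT.fr (pt a c) (pt b d)"
 unfolding ft_def frac_tensor_def
proof (rule DA.UN_fr[OF ab], rule DB.UN_fr[OF cd])
 fix p q r s assume h: "p <: A" "q : nz A" "DA.fr p q = DA.fr a b"
   "r <: B" "s : nz B" "DB.fr r s = DB.fr c d"
 have e: "p \<otimes>\<^sub>A b = a \<otimes>\<^sub>A q" "r \<otimes>\<^sub>B d = c \<otimes>\<^sub>B s"
  using DA.fr_eq[OF h(1,2) ab] DB.fr_eq[OF h(4,5) cd] h by auto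
 have "pt p r \<otimes>\<^sub>T pt b d = pt a c \<otimes>\<^sub>T pt q s" using h ab cd e by (simp add: pt_mult)
 then show "DT.fr (pt p r) (pt q s) = DT.fr (pt a c) (pt b d)"
  using DT.fr_eq[OF pt_closed[OF h(1,4)] pt_nz[OF h(2,5)] pt_closed[OF ab(1) cd(1)] pt_nz[OF ab(2) cd(2)]] by simp
qed

lemma ft_closed: "x <: DA.L ==> y <: DB.L ==> ft x y <: DT.L"
proof -
 assume x: "x <: DA.L" and y: "y <: DB.L"
 obtain a b where ab: "a <: A" "b : nz A" "x = DA.fr a b" using DA.L_cases[OF x] .
 obtain c d where cd: "c <: B" "d : nz B" "y = DB.fr c d" using DB.L_cases[OF y] .
 show ?thesis unfolding ab(3) cd(3) ft_fr[OF ab(1,2) cd(1,2)] by (rule DT.fr_closed[OF pt_closed[OF ab(1) cd(1)] pt_nz[OF ab(2) cd(2)]])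
qed

lemma ft_mult:
 assumes x: "x <: DA.L" "x' <: DA.L" and y: "y <: DB.L" "y' <: DB.L"
 shows "ft (x \<otimes>\<^sub>DA.L x') (y \<otimes>\<^sub>DB.L y') = ft x y \<otimes>\<^sub>DT.L ft x' y'"
proof -
 obtain a b where ab: "a <: A" "b : nz A" "x = DA.fr a b" using DA.L_cases[OF x(1)] .
 obtain a' b' where ab': "a' <: A" "b' : nz A" "x' = DA.fr a' b'" using DA.L_cases[OF x(2)] .
 obtain c d where cd: "c <: B" "d : nz B" "y = DB.fr c d" using DB.L_cases[OF y(1)] .
 obtain c' d' where cd': "c' <: B" "d' : nz B" "y' = DB.fr c' d'" using DB.L_cases[OF y(2)] .
 show ?thesis unfolding ab(3) ab'(3) cd(3) cd'(3) DA.L_mult[OF ab(1,2) ab'(1,2)] DB.L_mult[OF cd(1,2) cd'(1,2)]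
   ft_fr[OF ab(1,2) cd(1,2)] ft_fr[OF ab'(1,2) cd'(1,2)]
   DT.L_mult[OF pt_closed[OF ab(1) cd(1)] pt_nz[OF ab(2) cd(2)] pt_closed[OF ab'(1) cd'(1)] pt_nz[OF ab'(2) cd'(2)]]
  using ab ab' cd cd' ft_fr[OF _ DA.nz_mult[OF ab(2) ab'(2)] _ DB.nz_mult[OF cd(2) cd'(2)]] by (simp add: pt_mult)
qed

end

lemma (in dom_alg) L_common:
 assumes "x <: L" "x' <: L"
 obtains a a' s where "a <: A" "a' <: A" "s : nz A" "x = fr a s" "x' = fr a' s"
proof -
 obtain a b where ab: "a <: A" "b : nz A" "x = fr a b" using L_cases[OF assms(1)] .
 obtain a' b' where ab': "a' <: A" "b' : nz A" "x' = fr a' b'" using L_cases[OF assms(2)] .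
 show ?thesis
 proof (rule that[of "a \<otimes>\<^sub>A b'" "a' \<otimes>\<^sub>A b" "b \<otimes>\<^sub>A b'"])
  show "b \<otimes>\<^sub>A b' : nz A" by (rule nz_mult[OF ab(2) ab'(2)])
  then show "x = fr (a \<otimes>\<^sub>A b') (b \<otimes>\<^sub>A b')" "x' = fr (a' \<otimes>\<^sub>A b) (b \<otimes>\<^sub>A b')"
   unfolding ab(3) ab'(3) using ab(1,2) ab'(1,2) by (simp_all add: fr_eq D.m_ac)
 qed (use ab ab' in simp_all)
qed

lemma (in dom_alg) fr_add_num:
 assumes "a <: A" "c <: A" "s : nz A"
 shows "fr (a \<oplus>\<^sub>A c) s = fr a s \<oplus>\<^sub>L fr c s"
proof -
 have "s <: A" using assms by simp
 then have "(a \<oplus>\<^sub>A c) \<otimes>\<^sub>A (s \<otimes>\<^sub>A s) = (a \<otimes>\<^sub>A s \<oplus>\<^sub>A c \<otimes>\<^sub>A s) \<otimes>\<^sub>A s"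
  using assms(1,2) by (simp add: A.l_distr A.m_assoc)
 then show ?thesis unfolding L_add[OF assms(1,3,2,3)] using assms nz_mult[OF assms(3,3)] by (simp add: fr_eq)
qed

lemma (in dom_alg) common_denominator:
 assumes "finite I" "!!i. i : I ==> x i <: L"
 obtains s a where "s : nz A" "!!i. i : I ==> a i <: A" "!!i. i : I ==> x i = fr (a i) s"
proof -
 have "EX s a. s : nz A & (ALL i:I. a i <: A & x i = fr (a i) s)" using assms
 proof (induction I rule: finite_induct)
  case empty then show ?case using one_nz by blast
 next
  case (insert j I)
  have "EX s a. s : nz A & (ALL i:I. a i <: A & x i = fr (a i) s)"
   by (rule insert.IH) (use insert.prems in simp)
  then obtain s a where sa: "s : nz A" "ALL i:I. a i <: A & x i = fr (a i) s" by blast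
  note s = sa(1) bspec[OF sa(2), THEN conjunct1] bspec[OF sa(2), THEN conjunct2]
  obtain c d where cd: "c <: A" "d : nz A" "x j = fr c d" using L_cases[of "x j"] insert.prems by auto
  let ?a = "\<lambda>i. if i = j then c \<otimes>\<^sub>A s else a i \<otimes>\<^sub>A d"
  have nz: "s \<otimes>\<^sub>A d : nz A" by (rule nz_mult[OF s(1) cd(2)])
  have key: "?a i <: A & x i = fr (?a i) (s \<otimes>\<^sub>A d)" if i: "i : insert j I" for i
  proof (cases "i = j")
   case True
   then show ?thesis using cd s(1) nz by (simp add: fr_eq D.m_ac)
  next
   case False
   then have "i : I" using i by simp
   then show ?thesis using False s(2,3)[of i] s(1) cd nz by (simp add: fr_eq D.m_ac)
  qed
  show ?case by (rule exI[of _ "s \<otimes>\<^sub>A d"], rule exI[of _ ?a]) (rule conjI[OF nz], rule ballI, rule key)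
 qed
 then obtain s a where "s : nz A" "ALL i:I. a i <: A & x i = fr (a i) s" by blast
 then show ?thesis using that[of s a] by blast
qed

section \<open>Tensor products of skew monoid rings\<close>

context dom_pair
begin

lemma ft_add1:
 assumes x: "x <: DA.L" "x' <: DA.L" and y: "y <: DB.L"
 shows "ft (x \<oplus>\<^sub>DA.L x') y = ft x y \<oplus>\<^sub>DT.L ft x' y"
proof -
 obtain a a' s where a: "a <: A" "a' <: A" "s : nz A" "x = DA.fr a s" "x' = DA.fr a' s"
  using DA.L_common[OF x] .
 obtain c d where cd: "c <: B" "d : nz B" "y = DB.fr c d" using DB.L_cases[OF y] .
 show ?thesis unfolding a(4,5) cd(3) DA.fr_add_num[OF a(1-3), symmetric] ft_fr[OF a(1,3) cd(1,2)] ft_fr[OF a(2,3) cd(1,2)]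
   ft_fr[OF A.A.a_closed[OF a(1,2)] a(3) cd(1,2)] pt_add1[OF a(1,2) cd(1)]
  by (rule DT.fr_add_num) (use a cd pt_nz pt_closed in auto)
qed

lemma ft_add2:
 assumes x: "x <: DA.L" and y: "y <: DB.L" "y' <: DB.L"
 shows "ft x (y \<oplus>\<^sub>DB.L y') = ft x y \<oplus>\<^sub>DT.L ft x y'"
proof -
 obtain a a' s where a: "a <: B" "a' <: B" "s : nz B" "y = DB.fr a s" "y' = DB.fr a' s"
  using DB.L_common[OF y] .
 obtain c d where cd: "c <: A" "d : nz A" "x = DA.fr c d" using DA.L_cases[OF x] .
 show ?thesis unfolding a(4,5) cd(3) DB.fr_add_num[OF a(1-3), symmetric] ft_fr[OF cd(1,2) a(1,3)] ft_fr[OF cd(1,2) a(2,3)]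
   ft_fr[OF cd(1,2) B.A.a_closed[OF a(1,2)] a(3)] pt_add2[OF cd(1) a(1,2)]
  by (rule DT.fr_add_num) (use a cd pt_nz pt_closed in auto)
qed

lemma ft_smult:
 assumes c: "c <: k" and x: "x <: DA.L" and y: "y <: DB.L"
 shows "ft (c \<odot>\<^sub>DA.L x) y = c \<odot>\<^sub>DT.L ft x y" "ft x (c \<odot>\<^sub>DB.L y) = c \<odot>\<^sub>DT.L ft x y"
proof -
 obtain a b where ab: "a <: A" "b : nz A" "x = DA.fr a b" using DA.L_cases[OF x] .
 obtain u v where uv: "u <: B" "v : nz B" "y = DB.fr u v" using DB.L_cases[OF y] .
 note p = pt_closed[OF ab(1) uv(1)] pt_nz[OF ab(2) uv(2)]
 show "ft (c \<odot>\<^sub>DA.L x) y = c \<odot>\<^sub>DT.L ft x y" unfolding ab(3) uv(3) DA.L_smult[OF c ab(1,2)]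
   ft_fr[OF ab(1,2) uv(1,2)] DT.L_smult[OF c p] ft_fr[OF A.V.smult_closed[OF c ab(1)] ab(2) uv(1,2)] pt_smult1[OF ab(1) uv(1) c] ..
 show "ft x (c \<odot>\<^sub>DB.L y) = c \<odot>\<^sub>DT.L ft x y" unfolding ab(3) uv(3) DB.L_smult[OF c uv(1,2)]
   ft_fr[OF ab(1,2) uv(1,2)] DT.L_smult[OF c p] ft_fr[OF ab(1,2) B.V.smult_closed[OF c uv(1)] uv(2)] pt_smult2[OF ab(1) uv(1) c] ..
qed

lemma ft_zero: "x <: DA.L ==> ft x \<zero>\<^sub>DB.L = \<zero>\<^sub>DT.L" "y <: DB.L ==> ft \<zero>\<^sub>DA.L y = \<zero>\<^sub>DT.L"
 using ft_add2[of x "\<zero>\<^sub>DB.L" "\<zero>\<^sub>DB.L"] ft_closed[of x "\<zero>\<^sub>DB.L"]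
  ft_add1[of "\<zero>\<^sub>DA.L" "\<zero>\<^sub>DA.L" y] ft_closed[of "\<zero>\<^sub>DA.L" y] by simp_all

lemma frac_map_ft:
 assumes s: "\<sigma> <: DA.AA" and t: "\<tau> <: DB.AA" and x: "x <: DA.L" and y: "y <: DB.L"
 shows "frac_map T (tm \<sigma> \<tau>) (ft x y) = ft (frac_map A \<sigma> x) (frac_map B \<tau> y)"
proof -
 obtain a b where ab: "a <: A" "b : nz A" "x = DA.fr a b" using DA.L_cases[OF x] .
 obtain u v where uv: "u <: B" "v : nz B" "y = DB.fr u v" using DB.L_cases[OF y] .
 note p = pt_closed[OF ab(1) uv(1)] pt_nz[OF ab(2) uv(2)]
 note isg = DA.Aut_alg_inj[OF s] and itau = DB.Aut_alg_inj[OF t]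
 show ?thesis unfolding ab(3) uv(3) ft_fr[OF ab(1,2) uv(1,2)] DT.frac_map_fr[OF DT.Aut_alg_inj[OF tm_Aut[OF s t]] p]
   DA.frac_map_fr[OF isg ab(1,2)] DB.frac_map_fr[OF itau uv(1,2)]
   ft_fr[OF DA.alg_injD(1)[OF isg ab(1)] DA.alg_injD(6)[OF isg ab(2)] DB.alg_injD(1)[OF itau uv(1)] DB.alg_injD(6)[OF itau uv(2)]]
  using ab uv by (simp add: tm_pt[OF isg itau])
qed

lemma ft_to_frac: "a <: A ==> b <: B ==> ft (to_frac A a) (to_frac B b) = to_frac T (pt a b)"
 unfolding to_frac_def using DA.one_nz DB.one_nz by (simp add: ft_fr pt_one)

lemma ft_one: "ft \<one>\<^sub>DA.L \<one>\<^sub>DB.L = \<one>\<^sub>DT.L"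
 using ft_to_frac[of "\<one>\<^sub>A" "\<one>\<^sub>B"] by (simp add: DA.to_frac_one DB.to_frac_one DT.to_frac_one pt_one)

lemma finsum_fr:
 assumes "dom_alg k D" "finite I" "!!i. i : I ==> a i <: D" "s : nz D"
 shows "finsum (Frac D) (\<lambda>i. frac D (a i) s) I = frac D (finsum D a I) s"
proof -
 interpret DD: dom_alg k D by fact
 show ?thesis
  by (rule finsum_hom[OF DD.A.abelian_group_axioms DD.L.abelian_group_axioms, of "\<lambda>z. DD.fr z s", symmetric])
   (use assms DD.fr_closed DD.fr_add_num in auto)
qed

text \<open>Common denominators \<open>s\<close> and \<open>t\<close> move the relation into
  \<open>T\<close>. There it is contracted with the functional on \<open>A\<close> that sends
  \<open>z\<close> to \<open>g\<close> of the fraction \<open>z / s\<close>, and the resulting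
  relation in \<open>B\<close> is divided by \<open>t\<close>.\<close>

lemma ft_contract:
 assumes I: "finite I" and x: "!!i. i : I ==> x i <: DA.L" and y: "!!i. i : I ==> y i <: DB.L"
  and z: "finsum DT.L (\<lambda>i. ft (x i) (y i)) I = \<zero>\<^sub>DT.L" and g: "DA.LA.functional g"
 shows "finsum DB.L (\<lambda>i. g (x i) \<odot>\<^sub>DB.L y i) I = \<zero>\<^sub>DB.L"
proof -
 obtain s a where s: "s : nz A" and a: "!!i. i : I ==> a i <: A" and xe: "!!i. i : I ==> x i = DA.fr (a i) s"
  using DA.common_denominator[where I=I and x=x, OF I x] by blast
 obtain t b where t: "t : nz B" and b: "!!i. i : I ==> b i <: B" and ye: "!!i. i : I ==> y i = DB.fr (b i) t"
  using DB.common_denominator[where I=I and x=y, OF I y] by blast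
 have "\<zero>\<^sub>DT.L = finsum DT.L (\<lambda>i. DT.fr (pt (a i) (b i)) (pt s t)) I" unfolding z[symmetric]
  by (rule DT.L.finsum_cong') (use xe ye a b s t ft_fr DT.fr_closed pt_closed pt_nz in auto)
 also have "\<dots> = DT.fr (finsum T (\<lambda>i. pt (a i) (b i)) I) (pt s t)"
  by (rule finsum_fr[OF DT.dom_alg_axioms I]) (use a b s t pt_closed pt_nz in auto)
 finally have "DT.fr (finsum T (\<lambda>i. pt (a i) (b i)) I) (pt s t) = \<zero>\<^sub>DT.L" by simp
 moreover have "finsum T (\<lambda>i. pt (a i) (b i)) I <: T" by (rule T.finsum_closed) (use a b pt_closed in auto)
 ultimately have "finsum T (\<lambda>i. pt (a i) (b i)) I = \<zero>\<^sub>T" using DT.fr_zero_iff pt_nz[OF s t] by blast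
 moreover have "A.functional (\<lambda>z. g (DA.fr z s))"
  using g s DA.fr_closed DA.fr_add_num DA.L_smult[symmetric] unfolding A.functional_def DA.LA.functional_def by simp
 ultimately have zz: "finsum B (\<lambda>i. g (DA.fr (a i) s) \<odot>\<^sub>B b i) I = \<zero>\<^sub>B"
  using functional_contract[where I=I and x=a and y=b and g="\<lambda>z. g (DA.fr z s)", OF I a b] by blast
 have gk: "g (DA.fr (a i) s) <: k" if "i : I" for i
  using g DA.fr_closed[OF a[OF that] s] unfolding DA.LA.functional_def by blast
 have "finsum DB.L (\<lambda>i. g (x i) \<odot>\<^sub>DB.L y i) I = finsum DB.L (\<lambda>i. DB.fr (g (DA.fr (a i) s) \<odot>\<^sub>B b i) t) I"
  by (rule DB.L.finsum_cong') (use xe ye gk b t in \<open>auto simp: DB.L_smult intro!: DB.fr_closed\<close>)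
 also have "\<dots> = DB.fr (finsum B (\<lambda>i. g (DA.fr (a i) s) \<odot>\<^sub>B b i) I) t"
  by (rule finsum_fr[OF DB.dom_alg_axioms I]) (use gk b t in auto)
 also have "\<dots> = \<zero>\<^sub>DB.L" unfolding zz using DB.fr_zero_iff[OF B.A.zero_closed t] by simp
 finally show ?thesis .
qed

end

section \<open>The action of normalizing automorphisms on the skew algebra\<close>

context aut_alg
begin

text \<open>Both directions of conjugation occur: one bounds the support of the transformed element,
  the other keeps the indices at which the action evaluates inside \<open>M\<close>.\<close>

definition normalizes :: "('a => 'a) => bool" where
 "normalizes w \<longleftrightarrow> w <: AA & (ALL \<mu>:M. inv\<^bsub>AA\<^esub> w \<otimes>\<^sub>AA \<mu> \<otimes>\<^sub>AA w : M) & (ALL \<mu>:M. w \<otimes>\<^sub>AA \<mu> \<otimes>\<^sub>AA inv\<^bsub>AA\<^esub> w : M)"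

abbreviation sact where "sact \<equiv> skew_action k A M"

lemma sact_closed:
 assumes w: "normalizes w" and f: "f <: SA"
 shows "sact w f <: SA"
proof -
 have wA: "w <: AA" using w by (simp add: normalizes_def)
 have f': "f : finsupp L M" using f by simp
 have "sact w f : finsupp L M"
 proof (rule L.finsuppI[of _ "(\<lambda>\<mu>. w \<otimes>\<^sub>AA \<mu> \<otimes>\<^sub>AA inv\<^bsub>AA\<^esub> w) ` supp L f"])
  show "sact w f p <: L" for p
   unfolding skew_action_def using frac_map_closed[OF Aut_alg_inj[OF wA]] SA_val[OF f] by simp
  show "sact w f p = \<zero>\<^sub>L" if p: "p \<notin> (\<lambda>\<mu>. w \<otimes>\<^sub>AA \<mu> \<otimes>\<^sub>AA inv\<^bsub>AA\<^esub> w) ` supp L f" for p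
  proof (cases "p : M")
   case True
   have pA: "p <: AA" by (rule M_Aut[OF True])
   let ?q = "inv\<^bsub>AA\<^esub> w \<otimes>\<^sub>AA p \<otimes>\<^sub>AA w"
   have e: "w \<otimes>\<^sub>AA ?q \<otimes>\<^sub>AA inv\<^bsub>AA\<^esub> w = p" using pA wA
    by (metis AG.inv_closed AG.inv_solve_left' AG.inv_solve_right' AG.m_assoc AG.m_closed)
   have "?q \<notin> supp L f"
   proof
    assume "?q : supp L f"
    then have "w \<otimes>\<^sub>AA ?q \<otimes>\<^sub>AA inv\<^bsub>AA\<^esub> w : (\<lambda>\<mu>. w \<otimes>\<^sub>AA \<mu> \<otimes>\<^sub>AA inv\<^bsub>AA\<^esub> w) ` supp L f" by (rule imageI)
    then show False using p unfolding e by simp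
   qed
   then have "f ?q = \<zero>\<^sub>L" by (simp add: supp_def)
   then show ?thesis using frac_map_zero[OF Aut_alg_inj[OF wA]] True by (simp add: skew_action_def)
  qed (simp add: skew_action_def)
  show "finite ((\<lambda>\<mu>. w \<otimes>\<^sub>AA \<mu> \<otimes>\<^sub>AA inv\<^bsub>AA\<^esub> w) ` supp L f)" using finsuppD(4)[OF f'] by simp
  show "(\<lambda>\<mu>. w \<otimes>\<^sub>AA \<mu> \<otimes>\<^sub>AA inv\<^bsub>AA\<^esub> w) ` supp L f <= M" using w finsuppD(3)[OF f'] by (auto simp: normalizes_def)
 qed
 then show ?thesis by simp
qed

lemma sact_add:
 assumes w: "normalizes w" and f: "f <: SA" and g: "g <: SA"
 shows "sact w (f \<oplus>\<^sub>SA g) = sact w f \<oplus>\<^sub>SA sact w g"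
proof -
 have wA: "w <: AA" using w by (simp add: normalizes_def)
 show ?thesis
  by (rule ext) (simp add: skew_action_def frac_map_props(1)[OF Aut_alg_inj[OF wA]] SA_val[OF f] SA_val[OF g])
qed

lemma SA_eval_finsum:
 assumes "finite I" and x: "!!i. i : I ==> x i <: SA"
 shows "finsum SA x I \<mu> = finsum L (\<lambda>i. x i \<mu>) I"
 by (rule finsum_hom[OF SA.abelian_group_axioms L.abelian_group_axioms, of "\<lambda>f. f \<mu>"]) (use assms SA_val in auto)

lemma SA_off: "f <: SA ==> \<mu> \<notin> M ==> f \<mu> = \<zero>\<^sub>L"
 using finsuppD(2)[of f L M \<mu>] by simp

lemma SA_eqI:
 assumes f: "f <: SA" and g: "g <: SA" and eq: "!!\<mu>. \<mu> : M ==> f \<mu> = g \<mu>"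
 shows "f = g"
proof
 fix \<mu> show "f \<mu> = g \<mu>" using eq SA_off[OF f] SA_off[OF g] by (cases "\<mu> : M") auto
qed

end

section \<open>The map from a pair of skew algebras into the skew algebra of the tensor
  product\<close>

locale skew_pair = dom_pair k A B + MA: aut_alg k A M1 + MB: aut_alg k B M2
 for k :: "('k, 'z) ring_scheme" and A :: "('k, 'a) module" and B :: "('k, 'b) module" and M1 M2
begin

abbreviation M where "M \<equiv> tensor_maps k A B M1 M2"

lemma M_eq: "M = {tm \<mu> \<nu> | \<mu> \<nu>. \<mu> : M1 & \<nu> : M2}"
 by (simp add: tensor_maps_def tm_def)

lemma tm_M: "\<mu> : M1 ==> \<nu> : M2 ==> tm \<mu> \<nu> : M" unfolding M_eq by blast

lemma M_submonoid: "submonoid M DT.AA"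
proof (rule submonoid.intro)
 note 1 = submonoid.m_closed[OF MA.submon] submonoid.one_closed[OF MA.submon]
 note 2 = submonoid.m_closed[OF MB.submon] submonoid.one_closed[OF MB.submon]
 show "M <= carrier DT.AA" unfolding M_eq using tm_Aut MA.M_Aut MB.M_Aut by blast
 show "\<one>\<^sub>DT.AA : M" using tm_M[OF 1(2) 2(2)] tm_one_eq by simp
 fix x y assume "x : M" "y : M"
 then obtain \<mu> \<nu> \<mu>' \<nu>' where h: "x = tm \<mu> \<nu>" "y = tm \<mu>' \<nu>'" "\<mu> : M1" "\<mu>' : M1" "\<nu> : M2" "\<nu>' : M2" unfolding M_eq by blast
 have "x \<otimes>\<^sub>DT.AA y = tm (\<mu> \<otimes>\<^sub>DA.AA \<mu>') (\<nu> \<otimes>\<^sub>DB.AA \<nu>')" using h by (simp add: tm_mult MA.M_Aut MB.M_Aut)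
 then show "x \<otimes>\<^sub>DT.AA y : M" using tm_M[OF 1(1)[OF h(3,4)] 2(1)[OF h(5,6)]] by simp
qed

sublocale MT: aut_alg k T M
 by (intro aut_alg.intro DT.dom_alg_axioms aut_alg_axioms.intro M_submonoid)

sublocale CV: biadditive_conv DA.L DB.L DT.L M1 M2 M tm "\<lambda>_ _. ft"
 by (intro biadditive_conv.intro biadditive_conv_axioms.intro DA.L.abelian_group_axioms DB.L.abelian_group_axioms DT.L.abelian_group_axioms)
  (simp_all add: tm_M ft_closed ft_add1 ft_add2)

abbreviation st where "st \<equiv> skew_tensor k A B"

lemma st_cv: "st f g = CV.cv f g"
 by (simp add: skew_tensor_def conv_def ft_def tm_def)

lemma st_closed: "f <: MA.SA ==> g <: MB.SA ==> st f g <: MT.SA"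
 using CV.cv_closed[of f g] by (simp add: st_cv)

text \<open>By injectivity of \<open>tm\<close> only one pair of indices contributes to the
  sum.\<close>

lemma st_val:
 assumes f: "f <: MA.SA" and g: "g <: MB.SA" and m: "\<mu> : M1" and n: "\<nu> : M2"
 shows "st f g (tm \<mu> \<nu>) = ft (f \<mu>) (g \<nu>)"
proof -
 have f': "f : finsupp DA.L M1" and g': "g : finsupp DB.L M2" using f g by simp_all
 let ?S = "insert \<mu> (supp DA.L f)" and ?T = "insert \<nu> (supp DB.L g)"
 have sub: "?S <= M1" "?T <= M2" using finsuppD(3)[OF f'] finsuppD(3)[OF g'] m n by auto
 have "CV.cv f g (tm \<mu> \<nu>) = finsum DT.L (\<lambda>(\<mu>, \<nu>). ft (f \<mu>) (g \<nu>)) {(\<mu>', \<nu>'). \<mu>' : ?S & \<nu>' : ?T & tm \<mu>' \<nu>' = tm \<mu> \<nu>}"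
  by (rule CV.cv_eq[OF f' g']) (use finsuppD(4)[OF f'] finsuppD(4)[OF g'] sub in auto)
 also have "{(\<mu>', \<nu>'). \<mu>' : ?S & \<nu>' : ?T & tm \<mu>' \<nu>' = tm \<mu> \<nu>} = {(\<mu>, \<nu>)}"
 proof -
  have "\<mu>' = \<mu> & \<nu>' = \<nu>" if "\<mu>' : ?S" "\<nu>' : ?T" "tm \<mu>' \<nu>' = tm \<mu> \<nu>" for \<mu>' \<nu>'
   using tm_inj[OF MA.M_Aut MA.M_Aut MB.M_Aut MB.M_Aut that(3)] that(1,2) sub m n by blast
  then show ?thesis by auto
 qed
 finally show ?thesis using ft_closed[OF MA.SA_val[OF f] MB.SA_val[OF g]] by (simp add: st_cv)
qed

lemma st_eqI:
 assumes u: "u <: MT.SA" and v: "v <: MT.SA" and eq: "!!\<mu> \<nu>. \<mu> : M1 ==> \<nu> : M2 ==> u (tm \<mu> \<nu>) = v (tm \<mu> \<nu>)"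
 shows "u = v"
proof (rule MT.SA_eqI[OF u v])
 fix \<rho> assume "\<rho> : M"
 then obtain \<mu> \<nu> where "\<rho> = tm \<mu> \<nu>" "\<mu> : M1" "\<nu> : M2" unfolding M_eq by blast
 then show "u \<rho> = v \<rho>" using eq by simp
qed

lemma st_add1: "f <: MA.SA ==> f' <: MA.SA ==> g <: MB.SA ==>
  st (f \<oplus>\<^sub>MA.SA f') g = st f g \<oplus>\<^sub>MT.SA st f' g"
 using CV.cv_add1[of f f' g] by (simp add: st_cv)

lemma st_add2: "f <: MA.SA ==> g <: MB.SA ==> g' <: MB.SA ==>
  st f (g \<oplus>\<^sub>MB.SA g') = st f g \<oplus>\<^sub>MT.SA st f g'"
 using CV.cv_add2[of f g g'] by (simp add: st_cv)

lemma st_smult1: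
 assumes c: "c <: k" and f: "f <: MA.SA" and g: "g <: MB.SA"
 shows "st (c \<odot>\<^sub>MA.SA f) g = c \<odot>\<^sub>MT.SA st f g"
 by (rule st_eqI[OF st_closed[OF MA.SA_smult_closed[OF c f] g] MT.SA_smult_closed[OF c st_closed[OF f g]]])
  (simp add: st_val[OF MA.SA_smult_closed[OF c f] g, unfolded MA.SA_simps] st_val[OF f g] ft_smult[OF c MA.SA_val[OF f] MB.SA_val[OF g]])

lemma st_smult2:
 assumes c: "c <: k" and f: "f <: MA.SA" and g: "g <: MB.SA"
 shows "st f (c \<odot>\<^sub>MB.SA g) = c \<odot>\<^sub>MT.SA st f g"
 by (rule st_eqI[OF st_closed[OF f MB.SA_smult_closed[OF c g]] MT.SA_smult_closed[OF c st_closed[OF f g]]])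
  (simp add: st_val[OF f MB.SA_smult_closed[OF c g], unfolded MB.SA_simps] st_val[OF f g] ft_smult[OF c MA.SA_val[OF f] MB.SA_val[OF g]])

lemma st_bilin: "MT.SAA.bilin MA.SA MB.SA st"
 by (rule MT.SAA.bilinI) (simp_all only: st_closed st_add1 st_add2 st_smult1 st_smult2)

lemma st_zero: "f <: MA.SA ==> st f \<zero>\<^sub>MB.SA = \<zero>\<^sub>MT.SA" "g <: MB.SA ==> st \<zero>\<^sub>MA.SA g = \<zero>\<^sub>MT.SA"
 using CV.cv_zero1[of g] CV.cv_zero2[of f] by (simp_all add: st_cv)

lemma st_single:
 "\<mu> : M1 ==> \<nu> : M2 ==> a <: DA.L ==> b <: DB.L ==>
  st (single DA.L \<mu> a) (single DB.L \<nu> b) = single DT.L (tm \<mu> \<nu>) (ft a b)"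
 unfolding st_cv by (rule CV.cv_single)

lemma st_one: "st \<one>\<^sub>MA.SA \<one>\<^sub>MB.SA = \<one>\<^sub>MT.SA"
 using st_single[OF submonoid.one_closed[OF MA.submon] submonoid.one_closed[OF MB.submon] DA.L.one_closed DB.L.one_closed]
 by (simp add: ft_one tm_one_eq)

text \<open>Both sides are additive in each of the four arguments. On singles the identity is the
  compatibility of \<open>ft\<close> with products and with the automorphisms.\<close>

lemma st_mult:
 assumes f: "f <: MA.SA" and f': "f' <: MA.SA" and g: "g <: MB.SA" and g': "g' <: MB.SA"
 shows "st (f \<otimes>\<^sub>MA.SA f') (g \<otimes>\<^sub>MB.SA g') = st f g \<otimes>\<^sub>MT.SA st f' g'"
proof -
 let ?Q = "\<lambda>f f' g g'. st (f \<otimes>\<^sub>MA.SA f') (g \<otimes>\<^sub>MB.SA g') = st f g \<otimes>\<^sub>MT.SA st f' g'"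
 note dist = MA.SA.l_distr MA.SA.r_distr MB.SA.l_distr MB.SA.r_distr MT.SA.l_distr MT.SA.r_distr
  st_add1 st_add2 st_closed MA.SA.m_closed MB.SA.m_closed MA.SA.l_null MA.SA.r_null MB.SA.l_null MB.SA.r_null
  MT.SA.l_null MT.SA.r_null st_zero MA.single_SA MB.single_SA
 have 1: "?Q (single DA.L \<mu> a) (single DA.L \<mu>' a') (single DB.L \<nu> b) (single DB.L \<nu>' b')"
  if h: "\<mu> : M1" "\<mu>' : M1" "\<nu> : M2" "\<nu>' : M2" "a <: DA.L" "a' <: DA.L" "b <: DB.L" "b' <: DB.L"
  for \<mu> \<mu>' \<nu> \<nu>' a a' b b'
 proof -
  note A = MA.M_Aut[OF h(1)] MA.M_Aut[OF h(2)] MB.M_Aut[OF h(3)] MB.M_Aut[OF h(4)]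
  note fm = DA.frac_map_closed[OF DA.Aut_alg_inj[OF A(1)] h(6)] DB.frac_map_closed[OF DB.Aut_alg_inj[OF A(3)] h(8)]
  note mm = submonoid.m_closed[OF MA.submon h(1,2)] submonoid.m_closed[OF MB.submon h(3,4)]
  show ?thesis
   unfolding MA.SA_mult_single[OF h(1,2,5,6)] MB.SA_mult_single[OF h(3,4,7,8)]
    st_single[OF h(1,3,5,7)] st_single[OF h(2,4,6,8)]
    MT.SA_mult_single[OF tm_M[OF h(1,3)] tm_M[OF h(2,4)] ft_closed[OF h(5,7)] ft_closed[OF h(6,8)]]
    st_single[OF mm DA.L.m_closed[OF h(5) fm(1)] DB.L.m_closed[OF h(7) fm(2)]]
   using tm_mult[OF A] ft_mult[OF h(5) fm(1) h(7) fm(2)] frac_map_ft[OF A(1,3) h(6,8)] by simp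
 qed
 have 2: "?Q (single DA.L \<mu> a) (single DA.L \<mu>' a') (single DB.L \<nu> b) g'"
  if h: "\<mu> : M1" "\<mu>' : M1" "\<nu> : M2" "a <: DA.L" "a' <: DA.L" "b <: DB.L" for \<mu> \<mu>' \<nu> a a' b
  using g'
 proof (induction rule: MB.SA_induct)
  case (single \<nu>' b') show ?case by (rule 1[OF h(1-3) single(1) h(4-6) single(2)])
 qed (use h in \<open>simp_all only: dist\<close>)
 have 3: "?Q (single DA.L \<mu> a) (single DA.L \<mu>' a') g g'"
  if h: "\<mu> : M1" "\<mu>' : M1" "a <: DA.L" "a' <: DA.L" for \<mu> \<mu>' a a'
  using g
 proof (induction rule: MB.SA_induct)
  case (single \<nu> b) show ?case by (rule 2[OF h(1,2) single(1) h(3,4) single(2)])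
 qed (use h g' in \<open>simp_all only: dist\<close>)
 have 4: "?Q (single DA.L \<mu> a) f' g g'" if h: "\<mu> : M1" "a <: DA.L" for \<mu> a
  using f'
 proof (induction rule: MA.SA_induct)
  case (single \<mu>' a') show ?case by (rule 3[OF h(1) single(1) h(2) single(2)])
 qed (use h g g' in \<open>simp_all only: dist\<close>)
 show ?thesis using f
 proof (induction rule: MA.SA_induct)
  case (single \<mu> a) show ?case by (rule 4[OF single])
 qed (use f' g g' in \<open>simp_all only: dist\<close>)
qed

text \<open>Comparing coefficients gives one relation in the field of fractions for each pair of
  indices. For fixed \<mu>, contraction with a functional \<open>g\<close> yields a relation between
  the \<open>y i\<close> with coefficients \<open>g (x i \<mu>)\<close>. Independence makes these
  vanish for every \<open>g\<close>, and functionals separate elements.\<close>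

lemma st_left_faithful:
 assumes I: "finite I" and x: "!!i. i : I ==> x i <: MA.SA" and y: "!!i. i : I ==> y i <: MB.SA"
  and ind: "MB.SAA.indep I y" and z: "finsum MT.SA (\<lambda>i. st (x i) (y i)) I = \<zero>\<^sub>MT.SA" and j: "j : I"
 shows "x j = \<zero>\<^sub>MA.SA"
proof -
 have xv: "!!i \<mu>. i : I ==> x i \<mu> <: DA.L" and yv: "!!i \<nu>. i : I ==> y i \<nu> <: DB.L"
  using MA.SA_val[OF x] MB.SA_val[OF y] by blast+
 have zero: "finsum DT.L (\<lambda>i. ft (x i \<mu>) (y i \<nu>)) I = \<zero>\<^sub>DT.L" if m: "\<mu> : M1" and n: "\<nu> : M2" for \<mu> \<nu>
 proof -
  have "finsum DT.L (\<lambda>i. ft (x i \<mu>) (y i \<nu>)) I = finsum DT.L (\<lambda>i. st (x i) (y i) (tm \<mu> \<nu>)) I"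
  proof (rule DT.L.finsum_cong'[OF refl])
   show "(\<lambda>i. st (x i) (y i) (tm \<mu> \<nu>)) : I \<rightarrow> carrier DT.L"
    by (rule funcsetI) (rule MT.SA_val[OF st_closed[OF x y]])
   show "ft (x i \<mu>) (y i \<nu>) = st (x i) (y i) (tm \<mu> \<nu>)" if "i : I" for i
    by (rule st_val[symmetric, OF x[OF that] y[OF that] m n])
  qed
  also have "\<dots> = finsum MT.SA (\<lambda>i. st (x i) (y i)) I (tm \<mu> \<nu>)"
   by (rule MT.SA_eval_finsum[symmetric, OF I]) (rule st_closed[OF x y])
  finally show ?thesis using z by simp
 qed
 have g0: "g (x j \<mu>) = \<zero>\<^sub>k" if m: "\<mu> : M1" and g: "DA.LA.functional g" for \<mu> g
 proof -
  have gk: "g (x i \<mu>) <: k" if "i : I" for i using g xv[OF that] unfolding DA.LA.functional_def by blast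
  have sc: "g (x i \<mu>) \<odot>\<^sub>MB.SA y i <: MB.SA" if "i : I" for i by (rule MB.SA_smult_closed[OF gk[OF that] y[OF that]])
  have "finsum MB.SA (\<lambda>i. g (x i \<mu>) \<odot>\<^sub>MB.SA y i) I = \<zero>\<^sub>MB.SA"
  proof (rule MB.SA_eqI)
   show "finsum MB.SA (\<lambda>i. g (x i \<mu>) \<odot>\<^sub>MB.SA y i) I <: MB.SA" by (rule MB.SA.finsum_closed) (use sc in auto)
   fix \<nu> assume n: "\<nu> : M2"
   have "finsum MB.SA (\<lambda>i. g (x i \<mu>) \<odot>\<^sub>MB.SA y i) I \<nu> = finsum DB.L (\<lambda>i. (g (x i \<mu>) \<odot>\<^sub>MB.SA y i) \<nu>) I"
    by (rule MB.SA_eval_finsum[OF I sc])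
   also have "\<dots> = finsum DB.L (\<lambda>i. g (x i \<mu>) \<odot>\<^sub>DB.L y i \<nu>) I" by simp
   also have "\<dots> = \<zero>\<^sub>DB.L"
    by (rule ft_contract[where x="\<lambda>i. x i \<mu>" and y="\<lambda>i. y i \<nu>" and I=I, OF I xv yv zero[OF m n] g])
   finally show "finsum MB.SA (\<lambda>i. g (x i \<mu>) \<odot>\<^sub>MB.SA y i) I \<nu> = \<zero>\<^sub>MB.SA \<nu>" by simp
  qed (rule MB.SA.zero_closed)
  then show ?thesis using ind[unfolded MB.SAA.indep_def, rule_format, of "\<lambda>i. g (x i \<mu>)" j] gk j by blast
 qed
 show ?thesis
 proof (rule MA.SA_eqI[OF x[OF j] MA.SA.zero_closed])
  fix \<mu> assume "\<mu> : M1"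
  then show "x j \<mu> = \<zero>\<^sub>MA.SA \<mu>" using DA.LA.functional_separates[OF xv[OF j]] g0 by simp
 qed
qed

sublocale TS: tensor_alg k MA.SA MB.SA by (intro tensor_alg.intro MA.SA_kalg MB.SA_kalg)
sublocale BS: bilin_lift k MA.SA MB.SA MT.SA by (intro bilin_lift.intro TS.tensor_alg_axioms MT.SAA.vspace_axioms)

lemma st_inj: "inj_on (tensor_lift k MT.SA st) (carrier TS.T)"
 by (rule BS.L_inj[OF st_bilin]) (rule st_left_faithful)

text \<open>Left faithfulness makes the lifted map injective, so the relation already holds in the
  tensor product, where both factors have the same standing.\<close>

lemma st_right_faithful:
 assumes I: "finite I" and x: "!!i. i : I ==> x i <: MA.SA" and y: "!!i. i : I ==> y i <: MB.SA"
  and ind: "MA.SAA.indep I x" and z: "finsum MT.SA (\<lambda>i. st (x i) (y i)) I = \<zero>\<^sub>MT.SA" and j: "j : I"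
 shows "y j = \<zero>\<^sub>MB.SA"
proof -
 have zz: "finsum TS.T (\<lambda>i. TS.pt (x i) (y i)) I = \<zero>\<^sub>TS.T"
  by (rule BS.faithful_left[where x=x and y=y and I=I, OF st_bilin st_inj I x y z])
 show ?thesis by (rule TS.pure_right_faithful[where x=x and y=y and I=I, OF I x y ind zz j])
qed

lemma sact_st:
 assumes w: "MA.normalizes w" and v: "MB.normalizes v" and f: "f <: MA.SA" and g: "g <: MB.SA"
 shows "MT.sact (tm w v) (st f g) = st (MA.sact w f) (MB.sact v g)" "MT.normalizes (tm w v)"
proof -
 have wA: "w <: DA.AA" and vA: "v <: DB.AA" using w v by (auto simp: MA.normalizes_def MB.normalizes_def)
 have wi: "inv\<^bsub>DA.AA\<^esub> w <: DA.AA" and vi: "inv\<^bsub>DB.AA\<^esub> v <: DB.AA" using wA vA by simp_all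
 have c1: "inv\<^bsub>DT.AA\<^esub> (tm w v) \<otimes>\<^sub>DT.AA tm \<mu> \<nu> \<otimes>\<^sub>DT.AA tm w v =
   tm (inv\<^bsub>DA.AA\<^esub> w \<otimes>\<^sub>DA.AA \<mu> \<otimes>\<^sub>DA.AA w) (inv\<^bsub>DB.AA\<^esub> v \<otimes>\<^sub>DB.AA \<nu> \<otimes>\<^sub>DB.AA v)"
  and c2: "tm w v \<otimes>\<^sub>DT.AA tm \<mu> \<nu> \<otimes>\<^sub>DT.AA inv\<^bsub>DT.AA\<^esub> (tm w v) =
   tm (w \<otimes>\<^sub>DA.AA \<mu> \<otimes>\<^sub>DA.AA inv\<^bsub>DA.AA\<^esub> w) (v \<otimes>\<^sub>DB.AA \<nu> \<otimes>\<^sub>DB.AA inv\<^bsub>DB.AA\<^esub> v)"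
  if "\<mu> : M1" "\<nu> : M2" for \<mu> \<nu>
  unfolding tm_inv[OF wA vA] using MA.M_Aut[OF that(1)] MB.M_Aut[OF that(2)] wA vA wi vi by (simp_all add: tm_mult)
 show n: "MT.normalizes (tm w v)" unfolding MT.normalizes_def
 proof (intro conjI ballI tm_Aut[OF wA vA])
  fix \<rho> assume "\<rho> : M"
  then obtain \<mu> \<nu> where r: "\<rho> = tm \<mu> \<nu>" "\<mu> : M1" "\<nu> : M2" unfolding M_eq by blast
  show "inv\<^bsub>DT.AA\<^esub> (tm w v) \<otimes>\<^sub>DT.AA \<rho> \<otimes>\<^sub>DT.AA tm w v : M" "tm w v \<otimes>\<^sub>DT.AA \<rho> \<otimes>\<^sub>DT.AA inv\<^bsub>DT.AA\<^esub> (tm w v) : M"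
   unfolding r(1) c1[OF r(2,3)] c2[OF r(2,3)] using w v r by (auto simp: MA.normalizes_def MB.normalizes_def intro!: tm_M)
 qed
 show "MT.sact (tm w v) (st f g) = st (MA.sact w f) (MB.sact v g)"
 proof (rule st_eqI[OF MT.sact_closed[OF n st_closed[OF f g]] st_closed[OF MA.sact_closed[OF w f] MB.sact_closed[OF v g]]])
  fix \<mu> \<nu> assume m: "\<mu> : M1" and n: "\<nu> : M2"
  let ?m = "inv\<^bsub>DA.AA\<^esub> w \<otimes>\<^sub>DA.AA \<mu> \<otimes>\<^sub>DA.AA w" and ?n = "inv\<^bsub>DB.AA\<^esub> v \<otimes>\<^sub>DB.AA \<nu> \<otimes>\<^sub>DB.AA v"
  have mn: "?m : M1" "?n : M2" using w v m n by (auto simp: MA.normalizes_def MB.normalizes_def)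
  have "MT.sact (tm w v) (st f g) (tm \<mu> \<nu>) = frac_map T (tm w v) (st f g (tm ?m ?n))"
   using tm_M[OF m n] c1[OF m n] by (simp add: skew_action_def)
  also have "\<dots> = ft (frac_map A w (f ?m)) (frac_map B v (g ?n))"
   unfolding st_val[OF f g mn] by (rule frac_map_ft[OF wA vA MA.SA_val[OF f] MB.SA_val[OF g]])
  also have "\<dots> = ft (MA.sact w f \<mu>) (MB.sact v g \<nu>)" using m n by (simp add: skew_action_def)
  also have "\<dots> = st (MA.sact w f) (MB.sact v g) (tm \<mu> \<nu>)" by (rule st_val[symmetric, OF MA.sact_closed[OF w f] MB.sact_closed[OF v g] m n])
  finally show "MT.sact (tm w v) (st f g) (tm \<mu> \<nu>) = st (MA.sact w f) (MB.sact v g) (tm \<mu> \<nu>)" .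
 qed
qed

end

section \<open>Galois ring settings\<close>

text \<open>A nonzero submodule contains the unit, so one generator suffices.\<close>

lemma (in ring) division_noeth:
 assumes F: "subring F R" and inv: "!!n. n : F ==> n ~= \<zero> ==> EX m:F. m \<otimes> n = \<one>"
 shows "noeth_on R F F"
 unfolding noeth_on_def
proof (intro allI impI, elim conjE)
 fix N assume N: "submod R F N" and NF: "N <= F"
 note NE = submodE[OF N]
 show "fg_left R F N"
 proof (cases "N = {\<zero>}")
  case True
  have "span_left R F {} = N" unfolding True
   using span_left_minimal[OF N[unfolded True], of "{}"] submodE(2)[OF span_left_submod[OF F, of "{}"]] by blast
  then show ?thesis unfolding fg_left_def by (intro exI[of _ "{}"]) simp
 next
  case False
  then obtain n where n: "n : N" "n ~= \<zero>" using NE(2) by blast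
  then obtain m where m: "m : F" "m \<otimes> n = \<one>" using inv NF by blast
  have one: "\<one> : N" using NE(5)[OF m(1) n(1)] m(2) by simp
  have "N = span_left R F {\<one>}"
  proof
   show "span_left R F {\<one>} <= N" by (rule span_left_minimal[OF N]) (use one in simp)
   show "N <= span_left R F {\<one>}"
   proof
    fix x assume "x : N"
    then have x: "x : F" "x <: R" using NF NE(1) by auto
    have "x \<otimes> \<one> : span_left R F {\<one>}" by (rule span_left_mult[OF F]) (use x in auto)
    then show "x : span_left R F {\<one>}" using x(2) by simp
   qed
  qed
  then show ?thesis unfolding fg_left_def by (intro exI[of _ "{\<one>}"]) simp
 qed
qed

text \<open>Preimages of submodules under \<open>h\<close> are submodules, and the images of their
  generators generate. It is also applied to maps from a commutative ring into an opposite
  ring.\<close>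

lemma noeth_hom:
 assumes R: "ring R" and R': "ring R'" and C: "subring C R" and n: "noeth_on R C C"
  and h: "!!a. a <: R ==> h a <: R'"
   "!!a b. a <: R ==> b <: R ==> h (a \<oplus>\<^sub>R b) = h a \<oplus>\<^sub>R' h b"
   "!!a b. a <: R ==> b <: R ==> h (a \<otimes>\<^sub>R b) = h a \<otimes>\<^sub>R' h b" "h \<one>\<^sub>R = \<one>\<^sub>R'"
 shows "subring (h ` C) R'" "noeth_on R' (h ` C) (h ` C)"
proof -
 interpret R: ring R by fact
 interpret R': ring R' by fact
 interpret hh: ring_hom_ring R R' h by (intro ring_hom_ringI2 R R' ring_hom_memI h)
 note CE = subringE[OF C]
 have neg: "h (\<ominus>\<^sub>R a) = \<ominus>\<^sub>R' h a" if "a <: R" for a using that by simp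
 show s: "subring (h ` C) R'" by (rule hh.img_is_subring[OF C])
 show "noeth_on R' (h ` C) (h ` C)" unfolding noeth_on_def
 proof (intro allI impI, elim conjE)
  fix N assume N: "submod R' (h ` C) N" and NC: "N <= h ` C"
  note NE = R'.submodE[OF N]
  let ?N = "{a : C. h a : N}"
  have "submod R C ?N"
  proof (rule R.submodI)
   show "?N <= carrier R" using CE(1) by auto
   show "\<zero>\<^sub>R : ?N" using CE(2) NE(2) by simp
   fix x assume x: "x : ?N"
   then have xc: "x <: R" using CE(1) by auto
   show "\<ominus>\<^sub>R x : ?N" using x CE(5) NE(4) neg[OF xc] by simp
   { fix y assume y: "y : ?N"
    then have yc: "y <: R" using CE(1) by auto
    show "x \<oplus>\<^sub>R y : ?N" using x y CE(7) NE(3) h(2)[OF xc yc] by simp }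
   { fix a assume a: "a : C"
    then have ac: "a <: R" using CE(1) by auto
    show "a \<otimes>\<^sub>R x : ?N" using x a CE(6) NE(5)[of "h a" "h x"] h(3)[OF ac xc] by simp }
  qed
  then have "fg_left R C ?N" by (rule noeth_onD[OF n]) auto
  then obtain S where S: "finite S" "S <= carrier R" "?N = span_left R C S" by (auto simp: fg_left_def)
  have hS: "h ` S <= carrier R'" using S(2) h(1) by auto
  have "S <= ?N" using R.span_left_incl[OF C S(2)] S(3) by blast
  then have 1: "span_left R' (h ` C) (h ` S) <= N" by (intro R'.span_left_minimal[OF N]) auto
  note spE = R'.submodE[OF R'.span_left_submod[OF s hS]]
  have "span_left R C S <= {a : carrier R. h a : span_left R' (h ` C) (h ` S)}"
  proof (rule R.span_left_minimal)
   show "S <= {a : carrier R. h a : span_left R' (h ` C) (h ` S)}" using S(2) R'.span_left_incl[OF s hS] by auto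
   show "submod R C {a : carrier R. h a : span_left R' (h ` C) (h ` S)}"
   proof (rule R.submodI)
    fix a x assume a: "a : C" and x: "x : {a : carrier R. h a : span_left R' (h ` C) (h ` S)}"
    then have ac: "a <: R" using CE(1) by auto
    show "a \<otimes>\<^sub>R x : {a : carrier R. h a : span_left R' (h ` C) (h ` S)}"
     using x a spE(5)[of "h a" "h x"] h(3)[OF ac, of x] ac by simp
   qed (use spE(2,3,4) h(2) neg in auto)
  qed
  then have 2: "N <= span_left R' (h ` C) (h ` S)" using NC S(3) by blast
  show "fg_left R' (h ` C) N" unfolding fg_left_def using S(1) hS equalityI[OF 2 1] by blast
 qed
qed

locale setting = aut_alg k A M for k :: "('k, 'z) ring_scheme" and A :: "('k, 'a) module" and M :: "('a => 'a) set" +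
 fixes W :: "('a => 'a) set"
 assumes setting: "galois_ring_setting k A M W"
begin

lemma W_subgroup: "subgroup W AA" and W_finite: "finite W"
 and conj: "!!w. w : W ==> (\<lambda>\<mu>. w \<otimes>\<^sub>AA \<mu> \<otimes>\<^sub>AA inv\<^bsub>AA\<^esub> w) ` M = M"
 using setting unfolding galois_ring_setting_def by auto

lemma W_Aut: "w : W ==> w <: AA"
 using subgroup.subset[OF W_subgroup] by blast

lemma W_normalizes:
 assumes w: "w : W" shows "normalizes w"
 unfolding normalizes_def
proof (intro conjI ballI W_Aut[OF w])
 fix \<mu> assume m: "\<mu> : M"
 show "w \<otimes>\<^sub>AA \<mu> \<otimes>\<^sub>AA inv\<^bsub>AA\<^esub> w : M" using conj[OF w] m by blast
 have wi: "inv\<^bsub>AA\<^esub> w : W" by (rule subgroup.m_inv_closed[OF W_subgroup w])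
 have "inv\<^bsub>AA\<^esub> w \<otimes>\<^sub>AA \<mu> \<otimes>\<^sub>AA inv\<^bsub>AA\<^esub> (inv\<^bsub>AA\<^esub> w) : M" using conj[OF wi] m by blast
 then show "inv\<^bsub>AA\<^esub> w \<otimes>\<^sub>AA \<mu> \<otimes>\<^sub>AA w : M" using W_Aut[OF w] by simp
qed

abbreviation G where "G \<equiv> fixed_elements A W"

lemma G_mem: "a : G \<longleftrightarrow> a <: A & (ALL w:W. w a = a)" by (simp add: fixed_elements_def)

lemma Winj: "w : W ==> alg_inj w" using Aut_alg_inj[OF W_Aut] .

lemma G_fix: "a : G ==> w : W ==> w a = a" and GI: "a <: A ==> (!!w. w : W ==> w a = a) ==> a : G"
 and G_carrier: "a : G ==> a <: A"
 by (auto simp: G_mem)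

lemma G_subring: "subring G A"
proof (rule A.subringI)
 show "G <= carrier A" by (auto simp: G_mem)
 show "\<one>\<^sub>A : G" by (rule GI) (simp_all add: alg_injD(4)[OF Winj])
 fix h assume h: "h : G"
 show "\<ominus>\<^sub>A h : G"
 proof (rule GI)
  fix w assume w: "w : W"
  have "\<ominus>\<^sub>A h = (\<ominus>\<^sub>k \<one>\<^sub>k) \<odot>\<^sub>A h" by (rule neg_smult[OF G_carrier[OF h]])
  then show "w (\<ominus>\<^sub>A h) = \<ominus>\<^sub>A h" using alg_injD(7)[OF Winj[OF w], of "\<ominus>\<^sub>k \<one>\<^sub>k" h] G_fix[OF h w] G_carrier[OF h] by simp
 qed (use G_carrier[OF h] in simp)
 fix h' assume h': "h' : G"
 show "h \<oplus>\<^sub>A h' : G"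
 proof (rule GI)
  show "w (h \<oplus>\<^sub>A h') = h \<oplus>\<^sub>A h'" if w: "w : W" for w
   using alg_injD(2)[OF Winj[OF w] G_carrier[OF h] G_carrier[OF h']] G_fix[OF h w] G_fix[OF h' w] by simp
 qed (use G_carrier[OF h] G_carrier[OF h'] in simp)
 show "h \<otimes>\<^sub>A h' : G"
 proof (rule GI)
  show "w (h \<otimes>\<^sub>A h') = h \<otimes>\<^sub>A h'" if w: "w : W" for w
   using alg_injD(3)[OF Winj[OF w] G_carrier[OF h] G_carrier[OF h']] G_fix[OF h w] G_fix[OF h' w] by simp
 qed (use G_carrier[OF h] G_carrier[OF h'] in simp)
qed

lemma G_scalars: "scalars <= G"
 by (auto simp: scalars_def G_mem alg_injD(4,7)[OF Winj])

lemma G_subalgebra: "k_subalgebra k G A" by (rule k_subalgebraI[OF G_subring G_scalars])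

text \<open>The product of all conjugates of \<open>b\<close> is invariant. The identity contributes
  \<open>b\<close> itself, so the product of the other conjugates is \<open>c\<close>.\<close>

lemma norm:
 assumes b: "b : nz A"
 obtains c where "c <: A" "b \<otimes>\<^sub>A c : G - {\<zero>\<^sub>A}"
proof -
 have bc: "b <: A" using b by simp
 have wb: "w b : nz A" if "w : W" for w by (rule alg_injD(6)[OF Winj[OF that] b])
 let ?n = "finprod A (\<lambda>w. w b) W"
 have nz: "finprod A (\<lambda>w. w b) V : nz A" if "V <= W" for V
 proof -
  have "finite V" using finite_subset[OF that W_finite] .
  then show ?thesis using that
  proof (induction V rule: finite_induct)
   case empty then show ?case using one_nz by simp
  next
   case (insert w V)
   have "finprod A (\<lambda>w. w b) (insert w V) = w b \<otimes>\<^sub>A finprod A (\<lambda>w. w b) V"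
    by (rule D.finprod_insert) (use insert wb in auto)
   then show ?case using nz_mult[OF wb] insert by simp
  qed
 qed
 have one: "\<one>\<^sub>AA : W" by (rule subgroup.one_closed[OF W_subgroup])
 have "finprod A (\<lambda>w. w b) (insert \<one>\<^sub>AA (W - {\<one>\<^sub>AA})) = \<one>\<^sub>AA b \<otimes>\<^sub>A finprod A (\<lambda>w. w b) (W - {\<one>\<^sub>AA})"
  by (rule D.finprod_insert) (use W_finite wb one in auto)
 moreover have "insert \<one>\<^sub>AA (W - {\<one>\<^sub>AA}) = W" using one by auto
 moreover have "\<one>\<^sub>AA b = b" using bc by (simp add: Aut_one)
 ultimately have e: "?n = b \<otimes>\<^sub>A finprod A (\<lambda>w. w b) (W - {\<one>\<^sub>AA})" by simp
 have "v ?n = ?n" if v: "v : W" for v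
 proof -
  have hom: "v (finprod A (\<lambda>w. w b) V) = finprod A (\<lambda>w. v (w b)) V" if "V <= W" for V
  proof -
   have "finite V" using finite_subset[OF that W_finite] .
   then show ?thesis using that
   proof (induction V rule: finite_induct)
    case empty then show ?case using alg_injD(4)[OF Winj[OF v]] by simp
   next
    case (insert w V)
    have w1: "w b <: A" and fV: "finprod A (\<lambda>w. w b) V <: A" using wb[of w] nz[of V] insert.prems by auto
    have "finprod A (\<lambda>w. w b) (insert w V) = w b \<otimes>\<^sub>A finprod A (\<lambda>w. w b) V"
     by (rule D.finprod_insert) (use insert wb in auto)
    moreover have "finprod A (\<lambda>w. v (w b)) (insert w V) = v (w b) \<otimes>\<^sub>A finprod A (\<lambda>w. v (w b)) V"
     by (rule D.finprod_insert) (use insert wb alg_injD(1)[OF Winj[OF v]] in auto)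
    ultimately show ?case using insert alg_injD(3)[OF Winj[OF v] w1 fV] by simp
   qed
  qed
  have vA: "v <: AA" by (rule W_Aut[OF v])
  have inj: "inj_on (\<lambda>w. v \<otimes>\<^sub>AA w) W" using vA W_Aut by (intro inj_onI) simp
  \<comment> \<open>Left translation by \<open>v\<close> permutes \<open>W\<close>, so
    \<open>v\<close> only permutes the factors of the product.\<close>
  have img: "(\<lambda>w. v \<otimes>\<^sub>AA w) ` W = W"
   by (rule endo_inj_surj[OF W_finite _ inj]) (use subgroup.m_closed[OF W_subgroup v] in auto)
  have "v ?n = finprod A (\<lambda>w. v (w b)) W" using hom[of W] by simp
  also have "\<dots> = finprod A (\<lambda>w. (v \<otimes>\<^sub>AA w) b) W"
   by (rule D.finprod_cong') (use Aut_apply[OF vA W_Aut bc] wb[OF subgroup.m_closed[OF W_subgroup v]] in auto)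
  also have "\<dots> = finprod A (\<lambda>w. w b) ((\<lambda>w. v \<otimes>\<^sub>AA w) ` W)"
   by (rule D.finprod_reindex[symmetric]) (use wb inj img in auto)
  finally show ?thesis unfolding img .
 qed
 then have "?n : G - {\<zero>\<^sub>A}" using nz[of W] by (simp add: G_mem)
 then show ?thesis using that[of "finprod A (\<lambda>w. w b) (W - {\<one>\<^sub>AA})"] nz[of "W - {\<one>\<^sub>AA}"] e by auto
qed

lemma G_nz: "\<gamma> : G - {\<zero>\<^sub>A} ==> \<gamma> : nz A" by (auto simp: G_mem)

text \<open>Expanding a fraction by the remaining conjugates makes its denominator invariant; thus
  only elements of \<open>G\<close> have to be inverted.\<close>

lemma L_cases_G:
 assumes x: "x <: L"
 obtains a \<gamma> where "a <: A" "\<gamma> : G - {\<zero>\<^sub>A}" "x = fr a \<gamma>"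
proof -
 obtain a b where ab: "a <: A" "b : nz A" "x = fr a b" using L_cases[OF x] .
 obtain c where c: "c <: A" "b \<otimes>\<^sub>A c : G - {\<zero>\<^sub>A}" using norm[OF ab(2)] .
 have "x = fr (a \<otimes>\<^sub>A c) (b \<otimes>\<^sub>A c)" unfolding ab(3)
  using ab(1,2) c G_nz[OF c(2)] by (simp add: fr_eq D.m_ac)
 then show ?thesis using that[of "a \<otimes>\<^sub>A c", OF _ c(2)] ab(1) c(1) by simp
qed

section \<open>The field of invariant fractions and its embedding into the skew algebra\<close>

abbreviation KK where "KK \<equiv> K_in_L A W"

lemma K_mem: "x : KK \<longleftrightarrow> (EX a b. x = fr a b & a : G & b : G - {\<zero>\<^sub>A})" by (auto simp: K_in_L_def)

lemma K_closed: "x : KK ==> x <: L"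
 unfolding K_mem using fr_closed G_nz G_carrier by blast

lemma K_fixed: "x : KK ==> w : W ==> frac_map A w x = x"
proof -
 assume x: "x : KK" and w: "w : W"
 then obtain a b where ab: "x = fr a b" "a : G" "b : G - {\<zero>\<^sub>A}" unfolding K_mem by blast
 show ?thesis unfolding ab(1) frac_map_fr[OF Winj[OF w] G_carrier[OF ab(2)] G_nz[OF ab(3)]]
  using G_fix[OF ab(2) w] G_fix[OF _ w, of b] ab(3) by simp
qed

lemma G_nz_mult: "b : G - {\<zero>\<^sub>A} ==> d : G - {\<zero>\<^sub>A} ==> b \<otimes>\<^sub>A d : G - {\<zero>\<^sub>A}"
 using nz_mult[OF G_nz G_nz, of b d] subringE(6)[OF G_subring, of b d] by simp

lemma G_one: "\<one>\<^sub>A : G - {\<zero>\<^sub>A}" using subringE(3)[OF G_subring] D.one_not_zero by simp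

lemma to_frac_K: "a : G ==> to_frac A a : KK" unfolding K_mem to_frac_def using G_one by blast

lemma fr_inv_K: "\<gamma> : G - {\<zero>\<^sub>A} ==> fr \<one>\<^sub>A \<gamma> : KK" unfolding K_mem using subringE(3)[OF G_subring] by blast

lemma K_subring: "subring KK L"
proof (rule L.subringI)
 show "KK <= carrier L" using K_closed by blast
 show "\<one>\<^sub>L : KK" using to_frac_K[of "\<one>\<^sub>A"] G_one by (simp add: to_frac_one)
 note GE = subringE[OF G_subring]
 fix x assume x: "x : KK"
 then obtain a b where ab: "x = fr a b" "a : G" "b : G - {\<zero>\<^sub>A}" unfolding K_mem by blast
 have "fr (\<ominus>\<^sub>A a) b \<oplus>\<^sub>L x = \<zero>\<^sub>L" unfolding ab(1)
  using fr_add_num[of "\<ominus>\<^sub>A a" a b] G_carrier[OF ab(2)] G_nz[OF ab(3)] fr_zero_iff[of "\<zero>\<^sub>A" b] by (simp add: A.l_neg)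
 then have "\<ominus>\<^sub>L x = fr (\<ominus>\<^sub>A a) b" using L.minus_equality[of "fr (\<ominus>\<^sub>A a) b" x] K_closed[OF x] fr_closed[of "\<ominus>\<^sub>A a" b] G_carrier[OF ab(2)] G_nz[OF ab(3)] by simp
 then show "\<ominus>\<^sub>L x : KK" unfolding K_mem using GE(5)[OF ab(2)] ab(3) by blast
 fix y assume y: "y : KK"
 then obtain c d where cd: "y = fr c d" "c : G" "d : G - {\<zero>\<^sub>A}" unfolding K_mem by blast
 note c = G_carrier[OF ab(2)] G_nz[OF ab(3)] G_carrier[OF cd(2)] G_nz[OF cd(3)]
 have d: "d : G" "b : G" using ab cd by auto
 show "x \<otimes>\<^sub>L y : KK" unfolding ab(1) cd(1) L_mult[OF c] K_mem using GE(6)[OF ab(2) cd(2)] G_nz_mult[OF ab(3) cd(3)] by blast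
 show "x \<oplus>\<^sub>L y : KK" unfolding ab(1) cd(1) L_add[OF c] K_mem
  using GE(7)[OF GE(6)[OF ab(2) d(1)] GE(6)[OF cd(2) d(2)]] G_nz_mult[OF ab(3) cd(3)] by blast
qed

lemma K_inverse: "x : KK ==> x ~= \<zero>\<^sub>L ==> EX y:KK. y \<otimes>\<^sub>L x = \<one>\<^sub>L"
proof -
 assume x: "x : KK" "x ~= \<zero>\<^sub>L"
 then obtain a b where ab: "x = fr a b" "a : G" "b : G - {\<zero>\<^sub>A}" unfolding K_mem by blast
 have a: "a : G - {\<zero>\<^sub>A}" using x(2) fr_zero_iff[OF G_carrier[OF ab(2)] G_nz[OF ab(3)]] ab by simp
 have bc: "b <: A" using ab(3) G_carrier by simp
 have "fr b a \<otimes>\<^sub>L x = \<one>\<^sub>L" unfolding ab(1) L_one L_mult[OF bc G_nz[OF a] G_carrier[OF ab(2)] G_nz[OF ab(3)]]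
  using fr_eq[OF _ nz_mult[OF G_nz[OF a] G_nz[OF ab(3)]] _ one_nz, of "b \<otimes>\<^sub>A a" "\<one>\<^sub>A"] bc G_carrier[OF ab(2)] by (simp add: D.m_comm)
 moreover have "fr b a : KK" unfolding K_mem using ab(3) a by blast
 ultimately show ?thesis by blast
qed

abbreviation sc where "sc \<equiv> scalar k A"

lemma one_M: "\<one>\<^sub>AA : M" by (rule submonoid.one_closed[OF submon])

lemma sc_closed: "l <: L ==> sc l <: SA"
 unfolding scalar_def by (rule single_SA[OF one_M])

lemma sc_add: "l <: L ==> l' <: L ==> sc (l \<oplus>\<^sub>L l') = sc l \<oplus>\<^sub>SA sc l'"
 by (simp add: scalar_def L.single_add)

lemma sc_one: "sc \<one>\<^sub>L = \<one>\<^sub>SA" by (simp add: scalar_def)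

lemma sc_mult_single:
 assumes "l <: L" "\<mu> : M" "a <: L"
 shows "sc l \<otimes>\<^sub>SA single L \<mu> a = single L \<mu> (l \<otimes>\<^sub>L a)" "single L \<mu> a \<otimes>\<^sub>SA sc l = single L \<mu> (a \<otimes>\<^sub>L frac_map A \<mu> l)"
 unfolding scalar_def SA_mult_single[OF one_M assms(2,1,3)] SA_mult_single[OF assms(2) one_M assms(3,1)]
 using M_Aut[OF assms(2)] frac_map_Aut_one[OF assms(3)] by simp_all

lemma sc_mult: "l <: L ==> l' <: L ==> sc (l \<otimes>\<^sub>L l') = sc l \<otimes>\<^sub>SA sc l'"
 using sc_mult_single(1)[OF _ one_M] by (simp add: scalar_def)

text \<open>On the right the scalar has to move past the automorphism \<mu>, so the second formula
  is restricted to \<mu> in \<open>M\<close>.\<close>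

lemma sc_mult_val:
 assumes l: "l <: L" and f: "f <: SA"
 shows "(sc l \<otimes>\<^sub>SA f) \<mu> = l \<otimes>\<^sub>L f \<mu> & (\<mu> : M --> (f \<otimes>\<^sub>SA sc l) \<mu> = f \<mu> \<otimes>\<^sub>L frac_map A \<mu> l)"
 using f
proof (induction rule: SA_induct)
 case zero
 have "frac_map A \<mu> l <: L" if "\<mu> : M" using frac_map_closed[OF Aut_alg_inj[OF M_Aut[OF that]] l] .
 then show ?case using l SA.l_null[OF sc_closed[OF l]] SA.r_null[OF sc_closed[OF l]] by simp
next
 case (single \<nu> a)
 have fl: "frac_map A \<mu> l <: L" if "\<mu> : M" using frac_map_closed[OF Aut_alg_inj[OF M_Aut[OF that]] l] .
 then show ?case unfolding sc_mult_single[OF l single] using l by (simp add: single_def)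
next
 case (add f g)
 have fl: "frac_map A \<mu> l <: L" if "\<mu> : M" using frac_map_closed[OF Aut_alg_inj[OF M_Aut[OF that]] l] .
 note v = SA_val[OF add(1), of \<mu>] SA_val[OF add(2), of \<mu>]
 have "(sc l \<otimes>\<^sub>SA (f \<oplus>\<^sub>SA g)) \<mu> = (sc l \<otimes>\<^sub>SA f) \<mu> \<oplus>\<^sub>L (sc l \<otimes>\<^sub>SA g) \<mu>"
  unfolding SA.r_distr[OF add(1,2) sc_closed[OF l]] by simp
 moreover have "((f \<oplus>\<^sub>SA g) \<otimes>\<^sub>SA sc l) \<mu> = (f \<otimes>\<^sub>SA sc l) \<mu> \<oplus>\<^sub>L (g \<otimes>\<^sub>SA sc l) \<mu>"
  unfolding SA.l_distr[OF add(1,2) sc_closed[OF l]] by simp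
 ultimately show ?case using add(3,4) fl v l by (simp add: L.l_distr L.r_distr)
qed

abbreviation INV where "INV \<equiv> skew_invariants k A M W"

lemma INV_mem: "f : INV \<longleftrightarrow> f <: SA & (ALL w:W. sact w f = f)" by (simp add: skew_invariants_def)

text \<open>\<open>L\<close> is commutative, so \<open>sc\<close> is a homomorphism into the skew
  algebra as well as into its opposite, and both images of the field \<open>K\<close> are
  Noetherian.\<close>

lemma scK_subring: "subring (sc ` KK) SA" and scK_subring_op: "subring (sc ` KK) (op_ring SA)"
 and scK_noeth: "noeth_on SA (sc ` KK) (sc ` KK)" and scK_noeth_op: "noeth_on (op_ring SA) (sc ` KK) (sc ` KK)"
proof -
 have n: "noeth_on L KK KK" by (rule L.division_noeth[OF K_subring K_inverse])
 show "subring (sc ` KK) SA" "noeth_on SA (sc ` KK) (sc ` KK)"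
  using noeth_hom[where h=sc, OF L.ring_axioms SA_ring K_subring n sc_closed sc_add sc_mult sc_one] by blast+
 have m: "sc (l \<otimes>\<^sub>L l') = sc l \<otimes>\<^bsub>op_ring SA\<^esub> sc l'" if "l <: L" "l' <: L" for l l'
  using that sc_mult[of l' l] by (simp only: op_ring_simps L.m_comm)
 show "subring (sc ` KK) (op_ring SA)" "noeth_on (op_ring SA) (sc ` KK) (sc ` KK)"
  using noeth_hom[where h=sc and R'="op_ring SA", OF L.ring_axioms SA.op_ring K_subring n _ _ m] sc_closed sc_add sc_one
  by (simp_all only: op_ring_simps)
qed

text \<open>\<open>S\<close> only bounds the support and need not be stable under conjugation by
  \<open>W\<close>. These spaces are the test spaces to which the order property of the factors will
  be applied.\<close>

definition VS where "VS S = {f : INV. ALL \<mu>. \<mu> \<notin> S --> f \<mu> = \<zero>\<^sub>L}"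

lemma sact_val: "\<nu> : M ==> sact w f \<nu> = frac_map A w (f (inv\<^bsub>AA\<^esub> w \<otimes>\<^sub>AA \<nu> \<otimes>\<^sub>AA w))"
 by (simp add: skew_action_def)

lemma sact_sc_left:
 assumes w: "w : W" and l: "l : KK" and f: "f <: SA"
 shows "sact w (sc l \<otimes>\<^sub>SA f) = sc l \<otimes>\<^sub>SA sact w f"
proof (rule SA_eqI)
 note n = W_normalizes[OF w] and lc = K_closed[OF l]
 have cl: "sc l \<otimes>\<^sub>SA f <: SA" by (rule SA.m_closed[OF sc_closed[OF lc] f])
 show "sact w (sc l \<otimes>\<^sub>SA f) <: SA" by (rule sact_closed[OF n cl])
 show "sc l \<otimes>\<^sub>SA sact w f <: SA" by (rule SA.m_closed[OF sc_closed[OF lc] sact_closed[OF n f]])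
 fix \<nu> assume nu: "\<nu> : M"
 show "sact w (sc l \<otimes>\<^sub>SA f) \<nu> = (sc l \<otimes>\<^sub>SA sact w f) \<nu>"
  unfolding sact_val[OF nu] conjunct1[OF sc_mult_val[OF lc f]] conjunct1[OF sc_mult_val[OF lc sact_closed[OF n f]]]
  using frac_map_props(2)[OF Winj[OF w] lc SA_val[OF f]] K_fixed[OF l w] by simp
qed

text \<open>At \<nu> the scalar appears twisted by the conjugated index. Moving \<open>w\<close>
  across turns this into the twist by \<nu> of \<open>w\<close> applied to \<open>l\<close>, and
  \<open>l\<close> is fixed by \<open>W\<close>.\<close>

lemma sact_sc_right:
 assumes w: "w : W" and l: "l : KK" and f: "f <: SA"
 shows "sact w (f \<otimes>\<^sub>SA sc l) = sact w f \<otimes>\<^sub>SA sc l"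
proof (rule SA_eqI)
 note n = W_normalizes[OF w] and lc = K_closed[OF l] and wA = W_Aut[OF w]
 have cl: "f \<otimes>\<^sub>SA sc l <: SA" by (rule SA.m_closed[OF f sc_closed[OF lc]])
 show "sact w (f \<otimes>\<^sub>SA sc l) <: SA" by (rule sact_closed[OF n cl])
 show "sact w f \<otimes>\<^sub>SA sc l <: SA" by (rule SA.m_closed[OF sact_closed[OF n f] sc_closed[OF lc]])
 fix \<nu> assume nu: "\<nu> : M"
 let ?q = "inv\<^bsub>AA\<^esub> w \<otimes>\<^sub>AA \<nu> \<otimes>\<^sub>AA w"
 have q: "?q : M" using n nu by (simp add: normalizes_def)
 have nA: "\<nu> <: AA" by (rule M_Aut[OF nu])
 have ql: "frac_map A ?q l <: L" by (rule frac_map_closed[OF Aut_alg_inj[OF M_Aut[OF q]] lc])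
 have "w \<otimes>\<^sub>AA ?q = \<nu> \<otimes>\<^sub>AA w"
 proof -
  have "w \<otimes>\<^sub>AA ?q = w \<otimes>\<^sub>AA (inv\<^bsub>AA\<^esub> w \<otimes>\<^sub>AA (\<nu> \<otimes>\<^sub>AA w))"
   unfolding AG.m_assoc[OF AG.inv_closed[OF wA] nA wA] ..
  also have "\<dots> = (w \<otimes>\<^sub>AA inv\<^bsub>AA\<^esub> w) \<otimes>\<^sub>AA (\<nu> \<otimes>\<^sub>AA w)"
   by (rule AG.m_assoc[symmetric, OF wA AG.inv_closed[OF wA] AG.m_closed[OF nA wA]])
  also have "\<dots> = \<nu> \<otimes>\<^sub>AA w" unfolding AG.r_inv[OF wA] by (rule AG.l_one[OF AG.m_closed[OF nA wA]])
  finally show ?thesis .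
 qed
 then have "frac_map A w (frac_map A ?q l) = frac_map A \<nu> (frac_map A w l)"
  using frac_map_Aut_comp[OF wA M_Aut[OF q] lc] frac_map_Aut_comp[OF nA wA lc] by simp
 then have e: "frac_map A w (frac_map A ?q l) = frac_map A \<nu> l" using K_fixed[OF l w] by simp
 have 1: "(f \<otimes>\<^sub>SA sc l) ?q = f ?q \<otimes>\<^sub>L frac_map A ?q l" using sc_mult_val[OF lc f] q by blast
 have 2: "(sact w f \<otimes>\<^sub>SA sc l) \<nu> = sact w f \<nu> \<otimes>\<^sub>L frac_map A \<nu> l" using sc_mult_val[OF lc sact_closed[OF n f]] nu by blast
 show "sact w (f \<otimes>\<^sub>SA sc l) \<nu> = (sact w f \<otimes>\<^sub>SA sc l) \<nu>"
  unfolding 2 sact_val[OF nu] 1 frac_map_props(2)[OF Winj[OF w] SA_val[OF f] ql] e ..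
qed

lemma sact_neg:
 assumes w: "w : W" and f: "f <: SA"
 shows "sact w (\<ominus>\<^sub>SA f) = \<ominus>\<^sub>SA sact w f"
proof -
 note n = W_normalizes[OF w]
 have "sact w (\<ominus>\<^sub>SA f) \<oplus>\<^sub>SA sact w f = sact w \<zero>\<^sub>SA"
  unfolding SA.l_neg[OF f, symmetric] by (rule sact_add[symmetric, OF n SA.a_inv_closed[OF f] f])
 also have "\<dots> = \<zero>\<^sub>SA" by (rule ext) (simp add: skew_action_def frac_map_zero[OF Winj[OF w]])
 finally show ?thesis using SA.minus_equality[OF _ sact_closed[OF n f] sact_closed[OF n SA.a_inv_closed[OF f]]] by simp
qed

lemma sact_zero: "w : W ==> sact w \<zero>\<^sub>SA = \<zero>\<^sub>SA"
 by (rule ext) (simp add: skew_action_def frac_map_zero[OF Winj])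

lemma INV_D: "f : INV ==> f <: SA" "f : INV ==> w : W ==> sact w f = f"
 unfolding INV_mem by auto

lemma INV_I: "f <: SA ==> (!!w. w : W ==> sact w f = f) ==> f : INV"
 unfolding INV_mem by auto

lemma INV_ops:
 "\<zero>\<^sub>SA : INV" "f : INV ==> \<ominus>\<^sub>SA f : INV" "f : INV ==> g : INV ==> f \<oplus>\<^sub>SA g : INV"
 "l : KK ==> f : INV ==> sc l \<otimes>\<^sub>SA f : INV" "l : KK ==> f : INV ==> f \<otimes>\<^sub>SA sc l : INV"
proof -
 show "\<zero>\<^sub>SA : INV" by (rule INV_I[OF SA.zero_closed sact_zero])
 show "\<ominus>\<^sub>SA f : INV" if f: "f : INV"
  by (rule INV_I[OF SA.a_inv_closed[OF INV_D(1)[OF f]]]) (simp only: sact_neg[OF _ INV_D(1)[OF f]] INV_D(2)[OF f])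
 show "f \<oplus>\<^sub>SA g : INV" if f: "f : INV" and g: "g : INV"
  by (rule INV_I[OF SA.a_closed[OF INV_D(1)[OF f] INV_D(1)[OF g]]])
   (simp only: sact_add[OF W_normalizes INV_D(1)[OF f] INV_D(1)[OF g]] INV_D(2)[OF f] INV_D(2)[OF g])
 show "sc l \<otimes>\<^sub>SA f : INV" if l: "l : KK" and f: "f : INV"
  by (rule INV_I[OF SA.m_closed[OF sc_closed[OF K_closed[OF l]] INV_D(1)[OF f]]])
   (simp only: sact_sc_left[OF _ l INV_D(1)[OF f]] INV_D(2)[OF f])
 show "f \<otimes>\<^sub>SA sc l : INV" if l: "l : KK" and f: "f : INV"
  by (rule INV_I[OF SA.m_closed[OF INV_D(1)[OF f] sc_closed[OF K_closed[OF l]]]])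
   (simp only: sact_sc_right[OF _ l INV_D(1)[OF f]] INV_D(2)[OF f])
qed

lemma INV_submod: "submod SA (sc ` KK) INV"
 by (rule SA.submodI) (use INV_ops INV_D(1) in blast)+

lemma op_neg:
 assumes "f <: SA" shows "\<ominus>\<^bsub>op_ring SA\<^esub> f = \<ominus>\<^sub>SA f"
proof -
 interpret O: ring "op_ring SA" by (rule SA.op_ring)
 have "\<ominus>\<^sub>SA f \<oplus>\<^bsub>op_ring SA\<^esub> f = \<zero>\<^bsub>op_ring SA\<^esub>" using SA.l_neg[OF assms] by (simp only: op_ring_simps)
 then show ?thesis using O.minus_equality[of "\<ominus>\<^sub>SA f" f] assms SA.a_inv_closed[OF assms] by (simp only: op_ring_simps)
qed

lemma neg_val: "f <: SA ==> (\<ominus>\<^sub>SA f) \<mu> = \<ominus>\<^sub>L f \<mu>"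
proof -
 assume f: "f <: SA"
 have "(\<ominus>\<^sub>SA f \<oplus>\<^sub>SA f) \<mu> = \<zero>\<^sub>SA \<mu>" using SA.l_neg[OF f] by simp
 then have "(\<ominus>\<^sub>SA f) \<mu> \<oplus>\<^sub>L f \<mu> = \<zero>\<^sub>L" by simp
 then show ?thesis using L.minus_equality[OF _ SA_val[OF f] SA_val[OF SA.a_inv_closed[OF f]]] by simp
qed

lemma VS_D: "f : VS S ==> f : INV" "f : VS S ==> \<mu> \<notin> S ==> f \<mu> = \<zero>\<^sub>L" by (auto simp: VS_def)

lemma VS_ops:
 "\<zero>\<^sub>SA : VS S" "f : VS S ==> \<ominus>\<^sub>SA f : VS S" "f : VS S ==> g : VS S ==> f \<oplus>\<^sub>SA g : VS S"
 "l : KK ==> f : VS S ==> sc l \<otimes>\<^sub>SA f : VS S" "l : KK ==> f : VS S ==> f \<otimes>\<^sub>SA sc l : VS S"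
proof -
 show "\<zero>\<^sub>SA : VS S" using INV_ops(1) by (simp add: VS_def)
 show "\<ominus>\<^sub>SA f : VS S" if f: "f : VS S"
  unfolding VS_def using INV_ops(2)[OF VS_D(1)[OF f]] VS_D(2)[OF f] neg_val[OF INV_D(1)[OF VS_D(1)[OF f]]] by simp
 show "f \<oplus>\<^sub>SA g : VS S" if f: "f : VS S" and g: "g : VS S"
  unfolding VS_def using INV_ops(3)[OF VS_D(1)[OF f] VS_D(1)[OF g]] VS_D(2)[OF f] VS_D(2)[OF g] by simp
 show "sc l \<otimes>\<^sub>SA f : VS S" if l: "l : KK" and f: "f : VS S"
  unfolding VS_def using INV_ops(4)[OF l VS_D(1)[OF f]] VS_D(2)[OF f] K_closed[OF l]
   conjunct1[OF sc_mult_val[OF K_closed[OF l] INV_D(1)[OF VS_D(1)[OF f]]]] by simp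
 show "f \<otimes>\<^sub>SA sc l : VS S" if l: "l : KK" and f: "f : VS S"
 proof -
  note i = INV_ops(5)[OF l VS_D(1)[OF f]]
  have "(f \<otimes>\<^sub>SA sc l) \<mu> = \<zero>\<^sub>L" if "\<mu> \<notin> S" for \<mu>
  proof (cases "\<mu> : M")
   case True
   then have "(f \<otimes>\<^sub>SA sc l) \<mu> = f \<mu> \<otimes>\<^sub>L frac_map A \<mu> l"
    using sc_mult_val[OF K_closed[OF l] INV_D(1)[OF VS_D(1)[OF f]]] by blast
   then show ?thesis using VS_D(2)[OF f that] frac_map_closed[OF Aut_alg_inj[OF M_Aut[OF True]] K_closed[OF l]] by simp
  qed (rule SA_off[OF INV_D(1)[OF i]])
  then show ?thesis using i by (simp add: VS_def)
 qed
qed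

lemma VS_submod: "submod SA (sc ` KK) (VS S)"
 by (rule SA.submodI) (use VS_ops INV_D(1) VS_D(1) in blast)+

lemma VS_submod_op: "submod (op_ring SA) (sc ` KK) (VS S)"
proof -
 interpret O: ring "op_ring SA" by (rule SA.op_ring)
 show ?thesis
 proof (rule O.submodI)
  show "VS S <= carrier (op_ring SA)" using INV_D(1) VS_D(1) by (simp only: op_ring_simps) blast
  show "\<zero>\<^bsub>op_ring SA\<^esub> : VS S" using VS_ops(1) by (simp only: op_ring_simps)
  show "x \<oplus>\<^bsub>op_ring SA\<^esub> y : VS S" if "x : VS S" "y : VS S" for x y using VS_ops(3)[OF that] by (simp only: op_ring_simps)
  show "\<ominus>\<^bsub>op_ring SA\<^esub> x : VS S" if "x : VS S" for x using VS_ops(2)[OF that] op_neg[OF INV_D(1)[OF VS_D(1)[OF that]]] by simp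
  show "a \<otimes>\<^bsub>op_ring SA\<^esub> x : VS S" if "a : sc ` KK" "x : VS S" for a x using VS_ops(5) that by (auto simp only: op_ring_simps)
 qed
qed

text \<open>Since denominators may be taken in \<open>G\<close>, generators of \<open>A\<close> over
  \<open>G\<close> generate \<open>L\<close> over \<open>K\<close>.\<close>

lemma L_span:
 assumes S: "finite S" "S <= carrier A" "span_left A G S = carrier A"
 shows "span_left L KK (to_frac A ` S) = carrier L"
proof
 have tS: "to_frac A ` S <= carrier L" using to_frac_closed S(2) by blast
 note sm = L.span_left_submod[OF K_subring tS]
 note E = L.submodE[OF sm]
 show "span_left L KK (to_frac A ` S) <= carrier L" by (rule E(1))
 let ?N = "{a : carrier A. to_frac A a : span_left L KK (to_frac A ` S)}"
 have "submod A G ?N"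
 proof (rule A.submodI)
  show "\<zero>\<^sub>A : ?N" using E(2) by (simp add: to_frac_zero)
  fix x assume x: "x : ?N"
  have "to_frac A (\<ominus>\<^sub>A x) = \<ominus>\<^sub>L to_frac A x"
  proof (rule L.minus_equality[symmetric])
   show "to_frac A (\<ominus>\<^sub>A x) \<oplus>\<^sub>L to_frac A x = \<zero>\<^sub>L"
    using x to_frac_add[of "\<ominus>\<^sub>A x" x] by (simp add: A.l_neg to_frac_zero)
  qed (use x to_frac_closed in auto)
  then show "\<ominus>\<^sub>A x : ?N" using x E(4) by simp
  show "x \<oplus>\<^sub>A y : ?N" if "y : ?N" for y using x that E(3) by (simp add: to_frac_add)
  show "a \<otimes>\<^sub>A x : ?N" if "a : G" for a using x G_carrier[OF that] E(5)[OF to_frac_K[OF that]] by (simp add: to_frac_mult)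
 qed auto
 moreover have "S <= ?N" using S(2) L.span_left_incl[OF K_subring tS] by auto
 ultimately have "carrier A <= ?N" using A.span_left_minimal[of G ?N S] S(3) by simp
 then have all: "to_frac A a : span_left L KK (to_frac A ` S)" if "a <: A" for a using that by blast
 show "carrier L <= span_left L KK (to_frac A ` S)"
 proof
  fix x assume "x <: L"
  then obtain a \<gamma> where a: "a <: A" "\<gamma> : G - {\<zero>\<^sub>A}" "x = fr a \<gamma>" by (rule L_cases_G)
  have gc: "\<gamma> <: A" using G_nz[OF a(2)] by simp
  have "fr \<one>\<^sub>A \<gamma> \<otimes>\<^sub>L to_frac A a = x" unfolding to_frac_def L_mult[OF A.one_closed G_nz[OF a(2)] a(1) one_nz] using a gc by simp
  then show "x : span_left L KK (to_frac A ` S)" using E(5)[OF fr_inv_K[OF a(2)] all[OF a(1)]] by simp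
 qed
qed

text \<open>Stated for a ring \<open>R\<close> with the additive structure of \<open>SA\<close> and
  a twist \<open>h\<close>, so that one proof serves both sides: \<open>R\<close> is
  \<open>SA\<close> with \<open>h\<close> the identity, or the opposite ring with \<open>h\<close>
  the extension of \<mu> to fractions.\<close>

lemma single_span:
 assumes S: "finite S" "S <= carrier A" "span_left A G S = carrier A"
  and R: "ring R" "carrier R = carrier SA" "!!x y. x \<oplus>\<^sub>R y = x \<oplus>\<^sub>SA y" "\<zero>\<^sub>R = \<zero>\<^sub>SA"
  and sub: "subring (sc ` KK) R" and \<mu>: "\<mu> : M"
  and h: "!!l. l <: L ==> h l <: L"
   "!!l l'. l <: L ==> l' <: L ==> h (l \<oplus>\<^sub>L l') = h l \<oplus>\<^sub>L h l'"
   "!!\<kappa> l. \<kappa> : KK ==> l <: L ==> single L \<mu> (h (\<kappa> \<otimes>\<^sub>L l)) = sc \<kappa> \<otimes>\<^sub>R single L \<mu> (h l)"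
  and T: "T <= carrier SA" "!!s. s : S ==> single L \<mu> (h (to_frac A s)) : T" and l: "l <: L"
 shows "single L \<mu> (h l) : span_left R (sc ` KK) T"
proof -
 interpret R: ring R by fact
 have Tc: "T <= carrier R" using T(1) R(2) by simp
 note sm = R.span_left_submod[OF sub Tc]
 note E = R.submodE[OF sm]
 let ?N = "{l : carrier L. single L \<mu> (h l) : span_left R (sc ` KK) T}"
 have z: "h \<zero>\<^sub>L = \<zero>\<^sub>L" using h(2)[of "\<zero>\<^sub>L" "\<zero>\<^sub>L"] h(1)[of "\<zero>\<^sub>L"] by simp
 have sadd: "single L \<mu> (h (x \<oplus>\<^sub>L y)) = single L \<mu> (h x) \<oplus>\<^sub>R single L \<mu> (h y)" if "x <: L" "y <: L" for x y
  using that h by (simp add: R(3) L.single_add)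
 have sz: "single L \<mu> (h \<zero>\<^sub>L) = \<zero>\<^sub>R" by (simp add: z R(4))
 have scl: "single L \<mu> (h x) <: R" if "x <: L" for x using single_SA[OF \<mu> h(1)[OF that]] R(2) by simp
 have "submod L KK ?N"
 proof (rule L.submodI)
  show "\<zero>\<^sub>L : ?N" using E(2) sz by simp
  fix x assume x: "x : ?N"
  then have xc: "x <: L" by simp
  show "x \<oplus>\<^sub>L y : ?N" if "y : ?N" for y using x that E(3) sadd by simp
  have "single L \<mu> (h (\<ominus>\<^sub>L x)) \<oplus>\<^sub>R single L \<mu> (h x) = \<zero>\<^sub>R"
   using sadd[of "\<ominus>\<^sub>L x" x] sz xc by (simp add: L.l_neg)
  then have "single L \<mu> (h (\<ominus>\<^sub>L x)) = \<ominus>\<^sub>R single L \<mu> (h x)"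
   using R.minus_equality[OF _ scl[OF xc] scl[of "\<ominus>\<^sub>L x"]] xc by simp
  then show "\<ominus>\<^sub>L x : ?N" using x E(4) by simp
  show "a \<otimes>\<^sub>L x : ?N" if a: "a : KK" for a using x K_closed[OF a] h(3)[OF a xc] E(5)[of "sc a" "single L \<mu> (h x)"] a by simp
 qed auto
 moreover have "to_frac A ` S <= ?N" using S(2) to_frac_closed T(2) R.span_left_incl[OF sub Tc] by auto
 ultimately have "span_left L KK (to_frac A ` S) <= ?N" by (rule L.span_left_minimal)
 then show ?thesis using l L_span[OF S] by blast
qed

text \<open>All elements supported in \<open>S\<close>, invariant or not, lie in the span of
  finitely many singles, one for each index in \<open>S\<close> and each generator of
  \<open>A\<close> over \<open>G\<close>. \<open>VS S\<close> is a subspace of this span, and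
  \<open>K\<close> is a field.\<close>

lemma VS_fg:
 assumes noeth: "noetherian_over A G" and S: "finite S" "S <= M"
 shows "fg_left SA (sc ` KK) (VS S)" "fg_right SA (sc ` KK) (VS S)"
proof -
 have "fg_left A G (carrier A)" using noeth A.submod_carrier[of G] subringE(1)[OF G_subring]
  unfolding noetherian_over_def submod_def by blast
 then obtain Q where Q: "finite Q" "Q <= carrier A" "span_left A G Q = carrier A" by (auto simp: fg_left_def)
 have main: "VS S <= span_left R (sc ` KK) T" if R: "ring R" "carrier R = carrier SA" "!!x y. x \<oplus>\<^sub>R y = x \<oplus>\<^sub>SA y" "\<zero>\<^sub>R = \<zero>\<^sub>SA"
  and sub: "subring (sc ` KK) R" and T: "T <= carrier SA"
  and single: "!!\<mu> l. \<mu> : S ==> l <: L ==> single L \<mu> l : span_left R (sc ` KK) T" for R T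
 proof
  interpret R: ring R by fact
  have Tc: "T <= carrier R" using T R(2) by simp
  note E = R.submodE[OF R.span_left_submod[OF sub Tc]]
  fix f assume f: "f : VS S"
  then have fc: "f <: SA" using VS_D(1) INV_D(1) by blast
  have "f : finsupp L S" by (rule L.finsuppI[of _ S]) (use SA_val[OF fc] VS_D(2)[OF f] S(1) in auto)
  then show "f : span_left R (sc ` KK) T"
  proof (induction rule: L.finsupp_induct)
   case zero then show ?case using E(2) R(4) by simp
  next
   case (single p l) then show ?case using that(7) by blast
  next
   case (add f g) then show ?case using E(3)[OF add(3,4)] by (simp add: R(3))
  qed
 qed
 show "fg_left SA (sc ` KK) (VS S)"
 proof -
  let ?T = "(\<lambda>(\<mu>, s). single L \<mu> (to_frac A s)) ` (S \<times> Q)"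
  have T: "?T <= carrier SA" using S(2) Q(2) by (auto simp del: SA_simps intro!: single_SA to_frac_closed)
  have single: "single L \<mu> l : span_left SA (sc ` KK) ?T" if m: "\<mu> : S" and l: "l <: L" for \<mu> l
  proof (rule single_span[where h="\<lambda>l. l", OF Q SA_ring refl refl refl scK_subring subsetD[OF S(2) m] _ _ _ T _ l])
   show "single L \<mu> (\<kappa> \<otimes>\<^sub>L l) = sc \<kappa> \<otimes>\<^sub>SA single L \<mu> l" if "\<kappa> : KK" "l <: L" for \<kappa> l
    using sc_mult_single(1)[OF K_closed[OF that(1)] subsetD[OF S(2) m] that(2)] by simp
   show "single L \<mu> (to_frac A s) : ?T" if "s : Q" for s using that m by force
  qed simp_all
  have "VS S <= span_left SA (sc ` KK) ?T" by (rule main[OF SA_ring refl refl refl scK_subring T single])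
  moreover have "noeth_on SA (sc ` KK) (span_left SA (sc ` KK) ?T)"
   by (rule SA.noeth_on_span_left[OF scK_subring scK_noeth _ T]) (use S(1) Q(1) in simp)
  ultimately show ?thesis using noeth_onD[OF _ VS_submod] by blast
 qed
 show "fg_right SA (sc ` KK) (VS S)" unfolding fg_right_op
 proof -
  interpret O: ring "op_ring SA" by (rule SA.op_ring)
  let ?T = "(\<lambda>(\<mu>, s). single L \<mu> (frac_map A \<mu> (to_frac A s))) ` (S \<times> Q)"
  have fm: "frac_map A \<mu> l <: L" if "\<mu> : S" "l <: L" for \<mu> l
   using frac_map_closed[OF Aut_alg_inj[OF M_Aut[OF subsetD[OF S(2) that(1)]]] that(2)] .
  have T: "?T <= carrier SA" using S(2) Q(2) by (auto simp del: SA_simps intro!: single_SA to_frac_closed fm)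
  have Tc: "?T <= carrier (op_ring SA)" using T by (simp only: op_ring_simps)
  have single: "single L \<mu> l : span_left (op_ring SA) (sc ` KK) ?T" if m: "\<mu> : S" and l: "l <: L" for \<mu> l
  proof -
   have mA: "\<mu> <: AA" by (rule M_Aut[OF subsetD[OF S(2) m]])
   note i = Aut_alg_inj[OF mA]
   \<comment> \<open>Right multiplication twists scalars by \<mu>, so the coefficient is written as
     the image under \<mu> of its preimage. The inverse of \<mu> exists as an automorphism, although
     it need not lie in \<open>M\<close>.\<close>
   let ?l = "frac_map A (inv\<^bsub>AA\<^esub> \<mu>) l"
   have lc: "?l <: L" using frac_map_closed[OF Aut_alg_inj[OF AG.inv_closed[OF mA]] l] .
   have "frac_map A \<mu> ?l = l" using frac_map_Aut_comp[OF mA AG.inv_closed[OF mA] l] frac_map_Aut_one[OF l] mA by simp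
   moreover have "single L \<mu> (frac_map A \<mu> ?l) : span_left (op_ring SA) (sc ` KK) ?T"
   proof (rule single_span[where h="frac_map A \<mu>", OF Q SA.op_ring _ _ _ scK_subring_op subsetD[OF S(2) m] fm[OF m] _ _ T _ lc])
    show "single L \<mu> (frac_map A \<mu> (\<kappa> \<otimes>\<^sub>L l)) = sc \<kappa> \<otimes>\<^bsub>op_ring SA\<^esub> single L \<mu> (frac_map A \<mu> l)" if "\<kappa> : KK" "l <: L" for \<kappa> l
    proof -
     have "frac_map A \<mu> (\<kappa> \<otimes>\<^sub>L l) = frac_map A \<mu> l \<otimes>\<^sub>L frac_map A \<mu> \<kappa>"
      using frac_map_props(2)[OF i that(2) K_closed[OF that(1)]] L.m_comm[OF that(2) K_closed[OF that(1)]] by simp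
     then show ?thesis using sc_mult_single(2)[OF K_closed[OF that(1)] subsetD[OF S(2) m] fm[OF m that(2)]] by (simp only: op_ring_simps)
    qed
    show "frac_map A \<mu> (l \<oplus>\<^sub>L l') = frac_map A \<mu> l \<oplus>\<^sub>L frac_map A \<mu> l'" if "l <: L" "l' <: L" for l l'
     by (rule frac_map_props(1)[OF i that])
    show "single L \<mu> (frac_map A \<mu> (to_frac A s)) : ?T" if "s : Q" for s using that m by force
   qed (simp_all only: op_ring_simps)
   ultimately show ?thesis by simp
  qed
  have "VS S <= span_left (op_ring SA) (sc ` KK) ?T" by (rule main[OF SA.op_ring _ _ _ scK_subring_op T single]) (simp_all only: op_ring_simps)
  moreover have "noeth_on (op_ring SA) (sc ` KK) (span_left (op_ring SA) (sc ` KK) ?T)"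
   by (rule O.noeth_on_span_left[OF scK_subring_op scK_noeth_op _ Tc]) (use S(1) Q(1) in simp)
  ultimately show "fg_left (op_ring SA) (sc ` KK) (VS S)" using noeth_onD[OF _ VS_submod_op] by blast
 qed
qed

text \<open>Membership in a span uses finitely many coefficients and persists over every subring
  that contains them. The elements with this property form a submodule, so no explicit sums are
  needed.\<close>

lemma span_finite_coeffs:
 assumes S: "S <= carrier A" and z: "z : span_left A G S"
 shows "EX F. finite F & F <= G & (ALL C. subring C A & F <= C --> z : span_left A C S)"
proof -
 let ?P = "\<lambda>z F. finite F & F <= G & (ALL C. subring C A & F <= C --> z : span_left A C S)"
 let ?N = "{z : carrier A. EX F. ?P z F}"
 have sp: "submod A C (span_left A C S)" if "subring C A" for C by (rule A.span_left_submod[OF that S])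
 have "submod A G ?N"
 proof (rule A.submodI)
  have "?P \<zero>\<^sub>A {}" using A.submodE(2)[OF sp] by simp
  then show "\<zero>\<^sub>A : ?N" by blast
  fix x assume x: "x : ?N"
  then obtain F where F: "x <: A" "?P x F" by blast
  have "?P (\<ominus>\<^sub>A x) F" using F(2) A.submodE(4)[OF sp] by blast
  then show "\<ominus>\<^sub>A x : ?N" using F(1) by blast
  { fix y assume "y : ?N"
   then obtain F' where F': "y <: A" "?P y F'" by blast
   have "?P (x \<oplus>\<^sub>A y) (F \<union> F')" using F(2) F'(2) A.submodE(3)[OF sp] by simp
   then show "x \<oplus>\<^sub>A y : ?N" using F(1) F'(1) by blast }
  { fix a assume a: "a : G"
   have "?P (a \<otimes>\<^sub>A x) (insert a F)" using F(2) a A.submodE(5)[OF sp] by simp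
   then show "a \<otimes>\<^sub>A x : ?N" using F(1) G_carrier[OF a] by blast }
 qed auto
 moreover have "S <= ?N"
 proof
  fix s assume s: "s : S"
  have "?P s {}" using A.span_left_incl[OF _ S s] by simp
  then show "s : ?N" using s S by blast
 qed
 ultimately have "span_left A G S <= ?N" by (rule A.span_left_minimal)
 then show ?thesis using z by blast
qed

text \<open>The algebra generators and the products of two module generators are combinations of
  module generators with finitely many coefficients from \<open>G\<close>. Over the subalgebra
  generated by these coefficients, the span of the module generators is closed under multiplication
  and contains all algebra generators, hence is everything.\<close>

theorem artin_tate:
 assumes aff: "affine_algebra k A" and noeth: "noetherian_over A G"
 obtains gs S where "set gs <= G" "finite S" "S <= carrier A" "span_left A (adjoins A scalars gs) S = carrier A"
proof -
 have "fg_left A G (carrier A)" using noeth A.submod_carrier[of G] subringE(1)[OF G_subring]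
  unfolding noetherian_over_def submod_def by blast
 then obtain Q where Q: "finite Q" "Q <= carrier A" "span_left A G Q = carrier A" by (auto simp: fg_left_def)
 \<comment> \<open>The unit is added so that the span becomes a unital ring containing the
   scalars.\<close>
 define S where "S = insert \<one>\<^sub>A Q"
 have S: "finite S" "S <= carrier A" using Q by (auto simp: S_def)
 have all: "span_left A G S = carrier A"
  using A.span_left_mono[OF G_subring S(2), of Q] Q(3) A.submodE(1)[OF A.span_left_submod[OF G_subring S(2)]] by (auto simp: S_def)
 obtain xs where xs: "set xs <= carrier A" "adjoins A scalars xs = carrier A" using affine_adjoins[OF aff] .
 define Z where "Z = set xs \<union> (\<lambda>(s, s'). s \<otimes>\<^sub>A s') ` (S \<times> S)"
 have Z: "finite Z" "Z <= carrier A" using S xs(1) by (auto simp: Z_def)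
 have "ALL z:Z. EX F. finite F & F <= G & (ALL C. subring C A & F <= C --> z : span_left A C S)"
  using span_finite_coeffs[OF S(2)] all Z(2) by blast
 then obtain F where F: "ALL z:Z. finite (F z) & F z <= G & (ALL C. subring C A & F z <= C --> z : span_left A C S)"
  using bchoice by (metis (no_types, lifting))
 have "finite (\<Union>z\<in>Z. F z)" using Z(1) F by blast
 then obtain gs where gs: "set gs = (\<Union>z\<in>Z. F z)" using finite_list by blast
 have gsG: "set gs <= G" unfolding gs using F by blast
 then have gsA: "set gs <= carrier A" using G_carrier by blast
 let ?C = "adjoins A scalars gs"
 have C: "subring ?C A" by (rule D.adjoins_subring[OF scalars_subring gsA])
 have inC: "scalars \<union> set gs <= ?C" by (rule D.adjoins_incl[OF scalars_subring gsA])
 let ?D = "span_left A ?C S"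
 note sm = A.span_left_submod[OF C S(2)]
 note E = A.submodE[OF sm]
 have ZD: "z : ?D" if "z : Z" for z
 proof -
  have "F z <= ?C" using inC gs that by blast
  then show ?thesis using F that C by blast
 qed
 have oneS: "\<one>\<^sub>A : ?D" by (rule A.span_left_incl[OF C S(2)]) (simp add: S_def)
 have D: "subring ?D A"
 proof (rule A.subringI[OF E(1) oneS E(4) _ E(3)])
  have 1: "?D <= {y : carrier A. s \<otimes>\<^sub>A y : ?D}" if s: "s : S" for s
  proof (rule A.span_left_minimal[OF D.submod_preimage[OF C sm]])
   show "s <: A" using s S by blast
   show "S <= {y : carrier A. s \<otimes>\<^sub>A y : ?D}" using S(2) ZD s by (force simp: Z_def)
  qed
  fix x y assume x: "x : ?D" and y: "y : ?D"
  have yc: "y <: A" using y E(1) by blast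
  have "?D <= {z : carrier A. y \<otimes>\<^sub>A z : ?D}"
  proof (rule A.span_left_minimal[OF D.submod_preimage[OF C sm yc]], rule subsetI)
   fix s assume s: "s : S"
   then have sc: "s <: A" using S by blast
   have "s \<otimes>\<^sub>A y : ?D" using 1[OF s] y by blast
   then show "s : {z : carrier A. y \<otimes>\<^sub>A z : ?D}" using sc D.m_comm[OF sc yc] by simp
  qed
  then have "y \<otimes>\<^sub>A x : ?D" using x by blast
  then show "x \<otimes>\<^sub>A y : ?D" using D.m_comm[of x y] yc x E(1) by auto
 qed
 have "scalars <= ?D"
 proof
  fix x assume x: "x : scalars"
  then have "x \<otimes>\<^sub>A \<one>\<^sub>A : ?D" using E(5)[OF _ oneS] inC by blast
  moreover have "x <: A" using x subringE(1)[OF scalars_subring] by blast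
  ultimately show "x : ?D" by simp
 qed
 moreover have "set xs <= ?D" using ZD by (auto simp: Z_def)
 ultimately have "adjoins A scalars xs <= ?D" by (rule D.adjoins_minimal[OF scalars_subring D])
 then have "carrier A <= ?D" using xs(2) by simp
 then have "?D = carrier A" using E(1) by blast
 then show ?thesis using that[OF gsG S] by blast
qed

end

section \<open>Tensor products of Galois rings\<close>

text \<open>The common frame for \<open>pt\<close> on the algebras and \<open>st\<close> on the skew
  algebras. The index type is the one in which \<open>indep_rep\<close> delivers its
  representations.\<close>

locale faithful_bilinear = A: kalg k A + B: kalg k B + C: kalg k C
 for k :: "('k, 'z) ring_scheme" and A :: "('k, 'a) module" and B :: "('k, 'b) module" and C :: "('k, 'c) module" +
 fixes \<beta> :: "'a => 'b => 'c"
 assumes bilin: "C.bilin A B \<beta>" and one: "\<beta> \<one>\<^sub>A \<one>\<^sub>B = \<one>\<^sub>C"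
  and mult: "!!a b a' b'. a <: A ==> b <: B ==> a' <: A ==> b' <: B ==>
   \<beta> (a \<otimes>\<^sub>A a') (b \<otimes>\<^sub>B b') = \<beta> a b \<otimes>\<^sub>C \<beta> a' b'"
  and left_faithful: "!!I x y j. finite (I :: ('a \<times> 'b) set) ==> (!!i. i : I ==> x i <: A) ==> (!!i. i : I ==> y i <: B) ==>
   B.indep I y ==> finsum C (\<lambda>i. \<beta> (x i) (y i)) I = \<zero>\<^sub>C ==> j : I ==> x j = \<zero>\<^sub>A"
  and right_faithful: "!!I x y j. finite (I :: ('a \<times> 'b) set) ==> (!!i. i : I ==> x i <: A) ==> (!!i. i : I ==> y i <: B) ==>
   A.indep I x ==> finsum C (\<lambda>i. \<beta> (x i) (y i)) I = \<zero>\<^sub>C ==> j : I ==> y j = \<zero>\<^sub>B"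
begin

lemma left_cancel:
 assumes I: "finite (I :: ('a \<times> 'b) set)" and x: "!!i. i : I ==> x i <: A" "!!i. i : I ==> x' i <: A"
  and y: "!!i. i : I ==> y i <: B" and ind: "B.indep I y"
  and eq: "finsum C (\<lambda>i. \<beta> (x i) (y i)) I = finsum C (\<lambda>i. \<beta> (x' i) (y i)) I" and j: "j : I"
 shows "x j = x' j"
proof -
 note D = C.bilinD[OF bilin]
 let ?d = "\<lambda>i. x i \<ominus>\<^sub>A x' i"
 have d: "?d i <: A" if "i : I" for i by (rule A.A.minus_closed[OF x(1)[OF that] x(2)[OF that]])
 have dx: "?d i \<oplus>\<^sub>A x' i = x i" if "i : I" for i by (rule A.A.diff_add_cancel[OF x(1)[OF that] x(2)[OF that]])
 have split: "\<beta> (x i) (y i) = \<beta> (?d i) (y i) \<oplus>\<^sub>C \<beta> (x' i) (y i)" if "i : I" for i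
  unfolding D(2)[OF d[OF that] x(2)[OF that] y[OF that], symmetric] dx[OF that] ..
 have c: "(\<lambda>i. \<beta> (?d i) (y i)) : I \<rightarrow> carrier C" "(\<lambda>i. \<beta> (x' i) (y i)) : I \<rightarrow> carrier C"
  using D(1) d x(2) y by auto
 have "finsum C (\<lambda>i. \<beta> (x i) (y i)) I = finsum C (\<lambda>i. \<beta> (?d i) (y i) \<oplus>\<^sub>C \<beta> (x' i) (y i)) I"
  by (rule C.A.finsum_cong') (use split D(1) d x(2) y in auto)
 also have "\<dots> = finsum C (\<lambda>i. \<beta> (?d i) (y i)) I \<oplus>\<^sub>C finsum C (\<lambda>i. \<beta> (x' i) (y i)) I"
  by (rule C.A.finsum_addf[OF c])
 finally have "finsum C (\<lambda>i. \<beta> (?d i) (y i)) I \<oplus>\<^sub>C finsum C (\<lambda>i. \<beta> (x' i) (y i)) I = \<zero>\<^sub>C \<oplus>\<^sub>C finsum C (\<lambda>i. \<beta> (x' i) (y i)) I"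
  using eq C.A.finsum_closed[OF c(2)] by simp
 then have "finsum C (\<lambda>i. \<beta> (?d i) (y i)) I = \<zero>\<^sub>C"
  using C.A.add.right_cancel[OF C.A.finsum_closed[OF c(2)] C.A.finsum_closed[OF c(1)] C.A.zero_closed] by simp
 then have "?d j = \<zero>\<^sub>A" using left_faithful[OF I d y ind _ j] by simp
 then show ?thesis using x j by simp
qed

lemma right_cancel:
 assumes I: "finite (I :: ('a \<times> 'b) set)" and x: "!!i. i : I ==> x i <: A"
  and y: "!!i. i : I ==> y i <: B" "!!i. i : I ==> y' i <: B" and ind: "A.indep I x"
  and eq: "finsum C (\<lambda>i. \<beta> (x i) (y i)) I = finsum C (\<lambda>i. \<beta> (x i) (y' i)) I" and j: "j : I"
 shows "y j = y' j"
proof -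
 note D = C.bilinD[OF bilin]
 let ?d = "\<lambda>i. y i \<ominus>\<^sub>B y' i"
 have d: "?d i <: B" if "i : I" for i by (rule B.A.minus_closed[OF y(1)[OF that] y(2)[OF that]])
 have dx: "?d i \<oplus>\<^sub>B y' i = y i" if "i : I" for i by (rule B.A.diff_add_cancel[OF y(1)[OF that] y(2)[OF that]])
 have split: "\<beta> (x i) (y i) = \<beta> (x i) (?d i) \<oplus>\<^sub>C \<beta> (x i) (y' i)" if "i : I" for i
  unfolding D(3)[OF x[OF that] d[OF that] y(2)[OF that], symmetric] dx[OF that] ..
 have c: "(\<lambda>i. \<beta> (x i) (?d i)) : I \<rightarrow> carrier C" "(\<lambda>i. \<beta> (x i) (y' i)) : I \<rightarrow> carrier C"
  using D(1) d y(2) x by auto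
 have "finsum C (\<lambda>i. \<beta> (x i) (y i)) I = finsum C (\<lambda>i. \<beta> (x i) (?d i) \<oplus>\<^sub>C \<beta> (x i) (y' i)) I"
  by (rule C.A.finsum_cong') (use split D(1) d y(2) x in auto)
 also have "\<dots> = finsum C (\<lambda>i. \<beta> (x i) (?d i)) I \<oplus>\<^sub>C finsum C (\<lambda>i. \<beta> (x i) (y' i)) I"
  by (rule C.A.finsum_addf[OF c])
 finally have "finsum C (\<lambda>i. \<beta> (x i) (?d i)) I \<oplus>\<^sub>C finsum C (\<lambda>i. \<beta> (x i) (y' i)) I = \<zero>\<^sub>C \<oplus>\<^sub>C finsum C (\<lambda>i. \<beta> (x i) (y' i)) I"
  using eq C.A.finsum_closed[OF c(2)] by simp
 then have "finsum C (\<lambda>i. \<beta> (x i) (?d i)) I = \<zero>\<^sub>C"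
  using C.A.add.right_cancel[OF C.A.finsum_closed[OF c(2)] C.A.finsum_closed[OF c(1)] C.A.zero_closed] by simp
 then have "?d j = \<zero>\<^sub>B" using right_faithful[OF I x d ind _ j] by simp
 then show ?thesis using y j by simp
qed

text \<open>\<phi> acts as \<open>f\<close> on first factors. Comparing the sum with its image,
  independence of the second family makes the first factors agree one by one.\<close>

lemma fixed_left:
 assumes I: "finite (I :: ('a \<times> 'b) set)" and x: "!!i. i : I ==> x i <: A"
  and y: "!!i. i : I ==> y i <: B" and ind: "B.indep I y"
  and f: "!!a. a <: A ==> f a <: A" and \<phi>: "!!c. c <: C ==> \<phi> c <: C"
  and add: "!!c d. c <: C ==> d <: C ==> \<phi> (c \<oplus>\<^sub>C d) = \<phi> c \<oplus>\<^sub>C \<phi> d"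
  and \<phi>f: "!!a b. a <: A ==> b <: B ==> \<phi> (\<beta> a b) = \<beta> (f a) b"
  and eq: "\<phi> (finsum C (\<lambda>i. \<beta> (x i) (y i)) I) = finsum C (\<lambda>i. \<beta> (x i) (y i)) I" and j: "j : I"
 shows "f (x j) = x j"
proof (rule left_cancel[where x="\<lambda>i. f (x i)" and x'=x and y=y, OF I f[OF x] x y ind _ j])
 note D = C.bilinD[OF bilin]
 have "\<phi> (finsum C (\<lambda>i. \<beta> (x i) (y i)) I) = finsum C (\<lambda>i. \<phi> (\<beta> (x i) (y i))) I"
  by (rule finsum_hom[OF C.A.abelian_group_axioms C.A.abelian_group_axioms \<phi> add D(1)[OF x y] I])
 also have "\<dots> = finsum C (\<lambda>i. \<beta> (f (x i)) (y i)) I"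
  by (rule C.A.finsum_cong') (use \<phi>f D(1) f x y in auto)
 finally show "finsum C (\<lambda>i. \<beta> (f (x i)) (y i)) I = finsum C (\<lambda>i. \<beta> (x i) (y i)) I" using eq by simp
qed

lemma fixed_right:
 assumes I: "finite (I :: ('a \<times> 'b) set)" and x: "!!i. i : I ==> x i <: A"
  and y: "!!i. i : I ==> y i <: B" and ind: "A.indep I x"
  and f: "!!a. a <: B ==> f a <: B" and \<phi>: "!!c. c <: C ==> \<phi> c <: C"
  and add: "!!c d. c <: C ==> d <: C ==> \<phi> (c \<oplus>\<^sub>C d) = \<phi> c \<oplus>\<^sub>C \<phi> d"
  and \<phi>f: "!!a b. a <: A ==> b <: B ==> \<phi> (\<beta> a b) = \<beta> a (f b)"
  and eq: "\<phi> (finsum C (\<lambda>i. \<beta> (x i) (y i)) I) = finsum C (\<lambda>i. \<beta> (x i) (y i)) I" and j: "j : I"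
 shows "f (y j) = y j"
proof (rule right_cancel[where y="\<lambda>i. f (y i)" and y'=y and x=x, OF I x f[OF y] y ind _ j])
 note D = C.bilinD[OF bilin]
 have "\<phi> (finsum C (\<lambda>i. \<beta> (x i) (y i)) I) = finsum C (\<lambda>i. \<phi> (\<beta> (x i) (y i))) I"
  by (rule finsum_hom[OF C.A.abelian_group_axioms C.A.abelian_group_axioms \<phi> add D(1)[OF x y] I])
 also have "\<dots> = finsum C (\<lambda>i. \<beta> (x i) (f (y i))) I"
  by (rule C.A.finsum_cong') (use \<phi>f D(1) f x y in auto)
 finally show "finsum C (\<lambda>i. \<beta> (x i) (f (y i))) I = finsum C (\<lambda>i. \<beta> (x i) (y i)) I" using eq by simp
qed

end

section \<open>Images of tensor products of subalgebras\<close>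

locale sub_bilinear = faithful_bilinear k A B C \<beta>
 for k :: "('k, 'z) ring_scheme" and A :: "('k, 'a) module" and B :: "('k, 'b) module" and C :: "('k, 'c) module" and \<beta> +
 fixes S S'
 assumes S: "k_subalgebra k S A" and S': "k_subalgebra k S' B"
begin

interpretation E: bilin_lift k "A\<lparr>carrier := S\<rparr>" "B\<lparr>carrier := S'\<rparr>" C
 by (intro bilin_lift.intro tensor_alg.intro kalg_sub[OF A.kalg_axioms S] kalg_sub[OF B.kalg_axioms S'] C.vspace_axioms)

abbreviation Im where "Im \<equiv> tensor_lift k C \<beta> ` carrier (tensor k (A\<lparr>carrier := S\<rparr>) (B\<lparr>carrier := S'\<rparr>))"

lemma S_sub: "a : S ==> a <: A" and S'_sub: "b : S' ==> b <: B"
 using S S' subringE(1) unfolding k_subalgebra_def by blast+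

lemma bilin_sub: "C.bilin (A\<lparr>carrier := S\<rparr>) (B\<lparr>carrier := S'\<rparr>) \<beta>"
 by (rule C.bilinI) (simp_all add: S_sub S'_sub C.bilinD[OF bilin])

lemma embedding: "algebra_embedding k (tensor k (A\<lparr>carrier := S\<rparr>) (B\<lparr>carrier := S'\<rparr>)) C (tensor_lift k C \<beta>)"
 unfolding algebra_embedding_def
proof (intro conjI ballI)
 show "tensor_lift k C \<beta> : ring_hom (tensor k (A\<lparr>carrier := S\<rparr>) (B\<lparr>carrier := S'\<rparr>)) C"
 proof (rule ring_hom_memI)
  have 1: "\<one>\<^sub>A <: (A\<lparr>carrier := S\<rparr>)" "\<one>\<^sub>B <: (B\<lparr>carrier := S'\<rparr>)"
   using S S' subringE(3) unfolding k_subalgebra_def by auto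
  show "tensor_lift k C \<beta> \<one>\<^sub>E.T = \<one>\<^sub>C" using E.L_pt[OF bilin_sub 1] E.pt_one one by simp
  fix x y assume x: "x <: E.T" and y: "y <: E.T"
  show "tensor_lift k C \<beta> x <: C" by (rule E.L_closed[OF bilin_sub x])
  show "tensor_lift k C \<beta> (x \<oplus>\<^sub>E.T y) = tensor_lift k C \<beta> x \<oplus>\<^sub>C tensor_lift k C \<beta> y" by (rule E.L_add[OF bilin_sub x y])
  show "tensor_lift k C \<beta> (x \<otimes>\<^sub>E.T y) = tensor_lift k C \<beta> x \<otimes>\<^sub>C tensor_lift k C \<beta> y"
   by (rule E.L_mult[OF bilin_sub C.A.ring_axioms _ x y]) (simp add: mult S_sub S'_sub)
 qed
 show "tensor_lift k C \<beta> (c \<odot>\<^sub>E.T t) = c \<odot>\<^sub>C tensor_lift k C \<beta> t" if "c <: k" "t <: E.T" for c t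
  by (rule E.L_smult[OF bilin_sub that])
 show "inj_on (tensor_lift k C \<beta>) (carrier E.T)"
 proof (rule E.L_inj[OF bilin_sub])
  fix I :: "('a \<times> 'b) set" and x y j
  assume I: "finite I" and x: "!!i. i : I ==> x i <: (A\<lparr>carrier := S\<rparr>)" and y: "!!i. i : I ==> y i <: (B\<lparr>carrier := S'\<rparr>)"
   and ind: "vspace.indep k (B\<lparr>carrier := S'\<rparr>) I y" and z: "finsum C (\<lambda>i. \<beta> (x i) (y i)) I = \<zero>\<^sub>C" and j: "j : I"
  have y': "y i : S'" if "i : I" for i using y[OF that] by simp
  have x': "x i <: A" if "i : I" for i using x[OF that] S_sub by simp
  have ind': "B.indep I y" using indep_sub[where y=y, OF B.kalg_axioms S' I y'] ind by blast
  have "x j = \<zero>\<^sub>A" by (rule left_faithful[where x=x and y=y, OF I x' S'_sub[OF y'] ind' z j])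
  then show "x j = \<zero>\<^bsub>A\<lparr>carrier := S\<rparr>\<^esub>" by simp
 qed
qed

lemma Im_hom: "tensor_lift k C \<beta> : ring_hom E.T C"
 using embedding by (simp add: algebra_embedding_def)

lemma Im_subring: "subring Im C"
proof -
 interpret H: ring_hom_ring E.T C "tensor_lift k C \<beta>"
  by (rule ring_hom_ringI2[OF E.T_ring C.A.ring_axioms Im_hom])
 show ?thesis using H.img_is_subring[OF E.T.carrier_is_subring] .
qed

lemma Im_subalgebra: "k_subalgebra k Im C"
 unfolding k_subalgebra_def
proof (intro conjI ballI)
 show "subring Im C" by (rule Im_subring)
 fix c b assume c: "c <: k" and "b : Im"
 then obtain t where t: "t <: E.T" "b = tensor_lift k C \<beta> t" by blast
 have "c \<odot>\<^sub>C b = tensor_lift k C \<beta> (c \<odot>\<^sub>E.T t)" unfolding t(2) by (rule E.L_smult[OF bilin_sub c t(1), symmetric])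
 moreover have "c \<odot>\<^sub>E.T t <: E.T" by (rule E.TA.V.smult_closed[OF c t(1)])
 ultimately show "c \<odot>\<^sub>C b : Im" by blast
qed

lemma Im_beta: "a : S ==> b : S' ==> \<beta> a b : Im"
 using E.L_pt[OF bilin_sub, of a b] imageI[OF E.pt_closed[of a b], of "tensor_lift k C \<beta>"] by simp

lemma Im_induct [consumes 1, case_names zero beta add]:
 assumes z: "z : Im" and zero: "P \<zero>\<^sub>C" and beta: "!!a b. a : S ==> b : S' ==> P (\<beta> a b)"
  and add: "!!u v. u : Im ==> v : Im ==> P u ==> P v ==> P (u \<oplus>\<^sub>C v)"
 shows "P z"
proof -
 obtain t where t: "t <: E.T" "z = tensor_lift k C \<beta> t" using z by blast
 have "P (tensor_lift k C \<beta> t)" using t(1)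
 proof (induction rule: E.T_induct)
  case zero then show ?case using assms(2) E.L_zero[OF bilin_sub] by simp
 next
  case (pt a b) then show ?case using beta[of a b] E.L_pt[OF bilin_sub, of a b] by simp
 next
  case (add s t)
  show ?case unfolding E.L_add[OF bilin_sub add(1,2)] by (rule assms(4)[OF imageI[OF add(1)] imageI[OF add(2)] add(3,4)])
 qed
 then show ?thesis using t by simp
qed

lemma Im_finsum:
 assumes I: "finite I" and x: "!!i. i : I ==> x i : S" and y: "!!i. i : I ==> y i : S'"
 shows "finsum C (\<lambda>i. \<beta> (x i) (y i)) I : Im"
proof -
 have x': "x i <: (A\<lparr>carrier := S\<rparr>)" if "i : I" for i using x[OF that] by simp
 have y': "y i <: (B\<lparr>carrier := S'\<rparr>)" if "i : I" for i using y[OF that] by simp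
 have "finsum E.T (\<lambda>i. E.pt (x i) (y i)) I <: E.T" by (rule E.T.finsum_closed) (use E.pt_closed[OF x' y'] in auto)
 from imageI[OF this, of "tensor_lift k C \<beta>"] show ?thesis
  using E.L_finsum[where x=x and y=y, OF bilin_sub I x' y'] by simp
qed

lemma Im_rep:
 assumes z: "z : Im"
 obtains I :: "('a \<times> 'b) set" and x y where "finite I" "!!i. i : I ==> x i : S" "!!i. i : I ==> y i : S'"
  "A.indep I x" "B.indep I y" "z = finsum C (\<lambda>i. \<beta> (x i) (y i)) I"
proof -
 obtain t where t: "t <: E.T" "z = tensor_lift k C \<beta> t" using z by blast
 obtain I :: "('a \<times> 'b) set" and x y where r: "E.rep t I x y" "vspace.indep k (A\<lparr>carrier := S\<rparr>) I x" "vspace.indep k (B\<lparr>carrier := S'\<rparr>) I y"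
  by (rule E.indep_rep[OF t(1)])
 have I: "finite I" and xy: "!!i. i : I ==> x i : S" "!!i. i : I ==> y i : S'" and te: "t = finsum E.T (\<lambda>i. E.pt (x i) (y i)) I"
  using r(1) unfolding E.rep_def by auto
 have x': "x i <: (A\<lparr>carrier := S\<rparr>)" if "i : I" for i using xy(1)[OF that] by simp
 have y': "y i <: (B\<lparr>carrier := S'\<rparr>)" if "i : I" for i using xy(2)[OF that] by simp
 have ix: "A.indep I x" using indep_sub[where y=x, OF A.kalg_axioms S I xy(1)] r(2) by blast
 have iy: "B.indep I y" using indep_sub[where y=y, OF B.kalg_axioms S' I xy(2)] r(3) by blast
 have ze: "z = finsum C (\<lambda>i. \<beta> (x i) (y i)) I" unfolding t(2) te by (rule E.L_finsum[where x=x and y=y, OF bilin_sub I x' y'])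
 show ?thesis by (rule that[of I x y]) (fact I xy ix iy ze)+
qed

end

lemma (in tensor_alg) pt_faithful: "faithful_bilinear k A B T pt"
proof (intro faithful_bilinear.intro faithful_bilinear_axioms.intro A.kalg_axioms B.kalg_axioms T_kalg)
 show "TA.bilin A B pt" by (rule pt_bilin)
 show "pt \<one>\<^sub>A \<one>\<^sub>B = \<one>\<^sub>T" by (rule pt_one)
next
 fix a b a' b' assume "a <: A" "b <: B" "a' <: A" "b' <: B"
 then show "pt (a \<otimes>\<^sub>A a') (b \<otimes>\<^sub>B b') = pt a b \<otimes>\<^sub>T pt a' b'" by (rule pt_mult[symmetric])
next
 fix I :: "('a \<times> 'b) set" and x y j
 assume "finite I" "!!i. i : I ==> x i <: A" "!!i. i : I ==> y i <: B"
  "B.indep I y" "finsum T (\<lambda>i. pt (x i) (y i)) I = \<zero>\<^sub>T" "j : I"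
 then show "x j = \<zero>\<^sub>A" by (rule pure_left_faithful)
next
 fix I :: "('a \<times> 'b) set" and x y j
 assume "finite I" "!!i. i : I ==> x i <: A" "!!i. i : I ==> y i <: B"
  "A.indep I x" "finsum T (\<lambda>i. pt (x i) (y i)) I = \<zero>\<^sub>T" "j : I"
 then show "y j = \<zero>\<^sub>B" by (rule pure_right_faithful)
qed

lemma (in skew_pair) st_faithful: "faithful_bilinear k MA.SA MB.SA MT.SA st"
proof (intro faithful_bilinear.intro faithful_bilinear_axioms.intro MA.SA_kalg MB.SA_kalg MT.SA_kalg)
 show "MT.SAA.bilin MA.SA MB.SA st" by (rule st_bilin)
 show "st \<one>\<^sub>MA.SA \<one>\<^sub>MB.SA = \<one>\<^sub>MT.SA" by (rule st_one)
next
 fix a b a' b' assume a: "a <: MA.SA" "b <: MB.SA" "a' <: MA.SA" "b' <: MB.SA"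
 show "st (a \<otimes>\<^sub>MA.SA a') (b \<otimes>\<^sub>MB.SA b') = st a b \<otimes>\<^sub>MT.SA st a' b'" by (rule st_mult[OF a(1,3,2,4)])
next
 fix I :: "('a, 'b) skew_index set" and x y j
 assume "finite I" "!!i. i : I ==> x i <: MA.SA" "!!i. i : I ==> y i <: MB.SA"
  "MB.SAA.indep I y" "finsum MT.SA (\<lambda>i. st (x i) (y i)) I = \<zero>\<^sub>MT.SA" "j : I"
 then show "x j = \<zero>\<^sub>MA.SA" by (rule st_left_faithful)
next
 fix I :: "('a, 'b) skew_index set" and x y j
 assume "finite I" "!!i. i : I ==> x i <: MA.SA" "!!i. i : I ==> y i <: MB.SA"
  "MA.SAA.indep I x" "finsum MT.SA (\<lambda>i. st (x i) (y i)) I = \<zero>\<^sub>MT.SA" "j : I"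
 then show "y j = \<zero>\<^sub>MB.SA" by (rule st_right_faithful)
qed

text \<open>An ideal is in particular a \<open>C\<close>-submodule, and its finitely many generators
  over \<open>C\<close> generate it as an ideal.\<close>

lemma (in cring) noetherian_ring_noeth_on:
 assumes sub: "subring C R" and n: "noeth_on R C (carrier R)"
 shows "noetherian_ring R"
proof (rule noetherian_ringI)
 note C = subringE(1)[OF sub]
 fix I assume I: "ideal I R"
 interpret I: ideal I R by fact
 have "submod R C I"
  by (rule submodI) (use I.a_subset I.zero_closed I.a_closed I.a_inv_closed I.I_l_closed C in auto)
 then have "fg_left R C I" by (rule noeth_onD[OF n _ I.a_subset])
 then obtain S where S: "finite S" "S <= carrier R" "I = span_left R C S" unfolding fg_left_def by blast
 interpret J: ideal "Idl S" R by (rule genideal_ideal[OF S(2)])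
 have "submod R C (Idl S)"
  by (rule submodI) (use J.a_subset J.zero_closed J.a_closed J.a_inv_closed J.I_l_closed C in auto)
 then have 1: "I <= Idl S" unfolding S(3) by (rule span_left_minimal[OF _ genideal_self[OF S(2)]])
 moreover have "Idl S <= I" by (rule genideal_minimal[OF I]) (use span_left_incl[OF sub S(2)] S(3) in blast)
 ultimately show "EX A<=carrier R. finite A & I = Idl A" using S(1,2) by blast
qed

text \<open>Membership of \<open>\<beta> x y\<close> in a span is linear in each argument, so
  generators suffice, one argument at a time. A coefficient on one side is paired with the unit on
  the other, which is why \<open>C1\<close> and \<open>C2\<close> must contain the units. The rings
  are arbitrary so that opposite rings are covered.\<close>

lemma bilinear_span:
 assumes R1: "ring R1" and R2: "ring R2" and R: "ring R"
  and closed: "!!x y. x <: R1 ==> y <: R2 ==> \<beta> x y <: R"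
  and add1: "!!x x' y. x <: R1 ==> x' <: R1 ==> y <: R2 ==> \<beta> (x \<oplus>\<^sub>R1 x') y = \<beta> x y \<oplus>\<^sub>R \<beta> x' y"
  and add2: "!!x y y'. x <: R1 ==> y <: R2 ==> y' <: R2 ==> \<beta> x (y \<oplus>\<^sub>R2 y') = \<beta> x y \<oplus>\<^sub>R \<beta> x y'"
  and mult: "!!a b x y. a : C1 ==> b : C2 ==> x <: R1 ==> y <: R2 ==>
   \<beta> (a \<otimes>\<^sub>R1 x) (b \<otimes>\<^sub>R2 y) = \<beta> a b \<otimes>\<^sub>R \<beta> x y"
  and C1: "C1 <= carrier R1" "\<one>\<^sub>R1 : C1" and C2: "C2 <= carrier R2" "\<one>\<^sub>R2 : C2"
  and C: "!!a b. a : C1 ==> b : C2 ==> \<beta> a b : C" "subring C R"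
  and Q1: "Q1 <= carrier R1" and Q2: "Q2 <= carrier R2"
  and Q: "!!q q'. q : Q1 ==> q' : Q2 ==> \<beta> q q' : Q" "Q <= carrier R"
  and x: "x : span_left R1 C1 Q1" "x <: R1" and y: "y : span_left R2 C2 Q2" "y <: R2"
 shows "\<beta> x y : span_left R C Q"
proof -
 interpret R1: ring R1 by fact
 interpret R2: ring R2 by fact
 interpret R: ring R by fact
 note E = R.submodE[OF R.span_left_submod[OF C(2) Q(2)]]
 have z1: "\<beta> \<zero>\<^sub>R1 y = \<zero>\<^sub>R" if "y <: R2" for y
  using add1[OF R1.zero_closed R1.zero_closed that] closed[OF R1.zero_closed that] by simp
 have z2: "\<beta> x \<zero>\<^sub>R2 = \<zero>\<^sub>R" if "x <: R1" for x
  using add2[OF that R2.zero_closed R2.zero_closed] closed[OF that R2.zero_closed] by simp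
 have n1: "\<beta> (\<ominus>\<^sub>R1 x) y = \<ominus>\<^sub>R \<beta> x y" if "x <: R1" "y <: R2" for x y
  using R.minus_equality[OF _ closed[OF that] closed[OF R1.a_inv_closed[OF that(1)] that(2)]]
   add1[OF R1.a_inv_closed[OF that(1)] that] z1[OF that(2)] R1.l_neg[OF that(1)] by simp
 have n2: "\<beta> x (\<ominus>\<^sub>R2 y) = \<ominus>\<^sub>R \<beta> x y" if "x <: R1" "y <: R2" for x y
  using R.minus_equality[OF _ closed[OF that] closed[OF that(1) R2.a_inv_closed[OF that(2)]]]
   add2[OF that(1) R2.a_inv_closed[OF that(2)] that(2)] z2[OF that(1)] R2.l_neg[OF that(2)] by simp
 let ?N = "span_left R C Q"
 have step: "\<beta> x q : ?N" if q: "q : Q2" and x: "x : span_left R1 C1 Q1" "x <: R1" for x q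
 proof -
  have qc: "q <: R2" using q Q2 by blast
  have "submod R1 C1 {x : carrier R1. \<beta> x q : ?N}"
  proof (rule R1.submodI)
   show "\<zero>\<^sub>R1 : {x : carrier R1. \<beta> x q : ?N}" using z1[OF qc] E(2) by simp
   fix u assume u: "u : {x : carrier R1. \<beta> x q : ?N}"
   then have uc: "u <: R1" by blast
   show "\<ominus>\<^sub>R1 u : {x : carrier R1. \<beta> x q : ?N}" using u E(4) n1[OF uc qc] by simp
   show "u \<oplus>\<^sub>R1 v : {x : carrier R1. \<beta> x q : ?N}" if "v : {x : carrier R1. \<beta> x q : ?N}" for v
    using u that E(3) add1[OF uc _ qc] by simp
   show "a \<otimes>\<^sub>R1 u : {x : carrier R1. \<beta> x q : ?N}" if a: "a : C1" for a
   proof -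
    have "\<beta> (a \<otimes>\<^sub>R1 u) q = \<beta> a \<one>\<^sub>R2 \<otimes>\<^sub>R \<beta> u q" using mult[OF a C2(2) uc qc] qc by simp
    then show ?thesis using E(5)[OF C(1)[OF a C2(2)]] u R1.m_closed[OF subsetD[OF C1(1) a] uc] by simp
   qed
  qed auto
  moreover have "Q1 <= {x : carrier R1. \<beta> x q : ?N}" using Q1 R.span_left_incl[OF C(2) Q(2) Q(1)[OF _ q]] by blast
  ultimately have "span_left R1 C1 Q1 <= {x : carrier R1. \<beta> x q : ?N}" by (rule R1.span_left_minimal)
  then show ?thesis using x by blast
 qed
 have "submod R2 C2 {y : carrier R2. \<beta> x y : ?N}"
 proof (rule R2.submodI)
  show "\<zero>\<^sub>R2 : {y : carrier R2. \<beta> x y : ?N}" using z2[OF x(2)] E(2) by simp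
  fix u assume u: "u : {y : carrier R2. \<beta> x y : ?N}"
  then have uc: "u <: R2" by blast
  show "\<ominus>\<^sub>R2 u : {y : carrier R2. \<beta> x y : ?N}" using u E(4) n2[OF x(2) uc] by simp
  show "u \<oplus>\<^sub>R2 v : {y : carrier R2. \<beta> x y : ?N}" if "v : {y : carrier R2. \<beta> x y : ?N}" for v
   using u that E(3) add2[OF x(2) uc] by simp
  show "a \<otimes>\<^sub>R2 u : {y : carrier R2. \<beta> x y : ?N}" if a: "a : C2" for a
  proof -
   have "\<beta> x (a \<otimes>\<^sub>R2 u) = \<beta> \<one>\<^sub>R1 a \<otimes>\<^sub>R \<beta> x u" using mult[OF C1(2) a x(2) uc] x(2) by simp
   then show ?thesis using E(5)[OF C(1)[OF C1(2) a]] u R2.m_closed[OF subsetD[OF C2(1) a] uc] by simp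
  qed
 qed auto
 moreover have "Q2 <= {y : carrier R2. \<beta> x y : ?N}" using Q2 step[OF _ x] by blast
 ultimately have "span_left R2 C2 Q2 <= {y : carrier R2. \<beta> x y : ?N}" by (rule R2.span_left_minimal)
 then show ?thesis using y by blast
qed

lemma subring_preimage:
 assumes "ring A" "ring R" "h : ring_hom A R" and C: "subring C R"
 shows "subring {a : carrier A. h a : C} A"
proof -
 interpret ring_hom_ring A R h by (rule ring_hom_ringI2[OF assms(1-3)])
 show ?thesis by (rule R.subringI) (use subringE[OF C] in auto)
qed

section \<open>The Galois ring setting on the tensor product\<close>

locale setting_pair = skew_pair k A B M1 M2
 for k :: "('k, 'z) ring_scheme" and A :: "('k, 'a) module" and B :: "('k, 'b) module" and M1 M2 +
 fixes W1 :: "('a => 'a) set" and W2 :: "('b => 'b) set"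
 assumes setting1: "setting k A M1 W1" and setting2: "setting k B M2 W2"
begin

interpretation S1: setting k A M1 W1 by (rule setting1)
interpretation S2: setting k B M2 W2 by (rule setting2)

abbreviation W where "W \<equiv> tensor_maps k A B W1 W2"

lemma W_eq: "W = {tm w v | w v. w : W1 & v : W2}"
 by (simp add: tensor_maps_def tm_def)

lemma tm_W: "w : W1 ==> v : W2 ==> tm w v : W" unfolding W_eq by blast

lemma W_cases: "\<rho> : W ==> (!!w v. w : W1 ==> v : W2 ==> \<rho> = tm w v ==> thesis) ==> thesis"
 unfolding W_eq by blast

lemma one_W1: "\<one>\<^sub>DA.AA : W1" and one_W2: "\<one>\<^sub>DB.AA : W2"
 by (rule subgroup.one_closed[OF S1.W_subgroup], rule subgroup.one_closed[OF S2.W_subgroup])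

interpretation PT: faithful_bilinear k A B T pt by (rule pt_faithful)
interpretation PG: sub_bilinear k A B T pt S1.G S2.G
 by (intro sub_bilinear.intro sub_bilinear_axioms.intro PT.faithful_bilinear_axioms S1.G_subalgebra S2.G_subalgebra)

lemma tm_pt_W: "w : W1 ==> v : W2 ==> a <: A ==> b <: B ==> tm w v (pt a b) = pt (w a) (v b)"
 by (rule tm_pt[OF S1.Winj S2.Winj])

text \<open>In an independent representation of an invariant tensor, the automorphisms acting only
  on the first factor fix every \<open>x i\<close>, and those acting only on the second factor fix
  every \<open>y i\<close>. The other inclusion holds on pure tensors.\<close>

lemma fixed_T: "PG.Im = fixed_elements T W"
proof
 show "PG.Im <= fixed_elements T W"
 proof
  fix z assume z: "z : PG.Im"
  have "z <: T & (ALL w:W1. ALL v:W2. tm w v z = z)" using z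
  proof (induction rule: PG.Im_induct)
   case zero then show ?case using tm_hom(5)[OF S1.Winj S2.Winj] by simp
  next
   case (beta a b)
   have c: "a <: A" "b <: B" using beta S1.G_carrier S2.G_carrier by blast+
   have "tm w v (pt a b) = pt a b" if "w : W1" "v : W2" for w v
    unfolding tm_pt_W[OF that c] S1.G_fix[OF beta(1) that(1)] S2.G_fix[OF beta(2) that(2)] ..
   then show ?case using pt_closed[OF c] by blast
  next
   case (add u v) then show ?case using tm_hom(2)[OF S1.Winj S2.Winj] by simp
  qed
  then show "z : fixed_elements T W" unfolding fixed_elements_def W_eq by blast
 qed
 show "fixed_elements T W <= PG.Im"
 proof
  fix z assume "z : fixed_elements T W"
  then have zT: "z <: T" and fx: "!!w v. w : W1 ==> v : W2 ==> tm w v z = z"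
   unfolding fixed_elements_def W_eq by blast+
  obtain I :: "('a \<times> 'b) set" and x y where r: "rep z I x y" "A.indep I x" "B.indep I y" by (rule indep_rep[OF zT])
  have I: "finite I" and x: "!!i. i : I ==> x i <: A" and y: "!!i. i : I ==> y i <: B"
   and ze: "z = finsum T (\<lambda>i. pt (x i) (y i)) I" using r(1) unfolding rep_def by auto
  have xG: "x i : S1.G" if i: "i : I" for i
  proof (rule S1.GI[OF x[OF i]])
   fix w assume w: "w : W1"
   note h = tm_hom[OF S1.Winj[OF w] S2.Winj[OF one_W2]]
   show "w (x i) = x i"
   proof (rule PT.fixed_left[where \<phi>="tm w \<one>\<^sub>DB.AA" and x=x and y=y and f=w, OF I x y r(3) _ h(1,2) _ _ i])
    show "w a <: A" if "a <: A" for a using DA.alg_injD(1)[OF S1.Winj[OF w] that] .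
    show "tm w \<one>\<^sub>DB.AA (pt a b) = pt (w a) b" if "a <: A" "b <: B" for a b
     using tm_pt_W[OF w one_W2 that] that(2) by (simp add: DB.Aut_one)
    show "tm w \<one>\<^sub>DB.AA (finsum T (\<lambda>i. pt (x i) (y i)) I) = finsum T (\<lambda>i. pt (x i) (y i)) I"
     using fx[OF w one_W2] ze by simp
   qed
  qed
  have yG: "y i : S2.G" if i: "i : I" for i
  proof (rule S2.GI[OF y[OF i]])
   fix w assume w: "w : W2"
   note h = tm_hom[OF S1.Winj[OF one_W1] S2.Winj[OF w]]
   show "w (y i) = y i"
   proof (rule PT.fixed_right[where \<phi>="tm \<one>\<^sub>DA.AA w" and x=x and y=y and f=w, OF I x y r(2) _ h(1,2) _ _ i])
    show "w a <: B" if "a <: B" for a using DB.alg_injD(1)[OF S2.Winj[OF w] that] .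
    show "tm \<one>\<^sub>DA.AA w (pt a b) = pt a (w b)" if "a <: A" "b <: B" for a b
     using tm_pt_W[OF one_W1 w that] that(1) by (simp add: DA.Aut_one)
    show "tm \<one>\<^sub>DA.AA w (finsum T (\<lambda>i. pt (x i) (y i)) I) = finsum T (\<lambda>i. pt (x i) (y i)) I"
     using fx[OF one_W1 w] ze by simp
   qed
  qed
  show "z : PG.Im" unfolding ze by (rule PG.Im_finsum[where x=x and y=y, OF I xG yG])
 qed
qed

text \<open>The preimages of \<open>?C\<close> in \<open>A\<close> and in \<open>B\<close> are
  subrings containing the scalars and the given generators. Hence \<open>?C\<close> contains the
  pure tensors of all coefficients, and \<open>bilinear_span\<close> applies.\<close>

lemma T_span:
 assumes g1: "set gs1 <= carrier A" and S1: "S1 <= carrier A" "span_left A (adjoins A A.scalars gs1) S1 = carrier A"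
  and g2: "set gs2 <= carrier B" and S2: "S2 <= carrier B" "span_left B (adjoins B B.scalars gs2) S2 = carrier B"
 shows "span_left T (adjoins T TA.scalars (map (\<lambda>g. pt g \<one>\<^sub>B) gs1 @ map (\<lambda>g. pt \<one>\<^sub>A g) gs2)) ((\<lambda>(s, t). pt s t) ` (S1 \<times> S2)) = carrier T"
  (is "span_left T ?C ?Q = _")
proof -
 have xs: "set (map (\<lambda>g. pt g \<one>\<^sub>B) gs1 @ map (\<lambda>g. pt \<one>\<^sub>A g) gs2) <= carrier T" using g1 g2 pt_closed by auto
 have C: "subring ?C T" by (rule DT.D.adjoins_subring[OF TA.scalars_subring xs])
 have Ci: "TA.scalars \<union> set (map (\<lambda>g. pt g \<one>\<^sub>B) gs1 @ map (\<lambda>g. pt \<one>\<^sub>A g) gs2) <= ?C"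
  by (rule DT.D.adjoins_incl[OF TA.scalars_subring xs])
 have Q: "?Q <= carrier T" using S1(1) S2(1) pt_closed by auto
 note N = T.span_left_submod[OF C Q]
 note E = T.submodE[OF N]
 note preim = subring_preimage[OF _ T.ring_axioms _ C]
 have h1: "(\<lambda>a. pt a \<one>\<^sub>B) : ring_hom A T"
  by (rule ring_hom_memI) (simp_all add: pt_closed pt_add1 pt_one pt_mult)
 have h2: "(\<lambda>b. pt \<one>\<^sub>A b) : ring_hom B T"
  by (rule ring_hom_memI) (simp_all add: pt_closed pt_add2 pt_one pt_mult)
 have C1: "adjoins A A.scalars gs1 <= {a : carrier A. pt a \<one>\<^sub>B : ?C}"
 proof (rule DA.D.adjoins_minimal[OF A.scalars_subring preim[OF A.A.ring_axioms h1]])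
  show "A.scalars <= {a : carrier A. pt a \<one>\<^sub>B : ?C}"
   using Ci pt_smult1[of "\<one>\<^sub>A" "\<one>\<^sub>B"] pt_one unfolding A.scalars_def TA.scalars_def by auto
  show "set gs1 <= {a : carrier A. pt a \<one>\<^sub>B : ?C}" using Ci g1 by auto
 qed
 have C2: "adjoins B B.scalars gs2 <= {a : carrier B. pt \<one>\<^sub>A a : ?C}"
 proof (rule DB.D.adjoins_minimal[OF B.scalars_subring preim[OF B.A.ring_axioms h2]])
  show "B.scalars <= {a : carrier B. pt \<one>\<^sub>A a : ?C}"
   using Ci pt_smult2[of "\<one>\<^sub>A" "\<one>\<^sub>B"] pt_one unfolding B.scalars_def TA.scalars_def by auto
  show "set gs2 <= {a : carrier B. pt \<one>\<^sub>A a : ?C}" using Ci g2 by auto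
 qed
 let ?C1 = "adjoins A A.scalars gs1" and ?C2 = "adjoins B B.scalars gs2" and ?N = "span_left T ?C ?Q"
 have c1: "?C1 <= carrier A" and c2: "?C2 <= carrier B" using C1 C2 by blast+
 have pt_N: "pt a b : ?N" if a: "a <: A" and b: "b <: B" for a b
 proof (rule bilinear_span[where \<beta>=pt and ?C1.0="?C1" and ?C2.0="?C2", OF A.A.ring_axioms B.A.ring_axioms T.ring_axioms
    pt_closed pt_add1 pt_add2 _ c1 _ c2 _ _ C S1(1) S2(1) _ Q _ a _ b])
  show "pt (c \<otimes>\<^sub>A x) (d \<otimes>\<^sub>B y) = pt c d \<otimes>\<^sub>T pt x y"
   if "c : ?C1" "d : ?C2" "x <: A" "y <: B" for c d x y
   by (rule pt_mult[symmetric, OF subsetD[OF c1 that(1)] subsetD[OF c2 that(2)] that(3,4)])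
  show "\<one>\<^sub>A : ?C1" by (rule subringE(3)[OF DA.D.adjoins_subring[OF A.scalars_subring g1]])
  show "\<one>\<^sub>B : ?C2" by (rule subringE(3)[OF DB.D.adjoins_subring[OF B.scalars_subring g2]])
  show "pt c d : ?C" if c: "c : ?C1" and d: "d : ?C2" for c d
  proof -
   have "pt c \<one>\<^sub>B \<otimes>\<^sub>T pt \<one>\<^sub>A d : ?C" by (rule subringE(6)[OF C]) (use C1 C2 c d in blast)+
   then show ?thesis using pt_mult[OF subsetD[OF c1 c] B.A.one_closed A.A.one_closed subsetD[OF c2 d]] subsetD[OF c1 c] subsetD[OF c2 d] by simp
  qed
  show "pt q q' : ?Q" if "q : S1" "q' : S2" for q q' using that by force
  show "a : span_left A ?C1 S1" unfolding S1(2) by (rule a)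
  show "b : span_left B ?C2 S2" unfolding S2(2) by (rule b)
 qed
 have "z : ?N" if "z <: T" for z using that
 proof (induction rule: T_induct)
  case zero show ?case by (rule E(2))
 next
  case (pt a b) then show ?case by (rule pt_N)
 next
  case (add s t) show ?case by (rule E(3)[OF add(3,4)])
 qed
 then show ?thesis using E(1) by blast
qed

text \<open>The fixed algebra of \<open>T\<close> is not known to be Noetherian beforehand. It is
  approached through a finitely generated subalgebra \<open>C\<close>, Noetherian by the basis
  theorem, over which \<open>T\<close> is a finite module.\<close>

lemma T_noeth:
 assumes "affine_algebra k A" "affine_algebra k B" "noetherian_over A S1.G" "noetherian_over B S2.G"
 obtains C where "subring C T" "C <= PG.Im" "noeth_on T C (carrier T)"
proof -
 obtain gs1 S1 where 1: "set gs1 <= S1.G" "finite S1" "S1 <= carrier A" "span_left A (adjoins A A.scalars gs1) S1 = carrier A"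
  by (rule S1.artin_tate[OF assms(1,3)])
 obtain gs2 S2 where 2: "set gs2 <= S2.G" "finite S2" "S2 <= carrier B" "span_left B (adjoins B B.scalars gs2) S2 = carrier B"
  by (rule S2.artin_tate[OF assms(2,4)])
 let ?xs = "map (\<lambda>g. pt g \<one>\<^sub>B) gs1 @ map (\<lambda>g. pt \<one>\<^sub>A g) gs2"
 let ?C = "adjoins T TA.scalars ?xs"
 have g: "set gs1 <= carrier A" "set gs2 <= carrier B" using 1(1) 2(1) S1.G_carrier S2.G_carrier by blast+
 have xs: "set ?xs <= carrier T" using g pt_closed by auto
 have C: "subring ?C T" by (rule DT.D.adjoins_subring[OF TA.scalars_subring xs])
 have "noeth_on T ?C ?C"
  by (rule DT.D.noeth_on_adjoins[OF TA.scalars_subring TA.scalars_noeth xs]) (rule DT.D.one_not_zero)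
 then have "noeth_on T ?C (span_left T ?C ((\<lambda>(s, t). pt s t) ` (S1 \<times> S2)))"
 proof (rule T.noeth_on_span_left[OF C])
   show "finite ((\<lambda>(s, t). pt s t) ` (S1 \<times> S2))" using 1(2) 2(2) by simp
   show "(\<lambda>(s, t). pt s t) ` (S1 \<times> S2) <= carrier T" using pt_closed[OF subsetD[OF 1(3)] subsetD[OF 2(3)]] by auto
  qed
 then have n: "noeth_on T ?C (carrier T)" unfolding T_span[OF g(1) 1(3,4) g(2) 2(3,4)] .
 have "?C <= PG.Im"
 proof (rule DT.D.adjoins_minimal[OF TA.scalars_subring PG.Im_subring])
  show "TA.scalars <= PG.Im" by (rule TA.scalars_sub[OF PG.Im_subalgebra])
  show "set ?xs <= PG.Im" using 1(1) 2(1) PG.Im_beta subringE(3)[OF S1.G_subring] subringE(3)[OF S2.G_subring] by auto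
 qed
 then show ?thesis using that[OF C _ n] by blast
qed

text \<open>\<open>tm\<close> is injective and multiplicative, so an element of the intersection has
  both components in the corresponding intersections of the factors.\<close>

lemma T_separating: "(M <#>\<^sub>DT.AA set_inv\<^bsub>DT.AA\<^esub> M) \<inter> W = {\<one>\<^sub>DT.AA}"
proof -
 have s1: "\<mu> \<otimes>\<^sub>DA.AA inv\<^bsub>DA.AA\<^esub> \<mu>' = \<one>\<^sub>DA.AA" if "\<mu> : M1" "\<mu>' : M1" "\<mu> \<otimes>\<^sub>DA.AA inv\<^bsub>DA.AA\<^esub> \<mu>' : W1" for \<mu> \<mu>'
 proof -
  have "\<mu> \<otimes>\<^sub>DA.AA inv\<^bsub>DA.AA\<^esub> \<mu>' : (M1 <#>\<^sub>DA.AA set_inv\<^bsub>DA.AA\<^esub> M1) \<inter> W1"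
   using that unfolding set_mult_def SET_INV_def by blast
  then show ?thesis using galois_ring_setting.separating[OF S1.setting] by blast
 qed
 have s2: "\<mu> \<otimes>\<^sub>DB.AA inv\<^bsub>DB.AA\<^esub> \<mu>' = \<one>\<^sub>DB.AA" if "\<mu> : M2" "\<mu>' : M2" "\<mu> \<otimes>\<^sub>DB.AA inv\<^bsub>DB.AA\<^esub> \<mu>' : W2" for \<mu> \<mu>'
 proof -
  have "\<mu> \<otimes>\<^sub>DB.AA inv\<^bsub>DB.AA\<^esub> \<mu>' : (M2 <#>\<^sub>DB.AA set_inv\<^bsub>DB.AA\<^esub> M2) \<inter> W2"
   using that unfolding set_mult_def SET_INV_def by blast
  then show ?thesis using galois_ring_setting.separating[OF S2.setting] by blast
 qed
 have "x = \<one>\<^sub>DT.AA" if xM: "x : M <#>\<^sub>DT.AA set_inv\<^bsub>DT.AA\<^esub> M" and xW: "x : W" for x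
 proof -
  obtain m m' where m: "m : M" "m' : M" "x = m \<otimes>\<^sub>DT.AA inv\<^bsub>DT.AA\<^esub> m'"
   using xM unfolding set_mult_def SET_INV_def by blast
  obtain \<mu> \<nu> where h: "\<mu> : M1" "\<nu> : M2" "m = tm \<mu> \<nu>" using m(1) unfolding M_eq by blast
  obtain \<mu>' \<nu>' where h': "\<mu>' : M1" "\<nu>' : M2" "m' = tm \<mu>' \<nu>'" using m(2) unfolding M_eq by blast
  obtain w v where w: "w : W1" "v : W2" "x = tm w v" using W_cases[OF xW] by blast
  note a = MA.M_Aut[OF h(1)] MA.M_Aut[OF h'(1)] MB.M_Aut[OF h(2)] MB.M_Aut[OF h'(2)]
  let ?p = "\<mu> \<otimes>\<^sub>DA.AA inv\<^bsub>DA.AA\<^esub> \<mu>'" and ?q = "\<nu> \<otimes>\<^sub>DB.AA inv\<^bsub>DB.AA\<^esub> \<nu>'"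
  have pq: "?p <: DA.AA" "?q <: DB.AA" using a by simp_all
  have xe: "x = tm ?p ?q" unfolding m(3) h(3) h'(3) tm_inv[OF a(2,4)]
   by (rule tm_mult[symmetric, OF a(1) DA.AG.inv_closed[OF a(2)] a(3) DB.AG.inv_closed[OF a(4)]])
  have "?p = w & ?q = v"
   by (rule tm_inj[OF pq(1) S1.W_Aut[OF w(1)] pq(2) S2.W_Aut[OF w(2)] trans[OF xe[symmetric] w(3)]])
  then have "?p = \<one>\<^sub>DA.AA" "?q = \<one>\<^sub>DB.AA" using s1[OF h(1) h'(1)] s2[OF h(2) h'(2)] w(1,2) by simp_all
  then show ?thesis unfolding xe by (simp only: tm_one_eq)
 qed
 moreover have "\<one>\<^sub>DT.AA : M <#>\<^sub>DT.AA set_inv\<^bsub>DT.AA\<^esub> M"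
 proof -
  have 1: "\<one>\<^sub>DT.AA : M" by (rule submonoid.one_closed[OF M_submonoid])
  have "\<one>\<^sub>DT.AA \<otimes>\<^sub>DT.AA inv\<^bsub>DT.AA\<^esub> \<one>\<^sub>DT.AA : M <#>\<^sub>DT.AA set_inv\<^bsub>DT.AA\<^esub> M"
   unfolding set_mult_def SET_INV_def using 1 by blast
  then show ?thesis by simp
 qed
 moreover have "\<one>\<^sub>DT.AA : W" using tm_W[OF one_W1 one_W2] tm_one_eq by simp
 ultimately show ?thesis by blast
qed

lemma T_conj:
 assumes "\<rho> : W"
 shows "(\<lambda>\<mu>. \<rho> \<otimes>\<^sub>DT.AA \<mu> \<otimes>\<^sub>DT.AA inv\<^bsub>DT.AA\<^esub> \<rho>) ` M = M"
proof -
 obtain w v where w: "w : W1" "v : W2" "\<rho> = tm w v" using W_cases[OF assms] by blast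
 note a = S1.W_Aut[OF w(1)] S2.W_Aut[OF w(2)]
 let ?f = "\<lambda>\<mu>. w \<otimes>\<^sub>DA.AA \<mu> \<otimes>\<^sub>DA.AA inv\<^bsub>DA.AA\<^esub> w" and ?g = "\<lambda>\<mu>. v \<otimes>\<^sub>DB.AA \<mu> \<otimes>\<^sub>DB.AA inv\<^bsub>DB.AA\<^esub> v"
 let ?h = "\<lambda>\<mu>. \<rho> \<otimes>\<^sub>DT.AA \<mu> \<otimes>\<^sub>DT.AA inv\<^bsub>DT.AA\<^esub> \<rho>"
 have e: "?h (tm \<mu> \<nu>) = tm (?f \<mu>) (?g \<nu>)" if "\<mu> : M1" "\<nu> : M2" for \<mu> \<nu>
 proof -
  note b = MA.M_Aut[OF that(1)] MB.M_Aut[OF that(2)]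
  show ?thesis unfolding w(3) tm_inv[OF a] tm_mult[OF a(1) b(1) a(2) b(2), symmetric]
   by (rule tm_mult[symmetric, OF DA.AG.m_closed[OF a(1) b(1)] DA.AG.inv_closed[OF a(1)] DB.AG.m_closed[OF a(2) b(2)] DB.AG.inv_closed[OF a(2)]])
 qed
 have f: "?f ` M1 = M1" and g: "?g ` M2 = M2" using S1.conj[OF w(1)] S2.conj[OF w(2)] by simp_all
 show ?thesis
 proof
  show "?h ` M <= M"
  proof
   fix x assume "x : ?h ` M"
   then obtain \<mu> \<nu> where h: "\<mu> : M1" "\<nu> : M2" "x = ?h (tm \<mu> \<nu>)" unfolding M_eq by blast
   have "?f \<mu> : M1" "?g \<nu> : M2" using f g h by blast+
   then show "x : M" unfolding h(3) e[OF h(1,2)] by (rule tm_M)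
  qed
  show "M <= ?h ` M"
  proof
   fix x assume "x : M"
   then obtain \<mu>' \<nu>' where h': "\<mu>' : M1" "\<nu>' : M2" "x = tm \<mu>' \<nu>'" unfolding M_eq by blast
   obtain \<mu> where m: "\<mu> : M1" "\<mu>' = ?f \<mu>" using h'(1) f by blast
   obtain \<nu> where n: "\<nu> : M2" "\<nu>' = ?g \<nu>" using h'(2) g by blast
   have "x = ?h (tm \<mu> \<nu>)" unfolding e[OF m(1) n(1)] h'(3) m(2) n(2) ..
   then show "x : ?h ` M" using tm_M[OF m(1) n(1)] by blast
  qed
 qed
qed

lemma W_subgroup: "subgroup W DT.AA"
proof (rule DT.AG.subgroupI)
 show "W <= carrier DT.AA" unfolding W_eq using tm_Aut S1.W_Aut S2.W_Aut by blast
 show "W ~= {}" using tm_W[OF one_W1 one_W2] by blast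
 fix a assume "a : W"
 then obtain w v where w: "w : W1" "v : W2" "a = tm w v" by (rule W_cases)
 show "inv\<^bsub>DT.AA\<^esub> a : W" unfolding w(3) tm_inv[OF S1.W_Aut[OF w(1)] S2.W_Aut[OF w(2)]]
  by (rule tm_W[OF subgroup.m_inv_closed[OF S1.W_subgroup w(1)] subgroup.m_inv_closed[OF S2.W_subgroup w(2)]])
 fix b assume "b : W"
 then obtain w' v' where w': "w' : W1" "v' : W2" "b = tm w' v'" by (rule W_cases)
 show "a \<otimes>\<^sub>DT.AA b : W" unfolding w(3) w'(3) tm_mult[symmetric, OF S1.W_Aut[OF w(1)] S1.W_Aut[OF w'(1)] S2.W_Aut[OF w(2)] S2.W_Aut[OF w'(2)]]
  by (rule tm_W[OF subgroup.m_closed[OF S1.W_subgroup w(1) w'(1)] subgroup.m_closed[OF S2.W_subgroup w(2) w'(2)]])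
qed

lemma W_finite: "finite W"
proof -
 have "W = (\<lambda>(w, v). tm w v) ` (W1 \<times> W2)" unfolding W_eq by auto
 then show ?thesis using S1.W_finite S2.W_finite by simp
qed

lemma T_setting:
 assumes "affine_algebra k A" "affine_algebra k B" "noetherian_over A S1.G" "noetherian_over B S2.G"
 shows "galois_ring_setting k T M W"
proof (intro galois_ring_setting.intro)
 show "field k" by (rule A.K.field_axioms)
 show "algebra k T" by (rule T_algebra[OF DA.D.is_cring DB.D.is_cring])
 obtain C where C: "subring C T" "C <= PG.Im" "noeth_on T C (carrier T)" by (rule T_noeth[OF assms])
 show "noetherian_domain T"
  by (rule noetherian_domain.intro[OF DT.D.noetherian_ring_noeth_on[OF C(1,3)] T_domain])
 show "submonoid M DT.AA" by (rule M_submonoid)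
 show "subgroup W DT.AA" by (rule W_subgroup)
 show "finite W" by (rule W_finite)
 show "(\<lambda>\<mu>. \<rho> \<otimes>\<^sub>DT.AA \<mu> \<otimes>\<^sub>DT.AA inv\<^bsub>DT.AA\<^esub> \<rho>) ` M = M" if "\<rho> : W" for \<rho> by (rule T_conj[OF that])
 show "(M <#>\<^sub>DT.AA set_inv\<^bsub>DT.AA\<^esub> M) \<inter> W = {\<one>\<^sub>DT.AA}" by (rule T_separating)
qed

lemma T_noetherian_over:
 assumes "affine_algebra k A" "affine_algebra k B" "noetherian_over A S1.G" "noetherian_over B S2.G"
 shows "noetherian_over T (fixed_elements T W)" "noeth_on T (fixed_elements T W) (carrier T)"
proof -
 obtain C where C: "subring C T" "C <= PG.Im" "noeth_on T C (carrier T)" by (rule T_noeth[OF assms])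
 show n: "noeth_on T (fixed_elements T W) (carrier T)" unfolding fixed_T[symmetric]
  by (rule T.noeth_on_extend[OF C(1) PG.Im_subring C(2,3)])
 show "noetherian_over T (fixed_elements T W)" unfolding noetherian_over_def
 proof (intro allI impI)
  fix N assume N: "subgroup N (add_monoid T) & (ALL a:fixed_elements T W. ALL n:N. a \<otimes>\<^sub>T n : N)"
  then have s: "submod T (fixed_elements T W) N" unfolding submod_def .
  show "fg_left T (fixed_elements T W) N" by (rule noeth_onD[OF n s T.submodE(1)[OF s]])
 qed
qed

end

text \<open>\<open>U\<close> and \<open>V\<close> are both submodules over \<open>C\<close>. As
  \<open>C\<close> is left Noetherian, a finitely generated module containing their intersection
  suffices.\<close>

lemma (in ring) fg_left_inter:
 assumes C: "subring C R" "noeth_on R C C" and U: "subring U R" "C <= U" and V: "submod R C V"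
  and Q: "finite Q" "Q <= carrier R" "U \<inter> V <= span_left R C Q"
 shows "fg_left R C (U \<inter> V)"
proof (rule noeth_onD[OF noeth_on_span_left[OF C Q(1,2)] submod_inter[OF _ V] Q(3)])
 show "submod R C U"
  by (rule submodI) (use subringE[OF U(1)] U(2) in auto)
qed

section \<open>Evaluation of skew elements at fractions\<close>

context aut_alg
begin

lemma skew_eval_lift: "linear_lift L L M (\<lambda>\<mu> l. l \<otimes>\<^sub>L frac_map A \<mu> a)" if "a <: L"
 by unfold_locales (simp_all add: frac_map_closed[OF Aut_alg_inj[OF M_Aut]] that L.l_distr)

lemma skew_eval_eq: "a <: L ==> skew_eval A f a = linear_lift.llift L L (\<lambda>\<mu> l. l \<otimes>\<^sub>L frac_map A \<mu> a) f"
 unfolding linear_lift.llift_def[OF skew_eval_lift] skew_eval_def ..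

lemma skew_eval_closed: "f <: SA ==> a <: L ==> skew_eval A f a <: L"
 using linear_lift.llift_closed[OF skew_eval_lift] skew_eval_eq by simp

lemma skew_eval_add1:
 "f <: SA ==> g <: SA ==> a <: L ==>
  skew_eval A (f \<oplus>\<^sub>SA g) a = skew_eval A f a \<oplus>\<^sub>L skew_eval A g a"
 using linear_lift.llift_add[OF skew_eval_lift] skew_eval_eq by simp

lemma skew_eval_zero1: "a <: L ==> skew_eval A \<zero>\<^sub>SA a = \<zero>\<^sub>L"
 using linear_lift.llift_zero[OF skew_eval_lift] skew_eval_eq by simp

lemma skew_eval_single: "\<mu> : M ==> l <: L ==> a <: L ==>
  skew_eval A (single L \<mu> l) a = l \<otimes>\<^sub>L frac_map A \<mu> a"
 using linear_lift.llift_single[OF skew_eval_lift] skew_eval_eq by simp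

lemma skew_eval_add2:
 assumes f: "f <: SA" and a: "a <: L" and b: "b <: L"
 shows "skew_eval A f (a \<oplus>\<^sub>L b) = skew_eval A f a \<oplus>\<^sub>L skew_eval A f b"
 using f
proof (induction rule: SA_induct)
 case zero
 show ?case unfolding skew_eval_zero1[OF a] skew_eval_zero1[OF b] skew_eval_zero1[OF L.a_closed[OF a b]] by simp
next
 case (single \<mu> l)
 note i = Aut_alg_inj[OF M_Aut[OF single(1)]]
 show ?case unfolding skew_eval_single[OF single a] skew_eval_single[OF single b] skew_eval_single[OF single L.a_closed[OF a b]]
   frac_map_props(1)[OF i a b] by (rule L.r_distr[OF frac_map_closed[OF i a] frac_map_closed[OF i b] single(2)])
next
 case (add f g)
 note c = skew_eval_closed[OF add(1) a] skew_eval_closed[OF add(1) b] skew_eval_closed[OF add(2) a] skew_eval_closed[OF add(2) b]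
 show ?case unfolding skew_eval_add1[OF add(1,2) a] skew_eval_add1[OF add(1,2) b] skew_eval_add1[OF add(1,2) L.a_closed[OF a b]] add(3,4)
  using c by (simp add: L.a_ac)
qed

lemma skew_eval_zero2: "f <: SA ==> skew_eval A f \<zero>\<^sub>L = \<zero>\<^sub>L"
 using skew_eval_add2[of f "\<zero>\<^sub>L" "\<zero>\<^sub>L"] skew_eval_closed[of f "\<zero>\<^sub>L"] by (simp del: SA_simps)

end

lemma (in aut_alg) sact_one:
 assumes f: "f <: SA"
 shows "sact \<one>\<^sub>AA f = f"
proof (rule ext)
 fix \<nu>
 show "sact \<one>\<^sub>AA f \<nu> = f \<nu>"
 proof (cases "\<nu> : M")
  case True
  then show ?thesis using M_Aut[OF True] frac_map_Aut_one[OF SA_val[OF f]] by (simp add: skew_action_def)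
 next
  case False
  then show ?thesis using SA_off[OF f False] by (simp add: skew_action_def)
 qed
qed

text \<open>Both sides are additive in \<open>f\<close> and in \<open>g\<close>; on singles this is
  the compatibility of \<open>ft\<close> with automorphisms and products.\<close>

lemma (in skew_pair) skew_eval_st:
 assumes f: "f <: MA.SA" and g: "g <: MB.SA" and a: "a <: DA.L" and b: "b <: DB.L"
 shows "skew_eval T (st f g) (ft a b) = ft (skew_eval A f a) (skew_eval B g b)"
 using f
proof (induction rule: MA.SA_induct)
 case zero
 show ?case unfolding st_zero(2)[OF g] MA.skew_eval_zero1[OF a] MT.skew_eval_zero1[OF ft_closed[OF a b]]
   ft_zero(2)[OF MB.skew_eval_closed[OF g b]] ..
next
 case (add f f')
 show ?case unfolding st_add1[OF add(1,2) g] MA.skew_eval_add1[OF add(1,2) a]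
   MT.skew_eval_add1[OF st_closed[OF add(1) g] st_closed[OF add(2) g] ft_closed[OF a b]]
   ft_add1[OF MA.skew_eval_closed[OF add(1) a] MA.skew_eval_closed[OF add(2) a] MB.skew_eval_closed[OF g b]] add(3,4) ..
next
 case (single \<mu> l)
 note s = MA.single_SA[OF single]
 note am = frac_map_ft
 have fa: "frac_map A \<mu> a <: DA.L" by (rule DA.frac_map_closed[OF DA.Aut_alg_inj[OF MA.M_Aut[OF single(1)]] a])
 show ?case using g
 proof (induction rule: MB.SA_induct)
  case zero
  show ?case unfolding st_zero(1)[OF s] MB.skew_eval_zero1[OF b] MT.skew_eval_zero1[OF ft_closed[OF a b]]
    ft_zero(1)[OF MA.skew_eval_closed[OF s a]] ..
 next
  case (add g g')
  show ?case unfolding st_add2[OF s add(1,2)] MB.skew_eval_add1[OF add(1,2) b]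
    MT.skew_eval_add1[OF st_closed[OF s add(1)] st_closed[OF s add(2)] ft_closed[OF a b]]
    ft_add2[OF MA.skew_eval_closed[OF s a] MB.skew_eval_closed[OF add(1) b] MB.skew_eval_closed[OF add(2) b]] add(3,4) ..
 next
  case (single \<nu> l')
  have fb: "frac_map B \<nu> b <: DB.L" by (rule DB.frac_map_closed[OF DB.Aut_alg_inj[OF MB.M_Aut[OF single(1)]] b])
  show ?case unfolding st_single[OF \<open>\<mu> : M1\<close> single(1) \<open>l <: DA.L\<close> single(2)]
   MT.skew_eval_single[OF tm_M[OF \<open>\<mu> : M1\<close> single(1)] ft_closed[OF \<open>l <: DA.L\<close> single(2)] ft_closed[OF a b]]
   MA.skew_eval_single[OF \<open>\<mu> : M1\<close> \<open>l <: DA.L\<close> a] MB.skew_eval_single[OF single b]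
   frac_map_ft[OF MA.M_Aut[OF \<open>\<mu> : M1\<close>] MB.M_Aut[OF single(1)] a b]
   by (rule ft_mult[symmetric, OF \<open>l <: DA.L\<close> fa single(2) fb])
 qed
qed

section \<open>The tensor product of two Galois rings\<close>

locale galois_pair = setting_pair k A B M1 M2 W1 W2
 for k :: "('k, 'z) ring_scheme" and A :: "('k, 'a) module" and B :: "('k, 'b) module" and M1 M2 W1 W2 +
 fixes U1 :: "(('a => 'a) => ('a \<times> 'a) set) set" and U2 :: "(('b => 'b) => ('b \<times> 'b) set) set"
 assumes affine: "affine_algebra k A" "affine_algebra k B"
  and gal1: "galois_ring k A M1 W1 U1" and gal2: "galois_ring k B M2 W2 U2"
begin

interpretation S1: setting k A M1 W1 by (rule setting1)
interpretation S2: setting k B M2 W2 by (rule setting2)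
interpretation PG: sub_bilinear k A B T pt S1.G S2.G
 by (intro sub_bilinear.intro sub_bilinear_axioms.intro pt_faithful S1.G_subalgebra S2.G_subalgebra)

lemmas noeth1 = galois_ring.noetherian_module[OF gal1] and noeth2 = galois_ring.noetherian_module[OF gal2]

lemma T_setting': "setting k T M W"
 by (intro setting.intro MT.aut_alg_axioms setting_axioms.intro T_setting affine noeth1 noeth2)

interpretation ST: setting k T M W by (rule T_setting')
interpretation PS: faithful_bilinear k MA.SA MB.SA MT.SA st by (rule st_faithful)
interpretation PU: sub_bilinear k MA.SA MB.SA MT.SA st U1 U2
 by (intro sub_bilinear.intro sub_bilinear_axioms.intro st_faithful galois_ring.subalgebra[OF gal1] galois_ring.subalgebra[OF gal2])

lemma U1_INV: "u : U1 ==> u : S1.INV" and U2_INV: "v : U2 ==> v : S2.INV"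
 using galois_ring.subset_invariants[OF gal1] galois_ring.subset_invariants[OF gal2] by blast+

lemma st_sc:
 assumes "a <: DA.L" "b <: DB.L"
 shows "st (S1.sc a) (S2.sc b) = ST.sc (ft a b)"
 unfolding scalar_def st_single[OF S1.one_M S2.one_M assms] tm_one_eq ..

lemma st_INV:
 assumes f: "f : S1.INV" and g: "g : S2.INV"
 shows "st f g : ST.INV"
proof (rule ST.INV_I[OF st_closed[OF S1.INV_D(1)[OF f] S2.INV_D(1)[OF g]]])
 fix \<rho> assume "\<rho> : W"
 then obtain w v where w: "w : W1" "v : W2" "\<rho> = tm w v" by (rule W_cases)
 show "MT.sact \<rho> (st f g) = st f g"
  unfolding w(3) sact_st(1)[OF S1.W_normalizes[OF w(1)] S2.W_normalizes[OF w(2)] S1.INV_D(1)[OF f] S2.INV_D(1)[OF g]]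
   S1.INV_D(2)[OF f w(1)] S2.INV_D(2)[OF g w(2)] ..
qed

lemma U_INV: "PU.Im <= ST.INV"
proof
 fix z assume "z : PU.Im"
 then show "z : ST.INV"
 proof (induction rule: PU.Im_induct)
  case zero show ?case by (rule ST.INV_ops(1))
 next
  case (beta a b) then show ?case by (intro st_INV U1_INV U2_INV)
 next
  case (add u v) show ?case by (rule ST.INV_ops(3)[OF add(3,4)])
 qed
qed

lemma fixed_T_induct [consumes 1, case_names zero pt add]:
 assumes z: "z : ST.G" and "P \<zero>\<^sub>T" and "!!a b. a : S1.G ==> b : S2.G ==> P (pt a b)"
  and "!!u v. u : ST.G ==> v : ST.G ==> P u ==> P v ==> P (u \<oplus>\<^sub>T v)"
 shows "P z"
 by (rule PG.Im_induct[of z P]) (use assms fixed_T in simp_all)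

lemma sc_zero: "ST.sc \<zero>\<^sub>DT.L = \<zero>\<^sub>MT.SA"
 by (simp add: scalar_def)

text \<open>By \<open>fixed_T\<close> it suffices to treat pure tensors of invariants, whose scalars
  are products under \<open>st\<close> of scalars in \<open>U1\<close> and
  \<open>U2\<close>.\<close>

lemma U_Gamma: "ST.sc ` Gamma_in_L T W <= PU.Im"
proof -
 note sub = PU.Im_subring
 have "ST.sc (to_frac T z) : PU.Im" if "z : ST.G" for z using that
 proof (induction rule: fixed_T_induct)
  case zero show ?case unfolding DT.to_frac_zero sc_zero by (rule subringE(2)[OF sub])
 next
  case (pt a b)
  note c = S1.G_carrier[OF pt(1)] S2.G_carrier[OF pt(2)]
  have "S1.sc (to_frac A a) : U1" "S2.sc (to_frac B b) : U2"
   using pt galois_ring.contains_Gamma[OF gal1] galois_ring.contains_Gamma[OF gal2] unfolding Gamma_in_L_def by blast+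
  from PU.Im_beta[OF this] show ?case
   unfolding st_sc[OF DA.to_frac_closed[OF c(1)] DB.to_frac_closed[OF c(2)]] ft_to_frac[OF c] .
 next
  case (add u v)
  note c = ST.G_carrier[OF add(1)] ST.G_carrier[OF add(2)]
  show ?case unfolding DT.to_frac_add[OF c] ST.sc_add[OF DT.to_frac_closed[OF c(1)] DT.to_frac_closed[OF c(2)]]
   by (rule subringE(7)[OF sub add(3,4)])
 qed
 then show ?thesis unfolding Gamma_in_L_def by blast
qed

lemma ft_K: "\<kappa> : S1.KK ==> \<kappa>' : S2.KK ==> ft \<kappa> \<kappa>' : ST.KK"
proof -
 assume "\<kappa> : S1.KK" "\<kappa>' : S2.KK"
 then obtain a b c d where h: "\<kappa> = DA.fr a b" "a : S1.G" "b : S1.G - {\<zero>\<^sub>A}" "\<kappa>' = DB.fr c d" "c : S2.G" "d : S2.G - {\<zero>\<^sub>B}"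
  unfolding S1.K_mem S2.K_mem by blast
 have "ft \<kappa> \<kappa>' = DT.fr (pt a c) (pt b d)" unfolding h(1,4)
  by (rule ft_fr[OF S1.G_carrier[OF h(2)] S1.G_nz[OF h(3)] S2.G_carrier[OF h(5)] S2.G_nz[OF h(6)]])
 moreover have "pt a c : ST.G" "pt b d : ST.G" unfolding fixed_T[symmetric] using PG.Im_beta h by blast+
 moreover have "pt b d ~= \<zero>\<^sub>T" using pt_nz[OF S1.G_nz[OF h(3)] S2.G_nz[OF h(6)]] by blast
 ultimately show ?thesis unfolding ST.K_mem by blast
qed

text \<open>Both halves are instances of \<open>bilinear_span\<close>, the second one over the
  opposite rings. The coefficient sets are left open because the lemma is used over \<open>K\<close>
  and over \<Gamma>.\<close>

lemma st_span:
 assumes C1: "C1 <= carrier DA.L" "\<one>\<^sub>DA.L : C1" and C2: "C2 <= carrier DB.L" "\<one>\<^sub>DB.L : C2"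
  and C: "!!a b. a : C1 ==> b : C2 ==> ft a b : C" "subring (ST.sc ` C) MT.SA"
  and Q1: "Q1 <= carrier MA.SA" and Q2: "Q2 <= carrier MB.SA"
  and Q: "!!q q'. q : Q1 ==> q' : Q2 ==> st q q' : Q" "Q <= carrier MT.SA"
  and x: "x <: MA.SA" and y: "y <: MB.SA"
 shows "x : span_left MA.SA (S1.sc ` C1) Q1 ==> y : span_left MB.SA (S2.sc ` C2) Q2 ==> st x y : span_left MT.SA (ST.sc ` C) Q"
  "x : span_right MA.SA (S1.sc ` C1) Q1 ==> y : span_right MB.SA (S2.sc ` C2) Q2 ==> st x y : span_right MT.SA (ST.sc ` C) Q"
proof -
 have 1: "S1.sc ` C1 <= carrier MA.SA" using C1(1) S1.sc_closed by blast
 have 2: "S2.sc ` C2 <= carrier MB.SA" using C2(1) S2.sc_closed by blast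
 have one1: "\<one>\<^sub>MA.SA : S1.sc ` C1" unfolding S1.sc_one[symmetric] by (rule imageI[OF C1(2)])
 have one2: "\<one>\<^sub>MB.SA : S2.sc ` C2" unfolding S2.sc_one[symmetric] by (rule imageI[OF C2(2)])
 have in_C: "st a b : ST.sc ` C" if ab: "a : S1.sc ` C1" "b : S2.sc ` C2" for a b
 proof -
  obtain a' b' where h: "a = S1.sc a'" "a' : C1" "b = S2.sc b'" "b' : C2" using ab by blast
  show ?thesis unfolding h(1,3) st_sc[OF subsetD[OF C1(1) h(2)] subsetD[OF C2(1) h(4)]] by (rule imageI[OF C(1)[OF h(2,4)]])
 qed
 show "x : span_left MA.SA (S1.sc ` C1) Q1 ==> y : span_left MB.SA (S2.sc ` C2) Q2 ==> st x y : span_left MT.SA (ST.sc ` C) Q"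
  by (rule bilinear_span[where \<beta>=st, OF MA.SA_ring MB.SA_ring MT.SA_ring st_closed st_add1 st_add2
    st_mult[OF subsetD[OF 1] _ subsetD[OF 2]] 1 one1 2 one2 in_C C(2) Q1 Q2 Q _ x _ y])
 show "x : span_right MA.SA (S1.sc ` C1) Q1 ==> y : span_right MB.SA (S2.sc ` C2) Q2 ==> st x y : span_right MT.SA (ST.sc ` C) Q"
  unfolding span_right_op
  by (rule bilinear_span[where \<beta>=st and ?C1.0="S1.sc ` C1" and ?C2.0="S2.sc ` C2" and ?Q1.0=Q1 and ?Q2.0=Q2,
     OF MA.SA.op_ring MB.SA.op_ring MT.SA.op_ring, unfolded op_ring_simps])
   (use 1 2 one1 one2 in_C C(2) Q1 Q2 Q x y MT.SA.subring_op in \<open>assumption | (simp only: op_ring_simps st_closed st_add1 st_add2 st_mult subsetD; fail) | blast\<close>)+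
qed

text \<open>With the full carriers, \<open>PF.Im\<close> is the image of the tensor product of the
  two skew algebras. It need not be all of \<open>MT.SA\<close>, since its coefficients only have
  denominators that are pure tensors.\<close>

interpretation PF: sub_bilinear k MA.SA MB.SA MT.SA st "carrier MA.SA" "carrier MB.SA"
proof (intro sub_bilinear.intro sub_bilinear_axioms.intro st_faithful)
 show "k_subalgebra k (carrier MA.SA) MA.SA" unfolding k_subalgebra_def
  by (intro conjI ballI MA.SA.carrier_is_subring MA.SA_smult_closed)
 show "k_subalgebra k (carrier MB.SA) MB.SA" unfolding k_subalgebra_def
  by (intro conjI ballI MB.SA.carrier_is_subring MB.SA_smult_closed)
qed

lemma single_T:
 assumes m: "\<mu> : M1" and n: "\<nu> : M2" and t: "t <: T"
 shows "single DT.L (tm \<mu> \<nu>) (to_frac T t) : PF.Im"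
 using t
proof (induction rule: T_induct)
 case zero
 show ?case unfolding DT.to_frac_zero DT.L.single_zero using subringE(2)[OF PF.Im_subring] by simp
next
 case (pt a b)
 show ?case unfolding ft_to_frac[OF pt, symmetric] st_single[OF m n DA.to_frac_closed[OF pt(1)] DB.to_frac_closed[OF pt(2)], symmetric]
  by (rule PF.Im_beta[OF MA.single_SA[OF m DA.to_frac_closed[OF pt(1)]] MB.single_SA[OF n DB.to_frac_closed[OF pt(2)]]])
next
 case (add s t)
 have "single DT.L (tm \<mu> \<nu>) (to_frac T (s \<oplus>\<^sub>T t)) = single DT.L (tm \<mu> \<nu>) (to_frac T s) \<oplus>\<^sub>MT.SA single DT.L (tm \<mu> \<nu>) (to_frac T t)"
  unfolding DT.to_frac_add[OF add(1,2)] MT.SA_simps(4) by (rule DT.L.single_add[OF DT.to_frac_closed[OF add(1)] DT.to_frac_closed[OF add(2)]])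
 then show ?case using subringE(7)[OF PF.Im_subring add(3,4)] by (simp only:)
qed

lemma sc_T: "t <: T ==> ST.sc (to_frac T t) : PF.Im"
 using single_T[OF S1.one_M S2.one_M] unfolding scalar_def tm_one_eq .

text \<open>Singles with coefficient in \<open>T\<close> are already in the image, and every
  fraction has a denominator in \<open>ST.G\<close>. For a sum the two denominators are
  multiplied.\<close>

lemma clear_denominators:
 assumes "f <: MT.SA"
 shows "EX \<gamma>:ST.G - {\<zero>\<^sub>T}. ST.sc (to_frac T \<gamma>) \<otimes>\<^sub>MT.SA f : PF.Im"
 using assms
proof (induction rule: MT.SA_induct)
 case zero
 have "ST.sc (to_frac T \<one>\<^sub>T) \<otimes>\<^sub>MT.SA \<zero>\<^sub>MT.SA = \<zero>\<^sub>MT.SA"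
  by (rule MT.SA.r_null[OF ST.sc_closed[OF DT.to_frac_closed[OF T.one_closed]]])
 then show ?case using ST.G_one subringE(2)[OF PF.Im_subring] by (metis (no_types, lifting))
next
 case (single \<rho> l)
 obtain \<mu> \<nu> where m: "\<mu> : M1" "\<nu> : M2" "\<rho> = tm \<mu> \<nu>" using single(1) unfolding M_eq by blast
 obtain a \<gamma> where g: "a <: T" "\<gamma> : ST.G - {\<zero>\<^sub>T}" "l = DT.fr a \<gamma>" by (rule ST.L_cases_G[OF single(2)])
 have gc: "\<gamma> <: T" using g(2) ST.G_carrier by blast
 have "ST.sc (to_frac T \<gamma>) \<otimes>\<^sub>MT.SA single DT.L \<rho> l = single DT.L (tm \<mu> \<nu>) (to_frac T a)"
  unfolding m(3) ST.sc_mult_single(1)[OF DT.to_frac_closed[OF gc] tm_M[OF m(1,2)] single(2)]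
  by (rule arg_cong[where f="single DT.L (tm \<mu> \<nu>)"]) (unfold g(3), rule DT.fr_to_frac[OF g(1) ST.G_nz[OF g(2)]])
 then show ?case using single_T[OF m(1,2) g(1)] g(2) by (intro bexI[of _ \<gamma>]) (simp_all only:)
next
 case (add f g)
 obtain \<gamma> where a: "\<gamma> : ST.G - {\<zero>\<^sub>T}" "ST.sc (to_frac T \<gamma>) \<otimes>\<^sub>MT.SA f : PF.Im" using add(3) by blast
 obtain \<delta> where b: "\<delta> : ST.G - {\<zero>\<^sub>T}" "ST.sc (to_frac T \<delta>) \<otimes>\<^sub>MT.SA g : PF.Im" using add(4) by blast
 have c: "\<gamma> <: T" "\<delta> <: T" using a b ST.G_carrier by blast+
 let ?s = "\<lambda>t. ST.sc (to_frac T t)"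
 note s = ST.sc_closed[OF DT.to_frac_closed[OF c(1)]] ST.sc_closed[OF DT.to_frac_closed[OF c(2)]]
 have e1: "?s (\<gamma> \<otimes>\<^sub>T \<delta>) = ?s \<gamma> \<otimes>\<^sub>MT.SA ?s \<delta>"
  unfolding DT.to_frac_mult[OF c] by (rule ST.sc_mult[OF DT.to_frac_closed[OF c(1)] DT.to_frac_closed[OF c(2)]])
 have e2: "?s (\<gamma> \<otimes>\<^sub>T \<delta>) = ?s \<delta> \<otimes>\<^sub>MT.SA ?s \<gamma>"
  unfolding DT.D.m_comm[OF c] DT.to_frac_mult[OF c(2,1)] by (rule ST.sc_mult[OF DT.to_frac_closed[OF c(2)] DT.to_frac_closed[OF c(1)]])
 have "?s (\<gamma> \<otimes>\<^sub>T \<delta>) \<otimes>\<^sub>MT.SA (f \<oplus>\<^sub>MT.SA g) = ?s (\<gamma> \<otimes>\<^sub>T \<delta>) \<otimes>\<^sub>MT.SA f \<oplus>\<^sub>MT.SA ?s (\<gamma> \<otimes>\<^sub>T \<delta>) \<otimes>\<^sub>MT.SA g"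
  by (rule MT.SA.r_distr[OF add(1,2) ST.sc_closed[OF DT.to_frac_closed[OF T.m_closed[OF c]]]])
 also have "?s (\<gamma> \<otimes>\<^sub>T \<delta>) \<otimes>\<^sub>MT.SA f = ?s \<delta> \<otimes>\<^sub>MT.SA (?s \<gamma> \<otimes>\<^sub>MT.SA f)" unfolding e2 by (rule MT.SA.m_assoc[OF s(2,1) add(1)])
 also have "?s (\<gamma> \<otimes>\<^sub>T \<delta>) \<otimes>\<^sub>MT.SA g = ?s \<gamma> \<otimes>\<^sub>MT.SA (?s \<delta> \<otimes>\<^sub>MT.SA g)" unfolding e1 by (rule MT.SA.m_assoc[OF s add(2)])
 finally have "?s (\<gamma> \<otimes>\<^sub>T \<delta>) \<otimes>\<^sub>MT.SA (f \<oplus>\<^sub>MT.SA g) : PF.Im"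
  using subringE(7)[OF PF.Im_subring subringE(6)[OF PF.Im_subring sc_T[OF c(2)] a(2)] subringE(6)[OF PF.Im_subring sc_T[OF c(1)] b(2)]]
  by (simp only:)
 then show ?case by (rule bexI[OF _ ST.G_nz_mult[OF a(1) b(1)]])
qed

text \<open>As for the invariants of \<open>T\<close>: in an independent representation, the
  automorphisms acting on one factor only fix the members of that family.\<close>

lemma INV_rep:
 assumes g: "g : ST.INV" and gF: "g : PF.Im"
 obtains I :: "('a, 'b) skew_index set" and x y
 where "finite I" "!!i. i : I ==> x i : S1.INV" "!!i. i : I ==> y i : S2.INV" "g = finsum MT.SA (\<lambda>i. st (x i) (y i)) I"
proof (rule PF.Im_rep[OF gF])
 fix I :: "('a, 'b) skew_index set" and x y
 assume r: "finite I" "!!i. i : I ==> x i <: MA.SA" "!!i. i : I ==> y i <: MB.SA"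
  "MA.SAA.indep I x" "MB.SAA.indep I y" "g = finsum MT.SA (\<lambda>i. st (x i) (y i)) I"
 have one1: "MA.sact \<one>\<^sub>DA.AA f = f" if "f <: MA.SA" for f by (rule MA.sact_one[OF that])
 have one2: "MB.sact \<one>\<^sub>DB.AA f = f" if "f <: MB.SA" for f by (rule MB.sact_one[OF that])
 have x: "x i : S1.INV" if i: "i : I" for i
 proof (rule S1.INV_I[OF r(2)[OF i]])
  fix w assume w: "w : W1"
  note n = S1.W_normalizes[OF w] S2.W_normalizes[OF one_W2]
  note N = sact_st(2)[OF n MA.SA.zero_closed MB.SA.zero_closed]
  show "MA.sact w (x i) = x i"
  proof (rule PS.fixed_left[where \<phi>="MT.sact (tm w \<one>\<^sub>DB.AA)" and x=x and y=y and f="MA.sact w", OF r(1,2,3,5) MA.sact_closed[OF n(1)] MT.sact_closed[OF N] MT.sact_add[OF N] _ _ i])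
   show "MT.sact (tm w \<one>\<^sub>DB.AA) (st a b) = st (MA.sact w a) b" if "a <: MA.SA" "b <: MB.SA" for a b
    unfolding sact_st(1)[OF n that] one2[OF that(2)] ..
   show "MT.sact (tm w \<one>\<^sub>DB.AA) (finsum MT.SA (\<lambda>i. st (x i) (y i)) I) = finsum MT.SA (\<lambda>i. st (x i) (y i)) I"
    unfolding r(6)[symmetric] by (rule ST.INV_D(2)[OF g tm_W[OF w one_W2]])
  qed
 qed
 have y: "y i : S2.INV" if i: "i : I" for i
 proof (rule S2.INV_I[OF r(3)[OF i]])
  fix w assume w: "w : W2"
  note n = S1.W_normalizes[OF one_W1] S2.W_normalizes[OF w]
  note N = sact_st(2)[OF n MA.SA.zero_closed MB.SA.zero_closed]
  show "MB.sact w (y i) = y i"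
  proof (rule PS.fixed_right[where \<phi>="MT.sact (tm \<one>\<^sub>DA.AA w)" and x=x and y=y and f="MB.sact w", OF r(1,2,3,4) MB.sact_closed[OF n(2)] MT.sact_closed[OF N] MT.sact_add[OF N] _ _ i])
   show "MT.sact (tm \<one>\<^sub>DA.AA w) (st a b) = st a (MB.sact w b)" if "a <: MA.SA" "b <: MB.SA" for a b
    unfolding sact_st(1)[OF n that] one1[OF that(1)] ..
   show "MT.sact (tm \<one>\<^sub>DA.AA w) (finsum MT.SA (\<lambda>i. st (x i) (y i)) I) = finsum MT.SA (\<lambda>i. st (x i) (y i)) I"
    unfolding r(6)[symmetric] by (rule ST.INV_D(2)[OF g tm_W[OF one_W1 w]])
  qed
 qed
 show ?thesis by (rule that[of I x y]) (fact r(1) x y r(6))+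
qed

text \<open>Multiplication by an invariant denominator \<gamma> turns an invariant into a sum of
  \<open>st x y\<close> with \<open>x\<close> and \<open>y\<close> invariant. These factors lie in
  the spans of \<open>U1\<close> and \<open>U2\<close> over the two fields, so \<open>st x y\<close>
  lies in the span of \<open>PU.Im\<close>. Finally \<gamma> is inverted in
  \<open>K\<close>.\<close>

lemma U_span: "span_left MT.SA (ST.sc ` ST.KK) PU.Im = ST.INV"
proof
 show "span_left MT.SA (ST.sc ` ST.KK) PU.Im <= ST.INV" by (rule MT.SA.span_left_minimal[OF ST.INV_submod U_INV])
 have Uc: "PU.Im <= carrier MT.SA" by (rule subringE(1)[OF PU.Im_subring])
 let ?N = "span_left MT.SA (ST.sc ` ST.KK) PU.Im"
 note E = MT.SA.submodE[OF MT.SA.span_left_submod[OF ST.scK_subring Uc]]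
 have st_N: "st x y : ?N" if x: "x : S1.INV" and y: "y : S2.INV" for x y
 proof (rule st_span(1)[where ?C1.0=S1.KK and ?C2.0=S2.KK and ?Q1.0=U1 and ?Q2.0=U2])
  show "S1.KK <= carrier DA.L" using S1.K_closed by blast
  show "S2.KK <= carrier DB.L" using S2.K_closed by blast
  show "\<one>\<^sub>DA.L : S1.KK" by (rule subringE(3)[OF S1.K_subring])
  show "\<one>\<^sub>DB.L : S2.KK" by (rule subringE(3)[OF S2.K_subring])
  show "U1 <= carrier MA.SA" using PU.S_sub by blast
  show "U2 <= carrier MB.SA" using PU.S'_sub by blast
  show "x <: MA.SA" "y <: MB.SA" using S1.INV_D(1)[OF x] S2.INV_D(1)[OF y] by blast+
  show "x : span_left MA.SA (S1.sc ` S1.KK) U1" unfolding galois_ring.KU[OF gal1] by (rule x)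
  show "y : span_left MB.SA (S2.sc ` S2.KK) U2" unfolding galois_ring.KU[OF gal2] by (rule y)
 qed (fact ft_K ST.scK_subring Uc PU.Im_beta)+
 show "ST.INV <= ?N"
 proof
  fix f assume f: "f : ST.INV"
  note fc = ST.INV_D(1)[OF f]
  obtain \<gamma> where g: "\<gamma> : ST.G - {\<zero>\<^sub>T}" "ST.sc (to_frac T \<gamma>) \<otimes>\<^sub>MT.SA f : PF.Im" using clear_denominators[OF fc] by blast
  note gz = ST.G_nz[OF g(1)]
  have gG: "\<gamma> : ST.G" using g(1) by blast
  note gc = ST.G_carrier[OF gG]
  let ?g = "ST.sc (to_frac T \<gamma>) \<otimes>\<^sub>MT.SA f"
  have gi: "?g : ST.INV" by (rule ST.INV_ops(4)[OF ST.to_frac_K[OF gG] f])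
  have gN: "?g : ?N"
  proof (rule INV_rep[OF gi g(2)])
   fix I :: "('a, 'b) skew_index set" and x y
   assume r: "finite I" "!!i. i : I ==> x i : S1.INV" "!!i. i : I ==> y i : S2.INV" "?g = finsum MT.SA (\<lambda>i. st (x i) (y i)) I"
   show "?g : ?N" unfolding r(4) using r(1,2,3)
  proof (induction I rule: finite_induct)
   case empty show ?case unfolding MT.SA.finsum_empty by (rule E(2))
  next
   case (insert i I)
   have st_mem: "st (x j) (y j) : ?N" if "j : insert i I" for j by (rule st_N[OF insert(4,5)[OF that]])
   have 1: "(\<lambda>i. st (x i) (y i)) : I \<rightarrow> carrier MT.SA" "st (x i) (y i) <: MT.SA" using st_mem E(1) by blast+
   have 2: "finsum MT.SA (\<lambda>i. st (x i) (y i)) I : ?N" by (rule insert(3)) (use insert(4,5) in blast)+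
   show ?case unfolding MT.SA.finsum_insert[OF insert(1,2) 1] by (rule E(3)[OF st_mem[OF insertI1] 2])
  qed
  qed
  have k: "DT.fr \<one>\<^sub>T \<gamma> : ST.KK" by (rule ST.fr_inv_K[OF g(1)])
  note tc = DT.to_frac_closed[OF gc]
  have "DT.fr \<one>\<^sub>T \<gamma> \<otimes>\<^sub>DT.L to_frac T \<gamma> = \<one>\<^sub>DT.L"
   using DT.fr_to_frac[OF T.one_closed gz] DT.L.m_comm[OF ST.K_closed[OF k] tc] DT.to_frac_one by (simp only:)
  then have "ST.sc (DT.fr \<one>\<^sub>T \<gamma>) \<otimes>\<^sub>MT.SA ST.sc (to_frac T \<gamma>) = \<one>\<^sub>MT.SA"
   using ST.sc_mult[OF ST.K_closed[OF k] tc] ST.sc_one by (simp only:)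
  then have "ST.sc (DT.fr \<one>\<^sub>T \<gamma>) \<otimes>\<^sub>MT.SA ?g = f"
   using MT.SA.m_assoc[OF ST.sc_closed[OF ST.K_closed[OF k]] ST.sc_closed[OF tc] fc] MT.SA.l_one[OF fc] by (simp only:)
  moreover have "ST.sc (DT.fr \<one>\<^sub>T \<gamma>) \<otimes>\<^sub>MT.SA ?g : ?N" by (rule E(5)[OF imageI[OF k] gN])
  ultimately show "f : ?N" by (simp only:)
 qed
qed

theorem U_galois_ring: "galois_ring k T M W PU.Im"
 by (intro galois_ring.intro galois_ring_axioms.intro ST.setting T_noetherian_over(1) affine noeth1 noeth2
   PU.Im_subalgebra U_INV U_Gamma U_span)

text \<open>In a representation with both families independent, the factors inherit the support of
  \<open>z\<close>. For an index outside \<open>S1\<close>, keep only the coefficients of the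
  \<open>x i\<close> there: the sum becomes zero by the assumption on \<open>z\<close>, and
  independence of the second family makes the retained coefficients zero. The other factor is
  symmetric.\<close>

lemma st_support:
 assumes z: "z : PU.Im" and S: "S1 <= M1" "S2 <= M2"
  and off: "!!\<mu> \<nu>. \<mu> : M1 ==> \<nu> : M2 ==> \<mu> \<notin> S1 \<or> \<nu> \<notin> S2 ==> z (tm \<mu> \<nu>) = \<zero>\<^sub>DT.L"
 obtains I :: "('a, 'b) skew_index set" and x y
 where "finite I" "!!i. i : I ==> x i : U1 \<inter> S1.VS S1" "!!i. i : I ==> y i : U2 \<inter> S2.VS S2"
  "z = finsum MT.SA (\<lambda>i. st (x i) (y i)) I"
proof (rule PU.Im_rep[OF z])
 fix I :: "('a, 'b) skew_index set" and x y
 assume r: "finite I" "!!i. i : I ==> x i : U1" "!!i. i : I ==> y i : U2"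
  "MA.SAA.indep I x" "MB.SAA.indep I y" "z = finsum MT.SA (\<lambda>i. st (x i) (y i)) I"
 have xc: "x i <: MA.SA" if "i : I" for i by (rule PU.S_sub[OF r(2)[OF that]])
 have yc: "y i <: MB.SA" if "i : I" for i by (rule PU.S'_sub[OF r(3)[OF that]])
 have sxy: "st (x i) (y i) <: MT.SA" if "i : I" for i by (rule st_closed[OF xc[OF that] yc[OF that]])
 have zv: "z (tm \<mu> \<nu>) = finsum DT.L (\<lambda>i. ft (x i \<mu>) (y i \<nu>)) I" if m: "\<mu> : M1" and n: "\<nu> : M2" for \<mu> \<nu>
 proof -
  have "z (tm \<mu> \<nu>) = finsum DT.L (\<lambda>i. st (x i) (y i) (tm \<mu> \<nu>)) I"
   unfolding r(6) by (rule MT.SA_eval_finsum[OF r(1) sxy])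
  also have "\<dots> = finsum DT.L (\<lambda>i. ft (x i \<mu>) (y i \<nu>)) I"
   by (rule DT.L.finsum_cong') (use st_val[OF xc yc m n] ft_closed[OF MA.SA_val[OF xc] MB.SA_val[OF yc]] in auto)
  finally show ?thesis .
 qed
 have zero_sum: "finsum DT.L (\<lambda>i. \<zero>\<^sub>DT.L) I = \<zero>\<^sub>DT.L" by (rule DT.L.finsum_zero)
 have x0: "x j \<mu> = \<zero>\<^sub>DA.L" if j: "j : I" and m: "\<mu> \<notin> S1" for j \<mu>
 proof (cases "\<mu> : M1")
  case False then show ?thesis by (rule MA.SA_off[OF xc[OF j]])
 next
  case True
  \<comment> \<open>Restricting the first factors to the single index \<mu> leaves the second family
    untouched, so its independence remains available.\<close>
  let ?x = "\<lambda>i. single DA.L \<mu> (x i \<mu>)"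
  have c: "?x i <: MA.SA" if "i : I" for i by (rule MA.single_SA[OF True MA.SA_val[OF xc[OF that]]])
  have sc: "st (?x i) (y i) <: MT.SA" if "i : I" for i by (rule st_closed[OF c[OF that] yc[OF that]])
  have z0: "finsum MT.SA (\<lambda>i. st (?x i) (y i)) I = \<zero>\<^sub>MT.SA"
  proof (rule st_eqI)
   show "finsum MT.SA (\<lambda>i. st (?x i) (y i)) I <: MT.SA" by (rule MT.SA.finsum_closed) (use sc in blast)
   show "\<zero>\<^sub>MT.SA <: MT.SA" by (rule MT.SA.zero_closed)
   fix \<mu>' \<nu> assume m': "\<mu>' : M1" and n: "\<nu> : M2"
   have e: "finsum MT.SA (\<lambda>i. st (?x i) (y i)) I (tm \<mu>' \<nu>) = finsum DT.L (\<lambda>i. st (?x i) (y i) (tm \<mu>' \<nu>)) I"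
    by (rule MT.SA_eval_finsum[OF r(1) sc])
   have v: "st (?x i) (y i) (tm \<mu>' \<nu>) = (if \<mu>' = \<mu> then ft (x i \<mu>) (y i \<nu>) else \<zero>\<^sub>DT.L)" if "i : I" for i
    unfolding st_val[OF c[OF that] yc[OF that] m' n] using ft_zero(2)[OF MB.SA_val[OF yc[OF that]]] by (simp add: single_def)
   have fc: "ft (x i \<mu>) (y i \<nu>) <: DT.L" if "i : I" for i by (rule ft_closed[OF MA.SA_val[OF xc[OF that]] MB.SA_val[OF yc[OF that]]])
   have "finsum DT.L (\<lambda>i. st (?x i) (y i) (tm \<mu>' \<nu>)) I = finsum DT.L (\<lambda>i. if \<mu>' = \<mu> then ft (x i \<mu>) (y i \<nu>) else \<zero>\<^sub>DT.L) I"
    by (rule DT.L.finsum_cong') (use v fc in auto)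
   also have "\<dots> = \<zero>\<^sub>DT.L"
   proof (cases "\<mu>' = \<mu>")
    case True
    then show ?thesis using zv[OF \<open>\<mu> : M1\<close> n] off[OF \<open>\<mu> : M1\<close> n] m by simp
   qed (simp add: zero_sum)
   finally show "finsum MT.SA (\<lambda>i. st (?x i) (y i)) I (tm \<mu>' \<nu>) = \<zero>\<^sub>MT.SA (tm \<mu>' \<nu>)" unfolding e by simp
  qed
  have "?x j = \<zero>\<^sub>MA.SA" by (rule PS.left_faithful[where x="?x" and y=y, OF r(1) c yc r(5) z0 j])
  from fun_cong[OF this, of \<mu>] show ?thesis by (simp add: single_def)
 qed
 have y0: "y j \<nu> = \<zero>\<^sub>DB.L" if j: "j : I" and m: "\<nu> \<notin> S2" for j \<nu>
 proof (cases "\<nu> : M2")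
  case False then show ?thesis by (rule MB.SA_off[OF yc[OF j]])
 next
  case True
  let ?y = "\<lambda>i. single DB.L \<nu> (y i \<nu>)"
  have c: "?y i <: MB.SA" if "i : I" for i by (rule MB.single_SA[OF True MB.SA_val[OF yc[OF that]]])
  have sc: "st (x i) (?y i) <: MT.SA" if "i : I" for i by (rule st_closed[OF xc[OF that] c[OF that]])
  have z0: "finsum MT.SA (\<lambda>i. st (x i) (?y i)) I = \<zero>\<^sub>MT.SA"
  proof (rule st_eqI)
   show "finsum MT.SA (\<lambda>i. st (x i) (?y i)) I <: MT.SA" by (rule MT.SA.finsum_closed) (use sc in blast)
   show "\<zero>\<^sub>MT.SA <: MT.SA" by (rule MT.SA.zero_closed)
   fix \<mu> \<nu>' assume m': "\<mu> : M1" and n: "\<nu>' : M2"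
   have e: "finsum MT.SA (\<lambda>i. st (x i) (?y i)) I (tm \<mu> \<nu>') = finsum DT.L (\<lambda>i. st (x i) (?y i) (tm \<mu> \<nu>')) I"
    by (rule MT.SA_eval_finsum[OF r(1) sc])
   have v: "st (x i) (?y i) (tm \<mu> \<nu>') = (if \<nu>' = \<nu> then ft (x i \<mu>) (y i \<nu>) else \<zero>\<^sub>DT.L)" if "i : I" for i
    unfolding st_val[OF xc[OF that] c[OF that] m' n] using ft_zero(1)[OF MA.SA_val[OF xc[OF that]]] by (simp add: single_def)
   have fc: "ft (x i \<mu>) (y i \<nu>) <: DT.L" if "i : I" for i by (rule ft_closed[OF MA.SA_val[OF xc[OF that]] MB.SA_val[OF yc[OF that]]])
   have "finsum DT.L (\<lambda>i. st (x i) (?y i) (tm \<mu> \<nu>')) I = finsum DT.L (\<lambda>i. if \<nu>' = \<nu> then ft (x i \<mu>) (y i \<nu>) else \<zero>\<^sub>DT.L) I"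
    by (rule DT.L.finsum_cong') (use v fc in auto)
   also have "\<dots> = \<zero>\<^sub>DT.L"
   proof (cases "\<nu>' = \<nu>")
    case True
    then show ?thesis using zv[OF m' \<open>\<nu> : M2\<close>] off[OF m' \<open>\<nu> : M2\<close>] m by simp
   qed (simp add: zero_sum)
   finally show "finsum MT.SA (\<lambda>i. st (x i) (?y i)) I (tm \<mu> \<nu>') = \<zero>\<^sub>MT.SA (tm \<mu> \<nu>')" unfolding e by simp
  qed
  have "?y j = \<zero>\<^sub>MB.SA" by (rule PS.right_faithful[where x=x and y="?y", OF r(1) xc c r(4) z0 j])
  from fun_cong[OF this, of \<nu>] show ?thesis by (simp add: single_def)
 qed
 have x: "x i : U1 \<inter> S1.VS S1" if "i : I" for i unfolding S1.VS_def using r(2)[OF that] U1_INV x0[OF that] by blast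
 have y: "y i : U2 \<inter> S2.VS S2" if "i : I" for i unfolding S2.VS_def using r(3)[OF that] U2_INV y0[OF that] by blast
 show ?thesis by (rule that[of I x y]) (fact r(1) x y r(6))+
qed

section \<open>The order properties\<close>

lemma Gamma_noeth:
 "subring (ST.sc ` Gamma_in_L T W) MT.SA" "noeth_on MT.SA (ST.sc ` Gamma_in_L T W) (ST.sc ` Gamma_in_L T W)"
 "noeth_on (op_ring MT.SA) (ST.sc ` Gamma_in_L T W) (ST.sc ` Gamma_in_L T W)"
proof -
 let ?h = "\<lambda>t. ST.sc (to_frac T t)"
 have eq: "ST.sc ` Gamma_in_L T W = ?h ` ST.G" unfolding Gamma_in_L_def image_image ..
 \<comment> \<open>The fixed algebra lies in \<open>T\<close>, which is Noetherian as a module over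
   it; hence it is a Noetherian ring.\<close>
 have n: "noeth_on T ST.G ST.G"
  by (rule noeth_on_mono[OF T_noetherian_over(2)[OF affine noeth1 noeth2]]) (use ST.G_carrier in blast)
 note tc = DT.to_frac_closed
 have h: "?h a <: MT.SA" if "a <: T" for a by (rule ST.sc_closed[OF tc[OF that]])
 have hadd: "?h (a \<oplus>\<^sub>T b) = ?h a \<oplus>\<^sub>MT.SA ?h b" if "a <: T" "b <: T" for a b
  unfolding DT.to_frac_add[OF that] by (rule ST.sc_add[OF tc[OF that(1)] tc[OF that(2)]])
 have hmult: "?h (a \<otimes>\<^sub>T b) = ?h a \<otimes>\<^sub>MT.SA ?h b" if "a <: T" "b <: T" for a b
  unfolding DT.to_frac_mult[OF that] by (rule ST.sc_mult[OF tc[OF that(1)] tc[OF that(2)]])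
 have hone: "?h \<one>\<^sub>T = \<one>\<^sub>MT.SA" unfolding DT.to_frac_one by (rule ST.sc_one)
 show "subring (ST.sc ` Gamma_in_L T W) MT.SA" "noeth_on MT.SA (ST.sc ` Gamma_in_L T W) (ST.sc ` Gamma_in_L T W)"
  unfolding eq by (rule noeth_hom[where h="?h", OF T.ring_axioms MT.SA_ring ST.G_subring n h hadd hmult hone]; assumption)+
 have op: "?h a <: (op_ring MT.SA)" if "a <: T" for a unfolding op_ring_simps by (rule h[OF that])
 have opadd: "?h (a \<oplus>\<^sub>T b) = ?h a \<oplus>\<^bsub>op_ring MT.SA\<^esub> ?h b" if "a <: T" "b <: T" for a b
  unfolding op_ring_simps by (rule hadd[OF that])
 have opmult: "?h (a \<otimes>\<^sub>T b) = ?h a \<otimes>\<^bsub>op_ring MT.SA\<^esub> ?h b" if "a <: T" "b <: T" for a b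
  unfolding op_ring_simps DT.D.m_comm[OF that] by (rule hmult[OF that(2,1)])
 have opone: "?h \<one>\<^sub>T = \<one>\<^bsub>op_ring MT.SA\<^esub>" unfolding op_ring_simps by (rule hone)
 show "noeth_on (op_ring MT.SA) (ST.sc ` Gamma_in_L T W) (ST.sc ` Gamma_in_L T W)"
  unfolding eq by (rule noeth_hom(2)[where h="?h", OF T.ring_axioms MT.SA.op_ring ST.G_subring n op opadd opmult opone]; assumption)
qed

text \<open>Finitely many generators have finite joint support, and scalars on either side do not
  enlarge supports. The resulting finite set of automorphisms is enclosed in a rectangle by
  projecting to the two components.\<close>

lemma V_support:
 assumes V: "fg_left MT.SA (ST.sc ` ST.KK) V \<or> fg_right MT.SA (ST.sc ` ST.KK) V"
 obtains S1 S2 where "finite S1" "S1 <= M1" "finite S2" "S2 <= M2"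
  "ALL z:V. ALL \<mu>:M1. ALL \<nu>:M2. \<mu> \<notin> S1 \<or> \<nu> \<notin> S2 --> z (tm \<mu> \<nu>) = \<zero>\<^sub>DT.L"
proof -
 obtain Q where Q: "finite Q" "Q <= carrier MT.SA"
  and VQ: "V = span_left MT.SA (ST.sc ` ST.KK) Q \<or> V = span_left (op_ring MT.SA) (ST.sc ` ST.KK) Q"
  using V unfolding fg_left_def fg_right_def span_right_op by blast
 let ?S = "\<Union>q\<in>Q. supp DT.L q"
 have sQ: "finite (supp DT.L q) & supp DT.L q <= M" if "q : Q" for q
  using finsuppD(3,4)[of q DT.L M] Q(2) that by auto
 then have S: "finite ?S" "?S <= M" using Q(1) by blast+
 let ?N = "{f : carrier MT.SA. ALL \<rho>. \<rho> \<notin> ?S --> f \<rho> = \<zero>\<^sub>DT.L}"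
 have QN: "Q <= ?N" using Q(2) by (auto simp: supp_def)
 have zN: "\<zero>\<^sub>MT.SA : ?N" using MT.SA.zero_closed by simp
 have aN: "f \<oplus>\<^sub>MT.SA g : ?N" if "f : ?N" "g : ?N" for f g using that MT.SA.a_closed[of f g] by simp
 have nN: "\<ominus>\<^sub>MT.SA f : ?N" if "f : ?N" for f using that MT.SA.a_inv_closed[of f] ST.neg_val[of f] by (simp del: MT.SA_simps)
 have lN: "ST.sc \<kappa> \<otimes>\<^sub>MT.SA f : ?N" if k: "\<kappa> : ST.KK" and f: "f : ?N" for \<kappa> f
 proof -
  have fc: "f <: MT.SA" and f0: "!!\<rho>. \<rho> \<notin> ?S ==> f \<rho> = \<zero>\<^sub>DT.L" using f by blast+
  have "(ST.sc \<kappa> \<otimes>\<^sub>MT.SA f) \<rho> = \<zero>\<^sub>DT.L" if "\<rho> \<notin> ?S" for \<rho>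
   using ST.sc_mult_val[OF ST.K_closed[OF k] fc, of \<rho>] f0[OF that] ST.K_closed[OF k] by simp
  then show ?thesis using MT.SA.m_closed[OF ST.sc_closed[OF ST.K_closed[OF k]] fc] by blast
 qed
 have rN: "f \<otimes>\<^sub>MT.SA ST.sc \<kappa> : ?N" if k: "\<kappa> : ST.KK" and f: "f : ?N" for \<kappa> f
 proof -
  have fc: "f <: MT.SA" and f0: "!!\<rho>. \<rho> \<notin> ?S ==> f \<rho> = \<zero>\<^sub>DT.L" using f by blast+
  note c = MT.SA.m_closed[OF fc ST.sc_closed[OF ST.K_closed[OF k]]]
  have "(f \<otimes>\<^sub>MT.SA ST.sc \<kappa>) \<rho> = \<zero>\<^sub>DT.L" if "\<rho> \<notin> ?S" for \<rho>
  proof (cases "\<rho> : M")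
   case True
   have "frac_map T \<rho> \<kappa> <: DT.L" by (rule DT.frac_map_closed[OF DT.Aut_alg_inj[OF MT.M_Aut[OF True]] ST.K_closed[OF k]])
   then show ?thesis using ST.sc_mult_val[OF ST.K_closed[OF k] fc, of \<rho>] f0[OF that] True by simp
  next
   case False then show ?thesis by (rule MT.SA_off[OF c])
  qed
  then show ?thesis using c by blast
 qed
 have s1: "submod MT.SA (ST.sc ` ST.KK) ?N"
 proof (rule MT.SA.submodI[OF _ zN aN nN])
  show "?N <= carrier MT.SA" by blast
  show "a \<otimes>\<^sub>MT.SA f : ?N" if "a : ST.sc ` ST.KK" "f : ?N" for a f using lN[OF _ that(2)] that(1) by blast
 qed
 interpret O: ring "op_ring MT.SA" by (rule MT.SA.op_ring)
 have s2: "submod (op_ring MT.SA) (ST.sc ` ST.KK) ?N"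
 proof (rule O.submodI)
  show "?N <= carrier (op_ring MT.SA)" unfolding op_ring_simps by blast
  show "\<zero>\<^bsub>op_ring MT.SA\<^esub> : ?N" unfolding op_ring_simps by (rule zN)
  fix f assume f: "f : ?N"
  then have fc: "f <: MT.SA" by blast
  show "\<ominus>\<^bsub>op_ring MT.SA\<^esub> f : ?N" unfolding ST.op_neg[OF fc] by (rule nN[OF f])
  show "f \<oplus>\<^bsub>op_ring MT.SA\<^esub> g : ?N" if "g : ?N" for g unfolding op_ring_simps by (rule aN[OF f that])
  show "a \<otimes>\<^bsub>op_ring MT.SA\<^esub> f : ?N" if "a : ST.sc ` ST.KK" for a unfolding op_ring_simps using rN[OF _ f] that by blast
 qed
 have VN: "V <= ?N" using VQ
 proof
  show "V <= ?N" if "V = span_left MT.SA (ST.sc ` ST.KK) Q" unfolding that by (rule MT.SA.span_left_minimal[OF s1 QN])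
  show "V <= ?N" if "V = span_left (op_ring MT.SA) (ST.sc ` ST.KK) Q" unfolding that by (rule O.span_left_minimal[OF s2 QN])
 qed
 have "?S <= (\<lambda>(\<mu>, \<nu>). tm \<mu> \<nu>) ` (M1 \<times> M2)" using S(2) unfolding M_eq by auto
 then obtain C where C: "C <= M1 \<times> M2" "finite C" "?S = (\<lambda>(\<mu>, \<nu>). tm \<mu> \<nu>) ` C" using finite_subset_image[OF S(1)] by metis
 show ?thesis
 proof (rule that[of "fst ` C" "snd ` C"])
  show "ALL z:V. ALL \<mu>:M1. ALL \<nu>:M2. \<mu> \<notin> fst ` C \<or> \<nu> \<notin> snd ` C --> z (tm \<mu> \<nu>) = \<zero>\<^sub>DT.L"
  proof (intro ballI impI)
  fix z \<mu> \<nu> assume z: "z : V" and mn: "\<mu> : M1" "\<nu> : M2" "\<mu> \<notin> fst ` C \<or> \<nu> \<notin> snd ` C"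
  have "tm \<mu> \<nu> \<notin> ?S"
  proof
   assume "tm \<mu> \<nu> : ?S"
   then obtain \<mu>' \<nu>' where h: "(\<mu>', \<nu>') : C" "tm \<mu> \<nu> = tm \<mu>' \<nu>'" unfolding C(3) by auto
   have "\<mu>' : M1" "\<nu>' : M2" using h(1) C(1) by auto
   then have "\<mu> = \<mu>' & \<nu> = \<nu>'"
    using tm_inj[OF MA.M_Aut[OF mn(1)] MA.M_Aut[of \<mu>'] MB.M_Aut[OF mn(2)] MB.M_Aut[of \<nu>'] h(2)] by blast
   then show False using h(1) mn(3) by force
  qed
  then show "z (tm \<mu> \<nu>) = \<zero>\<^sub>DT.L" using subsetD[OF VN z] by blast
  qed
 qed (use C in auto)
qed

lemma Gamma_in_L_incl:
 "Gamma_in_L A W1 <= carrier DA.L" "\<one>\<^sub>DA.L : Gamma_in_L A W1"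
 "Gamma_in_L B W2 <= carrier DB.L" "\<one>\<^sub>DB.L : Gamma_in_L B W2"
 "a : Gamma_in_L A W1 ==> b : Gamma_in_L B W2 ==> ft a b : Gamma_in_L T W"
proof -
 show "Gamma_in_L A W1 <= carrier DA.L" "Gamma_in_L B W2 <= carrier DB.L" unfolding Gamma_in_L_def
  using DA.to_frac_closed DB.to_frac_closed S1.G_carrier S2.G_carrier by blast+
 show "\<one>\<^sub>DA.L : Gamma_in_L A W1" unfolding Gamma_in_L_def DA.to_frac_one[symmetric] by (rule imageI[OF subringE(3)[OF S1.G_subring]])
 show "\<one>\<^sub>DB.L : Gamma_in_L B W2" unfolding Gamma_in_L_def DB.to_frac_one[symmetric] by (rule imageI[OF subringE(3)[OF S2.G_subring]])
 assume "a : Gamma_in_L A W1" "b : Gamma_in_L B W2"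
 then obtain a' b' where h: "a' : S1.G" "b' : S2.G" "a = to_frac A a'" "b = to_frac B b'" unfolding Gamma_in_L_def by blast
 have "pt a' b' : ST.G" unfolding fixed_T[symmetric] by (rule PG.Im_beta[OF h(1,2)])
 then show "ft a b : Gamma_in_L T W" unfolding h(3,4) ft_to_frac[OF S1.G_carrier[OF h(1)] S2.G_carrier[OF h(2)]] Gamma_in_L_def by (rule imageI)
qed

lemma Gamma_in_K: "ST.sc ` Gamma_in_L T W <= ST.sc ` ST.KK"
 unfolding Gamma_in_L_def using ST.to_frac_K by blast

text \<open>\<open>R\<close> is the skew algebra or its opposite; both have the same sums but
  different submodules.\<close>

lemma finsum_span:
 fixes x :: "'i => _"
 assumes R: "ring R" "finsum R x I = finsum MT.SA x I" "carrier R = carrier MT.SA"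
  and sm: "submod R C N" and I: "finite I" and x: "!!i. i : I ==> x i : N"
 shows "finsum MT.SA x I : N"
proof -
 interpret R: ring R by fact
 note E = R.submodE[OF sm]
 have "finsum R x I : N" using I x
 proof (induction I rule: finite_induct)
  case empty show ?case unfolding R.finsum_empty by (rule E(2))
 next
  case (insert i I)
  have m: "x j : N" if "j : insert i I" for j by (rule insert(4)[OF that])
  have 1: "x : I \<rightarrow> carrier R" "x i <: R" using m E(1) by blast+
  have 2: "finsum R x I : N" by (rule insert(3)) (use insert(4) in blast)
  show ?case unfolding R.finsum_insert[OF insert(1,2) 1] by (rule E(3)[OF m[OF insertI1] 2])
 qed
 then show ?thesis unfolding R(2) .
qed

text \<open>The support of \<open>V\<close> lies in a finite rectangle, so by
  \<open>st_support\<close> the elements of \<open>PU.Im \<inter> V\<close> are sums of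
  \<open>st x y\<close> with \<open>x\<close> and \<open>y\<close> in \<open>U1\<close> and
  \<open>U2\<close>, supported in the two sides. These parts of \<open>U1\<close> and
  \<open>U2\<close> are finitely generated by the order property of the factors. The images under
  \<open>st\<close> of pairs of generators therefore generate a module containing
  \<open>PU.Im \<inter> V\<close>, and \<Gamma> is Noetherian.\<close>

theorem U_galois_order:
 assumes o1: "galois_order k A M1 W1 U1" and o2: "galois_order k B M2 W2 U2"
 shows "galois_order k T M W PU.Im"
proof (intro galois_order.intro galois_order_axioms.intro U_galois_ring)
 note G = Gamma_in_L_incl
 let ?\<Gamma> = "ST.sc ` Gamma_in_L T W"
 fix V assume V: "V <= ST.INV"
 { assume fg: "fg_left MT.SA (ST.sc ` ST.KK) V"
  obtain S1 S2 where S: "finite S1" "S1 <= M1" "finite S2" "S2 <= M2"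
   "ALL z:V. ALL \<mu>:M1. ALL \<nu>:M2. \<mu> \<notin> S1 \<or> \<nu> \<notin> S2 --> z (tm \<mu> \<nu>) = \<zero>\<^sub>DT.L"
   by (rule V_support[OF disjI1[OF fg]])
  have "fg_left MA.SA (S1.sc ` Gamma_in_L A W1) (U1 \<inter> S1.VS S1)"
   by (rule galois_order.left_order[OF o1 _ S1.VS_fg(1)[OF noeth1 S(1,2)]]) (use S1.VS_D(1) in blast)
  then obtain Q1 where Q1: "finite Q1" "Q1 <= carrier MA.SA" "U1 \<inter> S1.VS S1 = span_left MA.SA (S1.sc ` Gamma_in_L A W1) Q1"
   unfolding fg_left_def by blast
  have "fg_left MB.SA (S2.sc ` Gamma_in_L B W2) (U2 \<inter> S2.VS S2)"
   by (rule galois_order.left_order[OF o2 _ S2.VS_fg(1)[OF noeth2 S(3,4)]]) (use S2.VS_D(1) in blast)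
  then obtain Q2 where Q2: "finite Q2" "Q2 <= carrier MB.SA" "U2 \<inter> S2.VS S2 = span_left MB.SA (S2.sc ` Gamma_in_L B W2) Q2"
   unfolding fg_left_def by blast
  let ?Q = "(\<lambda>(q, q'). st q q') ` (Q1 \<times> Q2)"
  have Qf: "finite ?Q" using Q1(1) Q2(1) by blast
  have Qc: "?Q <= carrier MT.SA" using st_closed[OF subsetD[OF Q1(2)] subsetD[OF Q2(2)]] by auto
  have Qi: "st q q' : ?Q" if "q : Q1" "q' : Q2" for q q' using that by force
  have sub: "PU.Im \<inter> V <= span_left MT.SA ?\<Gamma> ?Q"
  proof
   fix z assume z: "z : PU.Im \<inter> V"
   have off: "z (tm \<mu> \<nu>) = \<zero>\<^sub>DT.L" if "\<mu> : M1" "\<nu> : M2" "\<mu> \<notin> S1 \<or> \<nu> \<notin> S2" for \<mu> \<nu>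
    using S(5) z that by blast
   show "z : span_left MT.SA ?\<Gamma> ?Q"
   proof (rule st_support[OF IntD1[OF z] S(2,4) off])
   fix I :: "('a, 'b) skew_index set" and x y
   assume r: "finite I" "!!i. i : I ==> x i : U1 \<inter> S1.VS S1" "!!i. i : I ==> y i : U2 \<inter> S2.VS S2"
     "z = finsum MT.SA (\<lambda>i. st (x i) (y i)) I"
   show "z : span_left MT.SA ?\<Gamma> ?Q" unfolding r(4)
   proof (rule finsum_span[OF MT.SA_ring refl refl MT.SA.span_left_submod[OF Gamma_noeth(1) Qc] r(1)])
    fix i assume i: "i : I"
    note c = PU.S_sub[OF IntD1[OF r(2)[OF i]]] PU.S'_sub[OF IntD1[OF r(3)[OF i]]]
    show "st (x i) (y i) : span_left MT.SA ?\<Gamma> ?Q"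
     by (rule st_span(1)[OF G Gamma_noeth(1) Q1(2) Q2(2) Qi Qc c r(2)[OF i, unfolded Q1(3)] r(3)[OF i, unfolded Q2(3)]])
   qed
   qed
  qed
  have sV: "submod MT.SA ?\<Gamma> V"
  proof -
   obtain P where P: "P <= carrier MT.SA" "V = span_left MT.SA (ST.sc ` ST.KK) P" using fg unfolding fg_left_def by blast
   show ?thesis unfolding P(2) by (rule MT.SA.submod_antimono[OF MT.SA.span_left_submod[OF ST.scK_subring P(1)] Gamma_in_K])
  qed
  show "fg_left MT.SA ?\<Gamma> (PU.Im \<inter> V)"
   by (rule MT.SA.fg_left_inter[OF Gamma_noeth(1,2) PU.Im_subring U_Gamma sV Qf Qc sub]) }
 \<comment> \<open>The same argument for right subspaces, carried out in the opposite ring.\<close>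
 { assume fg: "fg_right MT.SA (ST.sc ` ST.KK) V"
  interpret O: ring "op_ring MT.SA" by (rule MT.SA.op_ring)
  note GO = MT.SA.subring_op[OF Gamma_noeth(1)]
  obtain S1 S2 where S: "finite S1" "S1 <= M1" "finite S2" "S2 <= M2"
   "ALL z:V. ALL \<mu>:M1. ALL \<nu>:M2. \<mu> \<notin> S1 \<or> \<nu> \<notin> S2 --> z (tm \<mu> \<nu>) = \<zero>\<^sub>DT.L"
   by (rule V_support[OF disjI2[OF fg]])
  have "fg_right MA.SA (S1.sc ` Gamma_in_L A W1) (U1 \<inter> S1.VS S1)"
   by (rule galois_order.right_order[OF o1 _ S1.VS_fg(2)[OF noeth1 S(1,2)]]) (use S1.VS_D(1) in blast)
  then obtain Q1 where Q1: "finite Q1" "Q1 <= carrier MA.SA" "U1 \<inter> S1.VS S1 = span_right MA.SA (S1.sc ` Gamma_in_L A W1) Q1"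
   unfolding fg_right_def by blast
  have "fg_right MB.SA (S2.sc ` Gamma_in_L B W2) (U2 \<inter> S2.VS S2)"
   by (rule galois_order.right_order[OF o2 _ S2.VS_fg(2)[OF noeth2 S(3,4)]]) (use S2.VS_D(1) in blast)
  then obtain Q2 where Q2: "finite Q2" "Q2 <= carrier MB.SA" "U2 \<inter> S2.VS S2 = span_right MB.SA (S2.sc ` Gamma_in_L B W2) Q2"
   unfolding fg_right_def by blast
  let ?Q = "(\<lambda>(q, q'). st q q') ` (Q1 \<times> Q2)"
  have Qf: "finite ?Q" using Q1(1) Q2(1) by blast
  have Qc: "?Q <= carrier MT.SA" using st_closed[OF subsetD[OF Q1(2)] subsetD[OF Q2(2)]] by auto
  have Qc': "?Q <= carrier (op_ring MT.SA)" unfolding op_ring_simps by (rule Qc)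
  have Qi: "st q q' : ?Q" if "q : Q1" "q' : Q2" for q q' using that by force
  have sub: "PU.Im \<inter> V <= span_left (op_ring MT.SA) ?\<Gamma> ?Q"
  proof
   fix z assume z: "z : PU.Im \<inter> V"
   have off: "z (tm \<mu> \<nu>) = \<zero>\<^sub>DT.L" if "\<mu> : M1" "\<nu> : M2" "\<mu> \<notin> S1 \<or> \<nu> \<notin> S2" for \<mu> \<nu>
    using S(5) z that by blast
   show "z : span_left (op_ring MT.SA) ?\<Gamma> ?Q"
   proof (rule st_support[OF IntD1[OF z] S(2,4) off])
   fix I :: "('a, 'b) skew_index set" and x y
   assume r: "finite I" "!!i. i : I ==> x i : U1 \<inter> S1.VS S1" "!!i. i : I ==> y i : U2 \<inter> S2.VS S2"
     "z = finsum MT.SA (\<lambda>i. st (x i) (y i)) I"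
   show "z : span_left (op_ring MT.SA) ?\<Gamma> ?Q" unfolding r(4)
   proof (rule finsum_span[OF MT.SA.op_ring _ op_ring_simps(1) O.span_left_submod[OF GO Qc'] r(1)])
    show "finsum (op_ring MT.SA) (\<lambda>i. st (x i) (y i)) I = finsum MT.SA (\<lambda>i. st (x i) (y i)) I"
     unfolding finsum_def finprod_def op_ring_def by simp
    fix i assume i: "i : I"
    note c = PU.S_sub[OF IntD1[OF r(2)[OF i]]] PU.S'_sub[OF IntD1[OF r(3)[OF i]]]
    show "st (x i) (y i) : span_left (op_ring MT.SA) ?\<Gamma> ?Q" unfolding span_right_op[symmetric]
     by (rule st_span(2)[OF G Gamma_noeth(1) Q1(2) Q2(2) Qi Qc c r(2)[OF i, unfolded Q1(3)] r(3)[OF i, unfolded Q2(3)]])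
   qed
   qed
  qed
  have sV: "submod (op_ring MT.SA) ?\<Gamma> V"
  proof -
   obtain P where P: "P <= carrier MT.SA" "V = span_left (op_ring MT.SA) (ST.sc ` ST.KK) P"
    using fg unfolding fg_right_def span_right_op by blast
   have P': "P <= carrier (op_ring MT.SA)" unfolding op_ring_simps by (rule P(1))
   show ?thesis unfolding P(2) by (rule O.submod_antimono[OF O.span_left_submod[OF ST.scK_subring_op P'] Gamma_in_K])
  qed
  show "fg_right MT.SA ?\<Gamma> (PU.Im \<inter> V)" unfolding fg_right_op
   by (rule O.fg_left_inter[OF GO Gamma_noeth(3) MT.SA.subring_op[OF PU.Im_subring] U_Gamma sV Qf Qc' sub]) }
qed

text \<open>Evaluation is additive in the skew element and in its argument, and \<Gamma> is closed
  under addition. Hence it suffices to evaluate \<open>st u v\<close> at a pure tensor, where the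
  value splits into the evaluations of \<open>u\<close> and \<open>v\<close>.\<close>

theorem U_principal:
 assumes p1: "principal_galois_order k A M1 W1 U1" and p2: "principal_galois_order k B M2 W2 U2"
 shows "principal_galois_order k T M W PU.Im"
proof (intro principal_galois_order.intro principal_galois_order_axioms.intro U_galois_ring)
 let ?\<Gamma> = "Gamma_in_L T W"
 have z\<Gamma>: "\<zero>\<^sub>DT.L : ?\<Gamma>" unfolding Gamma_in_L_def DT.to_frac_zero[symmetric] by (rule imageI[OF subringE(2)[OF ST.G_subring]])
 have a\<Gamma>: "x \<oplus>\<^sub>DT.L y : ?\<Gamma>" if xy: "x : ?\<Gamma>" "y : ?\<Gamma>" for x y
 proof -
  obtain s t where h: "s : ST.G" "t : ST.G" "x = to_frac T s" "y = to_frac T t" using xy unfolding Gamma_in_L_def by blast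
  show ?thesis unfolding h(3,4) DT.to_frac_add[OF ST.G_carrier[OF h(1)] ST.G_carrier[OF h(2)], symmetric] Gamma_in_L_def
   by (rule imageI[OF subringE(7)[OF ST.G_subring h(1,2)]])
 qed
 fix f l assume f: "f : PU.Im" and l: "l : ?\<Gamma>"
 obtain t where t: "t : ST.G" "l = to_frac T t" using l unfolding Gamma_in_L_def by blast
 have lc: "to_frac T t <: DT.L" if "t : ST.G" for t by (rule DT.to_frac_closed[OF ST.G_carrier[OF that]])
 have Uc: "u <: MT.SA" if "u : PU.Im" for u using subringE(1)[OF PU.Im_subring] that by blast
 show "skew_eval T f l : ?\<Gamma>" unfolding t(2) using f
 proof (induction rule: PU.Im_induct)
  case zero show ?case unfolding MT.skew_eval_zero1[OF lc[OF t(1)]] by (rule z\<Gamma>)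
 next
  case (add u v)
  show ?case unfolding MT.skew_eval_add1[OF Uc[OF add(1)] Uc[OF add(2)] lc[OF t(1)]] by (rule a\<Gamma>[OF add(3,4)])
 next
  case (beta u v)
  note uc = PU.S_sub[OF beta(1)] and vc = PU.S'_sub[OF beta(2)]
  note sc = st_closed[OF uc vc]
  show ?case using t(1)
  proof (induction rule: fixed_T_induct)
   case zero show ?case unfolding DT.to_frac_zero MT.skew_eval_zero2[OF sc] by (rule z\<Gamma>)
  next
   case (add s t)
   show ?case unfolding DT.to_frac_add[OF ST.G_carrier[OF add(1)] ST.G_carrier[OF add(2)]]
     MT.skew_eval_add2[OF sc lc[OF add(1)] lc[OF add(2)]] by (rule a\<Gamma>[OF add(3,4)])
  next
   case (pt a b)
   note c = S1.G_carrier[OF pt(1)] S2.G_carrier[OF pt(2)]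
   have 1: "skew_eval A u (to_frac A a) : Gamma_in_L A W1"
    by (rule principal_galois_order.eval_Gamma[OF p1 beta(1)]) (unfold Gamma_in_L_def, rule imageI[OF pt(1)])
   have 2: "skew_eval B v (to_frac B b) : Gamma_in_L B W2"
    by (rule principal_galois_order.eval_Gamma[OF p2 beta(2)]) (unfold Gamma_in_L_def, rule imageI[OF pt(2)])
   show ?case unfolding ft_to_frac[OF c, symmetric]
     skew_eval_st[OF uc vc DA.to_frac_closed[OF c(1)] DB.to_frac_closed[OF c(2)]]
    by (rule Gamma_in_L_incl(5)[OF 1 2])
  qed
 qed
qed

lemma conclusion:
 "algebra_embedding k (tensor k (A\<lparr>carrier := fixed_elements A W1\<rparr>) (B\<lparr>carrier := fixed_elements B W2\<rparr>)) T (tensor_lift k T pt)"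
 "algebra_embedding k (tensor k (MA.SA\<lparr>carrier := U1\<rparr>) (MB.SA\<lparr>carrier := U2\<rparr>)) MT.SA (tensor_lift k MT.SA st)"
 by (rule PG.embedding, rule PU.embedding)

end

theorem theorem3p19:
  fixes k :: "('k, 'z) ring_scheme"
    and \<Lambda>1 :: "('k, 'a) module" and \<Lambda>2 :: "('k, 'b) module"
    and M1 W1 :: "('a \<Rightarrow> 'a) set" and M2 W2 :: "('b \<Rightarrow> 'b) set"
    and U1 :: "(('a \<Rightarrow> 'a) \<Rightarrow> ('a \<times> 'a) set) set"
    and U2 :: "(('b \<Rightarrow> 'b) \<Rightarrow> ('b \<times> 'b) set) set"
    and \<Lambda> :: "('k, ('a \<times> 'b \<Rightarrow> 'k) set) module"
  assumes alg_closed: "algebraically_closed k"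
    and setting1: "galois_ring_setting k \<Lambda>1 M1 W1"
    and setting2: "galois_ring_setting k \<Lambda>2 M2 W2"
    and affine1: "affine_algebra k \<Lambda>1"
    and affine2: "affine_algebra k \<Lambda>2"
    and U1: "galois_ring k \<Lambda>1 M1 W1 U1"
    and U2: "galois_ring k \<Lambda>2 M2 W2 U2"
    and Lambda: "\<Lambda> = tensor k \<Lambda>1 \<Lambda>2"
    and M: "M = tensor_maps k \<Lambda>1 \<Lambda>2 M1 M2"
    and W: "W = tensor_maps k \<Lambda>1 \<Lambda>2 W1 W2"
    and tensor_Gamma: "\<Gamma>\<^sub>T = tensor k (\<Lambda>1\<lparr>carrier := fixed_elements \<Lambda>1 W1\<rparr>) (\<Lambda>2\<lparr>carrier := fixed_elements \<Lambda>2 W2\<rparr>)"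
    and tensor_U: "U\<^sub>T = tensor k ((skew_alg k \<Lambda>1 M1)\<lparr>carrier := U1\<rparr>) ((skew_alg k \<Lambda>2 M2)\<lparr>carrier := U2\<rparr>)"
    and embed_Gamma: "\<iota>\<^sub>\<Gamma> = tensor_lift k \<Lambda> (pure_tensor k \<Lambda>1 \<Lambda>2)"
    and embed_U: "\<iota>\<^sub>U = tensor_lift k (skew_alg k \<Lambda> M) (skew_tensor k \<Lambda>1 \<Lambda>2)"
    and Gamma: "\<Gamma> = \<iota>\<^sub>\<Gamma> ` carrier \<Gamma>\<^sub>T"
    and U: "U = \<iota>\<^sub>U ` carrier U\<^sub>T"
  shows "algebra_embedding k \<Gamma>\<^sub>T \<Lambda> \<iota>\<^sub>\<Gamma>
    \<and> algebra_embedding k U\<^sub>T (skew_alg k \<Lambda> M) \<iota>\<^sub>U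
    \<and> \<Gamma> = fixed_elements \<Lambda> W
    \<and> galois_ring k \<Lambda> M W U
    \<and> (galois_order k \<Lambda>1 M1 W1 U1 \<and> galois_order k \<Lambda>2 M2 W2 U2 \<longrightarrow> galois_order k \<Lambda> M W U)
    \<and> (principal_galois_order k \<Lambda>1 M1 W1 U1 \<and> principal_galois_order k \<Lambda>2 M2 W2 U2
        \<longrightarrow> principal_galois_order k \<Lambda> M W U)"
proof -
  note 1 = galois_ring_setting.base_field[OF setting1] galois_ring_setting.algebra[OF setting1] 
    galois_ring_setting.noetherian_domain[OF setting1] galois_ring_setting.submonoid[OF setting1]
  note 2 = galois_ring_setting.algebra[OF setting2] 
    galois_ring_setting.noetherian_domain[OF setting2] galois_ring_setting.submonoid[OF setting2]
  have A: "dom_alg k \<Lambda>1" by (intro dom_alg.intro kalgI_comm 1 noetherian_domain.axioms(2))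
  have B: "dom_alg k \<Lambda>2" by (intro dom_alg.intro kalgI_comm 1(1) 2 noetherian_domain.axioms(2))
  have MA: "aut_alg k \<Lambda>1 M1" by (intro aut_alg.intro A aut_alg_axioms.intro 1)
  have MB: "aut_alg k \<Lambda>2 M2" by (intro aut_alg.intro B aut_alg_axioms.intro 2)
  \<comment> \<open>Algebraic closedness of \<open>k\<close> enters here, through the characters of
    the affine algebra \<open>\<Lambda>1\<close>.\<close>
  have T: "domain (tensor k \<Lambda>1 \<Lambda>2)" by (rule tensor_domain[OF alg_closed A B affine1])
  have "galois_pair k \<Lambda>1 \<Lambda>2 M1 M2 W1 W2 U1 U2"
    by (intro galois_pair.intro galois_pair_axioms.intro setting_pair.intro setting_pair_axioms.intro skew_pair.intro
        dom_pair.intro dom_pair_axioms.intro tensor_alg.intro setting.intro setting_axioms.intro dom_alg.axioms(1)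
        A B MA MB T setting1 setting2 affine1 affine2 U1 U2)
  note P = galois_pair.conclusion[OF this] galois_pair.U_galois_ring[OF this] galois_pair.U_galois_order[OF this]
    galois_pair.U_principal[OF this] setting_pair.fixed_T[OF galois_pair.axioms(1)[OF this]]
  show ?thesis unfolding Gamma U M W tensor_Gamma tensor_U embed_Gamma embed_U Lambda using P by blast
qed

end
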